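(* Let $a,b,s\in\mathbb{R}$ with $s\neq0$ and $c\in L^2(0,1)$. Let $\delta>0$ be arbitrary. Let $N_0,M_0\geq0$ be integers such that $\lambda_{1,N_0+1}<-\delta$, $\lambda_{2,M_0+1}<-\delta$, $N_0\geq\max\Delta_1(a,b)$ and $M_0\geq\max\Delta_2(a,b)$. Assume that $\Theta(a,b)\cap\{0,\ldots,N_0\}=\emptyset$, that $c_{1,n}\neq0$ for all $0\leq n\leq N_0$, and that $c_{2,m}\neq0$ for all $m\in\{0,1,\ldots,M_0\}\setminus\Delta_2(a,b)$, where $c_{1,n}=\int_0^1c(x)\phi_{1,n}^1(x)\,dx$ and $c_{2,m}=\int_0^1c(x)\phi_{2,m}^1(x)\,dx$. Let $K=\begin{bmatrix}K_x&k_u\end{bmatrix}\in\mathbb{R}^{1\times(N_0+M_0+3)}$ (with $K_x\in\mathbb{R}^{1\times(N_0+M_0+2)}$, $k_u\in\mathbb{R}$) and $L\in\mathbb{R}^{N_0+M_0+2}$ be matrices such that $A_{1,a}-B_{1,a}K$ and $A_1-LC_1$ are Hurwitz with eigenvalues of real part less than $-\delta$. Then, for any integers $N\geq N_0$ and $M\geq M_0$ chosen sufficiently large, there exists $C>0$ such that, for all initial conditions $y_0,z_0\in L^2(0,1)$, $u(0)=u_0\in\mathbb{R}$, $\hat X_1(0)\in\mathbb{R}^{N_0+M_0+2}$, $\hat x_{1,n}(0),\hat x_{2,m}(0)\in\mathbb{R}$ ($N_0+1\le n\le N$, $M_0+1\le m\le M$), the solutions of the system $$\partial_t y=\partial_{xx}y+ay,\quad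 \partial_t z=\partial_{xx}z+bz,\quad \partial_x y(t,0)=s\,z(t,0),\quad y(t,1)=\partial_x z(t,1)=0,\quad \partial_x z(t,0)=u(t),$$ $$y(0,x)=y_0(x),\quad z(0,x)=z_0(x)\qquad(t>0,\ x\in(0,1)),$$ with measured output $y_m(t)=\int_0^1c(x)y(t,x)\,dx$, in closed loop with the output-feedback controller $$\dot u=v,\qquad v=-K_x\hat X_1-k_uu,$$ $$\dot{\hat X}_1=A_1\hat X_1+B_{1,u}u+B_{1,v}v-L\Big\{C_1\hat X_1+\sum_{n=N_0+1}^Nc_{1,n}\hat x_{1,n}+\sum_{m=M_0+1}^Mc_{2,m}\hat x_{2,m}-y_m(t)\Big\},$$ $$\dot{\hat x}_{1,n}=\lambda_{1,n}\hat x_{1,n}+\alpha_{1,n}u+\beta_{1,n}v\ \ (N_0+1\le n\le N),\qquad \dot{\hat x}_{2,m}=\lambda_{2,m}\hat x_{2,m}+\alpha_{2,m}u+\beta_{2,m}v\ \ (M_0+1\le m\le M),$$ satisfy $$\Vert(y(t,\cdot),z(t,\cdot))\Vert_Y^2+u(t)^2+\Vert\hat X_1(t)\Vert^2+\sum_{n=N_0+1}^N\hat x_{1,n}(t)^2+\sum_{m=M_0+1}^M\hat x_{2,m}(t)^2$$ $$\leq Ce^{-2\delta t}\Big(\Vert(y_0,z_0)\Vert_Y^2+u_0^2+\Vert\hat X_1(0)\Vert^2+\sum_{n=N_0+1}^N\hat x_{1,n}(0)^2+\sum_{m=M_0+1}^M\hat x_{2,m}(0)^2\Big)$$ for every $t\geq0$,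 with $Y=\mathcal{H}^0$. If the initial conditions are such that $y_0,z_0\in H^2(0,1)$ with $y_0(1)=z_0'(1)=0$, $y_0'(0)=sz_0(0)$ and $z_0'(0)=u(0)$, then the same estimate holds with $Y=\mathcal{H}^1$.
   Context: $\mathbb{N}=\{0,1,2,\ldots\}$. Spaces. $\mathcal{H}^0=L^2(0,1)\times L^2(0,1)$ with inner product $\langle(f_1,g_1),(f_2,g_2)\rangle=\int_0^1(f_1f_2+g_1g_2)\,dx$. $H^1_{(1)}(0,1)=\{f\in H^1(0,1)\mid f(1)=0\}$ with inner product $\int_0^1 f_1'f_2'\,dx$; $\mathcal{H}^1=H^1_{(1)}(0,1)\times H^1(0,1)$ with inner product $\int_0^1(f_1'f_2'+g_1g_2+g_1'g_2')\,dx$. Below $\langle\cdot,\cdot\rangle$ is the inner product of $\mathcal{H}^0$. Eigenvalues and index sets. For $n,m\in\mathbb{N}$: $\lambda_{1,n}=a-(n+1/2)^2\pi^2$, $\lambda_{2,m}=b-m^2\pi^2$. $\Delta(a,b)=\{(n,m)\in\mathbb{N}^2\mid 4(b-a)=(4m^2-(2n+1)^2)\pi^2\}$ (a finite set, equivalently the set of $(n,m)$ with $\lambda_{1,n}=\lambda_{2,m}$); $\Delta_1(a,b)$ and $\Delta_2(a,b)$ are its projections on the first and second coordinate (the conditions $N_0\ge\max\Delta_1(a,b)$, $M_0\ge\max\Delta_2(a,b)$ are vacuous if these sets are empty). $\Theta(a,b)=\{n\in\mathbb{N}\mid\exists k\in\mathbb{N},\ 4(b-a)=((2k+1)^2-(2n+1)^2)\pi^2\}$.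 $\mu_0=1$ and $\mu_m=\sqrt2$ for $m\geq1$. Functions $\phi_{i,k}^1$. $\phi_{1,n}^1(x)=\sqrt2\cos((n+1/2)\pi x)$. For $m\notin\Delta_2(a,b)$ with $b-a=m^2\pi^2$: $\phi_{2,m}^1(x)=s\mu_m(-1+x)$. For $m\notin\Delta_2(a,b)$ with $b-a\neq m^2\pi^2$: $\phi_{2,m}^1(x)=-\frac{s\mu_m}{r_m\cosh(r_m)}\sinh(r_m(1-x))$ where $r_m$ is one of the two (complex) square roots of $b-a-m^2\pi^2$. For $m\in\Delta_2(a,b)$ with $(k,m)\in\Delta(a,b)$: $\phi_{2,m}^1(x)=\frac{s\mu_m}{(k+1/2)\pi}(1-x)\sin((k+1/2)\pi x)$. Functions $\psi_{i,k}=(\psi_{i,k}^1,\psi_{i,k}^2)$. $\psi_{2,m}^1=0$ and $\psi_{2,m}^2(x)=\mu_m\cos(m\pi x)$. $\psi_{1,n}^1(x)=\sqrt2\cos((n+1/2)\pi x)$, and: if $n\notin\Delta_1(a,b)$, $\psi_{1,n}^2(x)=-\frac{\sqrt2 s}{r_n^*\sinh(r_n^* )}\cosh(r_n^*(1-x))$ where $r_n^*$ is one of the two (complex) square roots of $\lambda_{1,n}-b$; if $(n,0)\in\Delta(a,b)$, $\psi_{1,n}^2(x)=c_0+\sqrt2 s x-\frac{\sqrt2}{2}s x^2$ with $c_0=-s\sqrt2\left(\frac13+\frac1{(2n+1)^2\pi^2}\right)$; if $(n,k)\in\Delta(a,b)$ with $k\geq1$, $\psi_{1,n}^2(x)=\frac{\sqrt2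 s}{k\pi}(1-x)\sin(k\pi x)+c_n\sqrt2\cos(k\pi x)$ with $c_n=-\frac{2s}{\pi^2}\left(\frac1{(2n+1)^2}+\frac1{4k^2}\right)$. Homogenized state. $\varphi(x)=x-x^2/2$, $\alpha=\varphi''+b\varphi$, $\beta=-\varphi$, $\tilde z(t,x)=z(t,x)-\varphi(x)u(t)$, $\tilde{\mathcal X}(t)=(y(t,\cdot),\tilde z(t,\cdot))$, $v=\dot u$. The system is equivalent to $\frac{d}{dt}\tilde{\mathcal X}=\mathcal{A}\tilde{\mathcal X}+(0,\alpha)u+(0,\beta)v$, $\dot u=v$, where $\mathcal{A}(f,g)=(f''+af,g''+bg)$ on $D(\mathcal{A})=\{(f,g)\in H^2(0,1)^2\mid f(1)=g'(0)=g'(1)=0,\ f'(0)=s g(0)\}$; solutions are understood in this sense (mild solutions for $L^2$ data). Set $\alpha_{i,k}=\langle(0,\alpha),\psi_{i,k}\rangle$, $\beta_{i,k}=\langle(0,\beta),\psi_{i,k}\rangle$. Matrices. Let $N_\Delta=\mathrm{Card}(\Delta(a,b))$ and write $\Delta(a,b)=\{(\theta_1(i),\theta_2(i))\mid 0\le i\le N_\Delta-1\}$ with $\theta_1,\theta_2$ increasing. Let $\varphi_1$ be the permutation of $\{0,\ldots,N_0\}$ with $\varphi_1(i)=\theta_1(i)$ for $0\le i\le N_\Delta-1$ and $\varphi_1$ increasing on $\{N_\Delta,\ldots,N_0\}$; let $\varphi_2$ be the permutation of $\{0,\ldots,M_0\}$ with $\varphi_2(i)=\theta_2(i)$ for $0\le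 i\le N_\Delta-1$ and $\varphi_2$ increasing on $\{N_\Delta,\ldots,M_0\}$. For a family $w=(w_{i,k})$ write $[w]$ for the column vector of $\mathbb{R}^{N_0+M_0+2}$ with successive entries $w_{1,\varphi_1(0)},w_{2,\varphi_2(0)},\ldots,w_{1,\varphi_1(N_\Delta-1)},w_{2,\varphi_2(N_\Delta-1)},\ w_{1,\varphi_1(N_\Delta)},\ldots,w_{1,\varphi_1(N_0)},\ w_{2,\varphi_2(N_\Delta)},\ldots,w_{2,\varphi_2(M_0)}$. For $(n,m)\in\Delta(a,b)$ with $\lambda=\lambda_{1,n}=\lambda_{2,m}$ let $M_n=\begin{bmatrix}\lambda&-\sqrt2 s\mu_m\\0&\lambda\end{bmatrix}$. Set $B_{1,u}=[\alpha]$ (entries $\alpha_{i,k}$), $B_{1,v}=[\beta]$ (entries $\beta_{i,k}$), $C_1=[c]^\top$ (entries $c_{i,k}$), $A_1$ the block-diagonal matrix with successive diagonal blocks $M_{\varphi_1(0)},\ldots,M_{\varphi_1(N_\Delta-1)},\lambda_{1,\varphi_1(N_\Delta)},\ldots,\lambda_{1,\varphi_1(N_0)},\lambda_{2,\varphi_2(N_\Delta)},\ldots,\lambda_{2,\varphi_2(M_0)}$, and $$A_{1,a}=\begin{bmatrix}A_1&B_{1,u}\\0&0\end{bmatrix},\quad B_{1,a}=\begin{bmatrix}B_{1,v}\\1\end{bmatrix}.$$ *)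

theory Defs
  imports "HOL-Analysis.Analysis" "Jordan_Normal_Form.Char_Poly"
begin

(* The symbols $ and \<bullet> denote the Jordan_Normal_Form operations on vectors below. *)
unbundle no vec_syntax
unbundle no inner_syntax


section \<open>Function spaces on the unit interval\<close>

abbreviation I01 :: "real measure" where
  "I01 \<equiv> lebesgue_on {0<..<1}"

text \<open>Elements of \<open>L\<^sup>2(0,1)\<close> are represented by functions; they are identified when they agree
  almost everywhere on \<open>(0,1)\<close>.\<close>

definition L2I :: "(real \<Rightarrow> real) set" where
  "L2I = {f. f \<in> borel_measurable I01 \<and> integrable I01 (\<lambda>x. (f x)\<^sup>2)}"

text \<open>\<open>f\<close> is the continuous representative on \<open>[0,1]\<close> of an element of \<open>H\<^sup>1(0,1)\<close> whose derivative
  is \<open>f'\<close>: it is absolutely continuous, being the indefinite integral of \<open>f' \<in> L\<^sup>2(0,1)\<close>.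
  In particular \<open>f 0\<close> and \<open>f 1\<close> are the traces of \<open>f\<close>.\<close>

definition has_L2_deriv :: "(real \<Rightarrow> real) \<Rightarrow> (real \<Rightarrow> real) \<Rightarrow> bool" where
  "has_L2_deriv f f' \<longleftrightarrow>
     f' \<in> L2I \<and> (\<forall>x\<in>{0..1}. f x = f 0 + (LINT t|lebesgue_on {0<..<x}. f' t))"

text \<open>\<open>f \<in> H\<^sup>2(0,1)\<close>, with \<open>f'\<close> the continuous representative of the first derivative.\<close>

definition has_L2_deriv2 ::
  "(real \<Rightarrow> real) \<Rightarrow> (real \<Rightarrow> real) \<Rightarrow> (real \<Rightarrow> real) \<Rightarrow> bool" where
  "has_L2_deriv2 f f' f'' \<longleftrightarrow> has_L2_deriv f f' \<and> has_L2_deriv f' f''"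

definition eqI :: "(real \<Rightarrow> real) \<Rightarrow> (real \<Rightarrow> real) \<Rightarrow> bool" where
  "eqI f g \<longleftrightarrow> (AE x in I01. f x = g x)"

definition H1I :: "(real \<Rightarrow> real) set" where
  "H1I = {f. \<exists>g g'. eqI f g \<and> has_L2_deriv g g'}"

definition H1I_1 :: "(real \<Rightarrow> real) set" where
  "H1I_1 = {f. \<exists>g g'. eqI f g \<and> has_L2_deriv g g' \<and> g 1 = 0}"

text \<open>The weak derivative of an element of \<open>H\<^sup>1(0,1)\<close>, which is unique up to null sets.\<close>

definition wderiv :: "(real \<Rightarrow> real) \<Rightarrow> real \<Rightarrow> real" where
  "wderiv f = (SOME g'. \<exists>g. eqI f g \<and> has_L2_deriv g g')"


section \<open>The state spaces\<close>

type_synonym state = "(real \<Rightarrow> real) \<times> (real \<Rightarrow> real)"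

definition H0 :: "state set" where
  "H0 = L2I \<times> L2I"

definition H0_inner :: "state \<Rightarrow> state \<Rightarrow> real" where
  "H0_inner X Y = (LINT x|I01. fst X x * fst Y x + snd X x * snd Y x)"

definition H0_normsq :: "state \<Rightarrow> real" where
  "H0_normsq X = H0_inner X X"

definition H1 :: "state set" where
  "H1 = H1I_1 \<times> H1I"

definition H1_inner :: "state \<Rightarrow> state \<Rightarrow> real" where
  "H1_inner X Y = (LINT x|I01. wderiv (fst X) x * wderiv (fst Y) x
     + snd X x * snd Y x + wderiv (snd X) x * wderiv (snd Y) x)"

definition H1_normsq :: "state \<Rightarrow> real" where
  "H1_normsq X = H1_inner X X"

definition eq_state :: "state \<Rightarrow> state \<Rightarrow> bool" where
  "eq_state X Y \<longleftrightarrow> eqI (fst X) (fst Y) \<and> eqI (snd X) (snd Y)"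

definition add_state :: "state \<Rightarrow> state \<Rightarrow> state" where
  "add_state X Y = ((\<lambda>x. fst X x + fst Y x), (\<lambda>x. snd X x + snd Y x))"

definition diff_state :: "state \<Rightarrow> state \<Rightarrow> state" where
  "diff_state X Y = ((\<lambda>x. fst X x - fst Y x), (\<lambda>x. snd X x - snd Y x))"


section \<open>Mild solutions of inhomogeneous Cauchy problems\<close>

text \<open>\<open>W = \<integral>\<^sub>0\<^sup>t X(\<tau>) d\<tau>\<close> in the Hilbert space \<open>H0\<close>, tested against all elements of \<open>H0\<close>.
  For a continuous curve this is the Riemann (or Bochner) integral.\<close>

definition has_H0_integral :: "(real \<Rightarrow> state) \<Rightarrow> state \<Rightarrow> real \<Rightarrow> bool" where
  "has_H0_integral X W t \<longleftrightarrow> W \<in> H0 \<and>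
     (\<forall>H\<in>H0. ((\<lambda>\<tau>. H0_inner (X \<tau>) H) has_integral H0_inner W H) {0..t})"

text \<open>A (possibly unbounded) operator on \<open>H0\<close> is given by its graph: \<open>A X V\<close> says that \<open>X\<close> lies
  in the domain and is mapped to \<open>V\<close>. The curve \<open>X \<in> C([0,\<infinity>); H0)\<close> is a mild solution of
  \<open>X' = A X + F\<close>, \<open>X(0) = X\<^sub>0\<close>, if for all \<open>t \<ge> 0\<close> one has \<open>\<integral>\<^sub>0\<^sup>t X(\<tau>) d\<tau> \<in> D(A)\<close> and
  \<open>X(t) = X\<^sub>0 + A (\<integral>\<^sub>0\<^sup>t X(\<tau>) d\<tau>) + \<integral>\<^sub>0\<^sup>t F(\<tau>) d\<tau>\<close>
  (Arendt, Batty, Hieber and Neubrander, Vector-valued Laplace Transforms and Cauchy Problems,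
  Section 3.1). When \<open>A\<close> generates a \<open>C\<^sub>0\<close>-semigroup this is equivalent to the variation of constants formula.\<close>

definition mild_solution ::
  "(state \<Rightarrow> state \<Rightarrow> bool) \<Rightarrow> (real \<Rightarrow> state) \<Rightarrow> state \<Rightarrow> (real \<Rightarrow> state) \<Rightarrow> bool" where
  "mild_solution A F X0 X \<longleftrightarrow>
     (\<forall>t\<ge>0. X t \<in> H0) \<and>
     (\<forall>t\<ge>0. ((\<lambda>\<tau>. H0_normsq (diff_state (X \<tau>) (X t))) \<longlongrightarrow> 0) (at t within {0..})) \<and>
     (\<forall>t\<ge>0. \<exists>W V G. has_H0_integral X W t \<and> A W V \<and> has_H0_integral F G t \<and>
        eq_state (X t) (add_state X0 (add_state V G)))"

text \<open>The operator \<open>A(f,g) = (f'' + a f, g'' + b g)\<close>.\<close>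

definition opA :: "real \<Rightarrow> real \<Rightarrow> real \<Rightarrow> state \<Rightarrow> state \<Rightarrow> bool" where
  "opA a b s X V \<longleftrightarrow>
     (\<exists>f f' f'' g g' g''. has_L2_deriv2 f f' f'' \<and> has_L2_deriv2 g g' g'' \<and>
        f 1 = 0 \<and> g' 0 = 0 \<and> g' 1 = 0 \<and> f' 0 = s * g 0 \<and>
        eq_state X (f, g) \<and>
        eq_state V ((\<lambda>x. f'' x + a * f x), (\<lambda>x. g'' x + b * g x)))"


section \<open>Eigenvalues and index sets\<close>

definition lam1 :: "real \<Rightarrow> nat \<Rightarrow> real" where
  "lam1 a n = a - (real n + 1/2)\<^sup>2 * pi\<^sup>2"

definition lam2 :: "real \<Rightarrow> nat \<Rightarrow> real" where
  "lam2 b m = b - (real m)\<^sup>2 * pi\<^sup>2"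

definition Delta :: "real \<Rightarrow> real \<Rightarrow> (nat \<times> nat) set" where
  "Delta a b = {(n, m). 4 * (b - a) = (4 * (real m)\<^sup>2 - (2 * real n + 1)\<^sup>2) * pi\<^sup>2}"

definition Delta1 :: "real \<Rightarrow> real \<Rightarrow> nat set" where
  "Delta1 a b = fst ` Delta a b"

definition Delta2 :: "real \<Rightarrow> real \<Rightarrow> nat set" where
  "Delta2 a b = snd ` Delta a b"

definition Theta :: "real \<Rightarrow> real \<Rightarrow> nat set" where
  "Theta a b = {n. \<exists>k::nat. 4 * (b - a) = ((2 * real k + 1)\<^sup>2 - (2 * real n + 1)\<^sup>2) * pi\<^sup>2}"

definition mu :: "nat \<Rightarrow> real" where
  "mu m = (if m = 0 then 1 else sqrt 2)"


section \<open>The functions \<open>\<phi>\<close> and \<open>\<psi>\<close>\<close>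

definition phi1 :: "nat \<Rightarrow> real \<Rightarrow> real" where
  "phi1 n x = sqrt 2 * cos ((real n + 1/2) * pi * x)"

text \<open>The expressions involving complex square roots are real-valued and do not depend on the
  choice of the root (see \<open>sinh_cosh_root\<close> and \<open>cosh_sinh_root\<close> below), hence the use of
  \<^const>\<open>csqrt\<close> and \<^const>\<open>Re\<close>.\<close>

definition phi2 :: "real \<Rightarrow> real \<Rightarrow> real \<Rightarrow> nat \<Rightarrow> real \<Rightarrow> real" where
  "phi2 a b s m x =
     (if m \<in> Delta2 a b then
        let k = (THE k. (k, m) \<in> Delta a b);
            w = (real k + 1/2) * pi
        in s * mu m / w * (1 - x) * sin (w * x)
      else if b - a = (real m)\<^sup>2 * pi\<^sup>2 then s * mu m * (-1 + x)
      else
        let r = csqrt (complex_of_real (b - a - (real m)\<^sup>2 * pi\<^sup>2))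
        in Re (- (complex_of_real (s * mu m) / (r * cosh r)) * sinh (r * complex_of_real (1 - x))))"

definition psi1_snd :: "real \<Rightarrow> real \<Rightarrow> real \<Rightarrow> nat \<Rightarrow> real \<Rightarrow> real" where
  "psi1_snd a b s n x =
     (if n \<notin> Delta1 a b then
        let r = csqrt (complex_of_real (lam1 a n - b))
        in Re (- (complex_of_real (sqrt 2 * s) / (r * sinh r)) * cosh (r * complex_of_real (1 - x)))
      else
        let k = (THE k. (n, k) \<in> Delta a b) in
        if k = 0 then
          - s * sqrt 2 * (1/3 + 1 / ((2 * real n + 1)\<^sup>2 * pi\<^sup>2)) + sqrt 2 * s * x - sqrt 2 / 2 * s * x\<^sup>2
        else
          sqrt 2 * s / (real k * pi) * (1 - x) * sin (real k * pi * x)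
          - 2 * s / pi\<^sup>2 * (1 / (2 * real n + 1)\<^sup>2 + 1 / (4 * (real k)\<^sup>2))
            * sqrt 2 * cos (real k * pi * x))"

definition psi1 :: "real \<Rightarrow> real \<Rightarrow> real \<Rightarrow> nat \<Rightarrow> state" where
  "psi1 a b s n = ((\<lambda>x. sqrt 2 * cos ((real n + 1/2) * pi * x)), psi1_snd a b s n)"

definition psi2 :: "nat \<Rightarrow> state" where
  "psi2 m = ((\<lambda>x. 0), (\<lambda>x. mu m * cos (real m * pi * x)))"


section \<open>Homogenization and modal coefficients\<close>

definition hphi :: "real \<Rightarrow> real" where
  "hphi x = x - x\<^sup>2 / 2"

definition halpha :: "real \<Rightarrow> real \<Rightarrow> real" where
  "halpha b x = deriv (deriv hphi) x + b * hphi x"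

definition hbeta :: "real \<Rightarrow> real" where
  "hbeta x = - hphi x"

definition alpha1 :: "real \<Rightarrow> real \<Rightarrow> real \<Rightarrow> nat \<Rightarrow> real" where
  "alpha1 a b s n = H0_inner ((\<lambda>x. 0), halpha b) (psi1 a b s n)"

definition alpha2 :: "real \<Rightarrow> nat \<Rightarrow> real" where
  "alpha2 b m = H0_inner ((\<lambda>x. 0), halpha b) (psi2 m)"

definition beta1 :: "real \<Rightarrow> real \<Rightarrow> real \<Rightarrow> nat \<Rightarrow> real" where
  "beta1 a b s n = H0_inner ((\<lambda>x. 0), hbeta) (psi1 a b s n)"

definition beta2 :: "nat \<Rightarrow> real" where
  "beta2 m = H0_inner ((\<lambda>x. 0), hbeta) (psi2 m)"

definition c1 :: "(real \<Rightarrow> real) \<Rightarrow> nat \<Rightarrow> real" where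
  "c1 c n = (LINT x|I01. c x * phi1 n x)"

definition c2 :: "real \<Rightarrow> real \<Rightarrow> real \<Rightarrow> (real \<Rightarrow> real) \<Rightarrow> nat \<Rightarrow> real" where
  "c2 a b s c m = (LINT x|I01. c x * phi2 a b s m x)"


section \<open>Finite-dimensional matrices\<close>

text \<open>The elements of \<^term>\<open>Delta a b\<close> are the pairs of the \<open>i\<close>-th smallest element of
  \<^term>\<open>Delta1 a b\<close> and the \<open>i\<close>-th smallest element of \<^term>\<open>Delta2 a b\<close>, see
  \<open>Delta_enumeration\<close> below. The permutations are written as lists of their values.\<close>

definition perm1 :: "real \<Rightarrow> real \<Rightarrow> nat \<Rightarrow> nat list" where
  "perm1 a b N0 = sorted_list_of_set (Delta1 a b) @ sorted_list_of_set ({0..N0} - Delta1 a b)"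

definition perm2 :: "real \<Rightarrow> real \<Rightarrow> nat \<Rightarrow> nat list" where
  "perm2 a b M0 = sorted_list_of_set (Delta2 a b) @ sorted_list_of_set ({0..M0} - Delta2 a b)"

definition modal_vec ::
  "real \<Rightarrow> real \<Rightarrow> nat \<Rightarrow> nat \<Rightarrow> (nat \<Rightarrow> real) \<Rightarrow> (nat \<Rightarrow> real) \<Rightarrow> real Matrix.vec" where
  "modal_vec a b N0 M0 w1 w2 =
     (let N\<Delta> = card (Delta a b) in
      vec_of_list
        (concat (map (\<lambda>i. [w1 (perm1 a b N0 ! i), w2 (perm2 a b M0 ! i)]) [0..<N\<Delta>])
         @ map (\<lambda>i. w1 (perm1 a b N0 ! i)) [N\<Delta>..<N0 + 1]
         @ map (\<lambda>i. w2 (perm2 a b M0 ! i)) [N\<Delta>..<M0 + 1]))"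

definition jordan_block2 :: "real \<Rightarrow> real \<Rightarrow> nat \<Rightarrow> nat \<Rightarrow> real Matrix.mat" where
  "jordan_block2 a s n m =
     mat_of_rows_list 2 [[lam1 a n, - (sqrt 2) * s * mu m], [0, lam1 a n]]"

definition matA1 :: "real \<Rightarrow> real \<Rightarrow> real \<Rightarrow> nat \<Rightarrow> nat \<Rightarrow> real Matrix.mat" where
  "matA1 a b s N0 M0 =
     (let N\<Delta> = card (Delta a b) in
      diag_block_mat
        (map (\<lambda>i. jordan_block2 a s (perm1 a b N0 ! i) (perm2 a b M0 ! i)) [0..<N\<Delta>]
         @ map (\<lambda>i. mat_of_rows_list 1 [[lam1 a (perm1 a b N0 ! i)]]) [N\<Delta>..<N0 + 1]
         @ map (\<lambda>i. mat_of_rows_list 1 [[lam2 b (perm2 a b M0 ! i)]]) [N\<Delta>..<M0 + 1]))"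

definition vecB1u :: "real \<Rightarrow> real \<Rightarrow> real \<Rightarrow> nat \<Rightarrow> nat \<Rightarrow> real Matrix.vec" where
  "vecB1u a b s N0 M0 = modal_vec a b N0 M0 (alpha1 a b s) (alpha2 b)"

definition vecB1v :: "real \<Rightarrow> real \<Rightarrow> real \<Rightarrow> nat \<Rightarrow> nat \<Rightarrow> real Matrix.vec" where
  "vecB1v a b s N0 M0 = modal_vec a b N0 M0 (beta1 a b s) beta2"

definition vecC1 ::
  "real \<Rightarrow> real \<Rightarrow> real \<Rightarrow> (real \<Rightarrow> real) \<Rightarrow> nat \<Rightarrow> nat \<Rightarrow> real Matrix.vec" where
  "vecC1 a b s c N0 M0 = modal_vec a b N0 M0 (c1 c) (c2 a b s c)"

definition col_mat :: "real Matrix.vec \<Rightarrow> real Matrix.mat" where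
  "col_mat v = mat_of_cols (dim_vec v) [v]"

definition row_mat :: "real Matrix.vec \<Rightarrow> real Matrix.mat" where
  "row_mat v = mat_of_rows (dim_vec v) [v]"

definition matA1a :: "real \<Rightarrow> real \<Rightarrow> real \<Rightarrow> nat \<Rightarrow> nat \<Rightarrow> real Matrix.mat" where
  "matA1a a b s N0 M0 =
     four_block_mat (matA1 a b s N0 M0) (col_mat (vecB1u a b s N0 M0))
       (0\<^sub>m 1 (N0 + M0 + 2)) (0\<^sub>m 1 1)"

definition matB1a :: "real \<Rightarrow> real \<Rightarrow> real \<Rightarrow> nat \<Rightarrow> nat \<Rightarrow> real Matrix.mat" where
  "matB1a a b s N0 M0 = col_mat (vecB1v a b s N0 M0 @\<^sub>v vec_of_list [1])"

text \<open>\<open>K = [K\<^sub>x k\<^sub>u]\<close>, with the row vector \<open>K\<^sub>x\<close> given as a vector.\<close>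

definition matK :: "real Matrix.vec \<Rightarrow> real \<Rightarrow> real Matrix.mat" where
  "matK Kx ku = row_mat (Kx @\<^sub>v vec_of_list [ku])"

definition eigenvalues_left_of :: "real Matrix.mat \<Rightarrow> real \<Rightarrow> bool" where
  "eigenvalues_left_of A r \<longleftrightarrow>
     (\<forall>z::complex. eigenvalue (map_mat complex_of_real A) z \<longrightarrow> Re z < r)"


section \<open>The closed-loop system\<close>

text \<open>\<open>(y, z)\<close> is the state of the plant with initial condition \<open>(y0, z0)\<close>; it solves the
  equations in the sense that the homogenized state \<open>(y, z - \<phi> u)\<close> is a mild solution.\<close>

definition closed_loop ::
  "real \<Rightarrow> real \<Rightarrow> real \<Rightarrow> (real \<Rightarrow> real) \<Rightarrow> nat \<Rightarrow> nat \<Rightarrow> nat \<Rightarrow> nat \<Rightarrow>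
   real Matrix.vec \<Rightarrow> real \<Rightarrow> real Matrix.vec \<Rightarrow>
   (real \<Rightarrow> real) \<Rightarrow> (real \<Rightarrow> real) \<Rightarrow>
   (real \<Rightarrow> real \<Rightarrow> real) \<Rightarrow> (real \<Rightarrow> real \<Rightarrow> real) \<Rightarrow> (real \<Rightarrow> real) \<Rightarrow>
   (real \<Rightarrow> real Matrix.vec) \<Rightarrow> (nat \<Rightarrow> real \<Rightarrow> real) \<Rightarrow> (nat \<Rightarrow> real \<Rightarrow> real) \<Rightarrow> bool" where
  "closed_loop a b s c N0 M0 N M Kx ku L y0 z0 y z u Xh x1 x2 \<longleftrightarrow>
     (let v = (\<lambda>t. - (Kx \<bullet> Xh t) - ku * u t);
          ym = (\<lambda>t. LINT x|I01. c x * y t x);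
          innov = (\<lambda>t. vecC1 a b s c N0 M0 \<bullet> Xh t
                    + (\<Sum>n=N0+1..N. c1 c n * x1 n t)
                    + (\<Sum>m=M0+1..M. c2 a b s c m * x2 m t) - ym t)
      in
       mild_solution (opA a b s)
         (\<lambda>t. ((\<lambda>x. 0), (\<lambda>x. halpha b x * u t + hbeta x * v t)))
         (y0, (\<lambda>x. z0 x - hphi x * u 0))
         (\<lambda>t. (y t, (\<lambda>x. z t x - hphi x * u t))) \<and>
       (\<forall>t\<ge>0. (u has_real_derivative v t) (at t within {0..})) \<and>
       (\<forall>t\<ge>0. Xh t \<in> carrier_vec (N0 + M0 + 2)) \<and>
       (\<forall>t\<ge>0. \<forall>i<N0 + M0 + 2.
          ((\<lambda>\<tau>. Xh \<tau> $ i) has_real_derivative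
             (matA1 a b s N0 M0 *\<^sub>v Xh t + u t \<cdot>\<^sub>v vecB1u a b s N0 M0
              + v t \<cdot>\<^sub>v vecB1v a b s N0 M0 - innov t \<cdot>\<^sub>v L) $ i) (at t within {0..})) \<and>
       (\<forall>t\<ge>0. \<forall>n\<in>{N0+1..N}.
          (x1 n has_real_derivative
             lam1 a n * x1 n t + alpha1 a b s n * u t + beta1 a b s n * v t) (at t within {0..})) \<and>
       (\<forall>t\<ge>0. \<forall>m\<in>{M0+1..M}.
          (x2 m has_real_derivative
             lam2 b m * x2 m t + alpha2 b m * u t + beta2 m * v t) (at t within {0..})))"

definition controller_normsq ::
  "nat \<Rightarrow> nat \<Rightarrow> nat \<Rightarrow> nat \<Rightarrow> (real \<Rightarrow> real) \<Rightarrow> (real \<Rightarrow> real Matrix.vec) \<Rightarrow>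
   (nat \<Rightarrow> real \<Rightarrow> real) \<Rightarrow> (nat \<Rightarrow> real \<Rightarrow> real) \<Rightarrow> real \<Rightarrow> real" where
  "controller_normsq N0 M0 N M u Xh x1 x2 t =
     (u t)\<^sup>2 + Xh t \<bullet> Xh t + (\<Sum>n=N0+1..N. (x1 n t)\<^sup>2) + (\<Sum>m=M0+1..M. (x2 m t)\<^sup>2)"

definition compatible_data ::
  "real \<Rightarrow> (real \<Rightarrow> real) \<Rightarrow> (real \<Rightarrow> real) \<Rightarrow> real \<Rightarrow> bool" where
  "compatible_data s y0 z0 u0 \<longleftrightarrow>
     (\<exists>y0' y0'' z0' z0''. has_L2_deriv2 y0 y0' y0'' \<and> has_L2_deriv2 z0 z0' z0'' \<and>
        y0 1 = 0 \<and> z0' 1 = 0 \<and> y0' 0 = s * z0 0 \<and> z0' 0 = u0)"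


section \<open>Consistency of the definitions\<close>

lemma Delta_iff_lam_eq: "(n, m) \<in> Delta a b \<longleftrightarrow> lam1 a n = lam2 b m"
  by (auto simp: Delta_def lam1_def lam2_def power2_eq_square field_simps)

lemma cnj_csqrt_of_real:
  "cnj (csqrt (complex_of_real d)) = csqrt (complex_of_real d) \<or>
   cnj (csqrt (complex_of_real d)) = - csqrt (complex_of_real d)"
proof -
  have "(cnj (csqrt (complex_of_real d)))\<^sup>2 = cnj ((csqrt (complex_of_real d))\<^sup>2)"
    by (simp only: complex_cnj_power)
  also have "\<dots> = (csqrt (complex_of_real d))\<^sup>2"
    by simp
  finally show ?thesis
    by (simp only: power2_eq_iff)
qed

lemma root_cases:
  assumes "(r::complex)\<^sup>2 = complex_of_real d"
  shows "r = csqrt (complex_of_real d) \<or> r = - csqrt (complex_of_real d)"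
proof -
  have "r\<^sup>2 = (csqrt (complex_of_real d))\<^sup>2"
    using assms by simp
  then show ?thesis
    by (simp only: power2_eq_iff)
qed

lemma cnj_sinh_cosh: "cnj (sinh z) = sinh (cnj z)" "cnj (cosh z) = cosh (cnj z)"
  by (simp_all add: sinh_field_def cosh_field_def exp_cnj)

lemma sinh_cosh_root:
  assumes "(r::complex)\<^sup>2 = complex_of_real d"
  shows "- (complex_of_real p / (r * cosh r)) * sinh (r * complex_of_real x) =
    complex_of_real (let q = csqrt (complex_of_real d) in
      Re (- (complex_of_real p / (q * cosh q)) * sinh (q * complex_of_real x)))"
proof -
  define F where "F q = - (complex_of_real p / (q * cosh q)) * sinh (q * complex_of_real x)" for q
  define q where "q = csqrt (complex_of_real d)"
  have neg: "F (- t) = F t" for t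
    by (simp add: F_def)
  have "cnj (F q) = F (cnj q)"
    by (simp add: F_def cnj_sinh_cosh)
  also have "\<dots> = F q"
    using cnj_csqrt_of_real[of d] neg by (auto simp: q_def)
  finally have "complex_of_real (Re (F q)) = F q"
    by (metis Reals_cnj_iff of_real_Re)
  moreover have "F r = F q"
    using root_cases[OF assms] neg by (auto simp: q_def)
  ultimately show ?thesis
    by (simp add: F_def q_def Let_def)
qed

lemma cosh_sinh_root:
  assumes "(r::complex)\<^sup>2 = complex_of_real d"
  shows "- (complex_of_real p / (r * sinh r)) * cosh (r * complex_of_real x) =
    complex_of_real (let q = csqrt (complex_of_real d) in
      Re (- (complex_of_real p / (q * sinh q)) * cosh (q * complex_of_real x)))"
proof -
  define F where "F q = - (complex_of_real p / (q * sinh q)) * cosh (q * complex_of_real x)" for q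
  define q where "q = csqrt (complex_of_real d)"
  have neg: "F (- t) = F t" for t
    by (simp add: F_def)
  have "cnj (F q) = F (cnj q)"
    by (simp add: F_def cnj_sinh_cosh)
  also have "\<dots> = F q"
    using cnj_csqrt_of_real[of d] neg by (auto simp: q_def)
  finally have "complex_of_real (Re (F q)) = F q"
    by (metis Reals_cnj_iff of_real_Re)
  moreover have "F r = F q"
    using root_cases[OF assms] neg by (auto simp: q_def)
  ultimately show ?thesis
    by (simp add: F_def q_def Let_def)
qed

lemma Delta_diff_eq:
  assumes "(n, m) \<in> Delta a b" "(n', m') \<in> Delta a b"
  shows "4 * (int m)\<^sup>2 - (2 * int n + 1)\<^sup>2 = 4 * (int m')\<^sup>2 - (2 * int n' + 1)\<^sup>2"
proof -
  have "4 * (real m)\<^sup>2 - (2 * real n + 1)\<^sup>2 = 4 * (real m')\<^sup>2 - (2 * real n' + 1)\<^sup>2"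
    using assms by (auto simp: Delta_def)
  then have "real_of_int (4 * (int m)\<^sup>2 - (2 * int n + 1)\<^sup>2) =
      real_of_int (4 * (int m')\<^sup>2 - (2 * int n' + 1)\<^sup>2)"
    by simp
  then show ?thesis
    by (simp only: of_int_eq_iff)
qed

lemma Delta_less_iff:
  assumes "(n, m) \<in> Delta a b" "(n', m') \<in> Delta a b"
  shows "n < n' \<longleftrightarrow> m < m'"
proof -
  have "m < m' \<longleftrightarrow> (int m)\<^sup>2 < (int m')\<^sup>2"
    using power2_less_imp_less[of "int m" "int m'"] power_strict_mono[of "int m" "int m'" 2] by auto
  also have "\<dots> \<longleftrightarrow> (2 * int n + 1)\<^sup>2 < (2 * int n' + 1)\<^sup>2"
    using Delta_diff_eq[OF assms] by linarith
  also have "\<dots> \<longleftrightarrow> n < n'"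
    using power2_less_imp_less[of "2 * int n + 1" "2 * int n' + 1"]
      power_strict_mono[of "2 * int n + 1" "2 * int n' + 1" 2] by auto
  finally show ?thesis ..
qed

lemma Delta_eq_iff:
  assumes "(n, m) \<in> Delta a b" "(n', m') \<in> Delta a b"
  shows "n = n' \<longleftrightarrow> m = m'"
  using Delta_less_iff[OF assms] Delta_less_iff[OF assms(2,1)] by linarith

lemma finite_Delta: "finite (Delta a b)"
proof (cases "Delta a b = {}")
  case False
  then obtain n0 m0 where nm0: "(n0, m0) \<in> Delta a b"
    by auto
  define D where "D = 4 * (int m0)\<^sup>2 - (2 * int n0 + 1)\<^sup>2"
  have bound: "n \<le> nat \<bar>D\<bar> \<and> m \<le> nat \<bar>D\<bar>" if "(n, m) \<in> Delta a b" for n m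
  proof -
    have D: "D = (2 * int m - 2 * int n - 1) * (2 * int m + 2 * int n + 1)"
      using Delta_diff_eq[OF that nm0] by (simp add: D_def power2_eq_square algebra_simps)
    have "1 \<le> \<bar>2 * int m - 2 * int n - 1\<bar>"
      by presburger
    then have "1 * \<bar>2 * int m + 2 * int n + 1\<bar> \<le> \<bar>2 * int m - 2 * int n - 1\<bar> * \<bar>2 * int m + 2 * int n + 1\<bar>"
      by (rule mult_right_mono) simp
    then have "2 * int m + 2 * int n + 1 \<le> \<bar>D\<bar>"
      by (simp add: D abs_mult)
    then show ?thesis
      by linarith
  qed
  then have "Delta a b \<subseteq> {..nat \<bar>D\<bar>} \<times> {..nat \<bar>D\<bar>}"
    by auto
  then show ?thesis
    by (rule finite_subset) simp
qed simp

lemma Delta_enumeration: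
  "Delta a b = {(sorted_list_of_set (Delta1 a b) ! i, sorted_list_of_set (Delta2 a b) ! i) |i.
     i < card (Delta a b)}"
proof -
  define f where "f n = (THE m. (n, m) \<in> Delta a b)" for n
  have f: "f n = m" if "(n, m) \<in> Delta a b" for n m
    unfolding f_def using that Delta_eq_iff by blast
  define xs where "xs = sorted_list_of_set (Delta1 a b)"
  have fin: "finite (Delta1 a b)" "finite (Delta2 a b)"
    by (simp_all add: Delta1_def Delta2_def finite_Delta)
  have xs: "set xs = Delta1 a b" "sorted_wrt (<) xs"
    using fin by (simp_all add: xs_def)
  have graph: "Delta a b = (\<lambda>n. (n, f n)) ` Delta1 a b"
    using f by (force simp: Delta1_def)
  then have D2: "Delta2 a b = f ` Delta1 a b"
    by (auto simp: Delta2_def image_image)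
  have "inj_on (\<lambda>n. (n, f n)) (Delta1 a b)"
    by (simp add: inj_on_def)
  then have "card (Delta a b) = card (Delta1 a b)"
    using graph by (metis card_image)
  then have card: "card (Delta a b) = length xs"
    by (simp add: xs_def)
  have "f n < f n'" if "n \<in> Delta1 a b" "n' \<in> Delta1 a b" "n < n'" for n n'
    using that graph Delta_less_iff[of n "f n" a b n' "f n'"] by auto
  then have "sorted_wrt (<) (map f xs)"
    using xs by (auto simp: sorted_wrt_map intro: sorted_wrt_mono_rel)
  then have "sorted_list_of_set (Delta2 a b) = map f xs"
    using D2 xs fin by (intro strict_sorted_equal) auto
  then have "{(xs ! i, sorted_list_of_set (Delta2 a b) ! i) |i. i < card (Delta a b)} =
      (\<lambda>n. (n, f n)) ` set xs"
    by (auto simp: card set_conv_nth)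
  also have "\<dots> = Delta a b"
    by (simp only: graph xs(1))
  finally show ?thesis
    by (simp only: xs_def)
qed

lemma dims:
  assumes "\<forall>n\<in>Delta1 a b. n \<le> N0" "\<forall>m\<in>Delta2 a b. m \<le> M0"
  shows "dim_vec (modal_vec a b N0 M0 w1 w2) = N0 + M0 + 2"
    and "matA1 a b s N0 M0 \<in> carrier_mat (N0 + M0 + 2) (N0 + M0 + 2)"
proof -
  have inj: "inj_on fst (Delta a b)" "inj_on snd (Delta a b)"
    using Delta_eq_iff by (fastforce simp: inj_on_def)+
  have "card (Delta1 a b) \<le> card {..N0}" "card (Delta2 a b) \<le> card {..M0}"
    using assms by (intro card_mono; blast)+
  then have le: "card (Delta a b) \<le> N0 + 1" "card (Delta a b) \<le> M0 + 1"
    using inj by (simp_all add: Delta1_def Delta2_def card_image)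
  have len: "length (concat (map (\<lambda>i. [g i, h i]) xs)) = 2 * length xs"
    for g h :: "nat \<Rightarrow> real" and xs
    by (induction xs) auto
  show "dim_vec (modal_vec a b N0 M0 w1 w2) = N0 + M0 + 2"
    using le by (simp add: modal_vec_def Let_def len)
  have sums: "sum_list (map (\<lambda>x. k) xs) = k * length xs" for k :: nat and xs :: "nat list"
    by (induction xs) auto
  have "dim_row (matA1 a b s N0 M0) = N0 + M0 + 2"
    using le by (simp add: matA1_def Let_def dim_diag_block_mat jordan_block2_def
        mat_of_rows_list_def o_def sums)
  moreover have "dim_col (matA1 a b s N0 M0) = N0 + M0 + 2"
    using le by (simp add: matA1_def Let_def dim_diag_block_mat jordan_block2_def
        mat_of_rows_list_def o_def sums)
  ultimately show "matA1 a b s N0 M0 \<in> carrier_mat (N0 + M0 + 2) (N0 + M0 + 2)"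
    by auto
qed

end

theory Submission
  imports Defs "Jordan_Normal_Form.Schur_Decomposition"
begin

text \<open>
  The plant is a cascade of two heat equations: the second component evolves on its own, with
  eigenvalues \<open>lam2\<close> and cosine eigenfunctions, and drives the first one through the boundary
  condition \<open>y'(0) = s z(0)\<close>. The proof works with the coordinates \<open>x1 n = \<langle>X, \<psi>1 n\<rangle>\<close> and
  \<open>x2 m = \<langle>X, \<psi>2 m\<rangle>\<close> of the homogenized state \<open>X\<close>. The functions \<open>\<psi>\<close> are generalized eigenvectors of
  the adjoint operator (\<open>ip_psi1_opA\<close>, \<open>ip_ecos_opA\<close>), so testing a mild solution against them yields
  scalar differential equations, which are coupled only inside the Jordan blocks belonging to the
  resonances in \<open>Delta a b\<close> (\<open>mild_solution_modes\<close>).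

  These coordinates describe the state faithfully because of one identity. Let
  \<open>lift = \<Sum>m. x2 m * \<phi>2 m\<close> be the part of \<open>y\<close> that is slaved to \<open>z\<close>. Biorthogonality of \<open>\<phi>\<close> and \<open>\<psi>\<close>
  says that the coefficients of \<open>y - lift\<close> in the orthonormal basis \<open>\<phi>1\<close> are exactly the numbers \<open>x1 n\<close>
  (\<open>ip_diff_lift\<close>). Since \<open>\<phi>2 m = O(1/m)\<close>, the lift is bounded on \<open>L\<^sup>2\<close>. Parseval's identity then shows
  that the norm of the state is equivalent to the \<open>\<ell>\<^sup>2\<close> norm of its coordinates
  (\<open>norm_equivalence_H0\<close>) and that the output is \<open>\<Sum>n. c1 n * x1 n + \<Sum>m. c2 m * x2 m\<close> with
  square-summable coefficients (\<open>output_expansion\<close>). With the weight \<open>n + 1\<close> the same identity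
  describes the \<open>H\<^sup>1\<close> norm (\<open>H1_synthesis\<close>, \<open>H1_analysis\<close>).

  The slow modes, the observer state and the input form a finite-dimensional system. Written with the
  observer error it is block triangular with the diagonal blocks \<open>A1 - L C1\<close> and \<open>A1a - B1a K\<close>. All
  their eigenvalues lie strictly to the left of \<open>- \<delta>\<close>, and therefore a forcing of size
  \<open>exp (- \<delta> t)\<close> produces a response of the same size (\<open>Hurwitz_decay\<close>). The fast modes are stable
  scalar equations forced by \<open>u\<close> and \<open>v\<close>. In the observer errors of the modes with
  \<open>N0 < n \<le> N\<close> the input cancels, so these errors decay by themselves. What the infinite-dimensional
  part feeds back is thus only the unmodelled output tail \<open>\<Sum>n>N. c1 n * x1 n + \<Sum>m>M. c2 m * x2 m\<close>.
  Its gain from the input is at most the \<open>\<ell>\<^sup>2\<close> norm of the tail of the output coefficients times a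
  constant that depends neither on \<open>N\<close> nor on \<open>M\<close>. For large \<open>N\<close> and \<open>M\<close> the loop gain is less than
  one, and the loop can be closed on every finite time interval (\<open>small_gain\<close>).

  Once \<open>u\<close> and \<open>v\<close> decay, every fast mode decays with the gain
  \<open>(\<bar>\<alpha> n\<bar> + \<bar>\<beta> n\<bar>) / (- \<delta> - \<lambda> n)\<close>. As \<open>(n + 1)\<^sup>2\<close> is eventually at most \<open>- \<delta> - \<lambda> n\<close>, these gains
  are square summable even with the weight \<open>(n + 1)\<^sup>2\<close> (\<open>summable_weighted_gain\<close>). The weight \<open>1\<close> gives
  the estimate in \<open>H0\<close> and the weight \<open>n + 1\<close> the estimate in \<open>H1\<close>. For compatible initial data, which
  lie in the domain of the operator after homogenization, the norm with the weight \<open>(n + 1)\<^sup>2\<close> is finite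
  as well (\<open>domain_modes_summable\<close>); this norm stays finite and makes the modal series differentiable
  term by term, so that the state lies in \<open>H1\<close> at all times.
\<close>


section \<open>The inner product of \<open>L\<^sup>2(0,1)\<close>\<close>

definition ip :: "(real \<Rightarrow> real) \<Rightarrow> (real \<Rightarrow> real) \<Rightarrow> real" where
  "ip f g = (LINT x|I01. f x * g x)"

abbreviation nsq :: "(real \<Rightarrow> real) \<Rightarrow> real" where
  "nsq f \<equiv> ip f f"

lemma finite_measure_I01: "finite_measure I01"
  by (intro finite_measureI) (auto simp: emeasure_restrict_space space_restrict_space)

lemma measure_I01: "measure I01 (space I01) = 1"
  by (simp add: measure_restrict_space space_restrict_space)

lemma L2I_measurable [measurable_dest]: "f \<in> L2I \<Longrightarrow> f \<in> borel_measurable I01"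
  by (simp add: L2I_def)

lemma L2I_square: "f \<in> L2I \<Longrightarrow> integrable I01 (\<lambda>x. (f x)\<^sup>2)"
  by (simp add: L2I_def)

lemma L2I_mult_integrable:
  assumes "f \<in> L2I" "g \<in> L2I"
  shows "integrable I01 (\<lambda>x. f x * g x)"
proof (rule Bochner_Integration.integrable_bound)
  show "integrable I01 (\<lambda>x. (f x)\<^sup>2 + (g x)\<^sup>2)"
    using assms by (intro Bochner_Integration.integrable_add L2I_square)
  show "(\<lambda>x. f x * g x) \<in> borel_measurable I01"
    using assms by (auto intro!: borel_measurable_times L2I_measurable)
  have "\<bar>u * v\<bar> \<le> u\<^sup>2 + v\<^sup>2" for u v :: real
    using sum_squares_bound[of "\<bar>u\<bar>" "\<bar>v\<bar>"] mult_nonneg_nonneg[of "\<bar>u\<bar>" "\<bar>v\<bar>"]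
    unfolding abs_mult power2_abs by linarith
  then show "AE x in I01. norm (f x * g x) \<le> norm ((f x)\<^sup>2 + (g x)\<^sup>2)"
    by simp
qed

lemma L2I_add: "f \<in> L2I \<Longrightarrow> g \<in> L2I \<Longrightarrow> (\<lambda>x. f x + g x) \<in> L2I"
  using L2I_mult_integrable[of f g]
  by (auto simp: L2I_def power2_sum mult.assoc)

lemma L2I_scale: "f \<in> L2I \<Longrightarrow> (\<lambda>x. r * f x) \<in> L2I"
  by (auto simp: L2I_def power_mult_distrib)

lemma L2I_scale_right: "f \<in> L2I \<Longrightarrow> (\<lambda>x. f x * r) \<in> L2I"
  by (auto simp: L2I_def power_mult_distrib)

lemma L2I_diff: "f \<in> L2I \<Longrightarrow> g \<in> L2I \<Longrightarrow> (\<lambda>x. f x - g x) \<in> L2I"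
  using L2I_add[of f "\<lambda>x. (-1) * g x"] L2I_scale[of g "-1"] by simp

lemma L2I_sum: "(\<And>i. i \<in> S \<Longrightarrow> f i \<in> L2I) \<Longrightarrow> (\<lambda>x. \<Sum>i\<in>S. f i x) \<in> L2I"
proof (induction S rule: infinite_finite_induct)
  case (insert i S)
  then show ?case using L2I_add[of "f i" "\<lambda>x. \<Sum>i\<in>S. f i x"] by simp
qed (simp_all add: L2I_def)

lemma L2I_bounded:
  assumes "f \<in> borel_measurable I01" and "\<And>x. x \<in> {0<..<1} \<Longrightarrow> \<bar>f x\<bar> \<le> B"
  shows "f \<in> L2I"
proof -
  have "integrable I01 (\<lambda>x. (f x)\<^sup>2)"
  proof (rule finite_measure.integrable_const_bound[OF finite_measure_I01, where B="B\<^sup>2"])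
    show "AE x in I01. norm ((f x)\<^sup>2) \<le> B\<^sup>2"
      by (rule AE_I2)
        (use assms(2) in \<open>force simp: space_restrict_space abs_le_square_iff[symmetric]\<close>)
    show "(\<lambda>x. (f x)\<^sup>2) \<in> borel_measurable I01"
      using assms(1) by measurable
  qed
  with assms show ?thesis by (simp add: L2I_def)
qed

lemma measurable_I01_continuous:
  "continuous_on {0<..<1} f \<Longrightarrow> (f :: real \<Rightarrow> real) \<in> borel_measurable I01"
  by (rule continuous_imp_measurable_on_sets_lebesgue) auto

lemma L2I_continuous:
  assumes "continuous_on {0..1} f" shows "f \<in> L2I"
proof -
  have "compact (f ` {0..1})"
    using assms by (intro compact_continuous_image) auto
  then obtain B where "\<forall>x\<in>{0..1}. \<bar>f x\<bar> \<le> B"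
    using compact_imp_bounded[of "f ` {0..1}"] by (auto simp: bounded_iff)
  then show ?thesis
    using assms by (intro L2I_bounded[where B=B] measurable_I01_continuous)
       (auto intro: continuous_on_subset)
qed

lemma ip_commute: "ip f g = ip g f"
  by (simp add: ip_def mult.commute)

lemma ip_add_left: "f \<in> L2I \<Longrightarrow> g \<in> L2I \<Longrightarrow> h \<in> L2I \<Longrightarrow> ip (\<lambda>x. f x + g x) h = ip f h + ip g h"
  by (simp add: ip_def distrib_right L2I_mult_integrable)

lemma ip_diff_left: "f \<in> L2I \<Longrightarrow> g \<in> L2I \<Longrightarrow> h \<in> L2I \<Longrightarrow> ip (\<lambda>x. f x - g x) h = ip f h - ip g h"
  by (simp add: ip_def left_diff_distrib L2I_mult_integrable)

lemma ip_scale_left: "ip (\<lambda>x. r * f x) h = r * ip f h"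
  by (simp add: ip_def mult.assoc)

lemma ip_add_right: "f \<in> L2I \<Longrightarrow> g \<in> L2I \<Longrightarrow> h \<in> L2I \<Longrightarrow> ip h (\<lambda>x. f x + g x) = ip h f + ip h g"
  by (simp add: ip_def distrib_left L2I_mult_integrable)

lemma ip_diff_right: "f \<in> L2I \<Longrightarrow> g \<in> L2I \<Longrightarrow> h \<in> L2I \<Longrightarrow> ip h (\<lambda>x. f x - g x) = ip h f - ip h g"
  by (simp add: ip_def right_diff_distrib L2I_mult_integrable)

lemma ip_scale_right: "ip h (\<lambda>x. r * f x) = r * ip h f"
  by (simp add: ip_commute[of h] ip_scale_left)

lemma ip_zero [simp]: "ip (\<lambda>x. 0) f = 0" "ip f (\<lambda>x. 0) = 0"
  by (simp_all add: ip_def)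

lemma ip_sum_right:
  "g \<in> L2I \<Longrightarrow> (\<And>i. i \<in> S \<Longrightarrow> f i \<in> L2I) \<Longrightarrow> ip g (\<lambda>x. \<Sum>i\<in>S. f i x) = (\<Sum>i\<in>S. ip g (f i))"
proof (induction S rule: infinite_finite_induct)
  case (insert i S)
  then show ?case using ip_add_right[of "f i" "\<lambda>x. \<Sum>i\<in>S. f i x" g] L2I_sum[of S f] by simp
qed simp_all

lemma ip_cong_AE:
  assumes "f \<in> L2I" "f' \<in> L2I" "g \<in> L2I" "g' \<in> L2I" "eqI f f'" "eqI g g'"
  shows "ip f g = ip f' g'"
  unfolding ip_def
proof (rule integral_cong_AE)
  show "AE x in I01. f x * g x = f' x * g' x"
    using assms(5,6) unfolding eqI_def by eventually_elim simp
qed (use assms in \<open>auto intro!: borel_measurable_times L2I_measurable\<close>)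

lemma ip_cong: "(\<And>x. x \<in> {0<..<1} \<Longrightarrow> f x * g x = f' x * g' x) \<Longrightarrow> ip f g = ip f' g'"
  unfolding ip_def by (rule Bochner_Integration.integral_cong) (auto simp: space_restrict_space)

lemma nsq_nonneg: "0 \<le> nsq f"
  unfolding ip_def by (rule Bochner_Integration.integral_nonneg) simp

lemma nsq_add: "f \<in> L2I \<Longrightarrow> g \<in> L2I \<Longrightarrow> nsq (\<lambda>x. f x + g x) = nsq f + 2 * ip f g + nsq g"
  by (simp add: ip_add_left ip_add_right L2I_add ip_commute[of g f])

lemma nsq_diff: "f \<in> L2I \<Longrightarrow> g \<in> L2I \<Longrightarrow> nsq (\<lambda>x. f x - g x) = nsq f - 2 * ip f g + nsq g"
  by (simp add: ip_diff_left ip_diff_right L2I_diff ip_commute[of g f])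

lemma nsq_scale: "nsq (\<lambda>x. r * f x) = r\<^sup>2 * nsq f"
  by (simp add: ip_scale_left ip_scale_right power2_eq_square)

lemma Cauchy_Schwarz_ip:
  assumes "f \<in> L2I" "g \<in> L2I"
  shows "(ip f g)\<^sup>2 \<le> nsq f * nsq g"
proof -
  have q: "0 \<le> nsq f - 2 * r * ip f g + r\<^sup>2 * nsq g" for r
    using nsq_nonneg[of "\<lambda>x. f x - r * g x"] nsq_diff[OF assms(1) L2I_scale[OF assms(2), of r]]
    by (simp add: nsq_scale ip_scale_right)
  \<comment> \<open>Minimize the quadratic polynomial in \<open>r\<close>. It degenerates to an
    affine one if \<open>nsq g = 0\<close>; an affine function that is bounded below is
    constant.\<close>
  show ?thesis
  proof (cases "nsq g = 0")
    case True
    have "ip f g = 0"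
    proof (rule ccontr)
      assume "ip f g \<noteq> 0"
      then show False
        using q[of "(nsq f + 1) / (2 * ip f g)"] True by simp
    qed
    then show ?thesis using True by simp
  next
    case False
    then have p: "nsq g > 0" using nsq_nonneg[of g] by simp
    have "0 \<le> nsq f - (ip f g)\<^sup>2 / nsq g"
      using q[of "ip f g / nsq g"] p by (simp add: power2_eq_square field_simps)
    then show ?thesis using p by (simp add: field_simps)
  qed
qed

lemma abs_ip_le: "f \<in> L2I \<Longrightarrow> g \<in> L2I \<Longrightarrow> \<bar>ip f g\<bar> \<le> sqrt (nsq f) * sqrt (nsq g)"
  using real_sqrt_le_mono[OF Cauchy_Schwarz_ip[of f g]] by (simp add: real_sqrt_mult)

lemma nsq_add_le:
  assumes "f \<in> L2I" "g \<in> L2I"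
  shows "nsq (\<lambda>x. f x + g x) \<le> 2 * nsq f + 2 * nsq g"
  using nsq_nonneg[of "\<lambda>x. f x - g x"] nsq_add[OF assms] nsq_diff[OF assms] by linarith

lemma nsq_diff_le:
  assumes "f \<in> L2I" "g \<in> L2I"
  shows "nsq (\<lambda>x. f x - g x) \<le> 2 * nsq f + 2 * nsq g"
  using nsq_nonneg[of "\<lambda>x. f x + g x"] nsq_add[OF assms] nsq_diff[OF assms] by linarith

lemma nsq_le_bound:
  assumes "f \<in> L2I" "\<And>x. x \<in> {0<..<1} \<Longrightarrow> \<bar>f x\<bar> \<le> B"
  shows "nsq f \<le> B\<^sup>2"
proof -
  interpret finite_measure I01 by (rule finite_measure_I01)
  have "nsq f \<le> (LINT x|I01. B\<^sup>2)"
    unfolding ip_def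
  proof (rule Bochner_Integration.integral_mono)
    show "f x * f x \<le> B\<^sup>2" if "x \<in> space I01" for x
      using power_mono[OF assms(2)[of x], of 2] that by (simp add: space_restrict_space power2_eq_square)
  qed (use assms L2I_mult_integrable in auto)
  then show ?thesis using measure_I01 by simp
qed

lemma nsq_eq_0_imp: 
  assumes "f \<in> L2I" "nsq f = 0" shows "eqI f (\<lambda>x. 0)"
proof -
  have "AE x in I01. f x * f x = 0"
    using assms L2I_mult_integrable[of f f] unfolding ip_def
    by (subst (asm) integral_nonneg_eq_0_iff_AE) auto
  then show ?thesis by (simp add: eqI_def)
qed

text \<open>The set where a continuous function does not vanish is open, and a nonempty open set
  is not negligible. The endpoints follow by continuity.\<close>

lemma eqI_continuous_imp:
  assumes f: "continuous_on {0..1} f" and eq: "eqI f (\<lambda>x. 0)" and x: "x \<in> {0..1::real}"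
  shows "f x = 0"
proof -
  have zero: "f x = 0" if x: "x \<in> {0<..<1}" for x
  proof (rule ccontr)
    assume "f x \<noteq> 0"
    have "continuous_on {0<..<1} f" using f by (rule continuous_on_subset) auto
    then have "open (f -` (- {0}) \<inter> {0<..<1})"
      by (subst Int_commute) (intro continuous_open_preimage, auto)
    moreover have "x \<in> f -` (- {0}) \<inter> {0<..<1}" using x \<open>f x \<noteq> 0\<close> by auto
    ultimately have "\<not> negligible (f -` (- {0}) \<inter> {0<..<1})"
      using open_not_negligible by blast
    moreover have "AE x in lebesgue. x \<in> {0<..<1} \<longrightarrow> f x = 0"
      using eq unfolding eqI_def by (subst (asm) AE_restrict_space_iff) auto
    then have "negligible {x. \<not> (x \<in> {0<..<1} \<longrightarrow> f x = 0)}"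
      by (simp add: negligible_iff_null_sets eventually_ae_filter)
         (metis (mono_tags, lifting) completion.complete_sets_sandwich_fmeasurable null_sets_subset mem_Collect_eq subsetI null_sets_completion_subset)
    moreover have "{x. \<not> (x \<in> {0<..<1} \<longrightarrow> f x = 0)} = f -` (- {0}) \<inter> {0<..<1}" by auto
    ultimately show False by simp
  qed
  have "closure {0<..<1::real} = {0..1}" by simp
  then show ?thesis
    using continuous_constant_on_closure[of "{0<..<1}" f 0 x] zero f x by auto
qed

lemma eqI_refl: "eqI f f" by (simp add: eqI_def)
lemma eqI_sym: "eqI f g \<Longrightarrow> eqI g f" by (simp add: eqI_def eq_commute)
lemma eqI_trans: "eqI f g \<Longrightarrow> eqI g h \<Longrightarrow> eqI f h"
  unfolding eqI_def by (elim AE_mp) auto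
lemma eqI_add: "eqI f f' \<Longrightarrow> eqI g g' \<Longrightarrow> eqI (\<lambda>x. f x + g x) (\<lambda>x. f' x + g' x)"
  unfolding eqI_def by (elim AE_mp) auto
lemma eqI_diff_zero: "eqI (\<lambda>x. f x - g x) (\<lambda>x. 0) \<longleftrightarrow> eqI f g"
  unfolding eqI_def by simp


section \<open>Orthonormal systems\<close>

lemma I01_FTC:
  assumes "continuous_on {0..1} f"
    and "\<And>x. x \<in> {0..1} \<Longrightarrow> (F has_real_derivative f x) (at x within {0..1})"
  shows "(LINT x|I01. f x) = F 1 - F 0"
proof -
  have "(f has_integral (F 1 - F 0)) {0..1}"
    using assms(2) by (intro fundamental_theorem_of_calculus)
      (auto simp: has_real_derivative_iff_has_vector_derivative)
  then have "(f has_integral (F 1 - F 0)) {0<..<1}"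
    using has_integral_Icc_iff_Ioo by blast
  moreover have "integrable I01 f"
    using L2I_mult_integrable[OF L2I_continuous[OF assms(1)] L2I_continuous[of "\<lambda>x. 1"]] by simp
  ultimately show ?thesis
    by (simp add: lebesgue_integral_eq_integral integral_unique)
qed

definition orthonormal :: "(nat \<Rightarrow> real \<Rightarrow> real) \<Rightarrow> bool" where
  "orthonormal e \<longleftrightarrow> (\<forall>n. e n \<in> L2I) \<and> (\<forall>i j. ip (e i) (e j) = (if i = j then 1 else 0))"

text \<open>Completeness is required as density of the finite linear combinations with arbitrary
  coefficients, which is what approximation theorems deliver.\<close>

definition complete_system :: "(nat \<Rightarrow> real \<Rightarrow> real) \<Rightarrow> bool" where
  "complete_system e \<longleftrightarrow> orthonormal e \<and>
     (\<forall>f\<in>L2I. \<forall>\<epsilon>>0. \<exists>S a. finite S \<and> nsq (\<lambda>x. f x - (\<Sum>j\<in>S. a j * e j x)) < \<epsilon>)"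

lemma orthonormal_L2I: "orthonormal e \<Longrightarrow> e n \<in> L2I"
  by (simp add: orthonormal_def)

text \<open>Pythagoras: the error of a linear combination splits into the error of the orthogonal
  projection and the distance of the coefficients from the Fourier coefficients. The first part
  gives the inequality of Bessel. As the second part is nonnegative, density of linear
  combinations with any coefficients implies Parseval.\<close>

lemma nsq_orthonormal_residual:
  assumes e: "orthonormal e" and f: "f \<in> L2I" and S: "finite S"
  shows "nsq (\<lambda>x. f x - (\<Sum>j\<in>S. a j * e j x)) =
     nsq f - (\<Sum>j\<in>S. (ip f (e j))\<^sup>2) + (\<Sum>j\<in>S. (a j - ip f (e j))\<^sup>2)"
proof -
  have eL: "e j \<in> L2I" for j using e by (simp add: orthonormal_def)
  let ?g = "\<lambda>x. \<Sum>j\<in>S. a j * e j x"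
  have g: "?g \<in> L2I" by (intro L2I_sum L2I_scale eL)
  have 1: "ip h ?g = (\<Sum>j\<in>S. a j * ip h (e j))" if "h \<in> L2I" for h
    using that by (simp add: ip_sum_right L2I_scale eL ip_scale_right)
  have "ip ?g (e i) = (\<Sum>j\<in>S. a j * (if i = j then 1 else 0))" for i
    using 1[OF eL, of i] e by (simp add: ip_commute[of _ "e i"] orthonormal_def)
  then have 2: "ip ?g (e i) = a i" if "i \<in> S" for i
    using that S by (simp add: if_distrib cong: if_cong)
  have "nsq ?g = (\<Sum>j\<in>S. a j * a j)"
    using 1[OF g] 2 by simp
  then have "nsq (\<lambda>x. f x - ?g x) = nsq f - 2 * (\<Sum>j\<in>S. a j * ip f (e j)) + (\<Sum>j\<in>S. a j * a j)"
    using nsq_diff[OF f g] 1[OF f] by simp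
  also have "\<dots> = nsq f - (\<Sum>j\<in>S. (ip f (e j))\<^sup>2) + (\<Sum>j\<in>S. (a j - ip f (e j))\<^sup>2)"
    by (simp add: power2_diff sum.distrib sum_subtractf sum_distrib_left power2_eq_square algebra_simps)
  finally show ?thesis .
qed

lemma Bessel_finite:
  assumes "orthonormal e" "f \<in> L2I" "finite S"
  shows "(\<Sum>j\<in>S. (ip f (e j))\<^sup>2) \<le> nsq f"
  using nsq_orthonormal_residual[OF assms, of "\<lambda>j. ip f (e j)"]
    nsq_nonneg[of "\<lambda>x. f x - (\<Sum>j\<in>S. ip f (e j) * e j x)"] by simp

lemma Bessel:
  assumes "orthonormal e" "f \<in> L2I"
  shows "summable (\<lambda>n. (ip f (e n))\<^sup>2)" and "(\<Sum>n. (ip f (e n))\<^sup>2) \<le> nsq f"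
proof -
  show s: "summable (\<lambda>n. (ip f (e n))\<^sup>2)"
    using Bessel_finite[OF assms] by (intro bounded_imp_summable[where B="nsq f"]) auto
  show "(\<Sum>n. (ip f (e n))\<^sup>2) \<le> nsq f"
    using Bessel_finite[OF assms] by (intro suminf_le_const[OF s]) auto
qed

lemma Parseval_nsq:
  assumes e: "complete_system e" and f: "f \<in> L2I"
  shows "(\<lambda>n. (ip f (e n))\<^sup>2) sums nsq f"
proof -
  have o: "orthonormal e" using e by (simp add: complete_system_def)
  have "nsq f \<le> (\<Sum>n. (ip f (e n))\<^sup>2)"
  proof (rule field_le_epsilon)
    fix \<epsilon> :: real assume "0 < \<epsilon>"
    then obtain S a where S: "finite S" "nsq (\<lambda>x. f x - (\<Sum>j\<in>S. a j * e j x)) < \<epsilon>"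
      using e f unfolding complete_system_def by blast
    have "nsq f - (\<Sum>j\<in>S. (ip f (e j))\<^sup>2) \<le> \<epsilon>"
      using S nsq_orthonormal_residual[OF o f S(1), of a] sum_nonneg[of S "\<lambda>j. (a j - ip f (e j))\<^sup>2"] by simp
    then show "nsq f \<le> (\<Sum>n. (ip f (e n))\<^sup>2) + \<epsilon>"
      using sum_le_suminf[OF Bessel(1)[OF o f] S(1)] by simp
  qed
  then show ?thesis
    using Bessel[OF o f] by (simp add: sums_iff)
qed

text \<open>By polarization from the quadratic case.\<close>

lemma Parseval:
  assumes e: "complete_system e" and f: "f \<in> L2I" and g: "g \<in> L2I"
  shows "(\<lambda>n. ip f (e n) * ip g (e n)) sums ip f g"
proof -
  have eL: "e n \<in> L2I" for n using e by (simp add: complete_system_def orthonormal_def)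
  have "(\<lambda>n. ((ip (\<lambda>x. f x + g x) (e n))\<^sup>2 - (ip (\<lambda>x. f x - g x) (e n))\<^sup>2) / 4) sums
      ((nsq (\<lambda>x. f x + g x) - nsq (\<lambda>x. f x - g x)) / 4)"
    using f g by (intro sums_divide sums_diff Parseval_nsq[OF e] L2I_add L2I_diff)
  moreover have "((ip (\<lambda>x. f x + g x) (e n))\<^sup>2 - (ip (\<lambda>x. f x - g x) (e n))\<^sup>2) / 4 = ip f (e n) * ip g (e n)" for n
    using f g eL by (simp add: ip_add_left ip_diff_left power2_eq_square algebra_simps)
  ultimately show ?thesis
    using f g by (simp add: nsq_add nsq_diff)
qed

lemma eqI_if_coefficients_eq:
  assumes e: "complete_system e" and f: "f \<in> L2I" and g: "g \<in> L2I"
    and "\<And>n. ip f (e n) = ip g (e n)"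
  shows "eqI f g"
proof -
  have "(\<lambda>n. (ip (\<lambda>x. f x - g x) (e n))\<^sup>2) sums nsq (\<lambda>x. f x - g x)"
    using f g by (intro Parseval_nsq[OF e] L2I_diff)
  moreover have "ip (\<lambda>x. f x - g x) (e n) = 0" for n
    using assms e by (simp add: ip_diff_left complete_system_def orthonormal_def)
  ultimately have "nsq (\<lambda>x. f x - g x) = 0" by (simp add: sums_iff)
  then show ?thesis
    using nsq_eq_0_imp[OF L2I_diff[OF f g]] by (simp add: eqI_diff_zero)
qed

section \<open>Density of trigonometric sums\<close>

definition clip :: "real \<Rightarrow> real \<Rightarrow> real" where "clip k y = max (-k) (min k y)"

lemma abs_clip_le: "0 \<le> k \<Longrightarrow> \<bar>clip k y\<bar> \<le> k"
  by (auto simp: clip_def)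

lemma abs_diff_clip_le: "0 \<le> k \<Longrightarrow> \<bar>y - clip k y\<bar> \<le> \<bar>y\<bar>"
  by (auto simp: clip_def)

lemma clip_eq: "\<bar>y\<bar> \<le> k \<Longrightarrow> clip k y = y"
  by (auto simp: clip_def)

lemma continuous_on_clip: "continuous_on S (clip k)"
  unfolding clip_def by (intro continuous_intros)

lemma nsq_tendsto_0:
  assumes "f \<in> L2I" "\<And>k. g k \<in> L2I"
    and lim: "AE x in I01. (\<lambda>k. g k x) \<longlonglongrightarrow> 0"
    and dom: "\<And>k x. x \<in> {0<..<1} \<Longrightarrow> \<bar>g k x\<bar> \<le> \<bar>f x\<bar>"
  shows "(\<lambda>k. nsq (g k)) \<longlonglongrightarrow> 0"
proof -
  have "(\<lambda>k. LINT x|I01. g k x * g k x) \<longlonglongrightarrow> (LINT x|I01. 0)"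
  proof (rule integral_dominated_convergence[where w="\<lambda>x. (f x)\<^sup>2"])
    show "AE x in I01. (\<lambda>k. g k x * g k x) \<longlonglongrightarrow> 0"
      using lim by eventually_elim (auto intro: tendsto_mult_zero)
    show "AE x in I01. norm (g k x * g k x) \<le> (f x)\<^sup>2" for k
    proof (rule AE_I2)
      fix x assume "x \<in> space I01"
      then have "\<bar>g k x\<bar> \<le> \<bar>f x\<bar>" using dom by (simp add: space_restrict_space)
      then show "norm (g k x * g k x) \<le> (f x)\<^sup>2"
        by (metis abs_le_square_iff power2_eq_square real_norm_def abs_of_nonneg zero_le_power2)
    qed
  qed (use assms in \<open>auto intro!: borel_measurable_times L2I_measurable L2I_square\<close>)
  then show ?thesis by (simp add: ip_def)
qed

text \<open>The weight serves systems such as \<^const>\<open>phi1\<close>, all of whose members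
  vanish at a boundary point: their span contains functions of the form \<open>w * h\<close> only.
  Clipping \<open>f / w\<close> at the level \<open>k\<close> leaves an error dominated by
  \<open>f\<close>, so dominated convergence applies as \<open>k\<close> grows. The clipped
  function is an almost everywhere limit of continuous functions, which can be clipped at the same
  level, and dominated convergence applies again.\<close>

lemma weighted_continuous_approximation:
  assumes f: "f \<in> L2I" and w: "continuous_on UNIV w" and wb: "\<And>x. \<bar>w x\<bar> \<le> 1"
    and wpos: "\<And>x. x \<in> {0<..<1} \<Longrightarrow> w x > 0" and "\<epsilon> > 0"
  obtains h :: "real \<Rightarrow> real" where "continuous_on UNIV h" "nsq (\<lambda>x. f x - w x * h x) < \<epsilon>"
proof -
  have wm: "w \<in> borel_measurable I01"
    using w by (intro measurable_I01_continuous) (rule continuous_on_subset, auto)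
  have wL: "(\<lambda>x. w x * h x) \<in> L2I" if "h \<in> borel_measurable I01" "\<And>x. \<bar>h x\<bar> \<le> B" for h B
  proof (rule L2I_bounded[where B=B])
    show "\<bar>w x * h x\<bar> \<le> B" for x
      using mult_mono[OF wb[of x] that(2)[of x]] by (simp add: abs_mult)
  qed (use that wm in measurable)
  define q where "q k x = clip (real k) (f x / w x)" for k :: nat and x
  have fm: "f \<in> borel_measurable I01" using f by (rule L2I_measurable)
  have qm: "q k \<in> borel_measurable I01" for k
    unfolding q_def clip_def using fm wm by measurable
  have qb: "\<bar>q k x\<bar> \<le> real k" for k x by (simp add: q_def abs_clip_le)
  have qL: "q k \<in> L2I" for k using qm qb by (intro L2I_bounded) auto
  have "(\<lambda>k. nsq (\<lambda>x. f x - w x * q k x)) \<longlonglongrightarrow> 0"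
  proof (rule nsq_tendsto_0[OF f])
    show "(\<lambda>x. f x - w x * q k x) \<in> L2I" for k
      using qm qb by (intro L2I_diff f wL)
    have eq: "f x - w x * q k x = w x * (f x / w x - q k x)" if "x \<in> {0<..<1}" for x k
      using wpos[OF that] by (simp add: field_simps)
    show "\<bar>f x - w x * q k x\<bar> \<le> \<bar>f x\<bar>" if "x \<in> {0<..<1}" for x k
    proof -
      have "\<bar>w x\<bar> * \<bar>f x / w x - q k x\<bar> \<le> \<bar>w x\<bar> * \<bar>f x / w x\<bar>"
        unfolding q_def by (intro mult_left_mono abs_diff_clip_le) auto
      then show ?thesis using wpos[OF that] eq[OF that, of k] by (simp add: abs_mult)
    qed
    show "AE x in I01. (\<lambda>k. f x - w x * q k x) \<longlonglongrightarrow> 0"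
    proof (rule AE_I2)
      fix x assume x: "x \<in> space I01"
      obtain K where "\<bar>f x / w x\<bar> \<le> real K" using real_arch_simple by blast
      then have "f x - w x * q k x = 0" if "k \<ge> K" for k
        using that x eq[of x k] by (simp add: space_restrict_space q_def clip_eq)
      then show "(\<lambda>k. f x - w x * q k x) \<longlonglongrightarrow> 0"
        by (intro tendsto_eventually eventually_sequentiallyI)
    qed
  qed
  then have "\<forall>\<^sub>F k in sequentially. nsq (\<lambda>x. f x - w x * q k x) < \<epsilon> / 4"
    using \<open>\<epsilon> > 0\<close> by (intro order_tendstoD) auto
  then obtain k where k: "nsq (\<lambda>x. f x - w x * q k x) < \<epsilon> / 4"
    by (auto simp: eventually_sequentially)
  have "q k measurable_on {0<..<1}"
    using qm by (simp add: measurable_on_iff_borel_measurable)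
  then obtain N g where N: "negligible N" and g: "\<And>n. continuous_on UNIV (g n)"
    and lim: "\<And>x. x \<notin> N \<Longrightarrow> (\<lambda>n. g n x) \<longlonglongrightarrow> (if x \<in> {0<..<1} then q k x else 0)"
    unfolding measurable_on_def by metis
  define h where "h n x = clip (real k) (g n x)" for n :: nat and x
  have hc: "continuous_on UNIV (h n)" for n
    unfolding h_def by (rule continuous_on_compose2[OF continuous_on_clip[of UNIV] g]) auto
  have hb: "\<bar>h n x\<bar> \<le> real k" for n x by (simp add: h_def abs_clip_le)
  have hL: "h n \<in> L2I" for n
    using hc by (intro L2I_continuous) (rule continuous_on_subset, auto)
  have wh: "(\<lambda>x. w x * h n x) \<in> L2I" for n using hL hb by (intro wL L2I_measurable)
  have wq: "(\<lambda>x. w x * q k x) \<in> L2I" using qL qb by (intro wL L2I_measurable)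
  have "(\<lambda>n. nsq (\<lambda>x. w x * q k x - w x * h n x)) \<longlonglongrightarrow> 0"
  proof (rule nsq_tendsto_0[of "\<lambda>x. 2 * real k"])
    show "(\<lambda>x. 2 * real k) \<in> L2I" by (intro L2I_continuous continuous_intros)
    show "(\<lambda>x. w x * q k x - w x * h n x) \<in> L2I" for n by (intro L2I_diff wq wh)
    show "\<bar>w x * q k x - w x * h n x\<bar> \<le> \<bar>2 * real k\<bar>" for n x
    proof -
      have "\<bar>w x\<bar> * \<bar>q k x - h n x\<bar> \<le> 1 * (2 * real k)"
        using qb[of k x] hb[of n x] by (intro mult_mono wb) linarith+
      then show ?thesis by (simp add: abs_mult[symmetric] right_diff_distrib)
    qed
    have "AE x in lebesgue. x \<notin> N" using N by (simp add: negligible_iff_null_sets AE_not_in)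
    then have "AE x in I01. x \<notin> N" by (subst AE_restrict_space_iff) auto
    moreover have "AE x in I01. x \<in> {0<..<1}"
      by (rule AE_I2) (simp add: space_restrict_space)
    ultimately show "AE x in I01. (\<lambda>n. w x * q k x - w x * h n x) \<longlonglongrightarrow> 0"
    proof eventually_elim
      fix x assume x: "x \<notin> N" "x \<in> {0<..<1}"
      have "isCont (clip (real k)) (q k x)"
        using continuous_on_clip[of UNIV "real k"] by (simp add: continuous_on_eq_continuous_at)
      then have "(\<lambda>n. h n x) \<longlonglongrightarrow> clip (real k) (q k x)"
        unfolding h_def using lim[OF x(1)] x(2) by (auto intro: isCont_tendsto_compose)
      then have "(\<lambda>n. h n x) \<longlonglongrightarrow> q k x" using qb by (simp add: clip_eq)
      then have "(\<lambda>n. w x * q k x - w x * h n x) \<longlonglongrightarrow> w x * q k x - w x * q k x"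
        by (intro tendsto_intros)
      then show "(\<lambda>n. w x * q k x - w x * h n x) \<longlonglongrightarrow> 0" by simp
    qed
  qed
  then have "\<forall>\<^sub>F n in sequentially. nsq (\<lambda>x. w x * q k x - w x * h n x) < \<epsilon> / 4"
    using \<open>\<epsilon> > 0\<close> by (intro order_tendstoD) auto
  then obtain n where n: "nsq (\<lambda>x. w x * q k x - w x * h n x) < \<epsilon> / 4"
    by (auto simp: eventually_sequentially)
  have "nsq (\<lambda>x. (f x - w x * q k x) + (w x * q k x - w x * h n x)) < \<epsilon>"
    using nsq_add_le[OF L2I_diff[OF f wq] L2I_diff[OF wq wh[of n]]] k n by linarith
  then have "nsq (\<lambda>x. f x - w x * h n x) < \<epsilon>" by simp
  then show ?thesis using hc that by blast
qed

definition in_span :: "(nat \<Rightarrow> real \<Rightarrow> real) \<Rightarrow> (real \<Rightarrow> real) \<Rightarrow> bool" where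
  "in_span e g \<longleftrightarrow> (\<exists>S a. finite S \<and> g = (\<lambda>x. \<Sum>j\<in>S. a j * e j x))"

lemma in_span_zero: "in_span e (\<lambda>x. 0)"
  unfolding in_span_def by (rule exI[of _ "{}"]) auto

lemma in_span_base: "in_span e (\<lambda>x. a * e j x)"
  unfolding in_span_def by (rule exI[of _ "{j}"]) auto

lemma in_span_scale: "in_span e g \<Longrightarrow> in_span e (\<lambda>x. r * g x)"
  unfolding in_span_def
  by (elim exE conjE, rename_tac S a, rule_tac x=S in exI, rule_tac x="\<lambda>j. r * a j" in exI)
    (simp add: sum_distrib_left mult.assoc)

lemma in_span_add:
  assumes "in_span e f" "in_span e g"
  shows "in_span e (\<lambda>x. f x + g x)"
proof -
  obtain S a T b where S: "finite S" "f = (\<lambda>x. \<Sum>j\<in>S. a j * e j x)"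
    and T: "finite T" "g = (\<lambda>x. \<Sum>j\<in>T. b j * e j x)"
    using assms unfolding in_span_def by blast
  have 1: "(\<Sum>j\<in>S. a j * e j x) = (\<Sum>j\<in>S \<union> T. (if j \<in> S then a j else 0) * e j x)" for x
    using S T by (intro sum.mono_neutral_cong_left) auto
  have 2: "(\<Sum>j\<in>T. b j * e j x) = (\<Sum>j\<in>S \<union> T. (if j \<in> T then b j else 0) * e j x)" for x
    using S T by (intro sum.mono_neutral_cong_left) auto
  show ?thesis
    unfolding in_span_def S(2) T(2) 1 2
    by (rule exI[of _ "S \<union> T"],
        rule exI[of _ "\<lambda>j. (if j \<in> S then a j else 0) + (if j \<in> T then b j else 0)"])
       (use S T in \<open>simp add: sum.distrib distrib_right\<close>)
qed

lemma in_span_sum: "(\<And>i. i \<in> S \<Longrightarrow> in_span e (g i)) \<Longrightarrow> in_span e (\<lambda>x. \<Sum>i\<in>S. g i x)"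
  by (induction S rule: infinite_finite_induct) (auto intro: in_span_zero in_span_add)

text \<open>By \<open>base\<close> and \<open>step\<close> the span contains
  \<open>w * p (cos (pi * x))\<close> for all polynomials \<open>p\<close>. The substitution
  \<open>u = cos (pi * x)\<close> is a homeomorphism of \<open>[0,1]\<close> and
  \<open>[-1,1]\<close>, so by the theorem of Weierstrass every continuous \<open>h\<close> is a
  uniform limit of functions \<open>p (cos (pi * x))\<close>.\<close>

lemma complete_systemI:
  assumes e: "orthonormal e" and w: "continuous_on UNIV w" "\<And>x. \<bar>w x\<bar> \<le> 1"
    "\<And>x. x \<in> {0<..<1} \<Longrightarrow> w x > 0"
    and base: "in_span e w" and step: "\<And>j. in_span e (\<lambda>x. cos (pi * x) * e j x)"
  shows "complete_system e"
  unfolding complete_system_def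
proof (intro conjI e ballI allI impI)
  fix f \<epsilon> assume f: "f \<in> L2I" and "0 < (\<epsilon>::real)"
  obtain h where h: "continuous_on UNIV h" "nsq (\<lambda>x. f x - w x * h x) < \<epsilon> / 4"
    using weighted_continuous_approximation[OF f w, of "\<epsilon> / 4"] \<open>0 < \<epsilon>\<close> by auto
  have "continuous_on {-1..1} (\<lambda>u. h (arccos u / pi))"
    by (rule continuous_on_compose2[OF h(1)]) (auto intro!: continuous_intros)
  then obtain p where p: "real_polynomial_function p"
    "\<And>u. u \<in> {-1..1} \<Longrightarrow> \<bar>h (arccos u / pi) - p u\<bar> < sqrt \<epsilon> / 3"
    using Stone_Weierstrass_real_polynomial_function[of "{-1..1}" _ "sqrt \<epsilon> / 3"] \<open>0 < \<epsilon>\<close>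
    by (metis compact_Icc divide_pos_pos real_sqrt_gt_zero zero_less_numeral)
  obtain a n where pn: "p = (\<lambda>x. \<Sum>i\<le>n::nat. a i * x ^ i)"
    using real_polynomial_function_imp_sum[OF p(1)] by blast
  have hp: "\<bar>h x - p (cos (pi * x))\<bar> \<le> sqrt \<epsilon> / 3" if "x \<in> {0<..<1}" for x
  proof -
    have "arccos (cos (pi * x)) / pi = x"
      using that by (subst arccos_cos) auto
    then show ?thesis using p(2)[of "cos (pi * x)"] by simp
  qed
  have span: "in_span e (\<lambda>x. cos (pi * x) * g x)" if "in_span e g" for g
  proof -
    obtain S b where S: "finite S" "g = (\<lambda>x. \<Sum>j\<in>S. b j * e j x)"
      using \<open>in_span e g\<close> unfolding in_span_def by blast
    have "in_span e (\<lambda>x. \<Sum>j\<in>S. b j * (cos (pi * x) * e j x))"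
      by (intro in_span_sum in_span_scale step)
    then show ?thesis by (simp add: S(2) sum_distrib_left mult.left_commute)
  qed
  have pow: "in_span e (\<lambda>x. w x * cos (pi * x) ^ i)" for i
  proof (induction i)
    case (Suc i) then show ?case using span[OF Suc] by (simp add: mult_ac)
  qed (simp add: base)
  have "in_span e (\<lambda>x. \<Sum>i\<le>n. a i * (w x * cos (pi * x) ^ i))"
    by (intro in_span_sum in_span_scale pow)
  then have "in_span e (\<lambda>x. w x * p (cos (pi * x)))"
    by (simp add: pn sum_distrib_left mult_ac)
  then obtain S b where S: "finite S" "\<And>x. w x * p (cos (pi * x)) = (\<Sum>j\<in>S. b j * e j x)"
    unfolding in_span_def by metis
  have c: "continuous_on A p" for A
    using p(1) continuous_real_polymonial_function continuous_at_imp_continuous_on by blast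
  have L: "(\<lambda>x. w x * h x) \<in> L2I" "(\<lambda>x. w x * p (cos (pi * x))) \<in> L2I"
    by (intro L2I_continuous continuous_intros continuous_on_subset[OF w(1)]
        continuous_on_subset[OF h(1)] continuous_on_compose2[OF c[of UNIV]]; simp)+
  have "nsq (\<lambda>x. w x * h x - w x * p (cos (pi * x))) \<le> (sqrt \<epsilon> / 3)\<^sup>2"
  proof (rule nsq_le_bound[OF L2I_diff[OF L]])
    fix x :: real assume "x \<in> {0<..<1}"
    have "\<bar>w x\<bar> * \<bar>h x - p (cos (pi * x))\<bar> \<le> 1 * (sqrt \<epsilon> / 3)"
      using hp[OF \<open>x \<in> _\<close>] by (intro mult_mono w(2)) auto
    then show "\<bar>w x * h x - w x * p (cos (pi * x))\<bar> \<le> sqrt \<epsilon> / 3"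
      by (simp add: abs_mult[symmetric] right_diff_distrib)
  qed
  also have "\<dots> = \<epsilon> / 9" using \<open>0 < \<epsilon>\<close> by (simp add: power_divide)
  finally have "nsq (\<lambda>x. (f x - w x * h x) + (w x * h x - w x * p (cos (pi * x)))) < \<epsilon>"
    using h(2) nsq_add_le[OF L2I_diff[OF f L(1)] L2I_diff[OF L]] \<open>0 < \<epsilon>\<close> by linarith
  then have "nsq (\<lambda>x. f x - (\<Sum>j\<in>S. b j * e j x)) < \<epsilon>"
    by (simp add: S(2))
  then show "\<exists>S a. finite S \<and> nsq (\<lambda>x. f x - (\<Sum>j\<in>S. a j * e j x)) < \<epsilon>"
    using S(1) by blast
qed

section \<open>Cosine and sine systems\<close>

definition ecos :: "nat \<Rightarrow> real \<Rightarrow> real" where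
  "ecos m x = mu m * cos (real m * pi * x)"

lemma integral_cos_int_pi: "(LINT x|I01. cos (of_int i * pi * x)) = (if i = 0 then 1 else 0)"
proof (cases "i = 0")
  case False
  have "(LINT x|I01. cos (of_int i * pi * x)) = sin (of_int i * pi * 1) / (of_int i * pi) - sin (of_int i * pi * 0) / (of_int i * pi)"
    using False by (intro I01_FTC) (auto intro!: continuous_intros derivative_eq_intros)
  then show ?thesis using False by (simp add: sin_int_times_real mult.commute)
qed (use measure_I01 in simp)

text \<open>The integer parameters cover whole and half-integer frequencies at once: all that is
  used is that sum and difference of the frequencies are integers.\<close>

lemma
  assumes p: "\<alpha> + \<beta> = real_of_int p" and q: "\<alpha> - \<beta> = real_of_int q"
  shows ip_cos_cos: "ip (\<lambda>x. cos (\<alpha> * pi * x)) (\<lambda>x. cos (\<beta> * pi * x)) =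
      ((if q = 0 then 1 else 0) + (if p = 0 then 1 else 0)) / 2"
    and ip_sin_sin: "ip (\<lambda>x. sin (\<alpha> * pi * x)) (\<lambda>x. sin (\<beta> * pi * x)) =
      ((if q = 0 then 1 else 0) - (if p = 0 then 1 else 0)) / 2"
proof -
  have i: "integrable I01 (\<lambda>x. cos (r * pi * x))" for r
    using L2I_mult_integrable[OF L2I_continuous L2I_continuous, of "\<lambda>x. cos (r * pi * x)" "\<lambda>x. 1"]
    by (simp add: continuous_intros)
  have arg: "\<alpha> * pi * x - \<beta> * pi * x = of_int q * pi * x" "\<alpha> * pi * x + \<beta> * pi * x = of_int p * pi * x" for x
    using p q by (simp_all add: left_diff_distrib[symmetric] distrib_right[symmetric])
  have "ip (\<lambda>x. cos (\<alpha> * pi * x)) (\<lambda>x. cos (\<beta> * pi * x)) =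
     (LINT x|I01. (cos (of_int q * pi * x) + cos (of_int p * pi * x)) / 2)"
    by (simp add: ip_def cos_times_cos arg)
  then show "ip (\<lambda>x. cos (\<alpha> * pi * x)) (\<lambda>x. cos (\<beta> * pi * x)) =
      ((if q = 0 then 1 else 0) + (if p = 0 then 1 else 0)) / 2"
    using i[of "of_int q"] i[of "of_int p"]
    by (simp only: integral_cos_int_pi integral_divide_zero Bochner_Integration.integral_add)
  have "ip (\<lambda>x. sin (\<alpha> * pi * x)) (\<lambda>x. sin (\<beta> * pi * x)) =
     (LINT x|I01. (cos (of_int q * pi * x) - cos (of_int p * pi * x)) / 2)"
    by (simp add: ip_def sin_times_sin arg)
  then show "ip (\<lambda>x. sin (\<alpha> * pi * x)) (\<lambda>x. sin (\<beta> * pi * x)) =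
      ((if q = 0 then 1 else 0) - (if p = 0 then 1 else 0)) / 2"
    using i[of "of_int q"] i[of "of_int p"]
    by (simp only: integral_cos_int_pi integral_divide_zero Bochner_Integration.integral_diff)
qed

lemma orthonormal_ecos: "orthonormal ecos"
  unfolding orthonormal_def
proof (intro conjI allI)
  show "ecos n \<in> L2I" for n
    unfolding ecos_def by (intro L2I_continuous continuous_intros)
  show "ip (ecos i) (ecos j) = (if i = j then 1 else 0)" for i j
    using ip_cos_cos[of "real i" "real j" "int i + int j" "int i - int j"]
    unfolding ecos_def by (auto simp: ip_scale_left ip_scale_right mu_def mult.assoc[symmetric])
qed

lemma orthonormal_phi1: "orthonormal phi1"
  unfolding orthonormal_def
proof (intro conjI allI)
  show "phi1 n \<in> L2I" for n
    unfolding phi1_def by (intro L2I_continuous continuous_intros)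
  show "ip (phi1 i) (phi1 j) = (if i = j then 1 else 0)" for i j
    using ip_cos_cos[of "real i + 1/2" "real j + 1/2" "int i + int j + 1" "int i - int j"]
    unfolding phi1_def by (auto simp: ip_scale_left ip_scale_right mult.assoc[symmetric])
qed

text \<open>Up to scaling, the derivatives of \<^const>\<open>phi1\<close>; the next system is
  related in the same way to \<^const>\<open>ecos\<close>. Through them coefficients with the
  weight \<open>n\<close> are controlled by derivatives.\<close>

lemma orthonormal_sin_half: "orthonormal (\<lambda>n x. sqrt 2 * sin ((real n + 1/2) * pi * x))"
  unfolding orthonormal_def
proof (intro conjI allI)
  show "(\<lambda>x. sqrt 2 * sin ((real n + 1/2) * pi * x)) \<in> L2I" for n
    by (intro L2I_continuous continuous_intros)
  show "ip (\<lambda>x. sqrt 2 * sin ((real i + 1/2) * pi * x)) (\<lambda>x. sqrt 2 * sin ((real j + 1/2) * pi * x)) = (if i = j then 1 else 0)" for i j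
    using ip_sin_sin[of "real i + 1/2" "real j + 1/2" "int i + int j + 1" "int i - int j"]
    by (auto simp: ip_scale_left ip_scale_right mult.assoc[symmetric])
qed

lemma orthonormal_sin: "orthonormal (\<lambda>n x. sqrt 2 * sin (real (Suc n) * pi * x))"
  unfolding orthonormal_def
proof (intro conjI allI)
  show "(\<lambda>x. sqrt 2 * sin (real (Suc n) * pi * x)) \<in> L2I" for n
    by (intro L2I_continuous continuous_intros)
  show "ip (\<lambda>x. sqrt 2 * sin (real (Suc i) * pi * x)) (\<lambda>x. sqrt 2 * sin (real (Suc j) * pi * x)) = (if i = j then 1 else 0)" for i j
    using ip_sin_sin[of "real (Suc i)" "real (Suc j)" "int i + int j + 2" "int i - int j"]
    by (auto simp: ip_scale_left ip_scale_right mult.assoc[symmetric])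
qed

lemma cos_times_ecos_shift:
  "cos (pi * x) * cos ((r + 1) * pi * x) = (cos (r * pi * x) + cos ((r + 2) * pi * x)) / 2"
proof -
  have "(r + 1) * pi * x - pi * x = r * pi * x" "(r + 1) * pi * x + pi * x = (r + 2) * pi * x"
    by (simp_all add: algebra_simps)
  then show ?thesis
    using cos_times_cos[of "(r + 1) * pi * x" "pi * x"] by (simp add: mult.commute)
qed

lemma complete_ecos: "complete_system ecos"
proof (rule complete_systemI[OF orthonormal_ecos, of "\<lambda>x. 1"])
  show "in_span ecos (\<lambda>x. 1)"
    using in_span_base[of ecos 1 0] by (simp add: ecos_def mu_def)
  show "in_span ecos (\<lambda>x. cos (pi * x) * ecos j x)" for j
  proof (cases j)
    case 0
    then show ?thesis
      using in_span_base[of ecos "1 / sqrt 2" 1] by (simp add: ecos_def mu_def)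
  next
    case (Suc i)
    have "in_span ecos (\<lambda>x. sqrt 2 / (2 * mu i) * ecos i x + 1 / 2 * ecos (i + 2) x)"
      by (intro in_span_add in_span_base)
    also have "(\<lambda>x. sqrt 2 / (2 * mu i) * ecos i x + 1 / 2 * ecos (i + 2) x) = (\<lambda>x. cos (pi * x) * ecos j x)"
    proof
      fix x
      have "mu i > 0" by (simp add: mu_def)
      then have "sqrt 2 / (2 * mu i) * ecos i x + 1 / 2 * ecos (i + 2) x =
         sqrt 2 * ((cos (real i * pi * x) + cos ((real i + 2) * pi * x)) / 2)"
        by (simp add: ecos_def mu_def field_simps)
      also have "\<dots> = cos (pi * x) * ecos j x"
        by (simp only: cos_times_ecos_shift[symmetric]) (simp add: Suc ecos_def mu_def add_ac)
      finally show "sqrt 2 / (2 * mu i) * ecos i x + 1 / 2 * ecos (i + 2) x = cos (pi * x) * ecos j x" .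
    qed
    finally show ?thesis .
  qed
qed auto

text \<open>The weight is the first member of the system, which is positive on
  \<open>(0,1)\<close>. In the recurrence for \<open>j = 0\<close> the index \<open>j - 1\<close>
  is truncated to \<open>0\<close>. This is the right value: the frequency \<open>-1/2\<close>
  gives the same cosine as \<open>1/2\<close>.\<close>

lemma complete_phi1: "complete_system phi1"
proof (rule complete_systemI[OF orthonormal_phi1, of "\<lambda>x. cos (1/2 * pi * x)"])
  show "continuous_on UNIV (\<lambda>x::real. cos (1/2 * pi * x))" by (intro continuous_intros)
  show "cos (1/2 * pi * x) > 0" if "x \<in> {0<..<1}" for x
    using that by (intro cos_gt_zero_pi) (auto intro: less_trans[of _ 0])
  show "in_span phi1 (\<lambda>x. cos (1/2 * pi * x))"
    using in_span_base[of phi1 "1 / sqrt 2" 0] by (simp add: phi1_def)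
  show "in_span phi1 (\<lambda>x. cos (pi * x) * phi1 j x)" for j
  proof -
    have "in_span phi1 (\<lambda>x. 1 / 2 * phi1 (j - 1) x + 1 / 2 * phi1 (j + 1) x)"
      by (intro in_span_add in_span_base)
    also have "(\<lambda>x. 1 / 2 * phi1 (j - 1) x + 1 / 2 * phi1 (j + 1) x) = (\<lambda>x. cos (pi * x) * phi1 j x)"
    proof
      fix x
      have "cos (pi * x) * cos ((real j - 1/2 + 1) * pi * x) =
         (cos ((real j - 1/2) * pi * x) + cos ((real j - 1/2 + 2) * pi * x)) / 2"
        by (rule cos_times_ecos_shift)
      moreover have "cos ((real j - 1/2) * pi * x) = cos ((real (j - 1) + 1/2) * pi * x)"
      proof (cases j)
        case 0
        then show ?thesis using cos_minus[of "1/2 * pi * x"] by simp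
      qed (simp add: add.commute)
      moreover have "real j - 1/2 + 1 = real j + 1/2" "real j - 1/2 + 2 = real (j + 1) + 1/2"
        by simp_all
      ultimately have "cos (pi * x) * cos ((real j + 1/2) * pi * x) =
          (cos ((real (j - 1) + 1/2) * pi * x) + cos ((real (j + 1) + 1/2) * pi * x)) / 2"
        by simp
      then have "cos (pi * x) * phi1 j x =
          sqrt 2 * ((cos ((real (j - 1) + 1/2) * pi * x) + cos ((real (j + 1) + 1/2) * pi * x)) / 2)"
        unfolding phi1_def by (simp only: mult.left_commute[of "cos (pi * x)"])
      then show "1 / 2 * phi1 (j - 1) x + 1 / 2 * phi1 (j + 1) x = cos (pi * x) * phi1 j x"
        by (simp add: phi1_def distrib_left)
    qed
    finally show ?thesis .
  qed
qed auto


section \<open>Weak derivatives\<close>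

text \<open>As an inner product with an indicator function, the indefinite integral becomes
  accessible to the calculus of \<^const>\<open>ip\<close>.\<close>

lemma LINT_initial_interval_eq_ip:
  assumes "x \<in> {0..1}"
  shows "(LINT t|lebesgue_on {0<..<x}. k t) = ip k (indicator {0<..<x})"
proof -
  have "(LINT t|lebesgue_on {0<..<x}. k t) = (LINT t|lebesgue. indicator {0<..<x} t *\<^sub>R k t)"
    by (rule integral_restrict_space) auto
  also have "\<dots> = (LINT t|lebesgue. indicator {0<..<1} t *\<^sub>R (k t * indicator {0<..<x} t))"
    by (rule Bochner_Integration.integral_cong) (use assms in \<open>auto simp: indicator_def\<close>)
  also have "\<dots> = ip k (indicator {0<..<x})"
    unfolding ip_def by (rule integral_restrict_space[symmetric]) auto
  finally show ?thesis .
qed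

lemma L2I_integrable: "f \<in> L2I \<Longrightarrow> integrable I01 f"
  using L2I_mult_integrable[of f "\<lambda>x. 1"] L2I_continuous[of "\<lambda>x. 1"] by simp

lemma L2I_indicator: "indicator {0<..<x::real} \<in> L2I"
proof (rule L2I_bounded[where B=1])
  have "{0<..<x} \<in> sets lebesgue" by simp
  then show "indicator {0<..<x} \<in> borel_measurable I01"
    by (intro measurable_restrict_space1 borel_measurable_indicator)
qed (simp add: indicator_def)

lemma L2I_integrable_on: "f \<in> L2I \<Longrightarrow> f integrable_on {0..1}"
  using integrable_on_lebesgue_on[OF L2I_integrable, of f] integrable_on_Icc_iff_Ioo[of f 0 1]
  by simp

lemma ip_indicator_eq_integral:
  assumes f: "f \<in> L2I" and x: "x \<in> {0..1}"
  shows "ip f (indicator {0<..<x}) = integral {0..x} f"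
proof -
  have "integrable I01 (\<lambda>t. f t * indicator {0<..<x} t)"
    using f L2I_indicator by (rule L2I_mult_integrable)
  then have "ip f (indicator {0<..<x}) = integral {0<..<1} (\<lambda>t. f t * indicator {0<..<x} t)"
    unfolding ip_def by (rule lebesgue_integral_eq_integral) simp
  also have "\<dots> = integral {0<..<1} (\<lambda>t. if t \<in> {0<..<x} then f t else 0)"
    by (rule Henstock_Kurzweil_Integration.integral_cong) (simp add: indicator_def)
  also have "\<dots> = integral {0<..<x} f"
  proof -
    have "{0<..<1} \<inter> {0<..<x} = {0<..<x}" using x by auto
    then show ?thesis using integral_restrict_Int[of "{0<..<1}" "{0<..<x}" f] by (simp add: Int_commute)
  qed
  also have "\<dots> = integral {0..x} f"
    by (rule integral_open_interval_real[symmetric])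
  finally show ?thesis .
qed

lemma has_L2_deriv_iff:
  "has_L2_deriv f f' \<longleftrightarrow> f' \<in> L2I \<and> (\<forall>x\<in>{0..1}. f x = f 0 + ip f' (indicator {0<..<x}))"
  by (simp add: has_L2_deriv_def LINT_initial_interval_eq_ip)

lemma has_L2_derivD_L2I: "has_L2_deriv f f' \<Longrightarrow> f' \<in> L2I"
  by (simp add: has_L2_deriv_def)

lemma has_L2_deriv_continuous:
  assumes "has_L2_deriv f f'" shows "continuous_on {0..1} f"
proof -
  have "f x = f 0 + integral {0..x} f'" if "x \<in> {0..1}" for x
  proof -
    have "f' \<in> L2I" "f x = f 0 + ip f' (indicator {0<..<x})"
      using assms that unfolding has_L2_deriv_iff by blast+
    then show ?thesis by (simp only: ip_indicator_eq_integral[OF _ that])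
  qed
  moreover have "continuous_on {0..1} (\<lambda>x. f 0 + integral {0..x} f')"
    using assms by (intro continuous_intros indefinite_integral_continuous_1 L2I_integrable_on)
      (simp add: has_L2_deriv_def)
  ultimately show ?thesis by (metis (no_types, lifting) continuous_on_eq)
qed

lemma has_L2_deriv_L2I: "has_L2_deriv f f' \<Longrightarrow> f \<in> L2I"
  by (intro L2I_continuous has_L2_deriv_continuous)

lemma has_L2_deriv_add:
  assumes "has_L2_deriv f f'" "has_L2_deriv g g'"
  shows "has_L2_deriv (\<lambda>x. f x + g x) (\<lambda>x. f' x + g' x)"
  unfolding has_L2_deriv_iff
proof (intro conjI ballI)
  show "(\<lambda>x. f' x + g' x) \<in> L2I" using assms by (intro L2I_add) (simp_all add: has_L2_deriv_iff)
  fix x :: real assume "x \<in> {0..1}"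
  then have "f x = f 0 + ip f' (indicator {0<..<x})" "g x = g 0 + ip g' (indicator {0<..<x})"
    using assms unfolding has_L2_deriv_iff by blast+
  moreover have "ip (\<lambda>x. f' x + g' x) (indicator {0<..<x}) = ip f' (indicator {0<..<x}) + ip g' (indicator {0<..<x})"
    using assms by (intro ip_add_left L2I_indicator) (simp_all add: has_L2_deriv_iff)
  ultimately show "f x + g x = f 0 + g 0 + ip (\<lambda>x. f' x + g' x) (indicator {0<..<x})"
    by linarith
qed

lemma has_L2_deriv_scale:
  assumes "has_L2_deriv f f'"
  shows "has_L2_deriv (\<lambda>x. r * f x) (\<lambda>x. r * f' x)"
  unfolding has_L2_deriv_iff
proof (intro conjI ballI)
  show "(\<lambda>x. r * f' x) \<in> L2I" using assms by (intro L2I_scale) (simp add: has_L2_deriv_iff)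
  fix x :: real assume "x \<in> {0..1}"
  then have "f x = f 0 + ip f' (indicator {0<..<x})" using assms unfolding has_L2_deriv_iff by blast
  then show "r * f x = r * f 0 + ip (\<lambda>x. r * f' x) (indicator {0<..<x})"
    by (simp only: distrib_left ip_scale_left)
qed

lemma has_L2_deriv_diff:
  assumes "has_L2_deriv f f'" "has_L2_deriv g g'"
  shows "has_L2_deriv (\<lambda>x. f x - g x) (\<lambda>x. f' x - g' x)"
  using has_L2_deriv_add[OF assms(1) has_L2_deriv_scale[OF assms(2), of "-1"]] by simp

lemma has_L2_derivI:
  assumes "continuous_on {0..1} f'"
    and d: "\<And>x. x \<in> {0..1} \<Longrightarrow> (f has_real_derivative f' x) (at x within {0..1})"
  shows "has_L2_deriv f f'"
  unfolding has_L2_deriv_iff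
proof (intro conjI ballI)
  show L: "f' \<in> L2I" using assms by (intro L2I_continuous)
  fix x :: real assume x: "x \<in> {0..1}"
  have "(f' has_integral (f x - f 0)) {0..x}"
    using x d by (intro fundamental_theorem_of_calculus)
      (auto simp: has_real_derivative_iff_has_vector_derivative[symmetric] intro!: DERIV_subset[OF d])
  then show "f x = f 0 + ip f' (indicator {0<..<x})"
    using L x by (simp add: ip_indicator_eq_integral integral_unique)
qed

text \<open>A function on the unit interval is controlled uniformly by one value and the
  \<open>L\<^sup>2\<close> norm of its derivative. This is how approximation of derivatives in
  \<open>L\<^sup>2\<close> becomes uniform approximation.\<close>

lemma has_L2_deriv_pointwise_bound:
  assumes "has_L2_deriv f f'" "x \<in> {0..1}" "y \<in> {0..1}"
  shows "\<bar>f x - f y\<bar> \<le> 2 * sqrt (nsq f')"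
proof -
  have n: "nsq (indicator {0<..<x::real}) \<le> 1" for x
    using nsq_le_bound[OF L2I_indicator, of x 1] by (simp add: indicator_def)
  have "\<bar>f x - f 0\<bar> \<le> sqrt (nsq f')" if "x \<in> {0..1}" for x
  proof -
    have "f x = f 0 + ip f' (indicator {0<..<x})"
      using assms that unfolding has_L2_deriv_iff by blast
    then have "\<bar>f x - f 0\<bar> = \<bar>ip f' (indicator {0<..<x})\<bar>"
      by linarith
    also have "\<dots> \<le> sqrt (nsq f') * sqrt (nsq (indicator {0<..<x}))"
      using assms by (intro abs_ip_le L2I_indicator) (simp add: has_L2_deriv_def)
    also have "\<dots> \<le> sqrt (nsq f') * 1"
      using n[of x] by (intro mult_left_mono) (auto simp: nsq_nonneg)
    finally show ?thesis by simp
  qed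
  from this[of x] this[of y] assms(2,3) show ?thesis by linarith
qed

lemma integration_by_parts_C1:
  assumes F: "continuous_on {0..1} F'" "\<And>x. x \<in> {0..1} \<Longrightarrow> (F has_real_derivative F' x) (at x within {0..1})"
    and \<psi>: "continuous_on {0..1} \<psi>'" "\<And>x. x \<in> {0..1} \<Longrightarrow> (\<psi> has_real_derivative \<psi>' x) (at x within {0..1})"
  shows "ip F' \<psi> = F 1 * \<psi> 1 - F 0 * \<psi> 0 - ip F \<psi>'"
proof -
  have c: "continuous_on {0..1} F" "continuous_on {0..1} \<psi>"
    using DERIV_continuous_on[OF F(2)] DERIV_continuous_on[OF \<psi>(2)] by simp_all
  have "(LINT x|I01. F' x * \<psi> x + F x * \<psi>' x) = F 1 * \<psi> 1 - F 0 * \<psi> 0"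
    by (rule I01_FTC) (use F \<psi> c in \<open>auto intro!: continuous_intros derivative_eq_intros\<close>)
  moreover have "(LINT x|I01. F' x * \<psi> x + F x * \<psi>' x) = ip F' \<psi> + ip F \<psi>'"
    unfolding ip_def using F(1) \<psi>(1) c
    by (intro Bochner_Integration.integral_add L2I_mult_integrable L2I_continuous)
  ultimately show ?thesis by simp
qed

text \<open>Approximate \<open>f'\<close> in \<open>L\<^sup>2\<close> by a continuous function.
  Its primitive is uniformly close to \<open>f\<close> by the preceding bound and satisfies the
  classical formula, and every term of the formula depends continuously on this
  approximation.\<close>

lemma integration_by_parts:
  assumes f: "has_L2_deriv f f'"
    and \<psi>: "continuous_on {0..1} \<psi>'" "\<And>x. x \<in> {0..1} \<Longrightarrow> (\<psi> has_real_derivative \<psi>' x) (at x within {0..1})"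
  shows "ip f' \<psi> = f 1 * \<psi> 1 - f 0 * \<psi> 0 - ip f \<psi>'"
proof -
  have c: "continuous_on {0..1} \<psi>" using DERIV_continuous_on[OF \<psi>(2)] by simp
  note L = L2I_continuous[OF c] L2I_continuous[OF \<psi>(1)] has_L2_derivD_L2I[OF f] has_L2_deriv_L2I[OF f]
  \<comment> \<open>An approximation of \<open>f'\<close> up to \<open>\<epsilon>\<close> changes
    the formula by at most \<open>\<epsilon> * C\<close>; the summand \<open>1\<close> makes
    \<open>C\<close> positive.\<close>
  define C where "C = sqrt (nsq \<psi>) + \<bar>\<psi> 1\<bar> * 2 + sqrt (nsq \<psi>') * 2 + 1"
  have C: "C > 0" unfolding C_def using nsq_nonneg by (simp add: add_nonneg_pos)
  have "\<bar>ip f' \<psi> - (f 1 * \<psi> 1 - f 0 * \<psi> 0 - ip f \<psi>')\<bar> \<le> 0 + e" if "e > 0" for e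
  proof -
    define \<epsilon> where "\<epsilon> = e / C"
    have e: "\<epsilon> > 0" using C that by (simp add: \<epsilon>_def)
    obtain h where h: "continuous_on UNIV h" "nsq (\<lambda>x. f' x - 1 * h x) < \<epsilon>\<^sup>2"
      using weighted_continuous_approximation[of f' "\<lambda>x. 1" "\<epsilon>\<^sup>2"] L(3) e by auto
    have hc: "continuous_on {0..1} h" using h(1) by (rule continuous_on_subset) auto
    define H where "H x = f 0 + integral {0..x} h" for x
    have Hd: "(H has_real_derivative h x) (at x within {0..1})" if "x \<in> {0..1}" for x
      unfolding H_def using integral_has_real_derivative[OF hc that] by (auto intro!: derivative_eq_intros)
    note H = has_L2_derivI[OF hc Hd]
    note k = has_L2_deriv_diff[OF f H]
    have k0: "f 0 - H 0 = 0" by (simp add: H_def)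
    have s: "sqrt (nsq (\<lambda>x. f' x - h x)) \<le> \<epsilon>"
      using h(2) e by (intro real_le_lsqrt) (auto simp: nsq_nonneg)
    have kb: "\<bar>f x - H x\<bar> \<le> 2 * \<epsilon>" if "x \<in> {0..1}" for x
      using has_L2_deriv_pointwise_bound[OF k that, of 0] k0 s by auto
    have "ip h \<psi> = H 1 * \<psi> 1 - H 0 * \<psi> 0 - ip H \<psi>'"
      by (rule integration_by_parts_C1[OF hc Hd \<psi>])
    then have "ip f' \<psi> - (f 1 * \<psi> 1 - f 0 * \<psi> 0 - ip f \<psi>') =
        ip (\<lambda>x. f' x - h x) \<psi> - (f 1 - H 1) * \<psi> 1 + ip (\<lambda>x. f x - H x) \<psi>'"
      using L k0 L2I_continuous[OF hc] has_L2_deriv_L2I[OF H]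
      by (simp add: ip_diff_left algebra_simps)
    also have "\<bar>\<dots>\<bar> \<le> \<bar>ip (\<lambda>x. f' x - h x) \<psi>\<bar> + \<bar>(f 1 - H 1) * \<psi> 1\<bar> + \<bar>ip (\<lambda>x. f x - H x) \<psi>'\<bar>"
      by linarith
    also have "\<dots> \<le> \<epsilon> * sqrt (nsq \<psi>) + 2 * \<epsilon> * \<bar>\<psi> 1\<bar> + 2 * \<epsilon> * sqrt (nsq \<psi>')"
    proof (intro add_mono)
      show "\<bar>ip (\<lambda>x. f' x - h x) \<psi>\<bar> \<le> \<epsilon> * sqrt (nsq \<psi>)"
        by (rule order_trans[OF abs_ip_le[OF L2I_diff[OF L(3) L2I_continuous[OF hc]] L(1)]])
          (intro mult_right_mono s, simp add: nsq_nonneg)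
      show "\<bar>(f 1 - H 1) * \<psi> 1\<bar> \<le> 2 * \<epsilon> * \<bar>\<psi> 1\<bar>"
        unfolding abs_mult by (intro mult_right_mono kb) auto
      have "nsq (\<lambda>x. f x - H x) \<le> (2 * \<epsilon>)\<^sup>2"
        by (intro nsq_le_bound has_L2_deriv_L2I[OF k] kb) auto
      then have "sqrt (nsq (\<lambda>x. f x - H x)) \<le> 2 * \<epsilon>"
        using e by (intro real_le_lsqrt) (auto simp: nsq_nonneg)
      then show "\<bar>ip (\<lambda>x. f x - H x) \<psi>'\<bar> \<le> 2 * \<epsilon> * sqrt (nsq \<psi>')"
        by (intro order_trans[OF abs_ip_le[OF has_L2_deriv_L2I[OF k] L(2)]] mult_right_mono)
          (auto simp: nsq_nonneg)
    qed
    also have "\<dots> \<le> \<epsilon> * C"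
      using e by (simp add: C_def algebra_simps)
    also have "\<dots> = e" using C by (simp add: \<epsilon>_def)
    finally show ?thesis by simp
  qed
  then have "\<bar>ip f' \<psi> - (f 1 * \<psi> 1 - f 0 * \<psi> 0 - ip f \<psi>')\<bar> \<le> 0"
    by (rule field_le_epsilon)
  then show ?thesis by simp
qed

lemma Green_formula:
  assumes f: "has_L2_deriv2 f f' f''"
    and \<psi>: "continuous_on {0..1} \<psi>''"
      "\<And>x. x \<in> {0..1} \<Longrightarrow> (\<psi> has_real_derivative \<psi>' x) (at x within {0..1})"
      "\<And>x. x \<in> {0..1} \<Longrightarrow> (\<psi>' has_real_derivative \<psi>'' x) (at x within {0..1})"
  shows "ip f'' \<psi> = f' 1 * \<psi> 1 - f' 0 * \<psi> 0 - f 1 * \<psi>' 1 + f 0 * \<psi>' 0 + ip f \<psi>''"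
proof -
  have c: "continuous_on {0..1} \<psi>'" using DERIV_continuous_on[OF \<psi>(3)] by simp
  show ?thesis
    using integration_by_parts[of f' f'' \<psi>' \<psi>] integration_by_parts[of f f' \<psi>'' \<psi>'] f \<psi> c
    by (simp add: has_L2_deriv2_def)
qed

lemma has_L2_deriv_eqI_imp_eq:
  assumes "has_L2_deriv f f'" "has_L2_deriv g g'" "eqI f g" "x \<in> {0..1}"
  shows "f x = g x"
  using eqI_continuous_imp[of "\<lambda>x. f x - g x" x] has_L2_deriv_continuous[OF assms(1)]
    has_L2_deriv_continuous[OF assms(2)] assms(3,4)
  by (simp add: eqI_diff_zero continuous_on_diff)

text \<open>Integration by parts against the cosines expresses the coefficients of the derivative
  by the function itself.\<close>

lemma has_L2_deriv_unique:
  assumes f: "has_L2_deriv f f'" and g: "has_L2_deriv g g'" and eq: "eqI f g"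
  shows "eqI f' g'"
proof (rule eqI_if_coefficients_eq[OF complete_ecos has_L2_derivD_L2I[OF f] has_L2_derivD_L2I[OF g]])
  fix n
  have d: "(ecos n has_real_derivative - mu n * sin (real n * pi * x) * (real n * pi)) (at x within {0..1})" for x
    unfolding ecos_def by (auto intro!: derivative_eq_intros)
  have c: "continuous_on {0..1} (\<lambda>x. - mu n * sin (real n * pi * x) * (real n * pi))"
    by (intro continuous_intros)
  have z: "f x = g x" if "x \<in> {0..1}" for x
    using has_L2_deriv_eqI_imp_eq[OF f g eq that] .
  have "ip f (\<lambda>x. - mu n * sin (real n * pi * x) * (real n * pi)) = ip g (\<lambda>x. - mu n * sin (real n * pi * x) * (real n * pi))"
    by (rule ip_cong) (simp add: z)
  then show "ip f' (ecos n) = ip g' (ecos n)"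
    using integration_by_parts[OF f c d] integration_by_parts[OF g c d] z[of 0] z[of 1]
    by simp
qed

lemma wderiv_eqI:
  assumes "eqI f g" "has_L2_deriv g g'"
  shows "wderiv f \<in> L2I" and "eqI (wderiv f) g'"
proof -
  have "\<exists>g' g. eqI f g \<and> has_L2_deriv g g'" using assms by blast
  then have "\<exists>g. eqI f g \<and> has_L2_deriv g (wderiv f)"
    unfolding wderiv_def by (rule someI_ex)
  then obtain h where h: "eqI f h" "has_L2_deriv h (wderiv f)" by blast
  show "wderiv f \<in> L2I" using h(2) by (rule has_L2_derivD_L2I)
  show "eqI (wderiv f) g'"
    by (rule has_L2_deriv_unique[OF h(2) assms(2) eqI_trans[OF eqI_sym[OF h(1)] assms(1)]])
qed

lemma H0_inner_eq:
  assumes "fst X \<in> L2I" "snd X \<in> L2I" "fst Y \<in> L2I" "snd Y \<in> L2I"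
  shows "H0_inner X Y = ip (fst X) (fst Y) + ip (snd X) (snd Y)"
  unfolding H0_inner_def ip_def using assms
  by (intro Bochner_Integration.integral_add L2I_mult_integrable)

lemma H1_normsq_eq:
  assumes "eqI y f" "has_L2_deriv f f'" "eqI z g" "has_L2_deriv g g'" "z \<in> L2I"
  shows "H1_normsq (y, z) = nsq f' + nsq g + nsq g'"
proof -
  note w = wderiv_eqI[OF assms(1,2)] wderiv_eqI[OF assms(3,4)]
  note L = has_L2_derivD_L2I[OF assms(2)] has_L2_derivD_L2I[OF assms(4)] has_L2_deriv_L2I[OF assms(4)]
  have "H1_normsq (y, z) = nsq (wderiv y) + nsq z + nsq (wderiv z)"
    unfolding H1_normsq_def H1_inner_def ip_def fst_conv snd_conv using w assms(5)
    by (subst Bochner_Integration.integral_add, intro Bochner_Integration.integrable_add L2I_mult_integrable; simp add: L2I_mult_integrable)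
  also have "\<dots> = nsq f' + nsq g + nsq g'"
  proof -
    have "nsq (wderiv y) = nsq f'" by (rule ip_cong_AE[OF w(1) L(1) w(1) L(1) w(2) w(2)])
    moreover have "nsq (wderiv z) = nsq g'" by (rule ip_cong_AE[OF w(3) L(2) w(3) L(2) w(4) w(4)])
    moreover have "nsq z = nsq g" by (rule ip_cong_AE[OF assms(5) L(3) assms(5) L(3) assms(3) assms(3)])
    ultimately show ?thesis by simp
  qed
  finally show ?thesis .
qed


section \<open>Generalized eigenfunctions\<close>

text \<open>The partner of an index is the index of the other family with the same eigenvalue; it
  is meaningful only for members of \<^term>\<open>Delta1 a b\<close> and
  \<^term>\<open>Delta2 a b\<close>.\<close>

definition partner1 :: "real \<Rightarrow> real \<Rightarrow> nat \<Rightarrow> nat" where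
  "partner1 a b m = (THE k. (k, m) \<in> Delta a b)"

definition partner2 :: "real \<Rightarrow> real \<Rightarrow> nat \<Rightarrow> nat" where
  "partner2 a b n = (THE k. (n, k) \<in> Delta a b)"

lemma partner_eq:
  assumes "(n, m) \<in> Delta a b"
  shows "partner1 a b m = n" "partner2 a b n = m" "n \<in> Delta1 a b" "m \<in> Delta2 a b"
  unfolding partner1_def partner2_def Delta1_def Delta2_def
  using assms Delta_eq_iff[OF assms] by (auto intro!: the_equality image_eqI[OF _ assms])

lemma partner_Delta:
  "n \<in> Delta1 a b \<Longrightarrow> (n, partner2 a b n) \<in> Delta a b"
  "m \<in> Delta2 a b \<Longrightarrow> (partner1 a b m, m) \<in> Delta a b"
  using partner_eq by (force simp: Delta1_def Delta2_def)+

lemma finite_Delta12: "finite (Delta1 a b)" "finite (Delta2 a b)"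
  by (simp_all add: Delta1_def Delta2_def finite_Delta)

lemma mu_pos: "mu m > 0" by (simp add: mu_def)

lemma mu_le: "mu m \<le> sqrt 2" by (simp add: mu_def)

text \<open>This and the next lemma show that the denominators in \<^const>\<open>psi1_snd\<close>
  and \<^const>\<open>phi2\<close> vanish only at resonances, where these functions are given by
  other formulas.\<close>

lemma sinh_root_eq_0_imp:
  assumes "(r::complex)\<^sup>2 = complex_of_real d" "r * sinh r = 0"
  obtains k :: nat where "d = - (real k)\<^sup>2 * pi\<^sup>2"
proof (cases "r = 0")
  case True
  then have "d = 0" using assms by simp
  then show ?thesis using that[of 0] by simp
next
  case False
  then have "sin (\<i> * r) = 0" using assms(2) by (simp add: sinh_conv_sin)
  then obtain n :: int where n: "\<i> * r = complex_of_real (n * pi)" by (auto simp: sin_eq_0)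
  have "- complex_of_real d = (\<i> * r)\<^sup>2" using assms(1) by (simp add: power_mult_distrib)
  also have "\<dots> = complex_of_real ((n * pi)\<^sup>2)" by (simp only: n of_real_power)
  finally have "- d = (n * pi)\<^sup>2" by (metis of_real_eq_iff of_real_minus)
  then show ?thesis
    using that[of "nat \<bar>n\<bar>"] by (simp add: power_mult_distrib)
qed

lemma cosh_root_eq_0_imp:
  assumes "(r::complex)\<^sup>2 = complex_of_real d" "cosh r = 0"
  obtains k :: nat where "d = - (real k + 1/2)\<^sup>2 * pi\<^sup>2"
proof -
  have "cos (\<i> * r) = 0" using assms(2) by (simp add: cosh_conv_cos)
  then obtain n :: int where n: "\<i> * r = complex_of_real (n * pi) + complex_of_real pi / 2"
    by (auto simp: cos_eq_0)
  then have n: "\<i> * r = complex_of_real ((n + 1/2) * pi)" by (simp add: field_simps)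
  have "- complex_of_real d = (\<i> * r)\<^sup>2" using assms(1) by (simp add: power_mult_distrib)
  also have "\<dots> = complex_of_real (((n + 1/2) * pi)\<^sup>2)" by (simp only: n of_real_power)
  finally have d: "- d = ((n + 1/2) * pi)\<^sup>2" by (metis of_real_eq_iff of_real_minus)
  show ?thesis
  proof (cases "n \<ge> 0")
    case True
    then show ?thesis using d that[of "nat n"] by (simp add: power_mult_distrib)
  next
    case False
    then have "real (nat (- n - 1)) = - n - 1" by simp
    moreover have "(- real_of_int n - 1 + 1/2)\<^sup>2 = (n + 1/2)\<^sup>2" by (simp add: power2_eq_square algebra_simps)
    ultimately show ?thesis using d that[of "nat (- n - 1)"] by (simp add: power_mult_distrib)
  qed
qed

lemma Re_has_real_derivative:
  assumes "(G has_field_derivative D) (at (complex_of_real x))"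
  shows "((\<lambda>x. Re (G (complex_of_real x))) has_real_derivative Re D) (at x)"
proof -
  have "((\<lambda>x. G (complex_of_real x)) has_vector_derivative D) (at x)"
    using assms by (rule has_vector_derivative_real_field)
  then have "((\<lambda>x. Re (G (complex_of_real x))) has_vector_derivative Re D) (at x)"
    by (rule bounded_linear.has_vector_derivative[OF bounded_linear_Re])
  then show ?thesis by (simp add: has_real_derivative_iff_has_vector_derivative)
qed

lemma
  fixes r \<kappa> :: complex
  shows Re_cosh_deriv: "((\<lambda>x. Re (\<kappa> * cosh (r * complex_of_real (1 - x)))) has_real_derivative
      Re (- \<kappa> * r * sinh (r * complex_of_real (1 - x)))) (at x)"
    and Re_sinh_deriv: "((\<lambda>x. Re (\<kappa> * sinh (r * complex_of_real (1 - x)))) has_real_derivative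
      Re (- \<kappa> * r * cosh (r * complex_of_real (1 - x)))) (at x)"
proof -
  have "((\<lambda>z. \<kappa> * cosh (r * (1 - z))) has_field_derivative - \<kappa> * r * sinh (r * (1 - complex_of_real x))) (at (complex_of_real x))"
    by (auto intro!: derivative_eq_intros)
  from Re_has_real_derivative[OF this]
  show "((\<lambda>x. Re (\<kappa> * cosh (r * complex_of_real (1 - x)))) has_real_derivative
      Re (- \<kappa> * r * sinh (r * complex_of_real (1 - x)))) (at x)" by simp
  have "((\<lambda>z. \<kappa> * sinh (r * (1 - z))) has_field_derivative - \<kappa> * r * cosh (r * (1 - complex_of_real x))) (at (complex_of_real x))"
    by (auto intro!: derivative_eq_intros)
  from Re_has_real_derivative[OF this]
  show "((\<lambda>x. Re (\<kappa> * sinh (r * complex_of_real (1 - x)))) has_real_derivative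
      Re (- \<kappa> * r * cosh (r * complex_of_real (1 - x)))) (at x)" by simp
qed

lemma Re_of_real_mult: "Re (complex_of_real r * z) = r * Re z"
  by simp

text \<open>The three formulas for \<^const>\<open>phi2\<close> are the solutions of one boundary
  value problem, which says that the pair of \<^const>\<open>phi2\<close> and
  \<^const>\<open>ecos\<close> is a generalized eigenvector of the operator: at a resonance
  \<open>(k, m)\<close> the operator maps it to \<open>lam2 b m\<close> times itself minus a
  multiple of the eigenvector belonging to \<open>phi1 k\<close>.\<close>

lemma phi2_boundary_problem:
  obtains f' f'' where
    "\<And>x. (phi2 a b s m has_real_derivative f' x) (at x)"
    "\<And>x. (f' has_real_derivative f'' x) (at x)"
    "\<And>x. f'' x = (lam2 b m - a) * phi2 a b s m x -
        (if m \<in> Delta2 a b then sqrt 2 * s * mu m * phi1 (partner1 a b m) x else 0)"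
    "phi2 a b s m 1 = 0" "f' 0 = s * mu m"
proof -
  define d where "d = b - a - (real m)\<^sup>2 * pi\<^sup>2"
  have lam: "lam2 b m - a = d" by (simp add: lam2_def d_def)
  consider (res) "m \<in> Delta2 a b" | (lin) "m \<notin> Delta2 a b" "d = 0" | (hyp) "m \<notin> Delta2 a b" "d \<noteq> 0"
    by blast
  then show ?thesis
  proof cases
    case res
    define k where "k = partner1 a b m"
    define w where "w = (real k + 1/2) * pi"
    have w: "w > 0" by (simp add: w_def)
    have "(k, m) \<in> Delta a b" using partner_Delta(2)[OF res] by (simp add: k_def)
    then have "lam1 a k = lam2 b m" by (simp add: Delta_iff_lam_eq)
    then have dw: "d = - w\<^sup>2" using lam by (simp add: lam1_def w_def power_mult_distrib)
    have f: "phi2 a b s m = (\<lambda>x. s * mu m / w * (1 - x) * sin (w * x))"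
      using res by (intro ext) (simp add: phi2_def Let_def w_def k_def partner1_def)
    define f' where "f' x = s * mu m / w * (- sin (w * x) + (1 - x) * (w * cos (w * x)))" for x
    define f'' where "f'' x = s * mu m / w * (- 2 * w * cos (w * x) - (1 - x) * (w * w * sin (w * x)))" for x
    show ?thesis
    proof (rule that[of f' f''])
      show "(phi2 a b s m has_real_derivative f' x) (at x)" for x
        unfolding f f'_def using w by (auto intro!: derivative_eq_intros simp: field_simps)
      show "(f' has_real_derivative f'' x) (at x)" for x
        unfolding f'_def f''_def using w by (auto intro!: derivative_eq_intros simp: field_simps)
      have ph: "phi1 k x = sqrt 2 * cos (w * x)" for x by (simp add: phi1_def w_def)
      show "f'' x = (lam2 b m - a) * phi2 a b s m x -
        (if m \<in> Delta2 a b then sqrt 2 * s * mu m * phi1 (partner1 a b m) x else 0)" for x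
        using res w unfolding lam f f''_def dw k_def[symmetric] ph
        by (simp add: field_simps power2_eq_square)
      show "phi2 a b s m 1 = 0" by (simp add: f)
      show "f' 0 = s * mu m" using w by (simp add: f'_def)
    qed
  next
    case lin
    then have "b - a = (real m)\<^sup>2 * pi\<^sup>2" by (simp add: d_def)
    then have f: "phi2 a b s m = (\<lambda>x. s * mu m * (- 1 + x))"
      using lin by (intro ext) (simp add: phi2_def)
    show ?thesis
      by (rule that[of "\<lambda>x. s * mu m" "\<lambda>x. 0"])
        (use lin in \<open>auto simp: f lam intro!: derivative_eq_intros\<close>)
  next
    case hyp
    define r where "r = csqrt (complex_of_real d)"
    define \<kappa> where "\<kappa> = - (complex_of_real (s * mu m) / (r * cosh r))"
    have r2: "r\<^sup>2 = complex_of_real d" by (simp add: r_def)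
    have r0: "r \<noteq> 0" using hyp r2 by auto
    have c0: "cosh r \<noteq> 0"
    proof
      assume "cosh r = 0"
      then obtain k :: nat where "d = - (real k + 1/2)\<^sup>2 * pi\<^sup>2"
        using cosh_root_eq_0_imp[OF r2] by blast
      then have "(k, m) \<in> Delta a b"
        using lam by (simp add: Delta_iff_lam_eq lam1_def)
      then show False using hyp partner_eq by blast
    qed
    have "b - a \<noteq> (real m)\<^sup>2 * pi\<^sup>2" using hyp by (simp add: d_def)
    then have f: "phi2 a b s m = (\<lambda>x. Re (\<kappa> * sinh (r * complex_of_real (1 - x))))"
      using hyp(1) by (intro ext) (simp only: phi2_def Let_def \<kappa>_def r_def d_def if_False)
    define f' where "f' x = Re (- \<kappa> * r * cosh (r * complex_of_real (1 - x)))" for x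
    define f'' where "f'' x = Re (- (- \<kappa> * r) * r * sinh (r * complex_of_real (1 - x)))" for x
    show ?thesis
    proof (rule that[of f' f''])
      show "(phi2 a b s m has_real_derivative f' x) (at x)" for x
        unfolding f f'_def by (rule Re_sinh_deriv)
      show "(f' has_real_derivative f'' x) (at x)" for x
        unfolding f''_def f'_def by (rule Re_cosh_deriv)
      show "f'' x = (lam2 b m - a) * phi2 a b s m x -
        (if m \<in> Delta2 a b then sqrt 2 * s * mu m * phi1 (partner1 a b m) x else 0)" for x
      proof -
        have "f'' x = Re (r\<^sup>2 * (\<kappa> * sinh (r * complex_of_real (1 - x))))"
          by (simp only: f''_def power2_eq_square) (simp only: mult_ac mult_minus_left mult_minus_right minus_minus)
        also have "\<dots> = d * phi2 a b s m x"
          by (simp only: r2 Re_of_real_mult f)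
        finally show ?thesis using hyp(1) by (simp add: lam)
      qed
      show "phi2 a b s m 1 = 0" by (simp add: f)
      have "- \<kappa> * r * cosh r = complex_of_real (s * mu m)"
        using r0 c0 by (simp add: \<kappa>_def)
      then show "f' 0 = s * mu m" by (simp add: f'_def)
    qed
  qed
qed

text \<open>The dual problem. The value of \<open>f' 0\<close> is \<open>s * phi1 n 0\<close>:
  this is what makes the boundary terms of the two components cancel in the adjoint
  relation.\<close>

lemma psi1_snd_boundary_problem:
  obtains f' f'' where
    "\<And>x. (psi1_snd a b s n has_real_derivative f' x) (at x)"
    "\<And>x. (f' has_real_derivative f'' x) (at x)"
    "\<And>x. f'' x = (lam1 a n - b) * psi1_snd a b s n x -
        (if n \<in> Delta1 a b then sqrt 2 * s * mu (partner2 a b n) * ecos (partner2 a b n) x else 0)"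
    "f' 1 = 0" "f' 0 = sqrt 2 * s"
proof (cases "n \<in> Delta1 a b")
  case res: True
  define k where "k = partner2 a b n"
  have "(n, k) \<in> Delta a b" using partner_Delta(1)[OF res] by (simp add: k_def)
  then have lam: "lam1 a n - b = - (real k * pi)\<^sup>2"
    by (simp add: Delta_iff_lam_eq lam2_def power_mult_distrib)
  have k': "(THE k. (n, k) \<in> Delta a b) = k" by (simp add: k_def partner2_def)
  show ?thesis
  proof (cases "k = 0")
    case True
    define c0 where "c0 = - s * sqrt 2 * (1/3 + 1 / ((2 * real n + 1)\<^sup>2 * pi\<^sup>2))"
    have f: "psi1_snd a b s n = (\<lambda>x. c0 + sqrt 2 * s * x - sqrt 2 / 2 * s * x\<^sup>2)"
      using res True by (intro ext) (simp add: psi1_snd_def k' c0_def)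
    show ?thesis
    proof (rule that[of "\<lambda>x. sqrt 2 * s - sqrt 2 * s * x" "\<lambda>x. - sqrt 2 * s"])
      show "- sqrt 2 * s = (lam1 a n - b) * psi1_snd a b s n x -
        (if n \<in> Delta1 a b then sqrt 2 * s * mu (partner2 a b n) * ecos (partner2 a b n) x else 0)" for x
        using res unfolding lam k_def[symmetric] by (simp add: True ecos_def mu_def)
    qed (auto simp: f intro!: derivative_eq_intros)
  next
    case False
    define w where "w = real k * pi"
    define c where "c = - 2 * s / pi\<^sup>2 * (1 / (2 * real n + 1)\<^sup>2 + 1 / (4 * (real k)\<^sup>2)) * sqrt 2"
    have w: "w > 0" using False by (simp add: w_def)
    have f: "psi1_snd a b s n = (\<lambda>x. sqrt 2 * s / w * (1 - x) * sin (w * x) + c * cos (w * x))"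
      using res False by (intro ext) (simp add: psi1_snd_def k' c_def w_def)
    define f' where "f' x = sqrt 2 * s / w * (- sin (w * x) + (1 - x) * (w * cos (w * x))) - c * w * sin (w * x)" for x
    define f'' where "f'' x = sqrt 2 * s / w * (- 2 * w * cos (w * x) - (1 - x) * (w * w * sin (w * x))) - c * w * w * cos (w * x)" for x
    show ?thesis
    proof (rule that[of f' f''])
      show "(psi1_snd a b s n has_real_derivative f' x) (at x)" for x
        unfolding f f'_def using w by (auto intro!: derivative_eq_intros simp: field_simps)
      show "(f' has_real_derivative f'' x) (at x)" for x
        unfolding f'_def f''_def using w by (auto intro!: derivative_eq_intros simp: field_simps)
      have e: "mu k * ecos k x = 2 * cos (w * x)" for x using False by (simp add: ecos_def w_def mu_def)
      show "f'' x = (lam1 a n - b) * psi1_snd a b s n x -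
        (if n \<in> Delta1 a b then sqrt 2 * s * mu (partner2 a b n) * ecos (partner2 a b n) x else 0)" for x
        using res w unfolding lam f f''_def k_def[symmetric] w_def[symmetric] mult.assoc[of _ "mu k"] e
        by (simp add: field_simps power2_eq_square)
      show "f' 0 = sqrt 2 * s" using w by (simp add: f'_def)
      show "f' 1 = 0" by (simp add: f'_def w_def)
    qed
  qed
next
  case False
  define d where "d = lam1 a n - b"
  define r where "r = csqrt (complex_of_real d)"
  define \<kappa> where "\<kappa> = - (complex_of_real (sqrt 2 * s) / (r * sinh r))"
  have r2: "r\<^sup>2 = complex_of_real d" by (simp add: r_def)
  have c0: "r * sinh r \<noteq> 0"
  proof
    assume "r * sinh r = 0"
    then obtain k :: nat where "d = - (real k)\<^sup>2 * pi\<^sup>2"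
      using sinh_root_eq_0_imp[OF r2] by blast
    then have "(n, k) \<in> Delta a b"
      by (simp add: Delta_iff_lam_eq lam2_def d_def)
    then show False using False partner_eq by blast
  qed
  have f: "psi1_snd a b s n = (\<lambda>x. Re (\<kappa> * cosh (r * complex_of_real (1 - x))))"
    using False by (intro ext) (simp only: psi1_snd_def Let_def \<kappa>_def r_def d_def if_True not_False_eq_True)
  define f' where "f' x = Re (- \<kappa> * r * sinh (r * complex_of_real (1 - x)))" for x
  define f'' where "f'' x = Re (- (- \<kappa> * r) * r * cosh (r * complex_of_real (1 - x)))" for x
  show ?thesis
  proof (rule that[of f' f''])
    show "(psi1_snd a b s n has_real_derivative f' x) (at x)" for x
      unfolding f f'_def by (rule Re_cosh_deriv)
    show "(f' has_real_derivative f'' x) (at x)" for x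
      unfolding f''_def f'_def by (rule Re_sinh_deriv)
    show "f'' x = (lam1 a n - b) * psi1_snd a b s n x -
        (if n \<in> Delta1 a b then sqrt 2 * s * mu (partner2 a b n) * ecos (partner2 a b n) x else 0)" for x
    proof -
      have "f'' x = Re (r\<^sup>2 * (\<kappa> * cosh (r * complex_of_real (1 - x))))"
        by (simp only: f''_def power2_eq_square) (simp only: mult_ac mult_minus_left mult_minus_right minus_minus)
      also have "\<dots> = d * psi1_snd a b s n x"
        by (simp only: r2 Re_of_real_mult f)
      finally show ?thesis using False by (simp add: d_def)
    qed
    show "f' 1 = 0" by (simp add: f'_def)
    have "- \<kappa> * r * sinh r = complex_of_real (sqrt 2 * s)"
      using c0 by (simp add: \<kappa>_def)
    then show "f' 0 = sqrt 2 * s" by (simp add: f'_def)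
  qed
qed

lemma phi1_boundary_problem:
  "(phi1 n has_real_derivative - sqrt 2 * ((real n + 1/2) * pi) * sin ((real n + 1/2) * pi * x)) (at x)"
  "((\<lambda>x. - sqrt 2 * ((real n + 1/2) * pi) * sin ((real n + 1/2) * pi * x)) has_real_derivative
     (lam1 a n - a) * phi1 n x) (at x)"
  "phi1 n 1 = 0" "phi1 n 0 = sqrt 2"
proof -
  show "(phi1 n has_real_derivative - sqrt 2 * ((real n + 1/2) * pi) * sin ((real n + 1/2) * pi * x)) (at x)"
    unfolding phi1_def by (auto intro!: derivative_eq_intros)
  show "((\<lambda>x. - sqrt 2 * ((real n + 1/2) * pi) * sin ((real n + 1/2) * pi * x)) has_real_derivative
     (lam1 a n - a) * phi1 n x) (at x)"
    unfolding phi1_def lam1_def by (auto intro!: derivative_eq_intros simp: power2_eq_square)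
  have "(real n + 1/2) * pi * 1 = real n * pi + pi / 2" by (simp add: algebra_simps)
  then show "phi1 n 1 = 0" unfolding phi1_def by (simp only:) (simp add: cos_add sin_npi)
  show "phi1 n 0 = sqrt 2" by (simp add: phi1_def)
qed

lemma ecos_boundary_problem:
  "(ecos m has_real_derivative - mu m * (real m * pi) * sin (real m * pi * x)) (at x)"
  "((\<lambda>x. - mu m * (real m * pi) * sin (real m * pi * x)) has_real_derivative (lam2 b m - b) * ecos m x) (at x)"
  "ecos m 0 = mu m"
proof -
  show "(ecos m has_real_derivative - mu m * (real m * pi) * sin (real m * pi * x)) (at x)"
    unfolding ecos_def by (auto intro!: derivative_eq_intros)
  show "((\<lambda>x. - mu m * (real m * pi) * sin (real m * pi * x)) has_real_derivative (lam2 b m - b) * ecos m x) (at x)"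
    unfolding ecos_def lam2_def by (auto intro!: derivative_eq_intros simp: power2_eq_square)
qed (simp add: ecos_def)

lemma L2I_differentiable:
  assumes "\<And>x. (f has_real_derivative f' x) (at x)" shows "f \<in> L2I" and "continuous_on A f"
proof -
  show "continuous_on A f" for A
    using assms by (intro continuous_at_imp_continuous_on ballI DERIV_isCont)
  then show "f \<in> L2I" by (rule L2I_continuous)
qed

lemma L2I_psi1_snd: "psi1_snd a b s n \<in> L2I"
  using psi1_snd_boundary_problem[of a b s n] L2I_differentiable by metis

lemma L2I_phi2: "phi2 a b s m \<in> L2I"
  using phi2_boundary_problem[of a b s m] L2I_differentiable by metis

lemma L2I_ecos: "ecos m \<in> L2I" using orthonormal_ecos by (rule orthonormal_L2I)

lemma L2I_phi1: "phi1 m \<in> L2I" using orthonormal_phi1 by (rule orthonormal_L2I)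

lemmas L2I_modes = L2I_psi1_snd L2I_phi2 L2I_ecos L2I_phi1

text \<open>Minus the off-diagonal entry of the Jordan block containing the mode
  \<open>n\<close>.\<close>

definition jordan_coupling :: "real \<Rightarrow> real \<Rightarrow> real \<Rightarrow> nat \<Rightarrow> real" where
  "jordan_coupling a b s n = (if n \<in> Delta1 a b then sqrt 2 * s * mu (partner2 a b n) else 0)"

text \<open>\<^const>\<open>psi1\<close> consists of generalized eigenvectors of the adjoint
  operator. Applied to both components, the formula of Green leaves the boundary terms
  \<open>- sqrt 2 * s * g 0\<close> and \<open>sqrt 2 * s * g 0\<close>; the first one comes from
  the coupling \<open>f' 0 = s * g 0\<close>, the second one from the slope of the dual function
  at \<open>0\<close>.\<close>

lemma ip_psi1_opA:
  assumes f: "has_L2_deriv2 f f' f''" and g: "has_L2_deriv2 g g' g''"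
    and bc: "f 1 = 0" "g' 0 = 0" "g' 1 = 0" "f' 0 = s * g 0"
  shows "ip (\<lambda>x. f'' x + a * f x) (phi1 n) + ip (\<lambda>x. g'' x + b * g x) (psi1_snd a b s n) =
     lam1 a n * (ip f (phi1 n) + ip g (psi1_snd a b s n)) - jordan_coupling a b s n * ip g (ecos (partner2 a b n))"
proof -
  obtain p' p'' where p: "\<And>x. (psi1_snd a b s n has_real_derivative p' x) (at x)"
    "\<And>x. (p' has_real_derivative p'' x) (at x)"
    "\<And>x. p'' x = (lam1 a n - b) * psi1_snd a b s n x -
        (if n \<in> Delta1 a b then sqrt 2 * s * mu (partner2 a b n) * ecos (partner2 a b n) x else 0)"
    "p' 1 = 0" "p' 0 = sqrt 2 * s"
    using psi1_snd_boundary_problem[of a b s n] by blast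
  have L: "f \<in> L2I" "g \<in> L2I" "f'' \<in> L2I" "g'' \<in> L2I"
    using f g unfolding has_L2_deriv2_def by (auto intro: has_L2_deriv_L2I has_L2_derivD_L2I)
  have p3: "p'' x = (lam1 a n - b) * psi1_snd a b s n x - jordan_coupling a b s n * ecos (partner2 a b n) x" for x
    by (simp add: p(3) jordan_coupling_def)
  have c: "continuous_on {0..1} p''" "continuous_on {0..1} (\<lambda>x. (lam1 a n - a) * phi1 n x)"
    unfolding p3 by (intro continuous_intros L2I_differentiable(2)[OF p(1)]
      L2I_differentiable(2)[OF ecos_boundary_problem(1)] L2I_differentiable(2)[OF phi1_boundary_problem(1)])+
  have "ip f'' (phi1 n) = - sqrt 2 * (s * g 0) + (lam1 a n - a) * ip f (phi1 n)"
    using Green_formula[OF f c(2) DERIV_subset[OF phi1_boundary_problem(1)] DERIV_subset[OF phi1_boundary_problem(2)]]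
    by (simp add: bc phi1_boundary_problem(3,4) ip_scale_right)
  moreover have "ip g'' (psi1_snd a b s n) = sqrt 2 * s * g 0 + ip g p''"
    using Green_formula[OF g c(1) DERIV_subset[OF p(1)] DERIV_subset[OF p(2)]] by (simp add: bc p(4,5))
  moreover have "ip g p'' = (lam1 a n - b) * ip g (psi1_snd a b s n) - jordan_coupling a b s n * ip g (ecos (partner2 a b n))"
    unfolding p3 using L by (simp add: ip_diff_right ip_scale_right L2I_scale L2I_modes)
  moreover have "ip (\<lambda>x. f'' x + a * f x) (phi1 n) = ip f'' (phi1 n) + a * ip f (phi1 n)"
    using L by (simp add: ip_add_left ip_scale_left L2I_scale L2I_modes)
  moreover have "ip (\<lambda>x. g'' x + b * g x) (psi1_snd a b s n) = ip g'' (psi1_snd a b s n) + b * ip g (psi1_snd a b s n)"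
    using L by (simp add: ip_add_left ip_scale_left L2I_scale L2I_modes)
  ultimately show ?thesis by (simp add: algebra_simps)
qed

lemma ip_ecos_opA:
  assumes g: "has_L2_deriv2 g g' g''" and bc: "g' 0 = 0" "g' 1 = 0"
  shows "ip (\<lambda>x. g'' x + b * g x) (ecos m) = lam2 b m * ip g (ecos m)"
proof -
  have L: "g \<in> L2I" "g'' \<in> L2I"
    using g unfolding has_L2_deriv2_def by (auto intro: has_L2_deriv_L2I has_L2_derivD_L2I)
  have c: "continuous_on {0..1} (\<lambda>x. (lam2 b m - b) * ecos m x)"
    by (intro continuous_intros L2I_differentiable(2)[OF ecos_boundary_problem(1)])
  have "ip g'' (ecos m) = (lam2 b m - b) * ip g (ecos m)"
    using Green_formula[OF g c DERIV_subset[OF ecos_boundary_problem(1)] DERIV_subset[OF ecos_boundary_problem(2)]]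
    by (simp add: bc ip_scale_right sin_npi)
  then show ?thesis
    using L by (simp add: ip_add_left ip_scale_left L2I_scale L2I_modes algebra_simps)
qed

lemma has_L2_deriv2I:
  assumes "continuous_on {0..1} f''" "\<And>x. (f has_real_derivative f' x) (at x)"
    "\<And>x. (f' has_real_derivative f'' x) (at x)"
  shows "has_L2_deriv2 f f' f''"
  unfolding has_L2_deriv2_def
  using assms by (auto intro!: has_L2_derivI L2I_differentiable(2)[OF assms(3)] intro: DERIV_subset)

text \<open>The only integral needed to evaluate the resonant pairings explicitly.\<close>

lemma ip_half_sin_cos:
  assumes "w > 0" "sin (2 * w) = 0"
  shows "ip (\<lambda>x. (1 - x) * sin (w * x)) (\<lambda>x. cos (w * x)) = 1 / (4 * w)"
proof -
  define F where "F x = - (1 - x) * cos (2 * w * x) / (4 * w) - sin (2 * w * x) / (8 * w\<^sup>2)" for x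
  have "(LINT x|I01. (1 - x) * sin (w * x) * cos (w * x)) = F 1 - F 0"
  proof (rule I01_FTC)
    show "continuous_on {0..1} (\<lambda>x. (1 - x) * sin (w * x) * cos (w * x))" by (intro continuous_intros)
    fix x :: real
    have s2: "sin (2 * w * x) = 2 * sin (w * x) * cos (w * x)" using sin_double[of "w * x"] by (simp add: mult.assoc)
    have "(F has_real_derivative (1 - x) * sin (2 * w * x) / 2) (at x within {0..1})"
      unfolding F_def using assms(1)
      by (auto intro!: derivative_eq_intros simp: field_simps power2_eq_square)
    then show "(F has_real_derivative (1 - x) * sin (w * x) * cos (w * x)) (at x within {0..1})"
      unfolding s2 by (simp add: mult.assoc)
  qed
  also have "\<dots> = 1 / (4 * w)" using assms by (simp add: F_def)
  finally show ?thesis by (simp add: ip_def)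
qed

text \<open>The generalized eigenvector with first component \<^const>\<open>phi2\<close> lies in
  the domain of the operator. Evaluating the pairing with the adjoint relation shows that it is
  annihilated by \<open>lam2 b m - lam1 a n\<close>, which is nonzero unless \<open>(n, m)\<close>
  is a resonance. At a resonance generalized eigenvectors may be shifted by eigenvectors, and the
  constants in the definition of \<^const>\<open>psi1_snd\<close> are those for which the pairing
  vanishes; this is checked by direct integration.\<close>

lemma biorthogonal:
  "ip (phi2 a b s m) (phi1 n) + ip (ecos m) (psi1_snd a b s n) = 0"
proof -
  define B where "B n = ip (phi2 a b s m) (phi1 n) + ip (ecos m) (psi1_snd a b s n)" for n
  obtain f' f'' where f: "\<And>x. (phi2 a b s m has_real_derivative f' x) (at x)"
    "\<And>x. (f' has_real_derivative f'' x) (at x)"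
    "\<And>x. f'' x = (lam2 b m - a) * phi2 a b s m x -
        (if m \<in> Delta2 a b then sqrt 2 * s * mu m * phi1 (partner1 a b m) x else 0)"
    "phi2 a b s m 1 = 0" "f' 0 = s * mu m"
    using phi2_boundary_problem[of a b s m] by blast
  define J where "J = (if m \<in> Delta2 a b then sqrt 2 * s * mu m else 0)"
  have f3: "f'' x + a * phi2 a b s m x = lam2 b m * phi2 a b s m x - J * phi1 (partner1 a b m) x" for x
    by (simp add: f(3) J_def algebra_simps)
  have c: "continuous_on {0..1} f''" "continuous_on {0..1} (\<lambda>x. (lam2 b m - b) * ecos m x)"
  proof -
    have "f'' = (\<lambda>x. (lam2 b m - a) * phi2 a b s m x - J * phi1 (partner1 a b m) x)"
      by (rule ext) (simp add: f(3) J_def)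
    then show "continuous_on {0..1} f''"
      by (simp only:) (intro continuous_intros L2I_differentiable(2)[OF f(1)] L2I_differentiable(2)[OF phi1_boundary_problem(1)])
    show "continuous_on {0..1} (\<lambda>x. (lam2 b m - b) * ecos m x)"
      by (intro continuous_intros L2I_differentiable(2)[OF ecos_boundary_problem(1)])
  qed
  have e: "(lam2 b m - b) * ecos m x + b * ecos m x = lam2 b m * ecos m x" for x by (simp add: algebra_simps)
  have d: "has_L2_deriv2 (phi2 a b s m) f' f''"
    "has_L2_deriv2 (ecos m) (\<lambda>x. - mu m * (real m * pi) * sin (real m * pi * x)) (\<lambda>x. (lam2 b m - b) * ecos m x)"
    by (intro has_L2_deriv2I c f(1,2) ecos_boundary_problem)+
  \<comment> \<open>The operator on the left factor, the adjoint on the right one. The Jordan terms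
    contribute only if the partner of one index is the other.\<close>
  have key: "lam2 b m * B n - J * (if partner1 a b m = n then 1 else 0) =
     lam1 a n * B n - jordan_coupling a b s n * (if m = partner2 a b n then 1 else 0)" for n
  proof -
    have "ip (\<lambda>x. lam2 b m * phi2 a b s m x - J * phi1 (partner1 a b m) x) (phi1 n) + ip (\<lambda>x. lam2 b m * ecos m x) (psi1_snd a b s n) =
      lam1 a n * B n - jordan_coupling a b s n * ip (ecos m) (ecos (partner2 a b n))"
      unfolding B_def using ip_psi1_opA[OF d, of s a n b] f(4,5)
      unfolding f3 e by (simp add: ecos_boundary_problem(3) sin_npi mult.commute)
    moreover have "ip (\<lambda>x. lam2 b m * phi2 a b s m x - J * phi1 (partner1 a b m) x) (phi1 n) =
      lam2 b m * ip (phi2 a b s m) (phi1 n) - J * (if partner1 a b m = n then 1 else 0)"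
      using orthonormal_phi1 by (simp add: ip_diff_left ip_scale_left L2I_scale L2I_modes orthonormal_def)
    moreover have "ip (ecos m) (ecos (partner2 a b n)) = (if m = partner2 a b n then 1 else 0)"
      using orthonormal_ecos by (simp add: orthonormal_def)
    ultimately show ?thesis by (simp add: ip_scale_left B_def algebra_simps)
  qed
  have "B n = 0"
  proof (cases "(n, m) \<in> Delta a b")
    case False
    have "jordan_coupling a b s n * (if m = partner2 a b n then 1 else 0) = 0"
      using False partner_Delta(1)[of n a b] by (auto simp: jordan_coupling_def)
    moreover have "J * (if partner1 a b m = n then 1 else 0) = 0"
      using False partner_Delta(2)[of m a b] by (auto simp: J_def)
    ultimately have "(lam2 b m - lam1 a n) * B n = 0" using key[of n] by (simp only: left_diff_distrib)
    then show ?thesis using False by (simp add: Delta_iff_lam_eq)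
  next
    case True
    define w where "w = (real n + 1/2) * pi"
    have w: "w > 0" by (simp add: w_def)
    have "2 * w = real (2 * n + 1) * pi" by (simp add: w_def algebra_simps)
    then have sw: "sin (2 * w) = 0" by (simp only: sin_npi)
    have "phi2 a b s m = (\<lambda>x. s * mu m / w * ((1 - x) * sin (w * x)))"
      using partner_eq[OF True] by (intro ext) (simp add: phi2_def Let_def w_def partner1_def[symmetric])
    moreover have "phi1 n = (\<lambda>x. sqrt 2 * cos (w * x))" by (simp add: phi1_def w_def fun_eq_iff)
    ultimately have 1: "ip (phi2 a b s m) (phi1 n) = s * mu m / w * (sqrt 2 * (1 / (4 * w)))"
      by (simp only: ip_scale_left ip_scale_right ip_half_sin_cos[OF w sw])
    have k': "(THE k. (n, k) \<in> Delta a b) = m" using partner_eq[OF True] by (simp add: partner2_def)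
    have n1: "n \<in> Delta1 a b" using partner_eq[OF True] by simp
    have w2: "w\<^sup>2 = (2 * real n + 1)\<^sup>2 * pi\<^sup>2 / 4" by (simp add: w_def power2_eq_square algebra_simps)
    show ?thesis
    proof (cases "m = 0")
      case m0: True
      define c0 where "c0 = - s * sqrt 2 * (1/3 + 1 / ((2 * real n + 1)\<^sup>2 * pi\<^sup>2))"
      have "ip (ecos m) (psi1_snd a b s n) = (LINT x|I01. c0 + sqrt 2 * s * x - sqrt 2 / 2 * s * x\<^sup>2)"
        unfolding ip_def using n1 m0 by (simp add: psi1_snd_def k' c0_def ecos_def mu_def)
      also have "\<dots> = (\<lambda>x. c0 * x + sqrt 2 * s * x\<^sup>2 / 2 - sqrt 2 / 6 * s * x ^ 3) 1 -
          (\<lambda>x. c0 * x + sqrt 2 * s * x\<^sup>2 / 2 - sqrt 2 / 6 * s * x ^ 3) 0"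
        by (rule I01_FTC) (auto intro!: continuous_intros derivative_eq_intros simp: field_simps power2_eq_square)
      finally have 2: "ip (ecos m) (psi1_snd a b s n) = - s * sqrt 2 / ((2 * real n + 1)\<^sup>2 * pi\<^sup>2)"
        by (simp add: c0_def algebra_simps)
      have "ip (phi2 a b s m) (phi1 n) = s * sqrt 2 / (4 * w\<^sup>2)"
        using 1 m0 by (simp add: mu_def power2_eq_square)
      then show ?thesis unfolding B_def 2 w2 by simp
    next
      case m0: False
      define c where "c = - 2 * s / pi\<^sup>2 * (1 / (2 * real n + 1)\<^sup>2 + 1 / (4 * (real m)\<^sup>2))"
      define v where "v = real m * pi"
      have v: "v > 0" using m0 by (simp add: v_def)
      have "2 * v = real (2 * m) * pi" by (simp add: v_def)
      then have sv: "sin (2 * v) = 0" by (simp only: sin_npi)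
      have em: "ecos m = (\<lambda>x. sqrt 2 * cos (v * x))" using m0 by (simp add: ecos_def mu_def v_def fun_eq_iff)
      have ps: "psi1_snd a b s n = (\<lambda>x. sqrt 2 * s / v * ((1 - x) * sin (v * x)) + c * ecos m x)"
        using n1 m0 by (intro ext) (simp add: psi1_snd_def k' c_def em v_def)
      have Lq: "(\<lambda>x. sqrt 2 * s / v * ((1 - x) * sin (v * x))) \<in> L2I"
        by (intro L2I_continuous continuous_intros)
      have "ip (ecos m) (psi1_snd a b s n) = ip (ecos m) (\<lambda>x. sqrt 2 * s / v * ((1 - x) * sin (v * x))) + c * nsq (ecos m)"
        unfolding ps using Lq by (simp add: ip_add_right L2I_scale L2I_modes ip_scale_right)
      also have "nsq (ecos m) = 1" using orthonormal_ecos by (simp add: orthonormal_def)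
      also have "ip (ecos m) (\<lambda>x. sqrt 2 * s / v * ((1 - x) * sin (v * x))) = sqrt 2 * s / v * (sqrt 2 * (1 / (4 * v)))"
        by (subst ip_commute) (simp only: em ip_scale_left ip_scale_right ip_half_sin_cos[OF v sv])
      also have "\<dots> = s / (2 * (real m)\<^sup>2 * pi\<^sup>2)"
        using real_sqrt_mult_self[of 2] by (simp add: v_def power2_eq_square mult_ac)
      finally have 2: "ip (ecos m) (psi1_snd a b s n) = s / (2 * (real m)\<^sup>2 * pi\<^sup>2) + c" by simp
      have "ip (phi2 a b s m) (phi1 n) = s * 2 / (4 * w\<^sup>2)"
        using 1 m0 real_sqrt_mult_self[of 2] by (simp add: mu_def power2_eq_square mult.assoc)
      then show ?thesis unfolding B_def 2 w2 c_def by (simp add: field_simps)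
    qed
  qed
  then show ?thesis by (simp add: B_def)
qed


section \<open>Uniform bounds on the coupling functions\<close>

lemma cos_near_multiple_of_pi:
  assumes "\<bar>\<rho> - real m * pi\<bar> \<le> 1"
  shows "\<bar>cos \<rho>\<bar> \<ge> 1 / 2"
proof -
  define t where "t = \<rho> - real m * pi"
  have "\<bar>t\<bar> \<le> pi / 3" using assms pi_gt3 by (simp add: t_def)
  then have "cos (pi / 3) \<le> cos \<bar>t\<bar>" by (intro cos_monotone_0_pi_le) (use pi_gt_zero in linarith)+
  then have t: "1 / 2 \<le> cos t" by (simp add: cos_60)
  have "cos \<rho> = cos (t + real m * pi)" by (simp add: t_def)
  also have "\<dots> = cos t * (- 1) ^ m" by (simp add: cos_add sin_npi cos_npi)
  finally show ?thesis using t by (simp add: abs_mult power_abs)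
qed

text \<open>For large \<open>m\<close> the root \<open>r\<^sub>m\<close> is
  \<open>\<i> * \<rho>\<close> with \<open>\<rho>\<close> close to \<open>m * pi\<close>. Hence
  \<open>phi2\<close> is a sine of frequency \<open>\<rho>\<close> with amplitude
  \<open>s * mu m / (\<rho> * \<bar>cos \<rho>\<bar>)\<close>, where
  \<open>\<bar>cos \<rho>\<bar> \<ge> 1/2\<close> stays away from zero.\<close>

lemma phi2_asymptotics:
  assumes m: "m \<ge> 1" "real m \<ge> \<bar>b - a\<bar>" "m \<notin> Delta2 a b" and x: "x \<in> {0..1}"
  shows "\<bar>phi2 a b s m x\<bar> \<le> 4 * \<bar>s\<bar> / (real m + 1)" and "\<bar>deriv (phi2 a b s m) x\<bar> \<le> 4 * \<bar>s\<bar>"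
proof -
  define d where "d = b - a"
  have m1: "real m \<ge> 1" using m(1) by simp
  have mp: "real m * 3 \<le> real m * pi" using pi_gt3 by (intro mult_left_mono) auto
  have mp1: "1 * (real m * pi) \<le> (real m * pi) * (real m * pi)"
    using mp m1 by (intro mult_right_mono) linarith+
  have dm: "\<bar>d\<bar> < real m * pi" using m(2) m1 mp unfolding d_def by linarith
  have dlt: "d < (real m * pi)\<^sup>2" using dm mp1 unfolding power2_eq_square by linarith
  define \<rho> where "\<rho> = sqrt ((real m * pi)\<^sup>2 - d)"
  have r2: "\<rho>\<^sup>2 = (real m * pi)\<^sup>2 - d" using dlt by (simp add: \<rho>_def)
  have rpos: "\<rho> > 0" using dlt by (simp add: \<rho>_def)
  have diff: "\<bar>\<rho> - real m * pi\<bar> \<le> 1"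
  proof -
    have "(\<rho> - real m * pi) * (\<rho> + real m * pi) = - d" using r2 by (simp add: power2_eq_square algebra_simps)
    then have "\<bar>\<rho> - real m * pi\<bar> * (\<rho> + real m * pi) = \<bar>d\<bar>"
      using rpos mp by (metis abs_minus_cancel abs_mult abs_of_pos add_pos_nonneg mult_nonneg_nonneg of_nat_0_le_iff pi_ge_zero)
    moreover have "\<bar>d\<bar> \<le> \<rho> + real m * pi" using dm rpos by simp
    ultimately have "\<bar>\<rho> - real m * pi\<bar> * (\<rho> + real m * pi) \<le> 1 * (\<rho> + real m * pi)" by simp
    moreover have "\<rho> + real m * pi > 0" using rpos mp m1 by linarith
    ultimately show ?thesis by (rule mult_right_le_imp_le)
  qed
  then have c: "\<bar>cos \<rho>\<bar> \<ge> 1 / 2" by (rule cos_near_multiple_of_pi)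
  then have c0: "cos \<rho> \<noteq> 0" by auto
  have rm: "\<rho> \<ge> real m + 1" using diff mp m1 by linarith
  define r where "r = csqrt (complex_of_real (b - a - (real m)\<^sup>2 * pi\<^sup>2))"
  have arg: "b - a - (real m)\<^sup>2 * pi\<^sup>2 = - (\<rho>\<^sup>2)" by (simp add: r2 d_def power_mult_distrib)
  have "r = \<i> * complex_of_real \<rho>"
    unfolding r_def arg using rpos by simp
  then have rr: "r = \<i> * complex_of_real \<rho>" .
  have ch: "cosh r = complex_of_real (cos \<rho>)"
    by (simp add: rr cosh_conv_cos cos_of_real mult.assoc[symmetric])
  have sh: "sinh (r * complex_of_real y) = \<i> * complex_of_real (sin (\<rho> * y))" for y
  proof -
    have "\<i> * (r * complex_of_real y) = - complex_of_real (\<rho> * y)" by (simp add: rr mult.assoc[symmetric])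
    then show ?thesis by (simp only: sinh_conv_sin sin_minus sin_of_real) simp
  qed
  define q where "q = - (s * mu m / (\<rho> * cos \<rho>))"
  have "b - a \<noteq> (real m)\<^sup>2 * pi\<^sup>2" using arg rpos by auto
  then have f: "phi2 a b s m = (\<lambda>x. q * sin (\<rho> * (1 - x)))"
  proof (intro ext)
    fix x
    assume n0: "b - a \<noteq> (real m)\<^sup>2 * pi\<^sup>2"
    have "phi2 a b s m x = Re (- (complex_of_real (s * mu m) / (r * cosh r)) * sinh (r * complex_of_real (1 - x)))"
      using m(3) n0 by (simp only: phi2_def Let_def r_def if_False)
    also have "- (complex_of_real (s * mu m) / (r * cosh r)) * sinh (r * complex_of_real (1 - x)) =
      complex_of_real (q * sin (\<rho> * (1 - x)))"
      unfolding sh ch unfolding rr q_def using rpos c0 by (simp add: field_simps)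
    finally show "phi2 a b s m x = q * sin (\<rho> * (1 - x))" by simp
  qed
  have d': "deriv (phi2 a b s m) x = - q * \<rho> * cos (\<rho> * (1 - x))"
    unfolding f by (rule DERIV_imp_deriv) (auto intro!: derivative_eq_intros)
  have q: "\<bar>q\<bar> * \<rho> \<le> 4 * \<bar>s\<bar>"
  proof -
    have "\<bar>q\<bar> * \<rho> = \<bar>s\<bar> * mu m / \<bar>cos \<rho>\<bar>" using rpos mu_pos[of m] by (simp add: q_def abs_mult field_simps)
    also have "\<dots> \<le> \<bar>s\<bar> * 2 / (1 / 2)"
    proof (intro frac_le mult_mono c)
      show "mu m \<le> 2" using mu_le[of m] sqrt2_less_2 by linarith
    qed (use mu_pos[of m] in auto)
    finally show ?thesis by simp
  qed
  have "\<bar>deriv (phi2 a b s m) x\<bar> = (\<bar>q\<bar> * \<rho>) * \<bar>cos (\<rho> * (1 - x))\<bar>"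
    unfolding d' using rpos by (simp add: abs_mult)
  also have "\<dots> \<le> (4 * \<bar>s\<bar>) * 1" using rpos by (intro mult_mono q) auto
  finally show "\<bar>deriv (phi2 a b s m) x\<bar> \<le> 4 * \<bar>s\<bar>" by simp
  have "\<bar>phi2 a b s m x\<bar> = \<bar>q\<bar> * \<bar>sin (\<rho> * (1 - x))\<bar>" by (simp add: f abs_mult)
  also have "\<dots> \<le> \<bar>q\<bar> * 1" by (intro mult_left_mono) auto
  also have "\<dots> \<le> 4 * \<bar>s\<bar> / \<rho>" using q rpos by (simp add: field_simps)
  also have "\<dots> \<le> 4 * \<bar>s\<bar> / (real m + 1)" using rm by (intro divide_left_mono) auto
  finally show "\<bar>phi2 a b s m x\<bar> \<le> 4 * \<bar>s\<bar> / (real m + 1)" .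
qed

lemma phi2_deriv:
  "(phi2 a b s m has_real_derivative deriv (phi2 a b s m) x) (at x)"
  "continuous_on A (deriv (phi2 a b s m))" "phi2 a b s m 1 = 0"
proof -
  obtain f' f'' where f: "\<And>x. (phi2 a b s m has_real_derivative f' x) (at x)"
    "\<And>x. (f' has_real_derivative f'' x) (at x)" "phi2 a b s m 1 = 0"
    using phi2_boundary_problem[of a b s m] by metis
  have "deriv (phi2 a b s m) = f'" using f(1) by (intro ext DERIV_imp_deriv)
  then show "(phi2 a b s m has_real_derivative deriv (phi2 a b s m) x) (at x)"
    "continuous_on A (deriv (phi2 a b s m))" "phi2 a b s m 1 = 0"
    using f L2I_differentiable(2)[OF f(2)] by auto
qed

text \<open>The asymptotic bounds leave out finitely many indices, each of which is handled by
  compactness of the interval.\<close>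

lemma phi2_bounds:
  obtains C where "C > 0" "\<And>m x. x \<in> {0..1} \<Longrightarrow> \<bar>phi2 a b s m x\<bar> \<le> C / (real m + 1)"
    "\<And>m x. x \<in> {0..1} \<Longrightarrow> \<bar>deriv (phi2 a b s m) x\<bar> \<le> C"
proof -
  have "\<exists>B. \<forall>x\<in>{0..1}. \<bar>phi2 a b s m x\<bar> \<le> B \<and> \<bar>deriv (phi2 a b s m) x\<bar> \<le> B" for m
  proof -
    have "compact ((\<lambda>x. \<bar>phi2 a b s m x\<bar> + \<bar>deriv (phi2 a b s m) x\<bar>) ` {0..1})"
      by (intro compact_continuous_image continuous_intros phi2_deriv(2) L2I_differentiable(2)[OF phi2_deriv(1)]) auto
    then obtain B where "\<forall>x\<in>{0..1}. \<bar>\<bar>phi2 a b s m x\<bar> + \<bar>deriv (phi2 a b s m) x\<bar>\<bar> \<le> B"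
      by (auto dest!: compact_imp_bounded simp: bounded_iff)
    then show ?thesis by (intro exI[of _ B]) fastforce
  qed
  then obtain B where B: "\<And>m x. x \<in> {0..1} \<Longrightarrow> \<bar>phi2 a b s m x\<bar> \<le> B m \<and> \<bar>deriv (phi2 a b s m) x\<bar> \<le> B m"
    by metis
  define S where "S = {m. m < 1 \<or> real m < \<bar>b - a\<bar> \<or> m \<in> Delta2 a b}"
  have "S \<subseteq> {..nat \<lceil>\<bar>b - a\<bar>\<rceil>} \<union> Delta2 a b"
    unfolding S_def by (auto simp: nat_le_iff) linarith
  then have fin: "finite S" by (rule finite_subset) (simp add: finite_Delta12)
  define C where "C = 4 * \<bar>s\<bar> + (\<Sum>m\<in>S. (real m + 1) * \<bar>B m\<bar>) + 1"
  have nn: "0 \<le> (\<Sum>m\<in>S. (real m + 1) * \<bar>B m\<bar>)" by (intro sum_nonneg) auto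
  have le: "(real m + 1) * \<bar>B m\<bar> \<le> C" if "m \<in> S" for m
    using member_le_sum[OF that, of "\<lambda>m. (real m + 1) * \<bar>B m\<bar>"] fin by (simp add: C_def)
  have C4: "4 * \<bar>s\<bar> \<le> C" using nn by (simp add: C_def)
  show ?thesis
  proof (rule that[of C])
    show "C > 0" using nn by (simp add: C_def)
    fix m :: nat and x :: real assume x: "x \<in> {0..1}"
    show "\<bar>phi2 a b s m x\<bar> \<le> C / (real m + 1)"
    proof (cases "m \<in> S")
      case True
      have "\<bar>phi2 a b s m x\<bar> \<le> \<bar>B m\<bar>" using B[OF x, of m] by linarith
      then have "(real m + 1) * \<bar>phi2 a b s m x\<bar> \<le> (real m + 1) * \<bar>B m\<bar>" by (intro mult_left_mono) auto
      then show ?thesis using le[OF True] by (simp add: field_simps)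
    next
      case False
      have "\<bar>phi2 a b s m x\<bar> \<le> 4 * \<bar>s\<bar> / (real m + 1)"
        using False x by (intro phi2_asymptotics) (auto simp: S_def)
      also have "\<dots> \<le> C / (real m + 1)" using C4 by (intro divide_right_mono) auto
      finally show ?thesis .
    qed
    show "\<bar>deriv (phi2 a b s m) x\<bar> \<le> C"
    proof (cases "m \<in> S")
      case True
      have "\<bar>deriv (phi2 a b s m) x\<bar> \<le> 1 * \<bar>B m\<bar>" using B[OF x, of m] by linarith
      also have "\<dots> \<le> (real m + 1) * \<bar>B m\<bar>" by (intro mult_right_mono) auto
      finally show ?thesis using le[OF True] by simp
    next
      case False
      have "\<bar>deriv (phi2 a b s m) x\<bar> \<le> 4 * \<bar>s\<bar>"
        using False x by (intro phi2_asymptotics) (auto simp: S_def)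
      then show ?thesis using C4 by simp
    qed
  qed
qed


section \<open>Series of functions\<close>

lemma summable_mult_l2:
  fixes a b :: "nat \<Rightarrow> real"
  assumes a: "summable (\<lambda>n. (a n)\<^sup>2)" and b: "summable (\<lambda>n. (b n)\<^sup>2)"
  shows "summable (\<lambda>n. \<bar>a n * b n\<bar>)"
    and "(\<Sum>n. \<bar>a n * b n\<bar>) \<le> sqrt (\<Sum>n. (a n)\<^sup>2) * sqrt (\<Sum>n. (b n)\<^sup>2)"
proof -
  have bound: "(\<Sum>i<n. \<bar>a i * b i\<bar>) \<le> sqrt (\<Sum>n. (a n)\<^sup>2) * sqrt (\<Sum>n. (b n)\<^sup>2)" for n
  proof -
    have "(\<Sum>i<n. \<bar>a i * b i\<bar>) \<le> L2_set a {..<n} * L2_set b {..<n}"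
      unfolding abs_mult by (rule L2_set_mult_ineq)
    also have "\<dots> \<le> sqrt (\<Sum>n. (a n)\<^sup>2) * sqrt (\<Sum>n. (b n)\<^sup>2)"
      unfolding L2_set_def using a b
      by (intro mult_mono real_sqrt_le_mono sum_le_suminf) (auto intro: sum_nonneg suminf_nonneg)
    finally show ?thesis .
  qed
  show s: "summable (\<lambda>n. \<bar>a n * b n\<bar>)"
    by (rule summableI_nonneg_bounded[OF _ bound]) auto
  show "(\<Sum>n. \<bar>a n * b n\<bar>) \<le> sqrt (\<Sum>n. (a n)\<^sup>2) * sqrt (\<Sum>n. (b n)\<^sup>2)"
    by (rule suminf_le_const[OF s bound])
qed

lemma summable_inverse_Suc_square: "summable (\<lambda>n. (1 / (real n + 1))\<^sup>2)"
  using summable_Suc_iff[of "\<lambda>n. inverse (real n ^ 2)"] inverse_power_summable[of 2, where 'a=real]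
  by (simp add: inverse_eq_divide power_divide add.commute)

definition harmonic_l2_norm :: real where "harmonic_l2_norm = sqrt (\<Sum>n. (1 / (real n + 1))\<^sup>2)"

text \<open>One power of \<open>n + 1\<close> in \<open>\<ell>\<^sup>2\<close> suffices for
  absolute convergence; this decides how much regularity is needed to differentiate a modal
  series.\<close>

lemma weighted_l2_imp_l1:
  assumes "summable (\<lambda>n. ((real n + 1) * a n)\<^sup>2)"
  shows "summable (\<lambda>n. \<bar>a n\<bar>)" "(\<Sum>n. \<bar>a n\<bar>) \<le> sqrt (\<Sum>n. ((real n + 1) * a n)\<^sup>2) * harmonic_l2_norm"
proof -
  have "(real n + 1) * a n * (1 / (real n + 1)) = a n" for n by simp
  then show "summable (\<lambda>n. \<bar>a n\<bar>)" "(\<Sum>n. \<bar>a n\<bar>) \<le> sqrt (\<Sum>n. ((real n + 1) * a n)\<^sup>2) * harmonic_l2_norm"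
    using summable_mult_l2[OF assms summable_inverse_Suc_square] unfolding harmonic_l2_norm_def by simp_all
qed

lemma
  assumes U: "\<And>m. continuous_on {0..1} (U m)" and M: "summable M"
    and le: "\<And>m x. x \<in> {0..1} \<Longrightarrow> \<bar>U m x\<bar> \<le> M m"
  shows continuous_on_uniform_series: "continuous_on {0..1} (\<lambda>x. \<Sum>m. U m x :: real)"
    and uniform_series_bound: "x \<in> {0..1} \<Longrightarrow> \<bar>\<Sum>m. U m x\<bar> \<le> (\<Sum>m. M m)"
    and ip_uniform_series: "h \<in> L2I \<Longrightarrow> (\<lambda>m. ip h (U m)) sums ip h (\<lambda>x. \<Sum>m. U m x)"
    and summable_uniform_series: "x \<in> {0..1} \<Longrightarrow> summable (\<lambda>m. U m x)"
proof -
  have ul: "uniform_limit {0..1} (\<lambda>n x. \<Sum>i<n. U i x) (\<lambda>x. \<Sum>i. U i x) sequentially"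
    using le M by (intro Weierstrass_m_test) auto
  show c: "continuous_on {0..1} (\<lambda>x. \<Sum>m. U m x)"
    using U by (intro uniform_limit_theorem[OF _ ul] always_eventually allI continuous_on_sum) auto
  show s: "summable (\<lambda>m. U m x)" if "x \<in> {0..1}" for x
    using le[OF that] by (intro summable_comparison_test'[OF M]) auto
  show "\<bar>\<Sum>m. U m x\<bar> \<le> (\<Sum>m. M m)" if "x \<in> {0..1}" for x
  proof -
    have a: "summable (\<lambda>m. \<bar>U m x\<bar>)"
      using le[OF that] by (intro summable_comparison_test'[OF M]) auto
    have "\<bar>\<Sum>m. U m x\<bar> \<le> (\<Sum>m. \<bar>U m x\<bar>)" by (rule summable_rabs[OF a])
    also have "\<dots> \<le> (\<Sum>m. M m)" by (intro suminf_le le that a M)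
    finally show ?thesis .
  qed
  assume h: "h \<in> L2I"
  have LU: "U m \<in> L2I" for m using U by (rule L2I_continuous)
  show "(\<lambda>m. ip h (U m)) sums ip h (\<lambda>x. \<Sum>m. U m x)"
    unfolding sums_def
  proof (rule LIMSEQ_I)
    fix e :: real assume "0 < e"
    define \<epsilon> where "\<epsilon> = e / (sqrt (nsq h) + 1)"
    have np: "sqrt (nsq h) \<ge> 0" by (simp add: nsq_nonneg)
    have ep: "\<epsilon> > 0" using \<open>0 < e\<close> np by (simp add: \<epsilon>_def add_nonneg_pos)
    from ul ep have "\<forall>\<^sub>F n in sequentially. \<forall>x\<in>{0..1}. dist (\<Sum>i<n. U i x) (\<Sum>i. U i x) < \<epsilon>"
      by (rule uniform_limitD)
    then obtain N where N: "\<And>n x. n \<ge> N \<Longrightarrow> x \<in> {0..1} \<Longrightarrow> \<bar>(\<Sum>i<n. U i x) - (\<Sum>i. U i x)\<bar> < \<epsilon>"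
      unfolding eventually_sequentially dist_real_def by blast
    show "\<exists>N. \<forall>n\<ge>N. norm ((\<Sum>m<n. ip h (U m)) - ip h (\<lambda>x. \<Sum>m. U m x)) < e"
    proof (intro exI allI impI)
      fix n assume "n \<ge> N"
      have L: "(\<lambda>x. \<Sum>i<n. U i x) \<in> L2I" "(\<lambda>x. \<Sum>i. U i x) \<in> L2I"
        by (intro L2I_sum LU L2I_continuous c)+
      have "nsq (\<lambda>x. (\<Sum>i<n. U i x) - (\<Sum>i. U i x)) \<le> \<epsilon>\<^sup>2"
        using N[OF \<open>n \<ge> N\<close>] by (intro nsq_le_bound L2I_diff L) (simp add: less_imp_le)
      then have sq: "sqrt (nsq (\<lambda>x. (\<Sum>i<n. U i x) - (\<Sum>i. U i x))) \<le> \<epsilon>"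
        using ep by (intro real_le_lsqrt) (auto simp: nsq_nonneg)
      have "(\<Sum>m<n. ip h (U m)) - ip h (\<lambda>x. \<Sum>m. U m x) = ip h (\<lambda>x. (\<Sum>i<n. U i x) - (\<Sum>i. U i x))"
        by (simp add: ip_diff_right[OF L h] ip_sum_right[OF h LU])
      also have "\<bar>\<dots>\<bar> \<le> sqrt (nsq h) * \<epsilon>"
        by (rule order_trans[OF abs_ip_le[OF h L2I_diff[OF L]] mult_left_mono[OF sq np]])
      also have "\<dots> < (sqrt (nsq h) + 1) * \<epsilon>" using ep by (simp add: distrib_right)
      also have "\<dots> = e"
      proof -
        have "sqrt (nsq h) + 1 \<noteq> 0" using np by linarith
        then show ?thesis by (simp add: \<epsilon>_def)
      qed
      finally show "norm ((\<Sum>m<n. ip h (U m)) - ip h (\<lambda>x. \<Sum>m. U m x)) < e" by simp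
    qed
  qed
qed

lemma has_L2_deriv_uniform_series:
  assumes d: "\<And>m x. (U m has_real_derivative U' m x) (at x)"
    and c: "\<And>m. continuous_on {0..1} (U' m)"
    and M: "summable M" "\<And>m x. x \<in> {0..1} \<Longrightarrow> \<bar>U m x\<bar> \<le> M m"
    and M': "summable M'" "\<And>m x. x \<in> {0..1} \<Longrightarrow> \<bar>U' m x\<bar> \<le> M' m"
  shows "has_L2_deriv (\<lambda>x. \<Sum>m. U m x) (\<lambda>x. \<Sum>m. U' m x)"
  unfolding has_L2_deriv_iff
proof (intro conjI ballI)
  show "(\<lambda>x. \<Sum>m. U' m x) \<in> L2I"
    by (intro L2I_continuous continuous_on_uniform_series[OF c M'])
  fix x :: real assume x: "x \<in> {0..1}"
  have "U m x - U m 0 = ip (U' m) (indicator {0<..<x})" for m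
  proof -
    have "has_L2_deriv (U m) (U' m)" by (rule has_L2_derivI[OF c DERIV_subset[OF d subset_UNIV]])
    then have "U m x = U m 0 + ip (U' m) (indicator {0<..<x})" using x unfolding has_L2_deriv_iff by blast
    then show ?thesis by simp
  qed
  then have "(\<lambda>m. U m x - U m 0) sums ip (indicator {0<..<x}) (\<lambda>x. \<Sum>m. U' m x)"
    using ip_uniform_series[OF c M' L2I_indicator[of x]] by (simp add: ip_commute)
  moreover have "(\<lambda>m. U m x - U m 0) sums ((\<Sum>m. U m x) - (\<Sum>m. U m 0))"
    using summable_uniform_series[OF L2I_differentiable(2)[OF d] M] x
    by (intro sums_diff summable_sums) auto
  ultimately have "(\<Sum>m. U m x) - (\<Sum>m. U m 0) = ip (indicator {0<..<x}) (\<lambda>x. \<Sum>m. U' m x)"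
    by (rule sums_unique2[symmetric])
  then show "(\<Sum>m. U m x) = (\<Sum>m. U m 0) + ip (\<lambda>x. \<Sum>m. U' m x) (indicator {0<..<x})"
    by (simp add: ip_commute)
qed

text \<open>The squared norms \<open>w\<close> may vanish: differentiating the cosine series
  yields a sine system whose member with index \<open>0\<close> is zero.\<close>

lemma nsq_orthogonal_series:
  assumes e: "\<And>m. continuous_on {0..1} (e m)" "\<And>m x. \<bar>e m x\<bar> \<le> B"
    and o: "\<And>i j. ip (e i) (e j) = (if i = j then w j else 0)"
    and a: "summable (\<lambda>m. \<bar>a m\<bar>)"
  shows "(\<lambda>m. (a m)\<^sup>2 * w m) sums nsq (\<lambda>x. \<Sum>m. a m * e m x)"
    and "ip (\<lambda>x. \<Sum>m. a m * e m x) (e k) = a k * w k"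
proof -
  have c: "continuous_on {0..1} (\<lambda>x. a m * e m x)" for m by (intro continuous_intros e)
  have M: "summable (\<lambda>m. \<bar>a m\<bar> * B)" using a by (rule summable_mult2)
  have le: "\<bar>a m * e m x\<bar> \<le> \<bar>a m\<bar> * B" for m x unfolding abs_mult by (intro mult_left_mono e) auto
  note s = ip_uniform_series[OF c M le]
  have L: "(\<lambda>x. \<Sum>m. a m * e m x) \<in> L2I"
    by (intro L2I_continuous continuous_on_uniform_series[OF c M le])
  show k: "ip (\<lambda>x. \<Sum>m. a m * e m x) (e k) = a k * w k" for k
  proof -
    have "(\<lambda>m. a m * (if k = m then w m else 0)) sums ip (e k) (\<lambda>x. \<Sum>m. a m * e m x)"
      using s[OF L2I_continuous[OF e(1)[of k]]] by (simp add: ip_scale_right o)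
    moreover have "(\<lambda>m. a m * (if k = m then w m else 0)) sums (a k * w k)"
      using sums_single[of k "\<lambda>m. a m * w m"] by (simp add: if_distrib eq_commute[of k] cong: if_cong)
    ultimately show ?thesis by (simp add: ip_commute sums_unique2)
  qed
  show "(\<lambda>m. (a m)\<^sup>2 * w m) sums nsq (\<lambda>x. \<Sum>m. a m * e m x)"
    using s[OF L] by (simp add: ip_scale_right k power2_eq_square mult.assoc)
qed

section \<open>Modal coordinates\<close>

text \<open>The pairing with \<^const>\<open>psi1\<close>. The pairing with
  \<^const>\<open>psi2\<close> is just \<open>ip g (ecos m)\<close>.\<close>

definition mode1 :: "real \<Rightarrow> real \<Rightarrow> real \<Rightarrow> (real \<Rightarrow> real) \<Rightarrow> (real \<Rightarrow> real) \<Rightarrow> nat \<Rightarrow> real" where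
  "mode1 a b s f g n = ip f (phi1 n) + ip g (psi1_snd a b s n)"

text \<open>The first component of the expansion of the state in the generalized eigenvectors
  belonging to \<open>lam2\<close>, which have the second components
  \<open>ecos m\<close>.\<close>

definition lift :: "real \<Rightarrow> real \<Rightarrow> real \<Rightarrow> (real \<Rightarrow> real) \<Rightarrow> real \<Rightarrow> real" where
  "lift a b s g x = (\<Sum>m. ip g (ecos m) * phi2 a b s m x)"

lemma nsq_ecos_sums: "g \<in> L2I \<Longrightarrow> (\<lambda>m. (ip g (ecos m))\<^sup>2) sums nsq g"
  by (rule Parseval_nsq[OF complete_ecos])

text \<open>The factor \<open>1 / (m + 1)\<close> in the bound on \<^const>\<open>phi2\<close>
  makes the defining series converge uniformly for square-summable coefficients, so the lift is
  bounded even from \<open>L\<^sup>2\<close> to the continuous functions.\<close>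

lemma
  assumes C: "\<And>m x. x \<in> {0..1} \<Longrightarrow> \<bar>phi2 a b s m x\<bar> \<le> C / (real m + 1)" "C > 0"
    and g: "g \<in> L2I"
  shows L2I_lift: "lift a b s g \<in> L2I"
    and nsq_lift: "nsq (lift a b s g) \<le> (C * harmonic_l2_norm)\<^sup>2 * nsq g"
    and ip_lift: "h \<in> L2I \<Longrightarrow> (\<lambda>m. ip h (phi2 a b s m) * ip g (ecos m)) sums ip h (lift a b s g)"
proof -
  define U where "U m x = ip g (ecos m) * phi2 a b s m x" for m x
  define M where "M m = \<bar>ip g (ecos m) * (1 / (real m + 1))\<bar> * C" for m
  have c: "continuous_on {0..1} (U m)" for m
    unfolding U_def by (intro continuous_intros L2I_differentiable(2)[OF phi2_deriv(1)])
  have M: "summable M"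
    unfolding M_def using summable_mult_l2[OF sums_summable[OF nsq_ecos_sums[OF g]] summable_inverse_Suc_square]
    by (intro summable_mult2)
  have le: "\<bar>U m x\<bar> \<le> M m" if "x \<in> {0..1}" for m x
    using mult_left_mono[OF C(1)[OF that, of m], of "\<bar>ip g (ecos m)\<bar>"] by (simp add: U_def M_def abs_mult)
  have eq: "lift a b s g = (\<lambda>x. \<Sum>m. U m x)" by (simp add: fun_eq_iff lift_def U_def)
  show L: "lift a b s g \<in> L2I"
    unfolding eq by (intro L2I_continuous continuous_on_uniform_series[OF c M le])
  note l2 = summable_mult_l2[OF sums_summable[OF nsq_ecos_sums[OF g]] summable_inverse_Suc_square]
  have "(\<Sum>m. M m) = (\<Sum>m. \<bar>ip g (ecos m) * (1 / (real m + 1))\<bar>) * C"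
    unfolding M_def by (rule suminf_mult2[OF l2(1), symmetric])
  also have "\<dots> \<le> (sqrt (nsq g) * harmonic_l2_norm) * C"
    using l2(2) C(2) unfolding harmonic_l2_norm_def sums_unique[OF nsq_ecos_sums[OF g], symmetric]
    by (intro mult_right_mono) auto
  finally have "(\<Sum>m. M m) \<le> (sqrt (nsq g) * harmonic_l2_norm) * C" .
  then have "\<bar>lift a b s g x\<bar> \<le> sqrt (nsq g) * harmonic_l2_norm * C" if "x \<in> {0..1}" for x
    using uniform_series_bound[OF c M le that] by (simp add: eq)
  then have "nsq (lift a b s g) \<le> (sqrt (nsq g) * harmonic_l2_norm * C)\<^sup>2"
    by (intro nsq_le_bound L) simp
  then show "nsq (lift a b s g) \<le> (C * harmonic_l2_norm)\<^sup>2 * nsq g"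
    by (simp add: power_mult_distrib nsq_nonneg mult_ac)
  assume "h \<in> L2I"
  then show "(\<lambda>m. ip h (phi2 a b s m) * ip g (ecos m)) sums ip h (lift a b s g)"
    using ip_uniform_series[OF c M le, of h] by (simp add: U_def[abs_def] eq ip_scale_right mult.commute)
qed

text \<open>The central identity of the modal analysis: subtracting the lift turns the pairing
  with the nonorthogonal functions \<^const>\<open>psi1\<close> into Fourier coefficients for the
  orthonormal basis \<^const>\<open>phi1\<close>. By biorthogonality the \<open>n\<close>-th
  coefficient of the lift is minus the pairing of \<open>g\<close> with the second component of
  \<^const>\<open>psi1\<close>.\<close>

lemma ip_diff_lift:
  assumes f: "f \<in> L2I" and g: "g \<in> L2I"
  shows "lift a b s g \<in> L2I" "ip (\<lambda>x. f x - lift a b s g x) (phi1 n) = mode1 a b s f g n"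
proof -
  obtain C where C: "C > 0" "\<And>m x. x \<in> {0..1} \<Longrightarrow> \<bar>phi2 a b s m x\<bar> \<le> C / (real m + 1)"
    using phi2_bounds[of a b s] by metis
  show L: "lift a b s g \<in> L2I" by (rule L2I_lift[OF C(2,1) g])
  have "(\<lambda>m. ip (phi1 n) (phi2 a b s m) * ip g (ecos m)) sums ip (phi1 n) (lift a b s g)"
    by (rule ip_lift[OF C(2,1) g L2I_phi1])
  moreover have "ip (phi1 n) (phi2 a b s m) = - ip (psi1_snd a b s n) (ecos m)" for m
    using biorthogonal[of a b s m n] by (simp add: ip_commute)
  moreover have "(\<lambda>m. - (ip (psi1_snd a b s n) (ecos m) * ip g (ecos m))) sums - ip (psi1_snd a b s n) g"
    by (intro sums_minus Parseval[OF complete_ecos L2I_psi1_snd g])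
  ultimately have "ip (phi1 n) (lift a b s g) = - ip (psi1_snd a b s n) g"
    by (simp add: sums_unique2)
  then show "ip (\<lambda>x. f x - lift a b s g x) (phi1 n) = mode1 a b s f g n"
    using f L by (simp add: ip_diff_left L2I_phi1 mode1_def ip_commute[of "lift a b s g"]
        ip_commute[of "psi1_snd a b s n" g])
qed

lemma mode1_sums:
  assumes "f \<in> L2I" "g \<in> L2I"
  shows "(\<lambda>n. (mode1 a b s f g n)\<^sup>2) sums nsq (\<lambda>x. f x - lift a b s g x)"
  using Parseval_nsq[OF complete_phi1 L2I_diff[OF assms(1) ip_diff_lift(1)[OF assms]]]
  by (simp add: ip_diff_lift(2)[OF assms])

text \<open>Write \<open>f\<close> as \<open>f - lift\<close>, which is expanded by Parseval, plus
  the lift, which is integrated term by term.\<close>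

lemma output_expansion:
  assumes c: "c \<in> L2I" and f: "f \<in> L2I" and g: "g \<in> L2I"
  obtains p q where "(\<lambda>n. c1 c n * mode1 a b s f g n) sums p"
    "(\<lambda>m. c2 a b s c m * ip g (ecos m)) sums q" "ip c f = p + q"
proof -
  obtain C where C: "C > 0" "\<And>m x. x \<in> {0..1} \<Longrightarrow> \<bar>phi2 a b s m x\<bar> \<le> C / (real m + 1)"
    using phi2_bounds[of a b s] by metis
  note L = ip_diff_lift(1)[OF f g, of a b s]
  have 1: "(\<lambda>n. c1 c n * mode1 a b s f g n) sums ip c (\<lambda>x. f x - lift a b s g x)"
    using Parseval[OF complete_phi1 c L2I_diff[OF f L]]
    by (simp add: ip_diff_lift(2)[OF f g]) (simp add: c1_def ip_def)
  have 2: "(\<lambda>m. c2 a b s c m * ip g (ecos m)) sums ip c (lift a b s g)"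
    using ip_lift[OF C(2,1) g c] by (simp add: c2_def ip_def)
  show ?thesis
    by (rule that[OF 1 2]) (simp add: ip_diff_right[OF f L c])
qed

lemma summable_c1: "c \<in> L2I \<Longrightarrow> summable (\<lambda>n. (c1 c n)\<^sup>2)"
  using Bessel(1)[OF orthonormal_phi1, of c] by (simp add: c1_def ip_def)

lemma summable_c2:
  assumes c: "c \<in> L2I" shows "summable (\<lambda>m. (c2 a b s c m)\<^sup>2)"
proof -
  obtain C where C: "C > 0" "\<And>m x. x \<in> {0..1} \<Longrightarrow> \<bar>phi2 a b s m x\<bar> \<le> C / (real m + 1)"
    using phi2_bounds[of a b s] by metis
  show ?thesis
  proof (rule summable_comparison_test')
    show "summable (\<lambda>m. nsq c * (C\<^sup>2 * (1 / (real m + 1))\<^sup>2))"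
      by (intro summable_mult summable_inverse_Suc_square)
    fix m :: nat
    have "(c2 a b s c m)\<^sup>2 \<le> nsq c * nsq (phi2 a b s m)"
      using Cauchy_Schwarz_ip[OF c L2I_phi2] by (simp add: c2_def ip_def)
    also have "\<dots> \<le> nsq c * (C / (real m + 1))\<^sup>2"
      by (intro mult_left_mono nsq_nonneg nsq_le_bound L2I_phi2 C) auto
    finally show "norm ((c2 a b s c m)\<^sup>2) \<le> nsq c * (C\<^sup>2 * (1 / (real m + 1))\<^sup>2)"
      by (simp add: power_divide)
  qed
qed

text \<open>The map \<open>(f, g) \<mapsto> (f - lift g, g)\<close> is a bounded triangular
  bijection with bounded inverse, and Parseval identifies the image with square-summable
  sequences.\<close>

lemma norm_equivalence_H0:
  obtains C where "C > 0"
    "\<And>f g. f \<in> L2I \<Longrightarrow> g \<in> L2I \<Longrightarrow> nsq f + nsq g \<le> C * ((\<Sum>n. (mode1 a b s f g n)\<^sup>2) + (\<Sum>m. (ip g (ecos m))\<^sup>2))"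
    "\<And>f g. f \<in> L2I \<Longrightarrow> g \<in> L2I \<Longrightarrow> (\<Sum>n. (mode1 a b s f g n)\<^sup>2) + (\<Sum>m. (ip g (ecos m))\<^sup>2) \<le> C * (nsq f + nsq g)"
proof -
  obtain C where C: "C > 0" "\<And>m x. x \<in> {0..1} \<Longrightarrow> \<bar>phi2 a b s m x\<bar> \<le> C / (real m + 1)"
    using phi2_bounds[of a b s] by metis
  define D where "D = 2 + 2 * (C * harmonic_l2_norm)\<^sup>2"
  have D: "D \<ge> 2" "D > 0" by (simp_all add: D_def add_pos_nonneg)
  have key: "nsq f + nsq g \<le> (D + 1) * (nsq (\<lambda>x. f x - lift a b s g x) + nsq g)"
    "nsq (\<lambda>x. f x - lift a b s g x) + nsq g \<le> (D + 1) * (nsq f + nsq g)"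
    if f: "f \<in> L2I" and g: "g \<in> L2I" for f g
  proof -
    note L = ip_diff_lift(1)[OF f g, of a b s]
    have l: "2 * nsq (lift a b s g) + 2 * nsq g \<le> D * nsq g"
      using nsq_lift[OF C(2,1) g] by (simp add: D_def algebra_simps)
    have "nsq (\<lambda>x. (f x - lift a b s g x) + lift a b s g x) \<le> 2 * nsq (\<lambda>x. f x - lift a b s g x) + 2 * nsq (lift a b s g)"
      by (intro nsq_add_le L2I_diff f L)
    then have "nsq f \<le> D * nsq (\<lambda>x. f x - lift a b s g x) + D * nsq g"
      using l mult_right_mono[OF D(1) nsq_nonneg[of "\<lambda>x. f x - lift a b s g x"]] nsq_nonneg[of g] by simp
    then show "nsq f + nsq g \<le> (D + 1) * (nsq (\<lambda>x. f x - lift a b s g x) + nsq g)"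
      using nsq_nonneg[of "\<lambda>x. f x - lift a b s g x"] by (simp add: algebra_simps)
    have "nsq (\<lambda>x. f x - lift a b s g x) \<le> 2 * nsq f + 2 * nsq (lift a b s g)"
      by (intro nsq_diff_le f L)
    then have "nsq (\<lambda>x. f x - lift a b s g x) \<le> D * nsq f + D * nsq g"
      using l mult_right_mono[OF D(1) nsq_nonneg[of f]] nsq_nonneg[of g] by simp
    then show "nsq (\<lambda>x. f x - lift a b s g x) + nsq g \<le> (D + 1) * (nsq f + nsq g)"
      using nsq_nonneg[of f] by (simp add: algebra_simps)
  qed
  show ?thesis
  proof (rule that[of "D + 1"])
    show "D + 1 > 0" using D by simp
    fix f g assume fg: "f \<in> L2I" "g \<in> L2I"
    have e: "(\<Sum>n. (mode1 a b s f g n)\<^sup>2) = nsq (\<lambda>x. f x - lift a b s g x)" "(\<Sum>m. (ip g (ecos m))\<^sup>2) = nsq g"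
      using sums_unique[OF mode1_sums[OF fg]] sums_unique[OF nsq_ecos_sums[OF fg(2)]] by simp_all
    show "nsq f + nsq g \<le> (D + 1) * ((\<Sum>n. (mode1 a b s f g n)\<^sup>2) + (\<Sum>m. (ip g (ecos m))\<^sup>2))"
      "(\<Sum>n. (mode1 a b s f g n)\<^sup>2) + (\<Sum>m. (ip g (ecos m))\<^sup>2) \<le> (D + 1) * (nsq f + nsq g)"
      unfolding e using key[OF fg] by simp_all
  qed
qed


section \<open>Modal coordinates and the norm of \<open>H\<^sup>1\<close>\<close>

lemma summable_weight_mono:
  assumes "summable (\<lambda>n. ((real n + 1) * a n)\<^sup>2)" shows "summable (\<lambda>n. (a n)\<^sup>2)"
    "(\<Sum>n. (a n)\<^sup>2) \<le> (\<Sum>n. ((real n + 1) * a n)\<^sup>2)"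
proof -
  have le: "(a n)\<^sup>2 \<le> ((real n + 1) * a n)\<^sup>2" for n
  proof -
    have "1 * (a n)\<^sup>2 \<le> (real n + 1)\<^sup>2 * (a n)\<^sup>2" by (intro mult_right_mono one_le_power) auto
    then show ?thesis by (simp add: power_mult_distrib)
  qed
  show s: "summable (\<lambda>n. (a n)\<^sup>2)" using le by (intro summable_comparison_test'[OF assms]) auto
  show "(\<Sum>n. (a n)\<^sup>2) \<le> (\<Sum>n. ((real n + 1) * a n)\<^sup>2)" by (intro suminf_le le s assms)
qed

text \<open>The derivatives of \<^const>\<open>phi2\<close> are merely bounded, so differentiating
  term by term needs absolutely summable coefficients, which one power of \<open>m + 1\<close>
  provides.\<close>

lemma lift_H1:
  assumes C: "\<And>m x. x \<in> {0..1} \<Longrightarrow> \<bar>phi2 a b s m x\<bar> \<le> C / (real m + 1)"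
    "\<And>m x. x \<in> {0..1} \<Longrightarrow> \<bar>deriv (phi2 a b s m) x\<bar> \<le> C" "C > 0"
    and E: "summable (\<lambda>m. ((real m + 1) * ip g (ecos m))\<^sup>2)"
  shows "has_L2_deriv (lift a b s g) (\<lambda>x. \<Sum>m. ip g (ecos m) * deriv (phi2 a b s m) x)"
    and "lift a b s g 1 = 0"
    and "nsq (\<lambda>x. \<Sum>m. ip g (ecos m) * deriv (phi2 a b s m) x) \<le> (C * harmonic_l2_norm)\<^sup>2 * (\<Sum>m. ((real m + 1) * ip g (ecos m))\<^sup>2)"
proof -
  define U where "U m x = ip g (ecos m) * phi2 a b s m x" for m x
  define U' where "U' m x = ip g (ecos m) * deriv (phi2 a b s m) x" for m x
  define M where "M m = \<bar>ip g (ecos m)\<bar> * C" for m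
  note l1 = weighted_l2_imp_l1[OF E]
  have M: "summable M" unfolding M_def by (rule summable_mult2[OF l1(1)])
  have d: "(U m has_real_derivative U' m x) (at x)" for m x
    unfolding U_def U'_def by (intro DERIV_cmult phi2_deriv(1))
  have c: "continuous_on {0..1} (U' m)" for m
    unfolding U'_def by (intro continuous_intros phi2_deriv(2))
  have le': "\<bar>U' m x\<bar> \<le> M m" if "x \<in> {0..1}" for m x
    unfolding U'_def M_def abs_mult by (intro mult_left_mono C that) auto
  have le: "\<bar>U m x\<bar> \<le> M m" if "x \<in> {0..1}" for m x
  proof -
    have "C / (real m + 1) \<le> C / 1" using C(3) by (intro divide_left_mono) auto
    then have "\<bar>phi2 a b s m x\<bar> \<le> C" using C(1)[OF that, of m] by simp
    then show ?thesis unfolding U_def M_def abs_mult by (intro mult_left_mono) auto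
  qed
  have eq: "lift a b s g = (\<lambda>x. \<Sum>m. U m x)" by (simp add: fun_eq_iff lift_def U_def)
  have h: "has_L2_deriv (lift a b s g) (\<lambda>x. \<Sum>m. U' m x)"
    unfolding eq by (rule has_L2_deriv_uniform_series[OF d c M le M le'])
  then show "has_L2_deriv (lift a b s g) (\<lambda>x. \<Sum>m. ip g (ecos m) * deriv (phi2 a b s m) x)"
    by (simp add: U'_def)
  show "lift a b s g 1 = 0" by (simp add: lift_def phi2_deriv(3))
  define E1 where "E1 = (\<Sum>m. ((real m + 1) * ip g (ecos m))\<^sup>2)"
  have E1: "E1 \<ge> 0" unfolding E1_def using E by (intro suminf_nonneg) auto
  have "(\<Sum>m. M m) = (\<Sum>m. \<bar>ip g (ecos m)\<bar>) * C" unfolding M_def by (rule suminf_mult2[OF l1(1), symmetric])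
  also have "\<dots> \<le> sqrt E1 * harmonic_l2_norm * C" using l1(2) C(3) unfolding E1_def by (intro mult_right_mono) auto
  finally have "\<bar>\<Sum>m. U' m x\<bar> \<le> sqrt E1 * harmonic_l2_norm * C" if "x \<in> {0..1}" for x
    using uniform_series_bound[OF c M le' that] by simp
  then have "nsq (\<lambda>x. \<Sum>m. U' m x) \<le> (sqrt E1 * harmonic_l2_norm * C)\<^sup>2"
    by (intro nsq_le_bound has_L2_derivD_L2I[OF h]) simp
  then show "nsq (\<lambda>x. \<Sum>m. ip g (ecos m) * deriv (phi2 a b s m) x) \<le> (C * harmonic_l2_norm)\<^sup>2 * (\<Sum>m. ((real m + 1) * ip g (ecos m))\<^sup>2)"
    using E1 unfolding E1_def[symmetric] by (simp add: U'_def power_mult_distrib mult_ac)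
qed

abbreviation H1_energy :: "real \<Rightarrow> real \<Rightarrow> real \<Rightarrow> (real \<Rightarrow> real) \<Rightarrow> (real \<Rightarrow> real) \<Rightarrow> real" where
  "H1_energy a b s f g \<equiv> (\<Sum>n. ((real n + 1) * mode1 a b s f g n)\<^sup>2) + (\<Sum>m. ((real m + 1) * ip g (ecos m))\<^sup>2)"

lemma abs_ecos_le: "\<bar>ecos m x\<bar> \<le> sqrt 2"
proof -
  have "mu m * \<bar>cos (real m * pi * x)\<bar> \<le> sqrt 2 * 1" by (intro mult_mono mu_le) (auto simp: mu_pos less_imp_le)
  then show ?thesis using mu_pos[of m] by (simp add: ecos_def abs_mult)
qed

lemma abs_phi1_le: "\<bar>phi1 n x\<bar> \<le> sqrt 2"
  unfolding phi1_def by (simp add: abs_mult mult_left_le)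

text \<open>The second power of \<open>n + 1\<close> makes the differentiated series for
  \<open>f - lift\<close> and \<open>g\<close> converge uniformly; this produces the absolutely
  continuous representatives and their derivatives. It enters only qualitatively: by orthogonality
  of the sine systems the bound itself involves a single power.\<close>

lemma H1_synthesis:
  obtains C where "C > 0"
    "\<And>f g. \<lbrakk>f \<in> L2I; g \<in> L2I; summable (\<lambda>n. ((real n + 1) * ((real n + 1) * mode1 a b s f g n))\<^sup>2);
       summable (\<lambda>m. ((real m + 1) * ((real m + 1) * ip g (ecos m)))\<^sup>2)\<rbrakk> \<Longrightarrow>
     \<exists>p p' q q'. eqI f p \<and> has_L2_deriv p p' \<and> p 1 = 0 \<and> eqI g q \<and> has_L2_deriv q q' \<and>
        nsq p' + nsq q + nsq q' \<le> C * H1_energy a b s f g"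
proof -
  obtain K where K: "K > 0" "\<And>m x. x \<in> {0..1} \<Longrightarrow> \<bar>phi2 a b s m x\<bar> \<le> K / (real m + 1)"
    "\<And>m x. x \<in> {0..1} \<Longrightarrow> \<bar>deriv (phi2 a b s m) x\<bar> \<le> K"
    using phi2_bounds[of a b s] by metis
  define C where "C = 2 * pi\<^sup>2 + 2 * (K * harmonic_l2_norm)\<^sup>2 + 1 + pi\<^sup>2"
  show ?thesis
  proof (rule that[of C])
    show "C > 0" unfolding C_def by (intro add_pos_nonneg add_nonneg_pos) auto
    fix f g assume f: "f \<in> L2I" and g: "g \<in> L2I"
      and s1: "summable (\<lambda>n. ((real n + 1) * ((real n + 1) * mode1 a b s f g n))\<^sup>2)"
      and s2: "summable (\<lambda>m. ((real m + 1) * ((real m + 1) * ip g (ecos m)))\<^sup>2)"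
    define x1 where "x1 n = mode1 a b s f g n" for n
    define x2 where "x2 m = ip g (ecos m)" for m
    define E1 where "E1 = (\<Sum>n. ((real n + 1) * x1 n)\<^sup>2)"
    define E2 where "E2 = (\<Sum>m. ((real m + 1) * x2 m)\<^sup>2)"
    note w1 = summable_weight_mono[OF s1, folded x1_def, folded E1_def]
    note w2 = summable_weight_mono[OF s2, folded x2_def, folded E2_def]
    note v1 = summable_weight_mono[OF w1(1), folded E1_def]
    note v2 = summable_weight_mono[OF w2(1), folded E2_def]
    have l1: "summable (\<lambda>n. \<bar>(real n + 1) * x1 n\<bar>)" "summable (\<lambda>m. \<bar>(real m + 1) * x2 m\<bar>)"
      using weighted_l2_imp_l1(1)[OF s1] weighted_l2_imp_l1(1)[OF s2] by (simp_all add: x1_def x2_def)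
    have l0: "summable (\<lambda>n. \<bar>x1 n\<bar>)" "summable (\<lambda>m. \<bar>x2 m\<bar>)"
      using weighted_l2_imp_l1(1)[OF w1(1)] weighted_l2_imp_l1(1)[OF w2(1)] by simp_all
    have lw: "summable (\<lambda>n. \<bar>- ((real n + 1/2) * pi * x1 n)\<bar>)" "summable (\<lambda>m. \<bar>- (real m * pi * x2 m)\<bar>)"
    proof -
      show "summable (\<lambda>n. \<bar>- ((real n + 1/2) * pi * x1 n)\<bar>)"
      proof (rule summable_comparison_test'[OF summable_mult[OF l1(1), of pi]])
        fix n :: nat
        have "\<bar>real n + 1/2\<bar> * \<bar>x1 n\<bar> \<le> \<bar>real n + 1\<bar> * \<bar>x1 n\<bar>" by (intro mult_right_mono) auto
        then show "norm \<bar>- ((real n + 1/2) * pi * x1 n)\<bar> \<le> pi * \<bar>(real n + 1) * x1 n\<bar>"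
          using mult_left_mono[OF _ pi_ge_zero] by (simp add: abs_mult mult_ac)
      qed
      show "summable (\<lambda>m. \<bar>- (real m * pi * x2 m)\<bar>)"
      proof (rule summable_comparison_test'[OF summable_mult[OF l1(2), of pi]])
        fix n :: nat
        have "\<bar>real n\<bar> * \<bar>x2 n\<bar> \<le> \<bar>real n + 1\<bar> * \<bar>x2 n\<bar>" by (intro mult_right_mono) auto
        then show "norm \<bar>- (real n * pi * x2 n)\<bar> \<le> pi * \<bar>(real n + 1) * x2 n\<bar>"
          using mult_left_mono[OF _ pi_ge_zero] by (simp add: abs_mult mult_ac)
      qed
    qed
    define e1 where "e1 n x = sqrt 2 * sin ((real n + 1/2) * pi * x)" for n and x :: real
    define e2 where "e2 m x = mu m * sin (real m * pi * x)" for m and x :: real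
    have eb: "\<bar>e1 n x\<bar> \<le> sqrt 2" "\<bar>e2 n x\<bar> \<le> sqrt 2" for n x
    proof -
      show "\<bar>e1 n x\<bar> \<le> sqrt 2" by (simp add: e1_def abs_mult mult_left_le)
      have "mu n * \<bar>sin (real n * pi * x)\<bar> \<le> sqrt 2 * 1" by (intro mult_mono mu_le) (auto simp: mu_pos less_imp_le)
      then show "\<bar>e2 n x\<bar> \<le> sqrt 2" using mu_pos[of n] by (simp add: e2_def abs_mult)
    qed
    have ec: "continuous_on {0..1} (e1 n)" "continuous_on {0..1} (e2 n)" for n
      unfolding e1_def e2_def by (intro continuous_intros)+
    have o1: "ip (e1 i) (e1 j) = (if i = j then 1 else 0)" for i j
      using orthonormal_sin_half unfolding orthonormal_def e1_def by simp
    \<comment> \<open>The constant function in the cosine system leaves a zero at index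
      \<open>0\<close>.\<close>
    have o2: "ip (e2 i) (e2 j) = (if i = j then (if j = 0 then 0 else 1) else 0)" for i j
    proof (cases "i = 0 \<or> j = 0")
      case True
      then have "e2 i = (\<lambda>x. 0) \<or> e2 j = (\<lambda>x. 0)" by (auto simp: e2_def fun_eq_iff)
      then show ?thesis using True by auto
    next
      case False
      then obtain i' j' where ij: "i = Suc i'" "j = Suc j'" by (metis not0_implies_Suc)
      then show ?thesis
        using orthonormal_sin unfolding orthonormal_def e2_def by (simp add: mu_def)
    qed
    define P where "P x = (\<Sum>n. x1 n * phi1 n x)" for x
    define P' where "P' x = (\<Sum>n. - ((real n + 1/2) * pi * x1 n) * e1 n x)" for x
    define q where "q x = (\<Sum>m. x2 m * ecos m x)" for x
    define q' where "q' x = (\<Sum>m. - (real m * pi * x2 m) * e2 m x)" for x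
    have dP: "has_L2_deriv P P'"
      unfolding P_def P'_def
    proof (rule has_L2_deriv_uniform_series)
      show "((\<lambda>x. x1 n * phi1 n x) has_real_derivative - ((real n + 1/2) * pi * x1 n) * e1 n x) (at x)" for n x
        using DERIV_cmult[OF phi1_boundary_problem(1)[of n x], of "x1 n"] by (simp add: e1_def mult_ac)
      show "continuous_on {0..1} (\<lambda>x. - ((real n + 1/2) * pi * x1 n) * e1 n x)" for n
        by (intro continuous_intros ec)
      show "summable (\<lambda>n. \<bar>x1 n\<bar> * sqrt 2)" by (rule summable_mult2[OF l0(1)])
      show "\<bar>x1 n * phi1 n x\<bar> \<le> \<bar>x1 n\<bar> * sqrt 2" for n x
        unfolding abs_mult by (intro mult_left_mono abs_phi1_le) auto
      show "summable (\<lambda>n. \<bar>- ((real n + 1/2) * pi * x1 n)\<bar> * sqrt 2)" by (rule summable_mult2[OF lw(1)])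
      show "\<bar>- ((real n + 1/2) * pi * x1 n) * e1 n x\<bar> \<le> \<bar>- ((real n + 1/2) * pi * x1 n)\<bar> * sqrt 2" for n x
        unfolding abs_mult[of _ "e1 n x"] by (intro mult_left_mono eb) auto
    qed
    have dq: "has_L2_deriv q q'"
      unfolding q_def q'_def
    proof (rule has_L2_deriv_uniform_series)
      show "((\<lambda>x. x2 m * ecos m x) has_real_derivative - (real m * pi * x2 m) * e2 m x) (at x)" for m x
        using DERIV_cmult[OF ecos_boundary_problem(1)[of m x], of "x2 m"] by (simp add: e2_def mult_ac)
      show "continuous_on {0..1} (\<lambda>x. - (real n * pi * x2 n) * e2 n x)" for n
        by (intro continuous_intros ec)
      show "summable (\<lambda>n. \<bar>x2 n\<bar> * sqrt 2)" by (rule summable_mult2[OF l0(2)])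
      show "\<bar>x2 n * ecos n x\<bar> \<le> \<bar>x2 n\<bar> * sqrt 2" for n x
        unfolding abs_mult by (intro mult_left_mono abs_ecos_le) auto
      show "summable (\<lambda>n. \<bar>- (real n * pi * x2 n)\<bar> * sqrt 2)" by (rule summable_mult2[OF lw(2)])
      show "\<bar>- (real n * pi * x2 n) * e2 n x\<bar> \<le> \<bar>- (real n * pi * x2 n)\<bar> * sqrt 2" for n x
        unfolding abs_mult[of _ "e2 n x"] by (intro mult_left_mono eb) auto
    qed
    note L = has_L2_deriv_L2I[OF dP] has_L2_derivD_L2I[OF dP] has_L2_deriv_L2I[OF dq] has_L2_derivD_L2I[OF dq]
    have P1: "P 1 = 0" by (simp add: P_def phi1_boundary_problem(3))
    have cP: "ip P (phi1 k) = x1 k" for k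
      using nsq_orthogonal_series(2)[where e=phi1 and w="\<lambda>_. 1" and a=x1 and k=k,
          OF L2I_differentiable(2)[OF phi1_boundary_problem(1)] abs_phi1_le]
        orthonormal_phi1 l0 unfolding P_def by (simp add: orthonormal_def)
    have cq: "ip q (ecos k) = x2 k" "(\<lambda>m. (x2 m)\<^sup>2) sums nsq q" for k
      using nsq_orthogonal_series[where e=ecos and w="\<lambda>_. 1" and a=x2,
          OF L2I_differentiable(2)[OF ecos_boundary_problem(1)] abs_ecos_le]
        orthonormal_ecos l0 unfolding q_def by (simp_all add: orthonormal_def)
    have eqg: "eqI g q"
      by (rule eqI_if_coefficients_eq[OF complete_ecos g L(3)]) (simp add: cq x2_def)
    note lL = ip_diff_lift(1)[OF f g, of a b s]
    have eqP: "eqI (\<lambda>x. f x - lift a b s g x) P"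
      by (rule eqI_if_coefficients_eq[OF complete_phi1 L2I_diff[OF f lL] L(1)])
        (simp add: cP ip_diff_lift(2)[OF f g] x1_def)
    define R' where "R' x = (\<Sum>m. ip g (ecos m) * deriv (phi2 a b s m) x)" for x
    have dR: "has_L2_deriv (lift a b s g) R'" "lift a b s g 1 = 0" "nsq R' \<le> (K * harmonic_l2_norm)\<^sup>2 * E2"
      unfolding R'_def[abs_def] E2_def x2_def using w2(1)
      by (intro lift_H1[OF K(2,3,1)]; simp add: x2_def)+
    have eqf: "eqI f (\<lambda>x. P x + lift a b s g x)"
      using eqI_add[OF eqP eqI_refl[of "lift a b s g"]] by simp
    have nP: "nsq P' \<le> pi\<^sup>2 * E1"
    proof -
      have "(\<lambda>n. (- ((real n + 1/2) * pi * x1 n))\<^sup>2 * 1) sums nsq P'"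
        unfolding P'_def by (rule nsq_orthogonal_series(1)[OF ec(1) eb(1) o1 lw(1)])
      moreover have "(\<lambda>n. pi\<^sup>2 * ((real n + 1) * x1 n)\<^sup>2) sums (pi\<^sup>2 * E1)"
        unfolding E1_def by (intro sums_mult summable_sums w1)
      moreover have "(- ((real n + 1/2) * pi * x1 n))\<^sup>2 * 1 \<le> pi\<^sup>2 * ((real n + 1) * x1 n)\<^sup>2" for n
      proof -
        have "(real n + 1/2)\<^sup>2 * (pi\<^sup>2 * (x1 n)\<^sup>2) \<le> (real n + 1)\<^sup>2 * (pi\<^sup>2 * (x1 n)\<^sup>2)"
          by (intro mult_right_mono power_mono) auto
        then show ?thesis by (simp add: power_mult_distrib mult_ac)
      qed
      ultimately show ?thesis by (rule sums_le[rotated])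
    qed
    have nq': "nsq q' \<le> pi\<^sup>2 * E2"
    proof -
      have "(\<lambda>n. (- (real n * pi * x2 n))\<^sup>2 * (if n = 0 then 0 else 1)) sums nsq q'"
        unfolding q'_def by (rule nsq_orthogonal_series(1)[OF ec(2) eb(2) o2 lw(2)])
      moreover have "(\<lambda>n. pi\<^sup>2 * ((real n + 1) * x2 n)\<^sup>2) sums (pi\<^sup>2 * E2)"
        unfolding E2_def by (intro sums_mult summable_sums w2)
      moreover have "(- (real n * pi * x2 n))\<^sup>2 * (if n = 0 then 0 else 1) \<le> pi\<^sup>2 * ((real n + 1) * x2 n)\<^sup>2" for n
      proof -
        have "(real n)\<^sup>2 * (pi\<^sup>2 * (x2 n)\<^sup>2) \<le> (real n + 1)\<^sup>2 * (pi\<^sup>2 * (x2 n)\<^sup>2)"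
          by (intro mult_right_mono power_mono) auto
        then show ?thesis by (simp add: power_mult_distrib mult_ac)
      qed
      ultimately show ?thesis by (rule sums_le[rotated])
    qed
    have nq: "nsq q \<le> E2" using v2(2) sums_unique[OF cq(2)] by simp
    have np: "nsq (\<lambda>x. P' x + R' x) \<le> 2 * nsq P' + 2 * nsq R'"
      by (intro nsq_add_le L has_L2_derivD_L2I[OF dR(1)])
    have E0: "E1 \<ge> 0" "E2 \<ge> 0"
      unfolding E1_def E2_def by (intro suminf_nonneg w1 w2; simp)+
    have "nsq (\<lambda>x. P' x + R' x) + nsq q + nsq q' \<le> 2 * pi\<^sup>2 * E1 + (2 * (K * harmonic_l2_norm)\<^sup>2 + 1 + pi\<^sup>2) * E2"
      using np nP dR(3) nq nq' by (simp add: algebra_simps)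
    also have "\<dots> \<le> C * E1 + C * E2"
      unfolding C_def using E0 by (intro add_mono mult_right_mono) (auto intro: add_nonneg_nonneg)
    finally have fin: "nsq (\<lambda>x. P' x + R' x) + nsq q + nsq q' \<le> C * (E1 + E2)" by (simp add: distrib_left)
    show "\<exists>p p' q q'. eqI f p \<and> has_L2_deriv p p' \<and> p 1 = 0 \<and> eqI g q \<and> has_L2_deriv q q' \<and>
        nsq p' + nsq q + nsq q' \<le> C * H1_energy a b s f g"
      using fin eqf eqg dq has_L2_deriv_add[OF dP dR(1)] P1 dR(2) unfolding E1_def E2_def x1_def x2_def
      by (intro exI[of _ "\<lambda>x. P x + lift a b s g x"] exI[of _ "\<lambda>x. P' x + R' x"] exI[of _ q] exI[of _ q']) simp
  qed
qed

text \<open>Integration by parts turns the coefficients with weight into sine coefficients of the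
  derivatives, to which the inequality of Bessel applies. No boundary terms arise: the sines of
  integer frequency vanish at both ends, those of half-integer frequency vanish at
  \<open>0\<close>, and \<open>f - lift\<close> vanishes at \<open>1\<close>.\<close>

lemma H1_analysis:
  obtains C where "C > 0"
    "\<And>f f' g g'. \<lbrakk>has_L2_deriv f f'; f 1 = 0; has_L2_deriv g g'\<rbrakk> \<Longrightarrow>
       summable (\<lambda>n. ((real n + 1) * mode1 a b s f g n)\<^sup>2) \<and> summable (\<lambda>m. ((real m + 1) * ip g (ecos m))\<^sup>2) \<and>
       H1_energy a b s f g \<le> C * (nsq f' + nsq g + nsq g')"
proof -
  obtain K where K: "K > 0" "\<And>m x. x \<in> {0..1} \<Longrightarrow> \<bar>phi2 a b s m x\<bar> \<le> K / (real m + 1)"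
    "\<And>m x. x \<in> {0..1} \<Longrightarrow> \<bar>deriv (phi2 a b s m) x\<bar> \<le> K"
    using phi2_bounds[of a b s] by metis
  define k where "k = (K * harmonic_l2_norm)\<^sup>2"
  have k: "k \<ge> 0" by (simp add: k_def)
  show ?thesis
  proof (rule that[of "4 + 4 * k"])
    show "4 + 4 * k > 0" using k by simp
    fix f f' g g' assume f: "has_L2_deriv f f'" "f 1 = 0" and g: "has_L2_deriv g g'"
    note L = has_L2_deriv_L2I[OF f(1)] has_L2_derivD_L2I[OF f(1)] has_L2_deriv_L2I[OF g] has_L2_derivD_L2I[OF g]
    define sn where "sn n x = sqrt 2 * sin (real (Suc n) * pi * x)" for n and x :: real
    have osn: "orthonormal sn" using orthonormal_sin by (simp add: sn_def[abs_def])
    have s2: "real (Suc m) * pi * ip g (ecos (Suc m)) = - ip g' (sn m)" for m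
    proof -
      have d: "(sn m has_real_derivative real (Suc m) * pi * ecos (Suc m) x) (at x within {0..1})" for x
        unfolding sn_def ecos_def mu_def by (auto intro!: derivative_eq_intros)
      have c: "continuous_on {0..1} (\<lambda>x. real (Suc m) * pi * ecos (Suc m) x)"
        unfolding ecos_def by (intro continuous_intros)
      have "sn m 1 = 0" "sn m 0 = 0" using sin_npi[of "Suc m"] by (simp_all add: sn_def)
      then show ?thesis
        using integration_by_parts[OF g c d] by (simp add: ip_scale_right)
    qed
    define h where "h m = (real m * pi * ip g (ecos m))\<^sup>2" for m
    have "(\<lambda>m. h (Suc m)) = (\<lambda>m. (ip g' (sn m))\<^sup>2)"
      by (rule ext) (simp only: h_def s2 power2_minus)
    then have hs: "summable (\<lambda>m. h (Suc m))" "(\<Sum>m. h (Suc m)) \<le> nsq g'"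
      using Bessel[OF osn L(4)] by simp_all
    have h0: "h 0 = 0" by (simp add: h_def)
    have h: "summable h" "suminf h \<le> nsq g'"
      using hs suminf_split_head[of h] h0 summable_Suc_iff[of h] by simp_all
    have le2: "((real m + 1) * ip g (ecos m))\<^sup>2 \<le> 2 * h m + 2 * (ip g (ecos m))\<^sup>2" for m
    proof -
      have "real m * 1 \<le> real m * pi" using pi_gt3 by (intro mult_left_mono) auto
      then have "(real m)\<^sup>2 \<le> (real m * pi)\<^sup>2" by (intro power_mono) auto
      moreover have "0 \<le> (real m - 1)\<^sup>2" by simp
      ultimately have "(real m + 1)\<^sup>2 \<le> 2 * (real m * pi)\<^sup>2 + 2" by (simp add: power2_eq_square algebra_simps)
      then have "(real m + 1)\<^sup>2 * (ip g (ecos m))\<^sup>2 \<le> (2 * (real m * pi)\<^sup>2 + 2) * (ip g (ecos m))\<^sup>2"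
        by (rule mult_right_mono) simp
      then show ?thesis
        unfolding h_def power_mult_distrib[of _ "ip g (ecos m)"] by (simp only: distrib_right mult.assoc)
    qed
    note P = nsq_ecos_sums[OF L(3)]
    have sm: "summable (\<lambda>m. 2 * h m + 2 * (ip g (ecos m))\<^sup>2)"
      by (intro summable_add summable_mult h sums_summable[OF P])
    have S2: "summable (\<lambda>m. ((real m + 1) * ip g (ecos m))\<^sup>2)"
      using le2 by (intro summable_comparison_test'[OF sm]) auto
    define E2 where "E2 = (\<Sum>m. ((real m + 1) * ip g (ecos m))\<^sup>2)"
    have "E2 \<le> (\<Sum>m. 2 * h m + 2 * (ip g (ecos m))\<^sup>2)"
      unfolding E2_def by (intro suminf_le le2 S2 sm)
    also have "\<dots> = 2 * suminf h + 2 * nsq g"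
      using suminf_add[OF summable_mult[OF h(1), of 2] summable_mult[OF sums_summable[OF P], of 2]]
        suminf_mult[OF h(1), of 2] suminf_mult[OF sums_summable[OF P], of 2] sums_unique[OF P] by simp
    finally have E2: "E2 \<le> 2 * nsq g' + 2 * nsq g" using h(2) by simp
    define R' where "R' x = (\<Sum>m. ip g (ecos m) * deriv (phi2 a b s m) x)" for x
    have dR: "has_L2_deriv (lift a b s g) R'" "lift a b s g 1 = 0" "nsq R' \<le> k * E2"
      unfolding R'_def[abs_def] E2_def k_def using S2
      by (intro lift_H1[OF K(2,3,1)]; simp)+
    note dh = has_L2_deriv_diff[OF f(1) dR(1)]
    define t where "t n x = sqrt 2 * sin ((real n + 1/2) * pi * x)" for n and x :: real
    have ot: "orthonormal t" using orthonormal_sin_half by (simp add: t_def[abs_def])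
    have s1: "(real n + 1/2) * pi * mode1 a b s f g n = - ip (\<lambda>x. f' x - R' x) (t n)" for n
    proof -
      have d: "(t n has_real_derivative (real n + 1/2) * pi * phi1 n x) (at x within {0..1})" for x
        unfolding t_def phi1_def by (auto intro!: derivative_eq_intros)
      have c: "continuous_on {0..1} (\<lambda>x. (real n + 1/2) * pi * phi1 n x)"
        unfolding phi1_def by (intro continuous_intros)
      show ?thesis
        using integration_by_parts[OF dh c d] f(2) dR(2) ip_diff_lift(2)[OF L(1,3), of a b s n]
        by (simp add: ip_scale_right t_def)
    qed
    have le1: "((real n + 1) * mode1 a b s f g n)\<^sup>2 \<le> (ip (\<lambda>x. f' x - R' x) (t n))\<^sup>2" for n
    proof -
      have "(real n + 1/2) * 3 \<le> (real n + 1/2) * pi" using pi_gt3 by (intro mult_left_mono) auto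
      moreover have "real n + 1 \<le> (real n + 1/2) * 3" by simp
      ultimately have "real n + 1 \<le> (real n + 1/2) * pi" by linarith
      then have "(real n + 1)\<^sup>2 \<le> ((real n + 1/2) * pi)\<^sup>2" by (intro power_mono) auto
      from mult_right_mono[OF this, of "(mode1 a b s f g n)\<^sup>2"]
      have "((real n + 1) * mode1 a b s f g n)\<^sup>2 \<le> ((real n + 1/2) * pi * mode1 a b s f g n)\<^sup>2"
        by (simp add: power_mult_distrib)
      then show ?thesis by (simp only: s1 power2_minus)
    qed
    note B = Bessel[OF ot has_L2_derivD_L2I[OF dh]]
    have S1: "summable (\<lambda>n. ((real n + 1) * mode1 a b s f g n)\<^sup>2)"
      using le1 by (intro summable_comparison_test'[OF B(1)]) auto
    have "(\<Sum>n. ((real n + 1) * mode1 a b s f g n)\<^sup>2) \<le> nsq (\<lambda>x. f' x - R' x)"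
      by (rule order_trans[OF suminf_le[OF le1 S1 B(1)] B(2)])
    also have "\<dots> \<le> 2 * nsq f' + 2 * nsq R'"
      by (intro nsq_diff_le L has_L2_derivD_L2I[OF dR(1)])
    also have "\<dots> \<le> 2 * nsq f' + 2 * (k * (2 * nsq g' + 2 * nsq g))"
      using dR(3) mult_left_mono[OF E2 k] by simp
    finally have E1: "(\<Sum>n. ((real n + 1) * mode1 a b s f g n)\<^sup>2) \<le> 2 * nsq f' + 2 * (k * (2 * nsq g' + 2 * nsq g))" .
    have "H1_energy a b s f g \<le> 2 * nsq f' + (2 + 4 * k) * (nsq g' + nsq g)"
      using E1 E2 unfolding E2_def by (simp add: algebra_simps)
    also have "\<dots> \<le> (4 + 4 * k) * nsq f' + (4 + 4 * k) * (nsq g' + nsq g)"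
      using k nsq_nonneg[of f'] nsq_nonneg[of g] nsq_nonneg[of g'] by (intro add_mono mult_right_mono) auto
    finally show "summable (\<lambda>n. ((real n + 1) * mode1 a b s f g n)\<^sup>2) \<and> summable (\<lambda>m. ((real m + 1) * ip g (ecos m))\<^sup>2) \<and>
       H1_energy a b s f g \<le> (4 + 4 * k) * (nsq f' + nsq g + nsq g')"
      using S1 S2 by (simp add: algebra_simps)
  qed
qed

text \<open>Growth of the eigenvalues converts applications of the operator into powers of
  \<open>n + 1\<close>.\<close>

lemma eventually_lam_large:
  "\<forall>\<^sub>F n in sequentially. (real n + 1)\<^sup>2 \<le> \<bar>lam1 a n\<bar>" "\<forall>\<^sub>F m in sequentially. (real m + 1)\<^sup>2 \<le> \<bar>lam2 b m\<bar>"
proof -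
  have ev: "\<forall>\<^sub>F n in sequentially. real n \<ge> \<bar>r\<bar> + 1" for r :: real
    using eventually_ge_at_top[of "nat \<lceil>\<bar>r\<bar> + 1\<rceil>"] by eventually_elim linarith
  have key: "(real n + 1)\<^sup>2 \<le> \<bar>r - x\<^sup>2 * pi\<^sup>2\<bar>" if "real n \<ge> \<bar>r\<bar> + 1" "x \<ge> real n" for n x r
  proof -
    have "3\<^sup>2 \<le> pi\<^sup>2" using pi_gt3 by (intro power_mono) auto
    then have p9: "9 \<le> pi\<^sup>2" by simp
    have "(real n)\<^sup>2 \<le> x\<^sup>2" using that(2) by (intro power_mono) auto
    then have "(real n)\<^sup>2 * 9 \<le> x\<^sup>2 * pi\<^sup>2" using p9 by (intro mult_mono) auto
    moreover have "1 * real n \<le> real n * real n" using that(1) by (intro mult_right_mono) linarith+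
    ultimately have "r + (real n + 1)\<^sup>2 \<le> x\<^sup>2 * pi\<^sup>2"
      using that(1) by (simp add: power2_eq_square algebra_simps)
    then show ?thesis by linarith
  qed
  show "\<forall>\<^sub>F n in sequentially. (real n + 1)\<^sup>2 \<le> \<bar>lam1 a n\<bar>"
    using ev[of a] unfolding lam1_def by eventually_elim (rule key; simp)
  show "\<forall>\<^sub>F m in sequentially. (real m + 1)\<^sup>2 \<le> \<bar>lam2 b m\<bar>"
    using ev[of b] unfolding lam2_def by eventually_elim (rule key; simp)
qed

lemma summable_if_lam_summable:
  assumes "\<forall>\<^sub>F n in sequentially. (real n + 1)\<^sup>2 \<le> \<bar>l n\<bar>" "summable (\<lambda>n. (v n)\<^sup>2)"
    "\<forall>\<^sub>F n in sequentially. v n = l n * x n"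
  shows "summable (\<lambda>n. ((real n + 1) * ((real n + 1) * x n :: real))\<^sup>2)"
proof (rule summable_comparison_test_ev[OF _ assms(2)])
  show "\<forall>\<^sub>F n in sequentially. norm (((real n + 1) * ((real n + 1) * x n))\<^sup>2) \<le> (v n)\<^sup>2"
    using assms(1,3)
  proof eventually_elim
    fix n assume n: "(real n + 1)\<^sup>2 \<le> \<bar>l n\<bar>" "v n = l n * x n"
    have "((real n + 1)\<^sup>2 * \<bar>x n\<bar>)\<^sup>2 \<le> (\<bar>l n\<bar> * \<bar>x n\<bar>)\<^sup>2"
      using n(1) by (intro power_mono mult_right_mono) auto
    then show "norm (((real n + 1) * ((real n + 1) * x n))\<^sup>2) \<le> (v n)\<^sup>2"
      by (simp add: n(2) power_mult_distrib power2_eq_square[of "real n + 1"] mult_ac)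
  qed
qed

text \<open>On the domain, the operator multiplies all but finitely many modal coordinates by
  their eigenvalues, and the result has square-summable coordinates.\<close>

lemma domain_modes_summable:
  assumes f: "has_L2_deriv2 f f' f''" and g: "has_L2_deriv2 g g' g''"
    and bc: "f 1 = 0" "g' 0 = 0" "g' 1 = 0" "f' 0 = s * g 0"
  shows "summable (\<lambda>n. ((real n + 1) * ((real n + 1) * mode1 a b s f g n))\<^sup>2)"
    and "summable (\<lambda>m. ((real m + 1) * ((real m + 1) * ip g (ecos m)))\<^sup>2)"
proof -
  define F where "F x = f'' x + a * f x" for x
  define G where "G x = g'' x + b * g x" for x
  have L: "F \<in> L2I" "G \<in> L2I"
    using f g unfolding has_L2_deriv2_def F_def G_def
    by (auto intro!: L2I_add L2I_scale intro: has_L2_deriv_L2I has_L2_derivD_L2I)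
  show "summable (\<lambda>n. ((real n + 1) * ((real n + 1) * mode1 a b s f g n))\<^sup>2)"
  proof (rule summable_if_lam_summable[OF eventually_lam_large(1)[of a] sums_summable[OF mode1_sums[OF L, of a b s]]])
    have "\<forall>\<^sub>F n in sequentially. n \<notin> Delta1 a b"
      using finite_Delta12(1)[of a b] by (simp add: cofinite_eq_sequentially[symmetric] eventually_cofinite)
    then show "\<forall>\<^sub>F n in sequentially. mode1 a b s F G n = lam1 a n * mode1 a b s f g n"
      by eventually_elim
        (use ip_psi1_opA[OF f g bc, of a _ b] in \<open>simp add: mode1_def F_def[abs_def] G_def[abs_def] jordan_coupling_def\<close>)
  qed
  show "summable (\<lambda>m. ((real m + 1) * ((real m + 1) * ip g (ecos m)))\<^sup>2)"
    using ip_ecos_opA[OF g bc(2,3), of b]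
    by (intro summable_if_lam_summable[OF eventually_lam_large(2)[of b] sums_summable[OF nsq_ecos_sums[OF L(2)]]] always_eventually)
      (simp add: G_def[abs_def])
qed


section \<open>Decay of forced linear systems\<close>

text \<open>Multiplied by the integrating factor, the forcing is bounded by
  \<open>G * exp (\<kappa> * t)\<close>. As \<open>\<kappa> > 0\<close>, its integral is at most
  \<open>G / \<kappa> * exp (\<kappa> * t)\<close>; there is no loss in the rate.\<close>

lemma scalar_decay_complex:
  fixes w :: "real \<Rightarrow> complex"
  assumes w: "\<And>t. t \<in> {0..T} \<Longrightarrow> (w has_vector_derivative \<mu> * w t + g t) (at t within {0..})"
    and g: "\<And>t. t \<in> {0..T} \<Longrightarrow> norm (g t) \<le> G * exp (- \<delta> * t)"
    and gap: "\<kappa> = - \<delta> - Re \<mu>" "\<kappa> > 0" and G: "G \<ge> 0" and t: "t \<in> {0..T}"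
  shows "norm (w t) \<le> (norm (w 0) + G / \<kappa>) * exp (- \<delta> * t)"
proof (cases "t = 0")
  case True
  then show ?thesis using G gap by simp
next
  case False
  then have tp: "t > 0" using t by simp
  define p where "p \<tau> = exp (- \<mu> * complex_of_real \<tau>) * w \<tau>" for \<tau>
  define \<phi> where "\<phi> \<tau> = G / \<kappa> * exp (\<kappa> * \<tau>)" for \<tau>
  have e: "((\<lambda>\<tau>. exp (- \<mu> * complex_of_real \<tau>)) has_vector_derivative - \<mu> * exp (- \<mu> * complex_of_real \<tau>)) (at \<tau> within S)" for \<tau> S
  proof (rule has_vector_derivative_real_field)
    show "((\<lambda>z. exp (- \<mu> * z)) has_field_derivative - \<mu> * exp (- \<mu> * complex_of_real \<tau>)) (at (complex_of_real \<tau>))"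
      by (auto intro!: derivative_eq_intros)
  qed
  have pd: "(p has_vector_derivative exp (- \<mu> * complex_of_real \<tau>) * g \<tau>) (at \<tau> within {0..})" if "\<tau> \<in> {0..T}" for \<tau>
    using has_vector_derivative_mult[OF e w[OF that]] unfolding p_def by (simp add: algebra_simps)
  have "norm (p t - p 0) \<le> \<phi> t - \<phi> 0"
  proof (rule differentiable_bound_general[OF tp])
    show "continuous_on {0..t} p"
    proof (rule continuous_on_vector_derivative)
      show "(p has_vector_derivative exp (- \<mu> * complex_of_real \<tau>) * g \<tau>) (at \<tau> within {0..t})" if "\<tau> \<in> {0..t}" for \<tau>
        by (rule has_vector_derivative_within_subset[OF pd]) (use that t in auto)
    qed
    show "continuous_on {0..t} \<phi>" unfolding \<phi>_def by (intro continuous_intros)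
    fix \<tau> assume \<tau>: "0 < \<tau>" "\<tau> < t"
    have at: "at \<tau> within {0..} = at \<tau>" using \<tau> by (intro at_within_interior) simp
    show "(p has_vector_derivative exp (- \<mu> * complex_of_real \<tau>) * g \<tau>) (at \<tau>)"
      using pd[of \<tau>] \<tau> t by (simp add: at)
    show "(\<phi> has_vector_derivative G * exp (\<kappa> * \<tau>)) (at \<tau>)"
      unfolding \<phi>_def has_real_derivative_iff_has_vector_derivative[symmetric]
      using gap(2) by (auto intro!: derivative_eq_intros)
    have "norm (exp (- \<mu> * complex_of_real \<tau>) * g \<tau>) \<le> exp (- Re \<mu> * \<tau>) * (G * exp (- \<delta> * \<tau>))"
      unfolding norm_mult using g[of \<tau>] \<tau> t by (intro mult_mono) auto
    also have "\<dots> = G * exp (\<kappa> * \<tau>)"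
      unfolding gap(1) by (simp add: exp_add[symmetric] algebra_simps)
    finally show "norm (exp (- \<mu> * complex_of_real \<tau>) * g \<tau>) \<le> G * exp (\<kappa> * \<tau>)" .
  qed
  then have "norm (p t) \<le> norm (w 0) + G / \<kappa> * exp (\<kappa> * t)"
    using norm_triangle_sub[of "p t" "p 0"] G gap(2) by (simp add: \<phi>_def p_def) (smt (verit) divide_nonneg_pos)
  moreover have "norm (w t) = exp (Re \<mu> * t) * norm (p t)"
    by (simp add: p_def norm_mult exp_add[symmetric] mult.assoc[symmetric])
  ultimately have "norm (w t) \<le> exp (Re \<mu> * t) * (norm (w 0) + G / \<kappa> * exp (\<kappa> * t))"
    by simp
  also have "\<dots> = exp (Re \<mu> * t) * norm (w 0) + G / \<kappa> * exp (- \<delta> * t)"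
    unfolding gap(1) by (simp add: distrib_left exp_add[symmetric] algebra_simps)
  also have "\<dots> \<le> exp (- \<delta> * t) * norm (w 0) + G / \<kappa> * exp (- \<delta> * t)"
  proof -
    have "Re \<mu> * t \<le> - \<delta> * t" using gap tp by (intro mult_right_mono) auto
    then show ?thesis by (intro add_right_mono mult_right_mono) auto
  qed
  finally show ?thesis by (simp add: algebra_simps)
qed

lemma scalar_decay_real:
  fixes x :: "real \<Rightarrow> real"
  assumes x: "\<And>t. t \<in> {0..T} \<Longrightarrow> (x has_real_derivative l * x t + g t) (at t within {0..})"
    and g: "\<And>t. t \<in> {0..T} \<Longrightarrow> \<bar>g t\<bar> \<le> G * exp (- \<delta> * t)"
    and gap: "l < - \<delta>" and G: "G \<ge> 0" and t: "t \<in> {0..T}"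
  shows "\<bar>x t\<bar> \<le> (\<bar>x 0\<bar> + G / (- \<delta> - l)) * exp (- \<delta> * t)"
proof -
  have "norm (complex_of_real (x t)) \<le> (norm (complex_of_real (x 0)) + G / (- \<delta> - l)) * exp (- \<delta> * t)"
  proof (rule scalar_decay_complex[of T _ "complex_of_real l" "\<lambda>t. complex_of_real (g t)"])
    fix \<tau> assume "\<tau> \<in> {0..T}"
    from bounded_linear.has_vector_derivative[OF bounded_linear_of_real x[OF this, unfolded has_real_derivative_iff_has_vector_derivative]]
    show "((\<lambda>t. complex_of_real (x t)) has_vector_derivative complex_of_real l * complex_of_real (x \<tau>) + complex_of_real (g \<tau>)) (at \<tau> within {0..})"
      by simp
  qed (use g gap G t in auto)
  then show ?thesis by simp
qed

text \<open>The bound on the forcing is required up to the time \<open>T\<close> only, because in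
  a feedback loop it is known on a finite interval before it is known globally.\<close>

definition linear_ode :: "nat \<Rightarrow> (nat \<Rightarrow> nat \<Rightarrow> real) \<Rightarrow> real \<Rightarrow> real \<Rightarrow> real \<Rightarrow> (real \<Rightarrow> nat \<Rightarrow> real) \<Rightarrow> bool" where
  "linear_ode n A \<delta> F T X \<longleftrightarrow> 0 \<le> F \<and> (\<exists>f. \<forall>t\<in>{0..T}. \<forall>i<n.
     ((\<lambda>\<tau>. X \<tau> i) has_real_derivative (\<Sum>j<n. A i j * X t j) + f t i) (at t within {0..}) \<and>
     \<bar>f t i\<bar> \<le> F * exp (- \<delta> * t))"

text \<open>A Schur decomposition makes the system upper triangular over the complex numbers.
  Solving from the last row upwards, each row is a scalar equation whose forcing consists of the
  given one and of the components that are already bounded by \<open>exp (- \<delta> * t)\<close>.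
  Since all eigenvalues are strictly to the left of \<open>- \<delta>\<close>, every step keeps
  the rate, and multiple eigenvalues cause no polynomial factors.\<close>

lemma Hurwitz_decay:
  assumes A: "A \<in> carrier_mat n n" and ev: "eigenvalues_left_of A (- \<delta>)"
  obtains C where "C \<ge> 0"
    "\<And>F T X t i. \<lbrakk>linear_ode n (\<lambda>i j. A $$ (i, j)) \<delta> F T X; t \<in> {0..T}; i < n\<rbrakk> \<Longrightarrow>
       \<bar>X t i\<bar> \<le> C * ((\<Sum>j<n. \<bar>X 0 j\<bar>) + F) * exp (- \<delta> * t)"
proof -
  define Ac where "Ac = map_mat complex_of_real A"
  have Ac: "Ac \<in> carrier_mat n n" using A by (simp add: Ac_def)
  obtain es where es: "char_poly Ac = (\<Prod>e\<leftarrow>es. [:- e, 1:])"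
    using char_poly_factorized[OF Ac] by blast
  obtain B P Q where sd: "schur_decomposition Ac es = (B, P, Q)" by (cases "schur_decomposition Ac es") auto
  from schur_decomposition[OF Ac es sd] have wit: "similar_mat_wit Ac B P Q"
    and ut: "upper_triangular B" and dg: "diag_mat B = es" by auto
  note W = similar_mat_witD2[OF Ac wit]
  have re: "Re (B $$ (i, i)) < - \<delta>" if "i < n" for i
  proof -
    have "B $$ (i, i) \<in> set es" using W that unfolding dg[symmetric] diag_mat_def by auto
    then have "poly (char_poly Ac) (B $$ (i, i)) = 0"
      unfolding es poly_prod_list by (auto simp: prod_list_zero_iff image_iff intro!: bexI)
    then have "eigenvalue Ac (B $$ (i, i))" by (simp add: eigenvalue_root_char_poly[OF Ac])
    then show ?thesis using ev by (simp add: eigenvalues_left_of_def Ac_def)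
  qed
  \<comment> \<open>The triangular coordinates.\<close>
  define w where "w X t i = (\<Sum>j<n. Q $$ (i, j) * complex_of_real (X t j))" for X :: "real \<Rightarrow> nat \<Rightarrow> real" and t i
  define q where "q = (\<Sum>i<n. \<Sum>j<n. norm (Q $$ (i, j)))"
  have q0: "q \<ge> 0" by (simp add: q_def sum_nonneg)
  have qi: "(\<Sum>j<n. norm (Q $$ (i, j))) \<le> q" if "i < n" for i
    unfolding q_def by (rule member_le_sum[of i "{..<n}" "\<lambda>i. \<Sum>j<n. norm (Q $$ (i, j))"]) (use that in \<open>auto intro: sum_nonneg\<close>)
  have QA: "Q * Ac = B * Q"
  proof -
    have "B * Q \<in> carrier_mat n n" using W(5,7) by simp
    then have "Q * (P * (B * Q)) = (Q * P) * (B * Q)"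
      using W(6,7) by (simp add: assoc_mult_mat[of Q n n P n "B * Q" n])
    then show ?thesis
      using W(2) assoc_mult_mat[OF W(6,5,7)] left_mult_one_mat[OF \<open>B * Q \<in> carrier_mat n n\<close>]
      by (subst W(3)) simp
  qed
  have QA': "(\<Sum>j<n. Q $$ (i, j) * complex_of_real (A $$ (j, k))) = (\<Sum>l<n. B $$ (i, l) * Q $$ (l, k))"
    if "i < n" "k < n" for i k
  proof -
    have "(Q * Ac) $$ (i, k) = (\<Sum>j<n. Q $$ (i, j) * complex_of_real (A $$ (j, k)))"
      using that W(4-7) A by (simp add: scalar_prod_def Ac_def atLeast0LessThan)
    moreover have "(B * Q) $$ (i, k) = (\<Sum>l<n. B $$ (i, l) * Q $$ (l, k))"
      using that W(4-7) by (simp add: scalar_prod_def atLeast0LessThan)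
    ultimately show ?thesis using QA by simp
  qed
  have PQ: "(\<Sum>l<n. P $$ (i, l) * Q $$ (l, k)) = (if i = k then 1 else 0)" if "i < n" "k < n" for i k
  proof -
    have "(P * Q) $$ (i, k) = (\<Sum>l<n. P $$ (i, l) * Q $$ (l, k))"
      using that W(4-7) by (simp add: scalar_prod_def atLeast0LessThan)
    then show ?thesis using that unfolding W(1) by simp
  qed
  define S where "S F X = (\<Sum>j<n. \<bar>X 0 j\<bar>) + F" for F and X :: "real \<Rightarrow> nat \<Rightarrow> real"
  \<comment> \<open>Back substitution: induction on the number of rows from the bottom that are
    already estimated.\<close>
  have substitution: "\<exists>D\<ge>0. \<forall>F T X t i. linear_ode n (\<lambda>i j. A $$ (i, j)) \<delta> F T X \<longrightarrow> t \<in> {0..T} \<longrightarrow> n - k \<le> i \<longrightarrow> i < n \<longrightarrow>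
       norm (w X t i) \<le> D * S F X * exp (- \<delta> * t)" if "k \<le> n" for k
    using that
  proof (induction k)
    case 0
    then show ?case by (intro exI[of _ 0]) auto
  next
    case (Suc k)
    then obtain D where D: "D \<ge> 0" "\<And>F T X t i. \<lbrakk>linear_ode n (\<lambda>i j. A $$ (i, j)) \<delta> F T X; t \<in> {0..T}; n - k \<le> i; i < n\<rbrakk> \<Longrightarrow>
       norm (w X t i) \<le> D * S F X * exp (- \<delta> * t)" by auto
    define i where "i = n - Suc k"
    have i: "i < n" using Suc.prems by (simp add: i_def)
    define \<kappa> where "\<kappa> = - \<delta> - Re (B $$ (i, i))"
    have \<kappa>: "\<kappa> > 0" using re[OF i] by (simp add: \<kappa>_def)
    define bb where "bb = (\<Sum>l\<in>{i<..<n}. norm (B $$ (i, l)))"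
    have bb: "bb \<ge> 0" by (simp add: bb_def sum_nonneg)
    define D' where "D' = q + (bb * D + q) / \<kappa>"
    have D': "D' \<ge> 0" using q0 bb D(1) \<kappa> by (simp add: D'_def)
    show ?case
    proof (intro exI[of _ "D + D'"] conjI allI impI)
      show "D + D' \<ge> 0" using D(1) D' by simp
      fix F T X t i'
      assume sol: "linear_ode n (\<lambda>i j. A $$ (i, j)) \<delta> F T X" and t: "t \<in> {0..T}" and i': "n - Suc k \<le> i'" "i' < n"
      obtain f where f: "F \<ge> 0" "\<And>t i. \<lbrakk>t \<in> {0..T}; i < n\<rbrakk> \<Longrightarrow> ((\<lambda>\<tau>. X \<tau> i) has_real_derivative (\<Sum>j<n. A $$ (i, j) * X t j) + f t i) (at t within {0..})"
        "\<And>t i. \<lbrakk>t \<in> {0..T}; i < n\<rbrakk> \<Longrightarrow> \<bar>f t i\<bar> \<le> F * exp (- \<delta> * t)"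
        using sol unfolding linear_ode_def by blast
      have S: "S F X \<ge> 0" using f(1) by (simp add: S_def sum_nonneg)
      have SF: "F \<le> S F X" by (simp add: S_def sum_nonneg)
      have wi: "norm (w X t i) \<le> D' * S F X * exp (- \<delta> * t)"
      proof -
        define g where "g \<tau> = (\<Sum>l\<in>{i<..<n}. B $$ (i, l) * w X \<tau> l) + (\<Sum>j<n. Q $$ (i, j) * complex_of_real (f \<tau> j))" for \<tau>
        have "norm (w X t i) \<le> (norm (w X 0 i) + (bb * D + q) * S F X / \<kappa>) * exp (- \<delta> * t)"
        proof (rule scalar_decay_complex[of T _ "B $$ (i, i)" g, OF _ _ \<kappa>_def \<kappa> _ t])
          show "(bb * D + q) * S F X \<ge> 0" using bb D(1) q0 S by simp
          fix \<tau> assume \<tau>: "\<tau> \<in> {0..T}"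
          have "((\<lambda>\<tau>. w X \<tau> i) has_vector_derivative
             (\<Sum>j<n. Q $$ (i, j) * complex_of_real ((\<Sum>k<n. A $$ (j, k) * X \<tau> k) + f \<tau> j))) (at \<tau> within {0..})"
            unfolding w_def
          proof (rule has_vector_derivative_sum)
            fix j assume "j \<in> {..<n}"
            then have "((\<lambda>\<tau>. complex_of_real (X \<tau> j)) has_vector_derivative complex_of_real ((\<Sum>k<n. A $$ (j, k) * X \<tau> k) + f \<tau> j)) (at \<tau> within {0..})"
              using bounded_linear.has_vector_derivative[OF bounded_linear_of_real
                  f(2)[OF \<tau>, of j, unfolded has_real_derivative_iff_has_vector_derivative]] by simp
            then show "((\<lambda>\<tau>. Q $$ (i, j) * complex_of_real (X \<tau> j)) has_vector_derivative
               Q $$ (i, j) * complex_of_real ((\<Sum>k<n. A $$ (j, k) * X \<tau> k) + f \<tau> j)) (at \<tau> within {0..})"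
              by (rule bounded_linear.has_vector_derivative[OF bounded_linear_mult_right])
          qed
          also have "(\<Sum>j<n. Q $$ (i, j) * complex_of_real ((\<Sum>k<n. A $$ (j, k) * X \<tau> k) + f \<tau> j)) =
             (\<Sum>j<n. \<Sum>k<n. Q $$ (i, j) * complex_of_real (A $$ (j, k)) * complex_of_real (X \<tau> k)) + (\<Sum>j<n. Q $$ (i, j) * complex_of_real (f \<tau> j))"
            by (simp add: distrib_left sum.distrib sum_distrib_left mult.assoc)
          also have "(\<Sum>j<n. \<Sum>k<n. Q $$ (i, j) * complex_of_real (A $$ (j, k)) * complex_of_real (X \<tau> k)) =
              (\<Sum>k<n. (\<Sum>j<n. Q $$ (i, j) * complex_of_real (A $$ (j, k))) * complex_of_real (X \<tau> k))"
            by (subst sum.swap) (simp add: sum_distrib_right)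
          also have "\<dots> = (\<Sum>k<n. (\<Sum>l<n. B $$ (i, l) * Q $$ (l, k)) * complex_of_real (X \<tau> k))"
            using i by (intro sum.cong refl) (simp add: QA')
          also have "\<dots> = (\<Sum>l<n. B $$ (i, l) * w X \<tau> l)"
            unfolding w_def sum_distrib_right sum_distrib_left by (subst sum.swap) (simp add: mult.assoc)
          also have "\<dots> = (\<Sum>l\<in>{i..<n}. B $$ (i, l) * w X \<tau> l)"
          proof (rule sum.mono_neutral_right)
            show "\<forall>l\<in>{..<n} - {i..<n}. B $$ (i, l) * w X \<tau> l = 0"
              using ut W i unfolding upper_triangular_def by auto
          qed auto
          also have "\<dots> = B $$ (i, i) * w X \<tau> i + (\<Sum>l\<in>{i<..<n}. B $$ (i, l) * w X \<tau> l)"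
          proof -
            have "{i..<n} = insert i {i<..<n}" using i by auto
            then show ?thesis by simp
          qed
          finally show "((\<lambda>\<tau>. w X \<tau> i) has_vector_derivative B $$ (i, i) * w X \<tau> i + g \<tau>) (at \<tau> within {0..})"
            by (simp add: g_def add.assoc)
          have "norm (\<Sum>l\<in>{i<..<n}. B $$ (i, l) * w X \<tau> l) \<le> (\<Sum>l\<in>{i<..<n}. norm (B $$ (i, l)) * (D * S F X * exp (- \<delta> * \<tau>)))"
            by (rule order_trans[OF norm_sum], intro sum_mono, unfold norm_mult, intro mult_left_mono D(2)[OF sol \<tau>])
              (auto simp: i_def)
          also have "\<dots> = bb * D * S F X * exp (- \<delta> * \<tau>)" by (simp add: bb_def sum_distrib_right mult.assoc)
          finally have 1: "norm (\<Sum>l\<in>{i<..<n}. B $$ (i, l) * w X \<tau> l) \<le> bb * D * S F X * exp (- \<delta> * \<tau>)" .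
          have "norm (\<Sum>j<n. Q $$ (i, j) * complex_of_real (f \<tau> j)) \<le> (\<Sum>j<n. norm (Q $$ (i, j)) * (S F X * exp (- \<delta> * \<tau>)))"
          proof (rule order_trans[OF norm_sum], intro sum_mono)
            fix j assume "j \<in> {..<n}"
            then have "\<bar>f \<tau> j\<bar> \<le> F * exp (- \<delta> * \<tau>)" using f(3)[OF \<tau>] by simp
            also have "\<dots> \<le> S F X * exp (- \<delta> * \<tau>)" using SF by (intro mult_right_mono) auto
            finally show "norm (Q $$ (i, j) * complex_of_real (f \<tau> j)) \<le> norm (Q $$ (i, j)) * (S F X * exp (- \<delta> * \<tau>))"
              unfolding norm_mult norm_of_real by (intro mult_left_mono) auto
          qed
          also have "\<dots> = (\<Sum>j<n. norm (Q $$ (i, j))) * (S F X * exp (- \<delta> * \<tau>))" by (simp add: sum_distrib_right)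
          also have "\<dots> \<le> q * (S F X * exp (- \<delta> * \<tau>))" using qi[OF i] S by (intro mult_right_mono) auto
          finally have 2: "norm (\<Sum>j<n. Q $$ (i, j) * complex_of_real (f \<tau> j)) \<le> q * (S F X * exp (- \<delta> * \<tau>))" .
          show "norm (g \<tau>) \<le> (bb * D + q) * S F X * exp (- \<delta> * \<tau>)"
            unfolding g_def by (rule order_trans[OF norm_triangle_ineq]) (use 1 2 in \<open>simp add: algebra_simps\<close>)
        qed
        also have "\<dots> \<le> D' * S F X * exp (- \<delta> * t)"
        proof (rule mult_right_mono)
          have "norm (w X 0 i) \<le> (\<Sum>j<n. norm (Q $$ (i, j)) * \<bar>X 0 j\<bar>)"
            unfolding w_def by (rule order_trans[OF norm_sum]) (simp add: norm_mult)
          also have "\<dots> \<le> (\<Sum>j<n. q * \<bar>X 0 j\<bar>)"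
          proof (intro sum_mono mult_right_mono)
            fix j assume "j \<in> {..<n}"
            then have "norm (Q $$ (i, j)) \<le> (\<Sum>j<n. norm (Q $$ (i, j)))"
              by (intro member_le_sum) auto
            then show "norm (Q $$ (i, j)) \<le> q" using qi[OF i] by simp
          qed auto
          also have "\<dots> = q * (\<Sum>j<n. \<bar>X 0 j\<bar>)" by (simp add: sum_distrib_left)
          also have "\<dots> \<le> q * S F X" using f(1) q0 by (intro mult_left_mono) (simp_all add: S_def)
          finally show "norm (w X 0 i) + (bb * D + q) * S F X / \<kappa> \<le> D' * S F X"
            by (simp add: D'_def algebra_simps add_divide_distrib)
        qed simp
        finally show ?thesis .
      qed
      have le: "D * S F X * exp (- \<delta> * t) \<le> (D + D') * S F X * exp (- \<delta> * t)"
        "D' * S F X * exp (- \<delta> * t) \<le> (D + D') * S F X * exp (- \<delta> * t)"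
        using D(1) D' S by (intro mult_right_mono; simp)+
      show "norm (w X t i') \<le> (D + D') * S F X * exp (- \<delta> * t)"
      proof (cases "i' = i")
        case True
        then show ?thesis using wi le(2) by simp
      next
        case False
        then have "n - k \<le> i'" using i' by (simp add: i_def)
        then show ?thesis using D(2)[OF sol t _ i'(2)] le(1) by fastforce
      qed
    qed
  qed
  then obtain D where D: "D \<ge> 0" "\<And>F T X t i. \<lbrakk>linear_ode n (\<lambda>i j. A $$ (i, j)) \<delta> F T X; t \<in> {0..T}; i < n\<rbrakk> \<Longrightarrow>
       norm (w X t i) \<le> D * S F X * exp (- \<delta> * t)"
    using substitution[of n] by auto
  define p where "p = (\<Sum>i<n. \<Sum>l<n. norm (P $$ (i, l)))"
  have p0: "p \<ge> 0" by (simp add: p_def sum_nonneg)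
  show ?thesis
  proof (rule that[of "p * D"])
    show "p * D \<ge> 0" using p0 D(1) by simp
    fix F T X t i
    assume sol: "linear_ode n (\<lambda>i j. A $$ (i, j)) \<delta> F T X" and t: "t \<in> {0..T}" and i: "i < n"
    have "(\<Sum>l<n. P $$ (i, l) * w X t l) = (\<Sum>k<n. (\<Sum>l<n. P $$ (i, l) * Q $$ (l, k)) * complex_of_real (X t k))"
      unfolding w_def sum_distrib_right sum_distrib_left by (subst sum.swap) (simp add: mult.assoc)
    also have "\<dots> = (\<Sum>k<n. if i = k then complex_of_real (X t k) else 0)"
      using i by (intro sum.cong refl) (simp add: PQ)
    also have "\<dots> = complex_of_real (X t i)" using i by simp
    finally have "\<bar>X t i\<bar> = norm (\<Sum>l<n. P $$ (i, l) * w X t l)" by simp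
    also have "\<dots> \<le> (\<Sum>l<n. norm (P $$ (i, l)) * (D * S F X * exp (- \<delta> * t)))"
      by (rule order_trans[OF norm_sum], intro sum_mono, unfold norm_mult, intro mult_left_mono D(2)[OF sol t]) auto
    also have "\<dots> = (\<Sum>l<n. norm (P $$ (i, l))) * (D * S F X * exp (- \<delta> * t))" by (simp add: sum_distrib_right)
    also have "\<dots> \<le> p * (D * S F X * exp (- \<delta> * t))"
    proof (rule mult_right_mono)
      show "(\<Sum>l<n. norm (P $$ (i, l))) \<le> p"
        unfolding p_def by (rule member_le_sum[of i "{..<n}" "\<lambda>i. \<Sum>j<n. norm (P $$ (i, j))"]) (use i in \<open>auto intro: sum_nonneg\<close>)
      have "F \<ge> 0" using sol by (simp add: linear_ode_def)
      then show "0 \<le> D * S F X * exp (- \<delta> * t)" using D(1) by (simp add: S_def sum_nonneg)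
    qed
    finally show "\<bar>X t i\<bar> \<le> p * D * ((\<Sum>j<n. \<bar>X 0 j\<bar>) + F) * exp (- \<delta> * t)" by (simp add: S_def mult.assoc)
  qed
qed


section \<open>The truncated model\<close>

text \<open>The modes in the order in which they appear as entries of the finite-dimensional
  vectors, with \<open>Inl n\<close> for \<open>x1 n\<close> and \<open>Inr m\<close> for
  \<open>x2 m\<close>. All statements about entries of matrices and vectors are reduced to
  statements about this list.\<close>

definition mode_list :: "real \<Rightarrow> real \<Rightarrow> nat \<Rightarrow> nat \<Rightarrow> (nat + nat) list" where
  "mode_list a b N0 M0 =
     concat (map (\<lambda>i. [Inl (perm1 a b N0 ! i), Inr (perm2 a b M0 ! i)]) [0..<card (Delta a b)])
     @ map (\<lambda>i. Inl (perm1 a b N0 ! i)) [card (Delta a b)..<N0 + 1]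
     @ map (\<lambda>i. Inr (perm2 a b M0 ! i)) [card (Delta a b)..<M0 + 1]"

lemma modal_vec_eq: "modal_vec a b N0 M0 w1 w2 = vec_of_list (map (case_sum w1 w2) (mode_list a b N0 M0))"
  by (simp add: modal_vec_def mode_list_def Let_def map_concat o_def del: vec_of_list_map)

lemma vec_of_list_append: "vec_of_list (xs @ ys) = vec_of_list xs @\<^sub>v vec_of_list ys"
  by (rule eq_vecI) (auto simp: vec_of_list_index nth_append)

lemma card_Delta: "card (Delta1 a b) = card (Delta a b)" "card (Delta2 a b) = card (Delta a b)"
proof -
  have inj: "inj_on fst (Delta a b)" "inj_on snd (Delta a b)"
    using Delta_eq_iff by (fastforce simp: inj_on_def)+
  then show "card (Delta1 a b) = card (Delta a b)" "card (Delta2 a b) = card (Delta a b)"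
    by (simp_all add: Delta1_def Delta2_def card_image)
qed

text \<open>Each triple in \<open>ps\<close> consists of a block, its argument and its value.
  Working with lists of entries avoids arithmetic with block offsets.\<close>

lemma diag_block_mat_mult:
  assumes "\<And>M v v'. (M, v, v') \<in> set ps \<Longrightarrow> M \<in> carrier_mat (length v) (length v) \<and> M *\<^sub>v vec_of_list v = vec_of_list v'"
  shows "diag_block_mat (map fst ps) \<in> carrier_mat (length (concat (map (\<lambda>p. fst (snd p)) ps))) (length (concat (map (\<lambda>p. fst (snd p)) ps))) \<and>
    diag_block_mat (map fst ps) *\<^sub>v vec_of_list (concat (map (\<lambda>p. fst (snd p)) ps)) = vec_of_list (concat (map (\<lambda>p. snd (snd p)) ps))"
  using assms
proof (induction ps)
  case Nil
  then show ?case by (auto intro!: eq_vecI)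
next
  case (Cons p ps)
  obtain M v v' where p: "p = (M, v, v')" by (cases p) auto
  define D where "D = diag_block_mat (map fst ps)"
  define w where "w = concat (map (\<lambda>p. fst (snd p)) ps)"
  have M: "M \<in> carrier_mat (length v) (length v)" "M *\<^sub>v vec_of_list v = vec_of_list v'"
    using Cons.prems[of M v v'] p by simp_all
  have D: "D \<in> carrier_mat (length w) (length w)" "D *\<^sub>v vec_of_list w = vec_of_list (concat (map (\<lambda>p. snd (snd p)) ps))"
  proof -
    have "M \<in> carrier_mat (length v) (length v) \<and> M *\<^sub>v vec_of_list v = vec_of_list v'"
      if "(M, v, v') \<in> set ps" for M v v'
      by (rule Cons.prems) (use that in simp)
    from Cons.IH[OF this] show "D \<in> carrier_mat (length w) (length w)"
      "D *\<^sub>v vec_of_list w = vec_of_list (concat (map (\<lambda>p. snd (snd p)) ps))"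
      unfolding D_def w_def by blast+
  qed
  have "diag_block_mat (map fst (p # ps)) = four_block_mat M (0\<^sub>m (length v) (length w)) (0\<^sub>m (length w) (length v)) D"
    using M(1) D(1) by (simp add: p Let_def D_def[symmetric])
  moreover have "four_block_mat M (0\<^sub>m (length v) (length w)) (0\<^sub>m (length w) (length v)) D *\<^sub>v (vec_of_list v @\<^sub>v vec_of_list w) =
      vec_of_list v' @\<^sub>v vec_of_list (concat (map (\<lambda>p. snd (snd p)) ps))"
    using mult_mat_vec_split[OF M(1) D(1), of "vec_of_list v" "vec_of_list w"] M(2) D(2) by (simp add: carrier_vecI)
  moreover have "four_block_mat M (0\<^sub>m (length v) (length w)) (0\<^sub>m (length w) (length v)) D \<in> carrier_mat (length v + length w) (length v + length w)"
    using M(1) D(1) by simp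
  ultimately show ?case by (simp add: p w_def[symmetric] vec_of_list_append)
qed

context
  fixes a b :: real and N0 M0 :: nat
  assumes D1: "\<forall>n\<in>Delta1 a b. n \<le> N0" and D2: "\<forall>m\<in>Delta2 a b. m \<le> M0"
begin

lemma length_mode_list: "length (mode_list a b N0 M0) = N0 + M0 + 2"
  using dims(1)[OF D1 D2, of "\<lambda>_. 0" "\<lambda>_. 0"] by (simp add: modal_vec_eq del: vec_of_list_map)

lemma perm_props:
  "length (perm1 a b N0) = N0 + 1" "set (perm1 a b N0) = {..N0}" "distinct (perm1 a b N0)"
  "length (perm2 a b M0) = M0 + 1" "set (perm2 a b M0) = {..M0}" "distinct (perm2 a b M0)"
proof -
  have s: "Delta1 a b \<subseteq> {0..N0}" "Delta2 a b \<subseteq> {0..M0}" using D1 D2 by auto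
  have c: "card ({0..N0} - Delta1 a b) + card (Delta1 a b) = N0 + 1"
    using s(1) card_mono[OF _ s(1)] by (simp add: card_Diff_subset finite_Delta12)
  have c': "card ({0..M0} - Delta2 a b) + card (Delta2 a b) = M0 + 1"
    using s(2) card_mono[OF _ s(2)] by (simp add: card_Diff_subset finite_Delta12)
  show "length (perm1 a b N0) = N0 + 1" "length (perm2 a b M0) = M0 + 1"
    using c c' by (simp_all add: perm1_def perm2_def)
  show "set (perm1 a b N0) = {..N0}" "distinct (perm1 a b N0)"
    using s by (auto simp: perm1_def finite_Delta12)
  show "set (perm2 a b M0) = {..M0}" "distinct (perm2 a b M0)"
    using s by (auto simp: perm2_def finite_Delta12)
qed

lemma card_Delta_le: "card (Delta a b) \<le> N0 + 1" "card (Delta a b) \<le> M0 + 1"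
  using perm_props(1,4) card_Delta[of a b] unfolding perm1_def perm2_def by simp_all

text \<open>Every slow mode occurs exactly once, so sums over entries are independent of the
  ordering.\<close>

lemma sum_mode_list:
  fixes f :: "nat + nat \<Rightarrow> real"
  shows "(\<Sum>i<N0 + M0 + 2. f (mode_list a b N0 M0 ! i)) = (\<Sum>n\<le>N0. f (Inl n)) + (\<Sum>m\<le>M0. f (Inr m))"
proof -
  let ?d = "card (Delta a b)"
  have "(\<Sum>i<N0 + M0 + 2. f (mode_list a b N0 M0 ! i)) = sum_list (map f (mode_list a b N0 M0))"
    by (simp add: sum_list_sum_nth length_mode_list atLeast0LessThan)
  also have "\<dots> = (\<Sum>i<?d. f (Inl (perm1 a b N0 ! i)) + f (Inr (perm2 a b M0 ! i)))
      + (\<Sum>i\<in>{?d..<N0 + 1}. f (Inl (perm1 a b N0 ! i))) + (\<Sum>i\<in>{?d..<M0 + 1}. f (Inr (perm2 a b M0 ! i)))"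
  proof -
    have 1: "sum_list (map f (concat (map (\<lambda>i. [Inl (g i), Inr (h i)]) xs))) = (\<Sum>i\<leftarrow>xs. f (Inl (g i)) + f (Inr (h i)))"
      for g h :: "nat \<Rightarrow> nat" and xs by (induction xs) auto
    show ?thesis
      unfolding mode_list_def map_append sum_list_append 1
      by (simp only: map_map o_def interv_sum_list_conv_sum_set_nat set_upt atLeast0LessThan add.assoc)
  qed
  also have "\<dots> = (\<Sum>i<N0 + 1. f (Inl (perm1 a b N0 ! i))) + (\<Sum>i<M0 + 1. f (Inr (perm2 a b M0 ! i)))"
  proof -
    have split: "{..<N0 + 1} = {..<?d} \<union> {?d..<N0 + 1}" "{..<M0 + 1} = {..<?d} \<union> {?d..<M0 + 1}"
      using card_Delta_le by auto
    show ?thesis unfolding split by (subst (1 2) sum.union_disjoint) (auto simp: sum.distrib)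
  qed
  also have "(\<Sum>i<N0 + 1. f (Inl (perm1 a b N0 ! i))) = (\<Sum>n\<le>N0. f (Inl n))"
    using sum_list_distinct_conv_sum_set[OF perm_props(3), of "\<lambda>n. f (Inl n)"] perm_props(1,2)
    by (simp add: sum_list_sum_nth atLeast0LessThan)
  also have "(\<Sum>i<M0 + 1. f (Inr (perm2 a b M0 ! i))) = (\<Sum>m\<le>M0. f (Inr m))"
    using sum_list_distinct_conv_sum_set[OF perm_props(6), of "\<lambda>n. f (Inr n)"] perm_props(4,5)
    by (simp add: sum_list_sum_nth atLeast0LessThan)
  finally show ?thesis .
qed

lemma modal_vec_index:
  "i < N0 + M0 + 2 \<Longrightarrow> modal_vec a b N0 M0 w1 w2 $ i = case_sum w1 w2 (mode_list a b N0 M0 ! i)"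
  by (simp add: modal_vec_eq vec_of_list_index length_mode_list del: vec_of_list_map)

lemma set_mode_list: "set (mode_list a b N0 M0) \<subseteq> Inl ` {..N0} \<union> Inr ` {..M0}"
proof -
  have "perm1 a b N0 ! i \<le> N0" if "i < N0 + 1" for i
    using nth_mem[of i "perm1 a b N0"] that perm_props(1,2) by simp
  moreover have "perm2 a b M0 ! i \<le> M0" if "i < M0 + 1" for i
    using nth_mem[of i "perm2 a b M0"] that perm_props(4,5) by simp
  ultimately show ?thesis
    using card_Delta_le unfolding mode_list_def by fastforce
qed

lemma mode_list_nth_cases:
  assumes "i < N0 + M0 + 2"
  obtains n where "n \<le> N0" "mode_list a b N0 M0 ! i = Inl n" | m where "m \<le> M0" "mode_list a b N0 M0 ! i = Inr m"
  using nth_mem[of i "mode_list a b N0 M0"] set_mode_list assms length_mode_list by fastforce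

lemma perm_nth_low:
  assumes "i < card (Delta a b)"
  shows "(perm1 a b N0 ! i, perm2 a b M0 ! i) \<in> Delta a b"
  using assms unfolding perm1_def perm2_def
  by (subst Delta_enumeration) (auto simp: nth_append card_Delta)

lemma perm_nth_high:
  "i \<ge> card (Delta a b) \<Longrightarrow> i < N0 + 1 \<Longrightarrow> perm1 a b N0 ! i \<notin> Delta1 a b"
proof -
  assume i: "i \<ge> card (Delta a b)" "i < N0 + 1"
  have "perm1 a b N0 ! i = sorted_list_of_set ({0..N0} - Delta1 a b) ! (i - card (Delta a b))"
    using i by (simp add: perm1_def nth_append card_Delta)
  also have "\<dots> \<in> set (sorted_list_of_set ({0..N0} - Delta1 a b))"
    using i perm_props(1) by (intro nth_mem) (simp add: perm1_def card_Delta)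
  finally show ?thesis by simp
qed

text \<open>The matrix of the truncated model acts on modal vectors exactly as the modal equations
  prescribe; in the Jordan blocks \<open>x1 n\<close> is followed by its partner.\<close>

lemma matA1_mult_modal_vec:
  "matA1 a b s N0 M0 *\<^sub>v modal_vec a b N0 M0 w1 w2 =
     modal_vec a b N0 M0 (\<lambda>n. lam1 a n * w1 n - jordan_coupling a b s n * w2 (partner2 a b n)) (\<lambda>m. lam2 b m * w2 m)"
proof -
  let ?d = "card (Delta a b)"
  define w1' where "w1' n = lam1 a n * w1 n - jordan_coupling a b s n * w2 (partner2 a b n)" for n
  define w2' where "w2' m = lam2 b m * w2 m" for m
  define p where "p i = perm1 a b N0 ! i" for i
  define q where "q i = perm2 a b M0 ! i" for i
  define ps where "ps = map (\<lambda>i. (jordan_block2 a s (p i) (q i), [w1 (p i), w2 (q i)], [w1' (p i), w2' (q i)])) [0..<?d]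
     @ map (\<lambda>i. (mat_of_rows_list 1 [[lam1 a (p i)]], [w1 (p i)], [w1' (p i)])) [?d..<N0 + 1]
     @ map (\<lambda>i. (mat_of_rows_list 1 [[lam2 b (q i)]], [w2 (q i)], [w2' (q i)])) [?d..<M0 + 1]"
  have one: "mat_of_rows_list 1 [[r]] \<in> carrier_mat (length [x]) (length [x]) \<and> mat_of_rows_list 1 [[r]] *\<^sub>v vec_of_list [x] = vec_of_list [r * x]"
    for r x :: real
    by (auto simp: mat_of_rows_list_def scalar_prod_def intro!: eq_vecI)
  have "M \<in> carrier_mat (length v) (length v) \<and> M *\<^sub>v vec_of_list v = vec_of_list v'" if "(M, v, v') \<in> set ps" for M v v'
  proof -
    have "(\<exists>i. i < ?d \<and> M = jordan_block2 a s (p i) (q i) \<and> v = [w1 (p i), w2 (q i)] \<and> v' = [w1' (p i), w2' (q i)])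
      \<or> (\<exists>i. ?d \<le> i \<and> i < N0 + 1 \<and> M = mat_of_rows_list 1 [[lam1 a (p i)]] \<and> v = [w1 (p i)] \<and> v' = [w1' (p i)])
      \<or> (\<exists>i. M = mat_of_rows_list 1 [[lam2 b (q i)]] \<and> v = [w2 (q i)] \<and> v' = [w2' (q i)])"
      using that unfolding ps_def by auto
    then consider i where "i < ?d" "M = jordan_block2 a s (p i) (q i)" "v = [w1 (p i), w2 (q i)]" "v' = [w1' (p i), w2' (q i)]"
      | i where "?d \<le> i" "i < N0 + 1" "M = mat_of_rows_list 1 [[lam1 a (p i)]]" "v = [w1 (p i)]" "v' = [w1' (p i)]"
      | i where "M = mat_of_rows_list 1 [[lam2 b (q i)]]" "v = [w2 (q i)]" "v' = [w2' (q i)]"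
      by blast
    then show ?thesis
    proof cases
      case 1
      note D = perm_nth_low[OF 1(1), folded p_def q_def]
      have j: "jordan_coupling a b s (p i) = sqrt 2 * s * mu (q i)" "partner2 a b (p i) = q i" "lam2 b (q i) = lam1 a (p i)"
        using partner_eq[OF D] D by (simp_all add: jordan_coupling_def Delta_iff_lam_eq)
      have "jordan_block2 a s (p i) (q i) *\<^sub>v vec_of_list [w1 (p i), w2 (q i)] = vec_of_list [w1' (p i), w2' (q i)]"
        unfolding jordan_block2_def w1'_def w2'_def j
        by (rule eq_vecI) (auto simp: mat_of_rows_list_def scalar_prod_def vec_of_list_index less_Suc_eq numeral_2_eq_2)
      moreover have "jordan_block2 a s (p i) (q i) \<in> carrier_mat 2 2"
        by (simp add: jordan_block2_def mat_of_rows_list_def numeral_2_eq_2)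
      ultimately show ?thesis by (simp add: 1 numeral_2_eq_2)
    next
      case 2
      have "w1' (p i) = lam1 a (p i) * w1 (p i)"
        using perm_nth_high[OF 2(1,2), folded p_def] by (simp add: w1'_def jordan_coupling_def)
      then show ?thesis using one[of "lam1 a (p i)" "w1 (p i)"] unfolding 2(3-5) by simp
    next
      case 3
      then show ?thesis using one[of "lam2 b (q i)" "w2 (q i)"] unfolding 3 w2'_def by simp
    qed
  qed
  from diag_block_mat_mult[OF this]
  have "diag_block_mat (map fst ps) *\<^sub>v vec_of_list (concat (map (\<lambda>p. fst (snd p)) ps)) = vec_of_list (concat (map (\<lambda>p. snd (snd p)) ps))"
    by blast
  moreover have "diag_block_mat (map fst ps) = matA1 a b s N0 M0"
    by (simp add: ps_def matA1_def Let_def o_def p_def q_def)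
  moreover have "vec_of_list (concat (map (\<lambda>p. fst (snd p)) ps)) = modal_vec a b N0 M0 w1 w2"
    "vec_of_list (concat (map (\<lambda>p. snd (snd p)) ps)) = modal_vec a b N0 M0 w1' w2'"
    by (simp_all add: ps_def modal_vec_def Let_def o_def p_def q_def concat_map_singleton del: vec_of_list_map)
  ultimately show ?thesis by (simp add: w1'_def[abs_def] w2'_def[abs_def])
qed

lemma modal_vec_carrier: "modal_vec a b N0 M0 w1 w2 \<in> carrier_vec (N0 + M0 + 2)"
  using dims(1)[OF D1 D2] by (rule carrier_vecI)

lemma vecC1_mult_modal_vec:
  "vecC1 a b s c N0 M0 \<bullet> modal_vec a b N0 M0 w1 w2 = (\<Sum>n\<le>N0. c1 c n * w1 n) + (\<Sum>m\<le>M0. c2 a b s c m * w2 m)"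
proof -
  have "vecC1 a b s c N0 M0 \<bullet> modal_vec a b N0 M0 w1 w2 =
     (\<Sum>i<N0 + M0 + 2. vecC1 a b s c N0 M0 $ i * modal_vec a b N0 M0 w1 w2 $ i)"
    using modal_vec_carrier[of w1 w2] by (simp add: scalar_prod_def atLeast0LessThan)
  also have "\<dots> = (\<Sum>i<N0 + M0 + 2. (\<lambda>k. case_sum (c1 c) (c2 a b s c) k * case_sum w1 w2 k) (mode_list a b N0 M0 ! i))"
    by (intro sum.cong refl) (simp add: vecC1_def modal_vec_index)
  also have "\<dots> = (\<Sum>n\<le>N0. c1 c n * w1 n) + (\<Sum>m\<le>M0. c2 a b s c m * w2 m)"
    by (subst sum_mode_list) simp
  finally show ?thesis .
qed

lemma sum_abs_modal_vec:
  "(\<Sum>i<N0 + M0 + 2. \<bar>modal_vec a b N0 M0 w1 w2 $ i\<bar>) = (\<Sum>n\<le>N0. \<bar>w1 n\<bar>) + (\<Sum>m\<le>M0. \<bar>w2 m\<bar>)"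
proof -
  have "(\<Sum>i<N0 + M0 + 2. \<bar>modal_vec a b N0 M0 w1 w2 $ i\<bar>) = (\<Sum>i<N0 + M0 + 2. (\<lambda>k. \<bar>case_sum w1 w2 k\<bar>) (mode_list a b N0 M0 ! i))"
    by (intro sum.cong refl) (simp add: modal_vec_index)
  also have "\<dots> = (\<Sum>n\<le>N0. \<bar>w1 n\<bar>) + (\<Sum>m\<le>M0. \<bar>w2 m\<bar>)"
    by (subst sum_mode_list) simp
  finally show ?thesis .
qed

text \<open>The entries of the two Hurwitz matrices, in the form in which they arise when the
  equations of the loop are written out in components.\<close>

lemma observer_matrix_index:
  assumes "L \<in> carrier_vec (N0 + M0 + 2)" "i < N0 + M0 + 2" "j < N0 + M0 + 2"
  shows "(matA1 a b s N0 M0 - col_mat L * row_mat (vecC1 a b s c N0 M0)) $$ (i, j) =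
    matA1 a b s N0 M0 $$ (i, j) - L $ i * vecC1 a b s c N0 M0 $ j"
    and "matA1 a b s N0 M0 - col_mat L * row_mat (vecC1 a b s c N0 M0) \<in> carrier_mat (N0 + M0 + 2) (N0 + M0 + 2)"
proof -
  have c: "vecC1 a b s c N0 M0 \<in> carrier_vec (N0 + M0 + 2)" unfolding vecC1_def by (rule modal_vec_carrier)
  note A = dims(2)[OF D1 D2, of s]
  have "(col_mat L * row_mat (vecC1 a b s c N0 M0)) $$ (i, j) = L $ i * vecC1 a b s c N0 M0 $ j"
    using assms c by (simp add: col_mat_def row_mat_def scalar_prod_def mat_of_cols_index mat_of_rows_index)
  then show "(matA1 a b s N0 M0 - col_mat L * row_mat (vecC1 a b s c N0 M0)) $$ (i, j) =
    matA1 a b s N0 M0 $$ (i, j) - L $ i * vecC1 a b s c N0 M0 $ j"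
    using assms c A by (simp add: col_mat_def row_mat_def)
  show "matA1 a b s N0 M0 - col_mat L * row_mat (vecC1 a b s c N0 M0) \<in> carrier_mat (N0 + M0 + 2) (N0 + M0 + 2)"
    using assms c A by (auto simp: col_mat_def row_mat_def)
qed

lemma controller_matrix_index:
  fixes s ku :: real
  assumes K: "Kx \<in> carrier_vec (N0 + M0 + 2)"
  defines "n \<equiv> N0 + M0 + 2"
  defines "A \<equiv> matA1a a b s N0 M0 - matB1a a b s N0 M0 * matK Kx ku"
  shows "A \<in> carrier_mat (n + 1) (n + 1)"
    and "i < n \<Longrightarrow> j < n \<Longrightarrow> A $$ (i, j) = matA1 a b s N0 M0 $$ (i, j) - vecB1v a b s N0 M0 $ i * Kx $ j"
    and "i < n \<Longrightarrow> A $$ (i, n) = vecB1u a b s N0 M0 $ i - vecB1v a b s N0 M0 $ i * ku"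
    and "j < n \<Longrightarrow> A $$ (n, j) = - (Kx $ j)"
    and "A $$ (n, n) = - ku"
proof -
  have u: "vecB1u a b s N0 M0 \<in> carrier_vec n" unfolding vecB1u_def n_def by (rule modal_vec_carrier)
  have v: "vecB1v a b s N0 M0 \<in> carrier_vec n" unfolding vecB1v_def n_def by (rule modal_vec_carrier)
  note A1 = dims(2)[OF D1 D2, of s, folded n_def]
  have B: "matB1a a b s N0 M0 \<in> carrier_mat (n + 1) 1" using v by (intro carrier_matI) (simp_all add: matB1a_def col_mat_def)
  have Km: "matK Kx ku \<in> carrier_mat 1 (n + 1)" using K by (intro carrier_matI) (simp_all add: matK_def row_mat_def n_def)
  have Aa: "matA1a a b s N0 M0 \<in> carrier_mat (n + 1) (n + 1)"
    using A1 unfolding matA1a_def by (rule four_block_carrier_mat) simp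
  show "A \<in> carrier_mat (n + 1) (n + 1)" using mult_carrier_mat[OF B Km] unfolding A_def by (rule minus_carrier_mat)
  have BK: "(matB1a a b s N0 M0 * matK Kx ku) $$ (i, j) =
      (vecB1v a b s N0 M0 @\<^sub>v vec_of_list [1]) $ i * (Kx @\<^sub>v vec_of_list [ku]) $ j" if "i < n + 1" "j < n + 1" for i j
    using that v K B Km
    by (simp add: scalar_prod_def matB1a_def matK_def col_mat_def row_mat_def mat_of_cols_index mat_of_rows_index n_def)
  have idx: "A $$ (i, j) = matA1a a b s N0 M0 $$ (i, j) - (vecB1v a b s N0 M0 @\<^sub>v vec_of_list [1]) $ i * (Kx @\<^sub>v vec_of_list [ku]) $ j"
    if "i < n + 1" "j < n + 1" for i j
    using that B Km Aa unfolding A_def BK[OF that, symmetric] by simp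
  have dK: "dim_vec Kx = n" using K by (simp add: n_def)
  have dc: "col_mat (vecB1u a b s N0 M0) \<in> carrier_mat n 1" using u by (intro carrier_matI) (simp_all add: col_mat_def)
  have z: "0\<^sub>m 1 (N0 + M0 + 2) $$ (0, j) = 0" if "j < n" for j using that by (simp add: n_def)
  show "i < n \<Longrightarrow> j < n \<Longrightarrow> A $$ (i, j) = matA1 a b s N0 M0 $$ (i, j) - vecB1v a b s N0 M0 $ i * Kx $ j"
    "i < n \<Longrightarrow> A $$ (i, n) = vecB1u a b s N0 M0 $ i - vecB1v a b s N0 M0 $ i * ku"
    "j < n \<Longrightarrow> A $$ (n, j) = - (Kx $ j)" "A $$ (n, n) = - ku"
    using A1 v u dK dc z
    by (simp_all add: idx matA1a_def col_mat_def mat_of_cols_index vec_of_list_index n_def[symmetric])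
qed

end


section \<open>Modal equations of mild solutions\<close>

lemma halpha_eq: "halpha b = (\<lambda>x. - 1 + b * (x - x\<^sup>2 / 2))"
proof
  fix x
  have "deriv hphi = (\<lambda>x. 1 - x)"
    unfolding hphi_def by (intro ext DERIV_imp_deriv) (auto intro!: derivative_eq_intros)
  moreover have "deriv (\<lambda>x::real. 1 - x) x = - 1"
    by (rule DERIV_imp_deriv) (auto intro!: derivative_eq_intros)
  ultimately show "halpha b x = - 1 + b * (x - x\<^sup>2 / 2)" by (simp add: halpha_def hphi_def)
qed

lemma L2I_hphi: "hphi \<in> L2I" "hbeta \<in> L2I" "halpha b \<in> L2I"
  unfolding halpha_eq hbeta_def hphi_def by (intro L2I_continuous continuous_intros; simp)+

lemma psi1_eq: "psi1 a b s n = (phi1 n, psi1_snd a b s n)"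
  by (simp add: psi1_def phi1_def fun_eq_iff)

lemma psi2_eq: "psi2 m = (\<lambda>x. 0, ecos m)"
  by (simp add: psi2_def ecos_def fun_eq_iff)

lemma L2I_zero: "(\<lambda>x. 0) \<in> L2I" by (simp add: L2I_def)

lemma psi_H0: "psi1 a b s n \<in> H0" "psi2 m \<in> H0"
  by (simp_all add: psi1_eq psi2_eq H0_def L2I_modes L2I_zero)

lemma H0_inner_psi:
  assumes "X \<in> H0"
  shows "H0_inner X (psi1 a b s n) = mode1 a b s (fst X) (snd X) n"
    and "H0_inner X (psi2 m) = ip (snd X) (ecos m)"
  using assms by (auto simp: H0_def psi1_eq psi2_eq H0_inner_eq L2I_modes L2I_zero mode1_def)

lemma mode1_add:
  "f \<in> L2I \<Longrightarrow> f' \<in> L2I \<Longrightarrow> g \<in> L2I \<Longrightarrow> g' \<in> L2I \<Longrightarrow>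
   mode1 a b s (\<lambda>x. f x + f' x) (\<lambda>x. g x + g' x) n = mode1 a b s f g n + mode1 a b s f' g' n"
  by (simp add: mode1_def ip_add_left L2I_modes)

lemma mode1_cong:
  "f \<in> L2I \<Longrightarrow> f' \<in> L2I \<Longrightarrow> g \<in> L2I \<Longrightarrow> g' \<in> L2I \<Longrightarrow> eqI f f' \<Longrightarrow> eqI g g' \<Longrightarrow>
   mode1 a b s f g n = mode1 a b s f' g' n"
  unfolding mode1_def by (intro arg_cong2[of _ _ _ _ "(+)"] ip_cong_AE L2I_modes eqI_refl)

text \<open>A mild solution satisfies an integrated equation. Testing it yields scalar integral
  equations with continuous integrands, which may be differentiated.\<close>

lemma derivative_if_has_integral:
  fixes x h :: "real \<Rightarrow> real"
  assumes I: "\<And>t. t \<ge> 0 \<Longrightarrow> (h has_integral (x t - x0)) {0..t}" and c: "continuous_on {0..} h"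
  shows "x 0 = x0" and "t \<ge> 0 \<Longrightarrow> (x has_real_derivative h t) (at t within {0..})"
proof -
  show "x 0 = x0" using integral_unique[OF I[of 0]] by simp
  assume t: "t \<ge> 0"
  have x: "x \<tau> = x0 + integral {0..\<tau>} h" if "\<tau> \<ge> 0" for \<tau>
    using integral_unique[OF I[OF that]] by simp
  have "((\<lambda>\<tau>. integral {0..\<tau>} h) has_real_derivative h t) (at t within {0..t + 1})"
    by (rule integral_has_real_derivative) (use t c in \<open>auto intro: continuous_on_subset\<close>)
  then have "((\<lambda>\<tau>. x0 + integral {0..\<tau>} h) has_real_derivative h t) (at t within {0..t + 1})"
    by (auto intro!: derivative_eq_intros)
  then have "(x has_real_derivative h t) (at t within {0..t + 1})"
    by (rule has_field_derivative_transform_within[where d=1]) (use t x in auto)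
  moreover have "at t within {0..t + 1} = at t within {0..}"
    by (rule at_within_nhd[of t "{..<t + 1}"]) auto
  ultimately show "(x has_real_derivative h t) (at t within {0..})" by simp
qed

text \<open>Testing the integrated equation with \<^const>\<open>psi1\<close> and
  \<^const>\<open>psi2\<close> moves the operator, which acts on the time integral of the
  solution, to the eigenvectors of the adjoint. The pairing with the time integral is the time
  integral of the modal coordinate, so an integral equation for each coordinate results.\<close>

lemma mild_solution_modes:
  assumes mild: "mild_solution (opA a b s) (\<lambda>t. ((\<lambda>x. 0), (\<lambda>x. halpha b x * u t + hbeta x * v t))) X0 X"
    and X0: "X0 \<in> H0" and u: "continuous_on {0..} u" and v: "continuous_on {0..} v"
  shows "t \<ge> 0 \<Longrightarrow> X t \<in> H0"
    and "mode1 a b s (fst (X 0)) (snd (X 0)) n = mode1 a b s (fst X0) (snd X0) n"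
    and "t \<ge> 0 \<Longrightarrow> ((\<lambda>\<tau>. mode1 a b s (fst (X \<tau>)) (snd (X \<tau>)) n) has_real_derivative
       lam1 a n * mode1 a b s (fst (X t)) (snd (X t)) n - jordan_coupling a b s n * ip (snd (X t)) (ecos (partner2 a b n))
       + alpha1 a b s n * u t + beta1 a b s n * v t) (at t within {0..})"
    and "ip (snd (X 0)) (ecos m) = ip (snd X0) (ecos m)"
    and "t \<ge> 0 \<Longrightarrow> ((\<lambda>\<tau>. ip (snd (X \<tau>)) (ecos m)) has_real_derivative
       lam2 b m * ip (snd (X t)) (ecos m) + alpha2 b m * u t + beta2 m * v t) (at t within {0..})"
proof -
  define F where "F t = ((\<lambda>x. 0) :: real \<Rightarrow> real, (\<lambda>x. halpha b x * u t + hbeta x * v t))" for t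
  define x1 where "x1 t = mode1 a b s (fst (X t)) (snd (X t)) n" for t
  define x2 where "x2 m t = ip (snd (X t)) (ecos m)" for m t
  have XH: "X t \<in> H0" if "t \<ge> 0" for t using mild that by (simp add: mild_solution_def)
  then show "t \<ge> 0 \<Longrightarrow> X t \<in> H0" .
  have XL: "fst (X t) \<in> L2I" "snd (X t) \<in> L2I" if "t \<ge> 0" for t using XH[OF that] by (auto simp: H0_def)
  \<comment> \<open>Continuity of the trajectory in norm gives continuity of all pairings.\<close>
  have cont: "continuous_on {0..} (\<lambda>t. H0_inner (X t) H)" if H: "H \<in> H0" for H
    unfolding continuous_on_def
  proof
    fix t :: real assume "t \<in> {0..}"
    then have t: "t \<ge> 0" by simp
    have HL: "fst H \<in> L2I" "snd H \<in> L2I" using H by (auto simp: H0_def)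
    define B where "B = H0_normsq H"
    have "((\<lambda>\<tau>. H0_normsq (diff_state (X \<tau>) (X t))) \<longlongrightarrow> 0) (at t within {0..})"
      using mild t by (simp add: mild_solution_def)
    then have "((\<lambda>\<tau>. sqrt (2 * H0_normsq (diff_state (X \<tau>) (X t)) * B)) \<longlongrightarrow> sqrt (2 * 0 * B)) (at t within {0..})"
      by (intro tendsto_intros)
    then have lim: "((\<lambda>\<tau>. sqrt (2 * H0_normsq (diff_state (X \<tau>) (X t)) * B)) \<longlongrightarrow> 0) (at t within {0..})" by simp
    have "\<forall>\<^sub>F \<tau> in at t within {0..}. norm (H0_inner (X \<tau>) H - H0_inner (X t) H) \<le> sqrt (2 * H0_normsq (diff_state (X \<tau>) (X t)) * B)"
    proof (rule eventually_at_topological[THEN iffD2], intro exI[of _ UNIV] conjI ballI impI)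
      fix \<tau> :: real assume "\<tau> \<in> {0..}"
      then have \<tau>: "\<tau> \<ge> 0" by simp
      define f where "f x = fst (X \<tau>) x - fst (X t) x" for x
      define g where "g x = snd (X \<tau>) x - snd (X t) x" for x
      have L: "f \<in> L2I" "g \<in> L2I" unfolding f_def g_def by (intro L2I_diff XL \<tau> t)+
      have N: "H0_normsq (diff_state (X \<tau>) (X t)) = nsq f + nsq g"
        unfolding H0_normsq_def using L by (subst H0_inner_eq) (simp_all add: diff_state_def f_def[abs_def] g_def[abs_def])
      have B: "B = nsq (fst H) + nsq (snd H)" unfolding B_def H0_normsq_def by (rule H0_inner_eq; rule HL)
      have "H0_inner (X \<tau>) H - H0_inner (X t) H = ip f (fst H) + ip g (snd H)"
        unfolding f_def g_def using XL[OF \<tau>] XL[OF t] HL by (simp add: H0_inner_eq ip_diff_left)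
      moreover have "(ip f (fst H) + ip g (snd H))\<^sup>2 \<le> 2 * (nsq f + nsq g) * B"
      proof -
        have "(p + q)\<^sup>2 \<le> 2 * (p\<^sup>2 + q\<^sup>2)" for p q :: real
          using sum_squares_bound[of p q] by (simp add: power2_sum)
        then have "(ip f (fst H) + ip g (snd H))\<^sup>2 \<le> 2 * ((ip f (fst H))\<^sup>2 + (ip g (snd H))\<^sup>2)" .
        also have "\<dots> \<le> 2 * (nsq f * nsq (fst H) + nsq g * nsq (snd H))"
          using Cauchy_Schwarz_ip[OF L(1) HL(1)] Cauchy_Schwarz_ip[OF L(2) HL(2)] by simp
        also have "\<dots> \<le> 2 * (nsq f + nsq g) * B"
          using mult_nonneg_nonneg[OF nsq_nonneg[of f] nsq_nonneg[of "snd H"]] mult_nonneg_nonneg[OF nsq_nonneg[of g] nsq_nonneg[of "fst H"]]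
          by (simp add: B algebra_simps)
        finally show ?thesis .
      qed
      ultimately show "norm (H0_inner (X \<tau>) H - H0_inner (X t) H) \<le> sqrt (2 * H0_normsq (diff_state (X \<tau>) (X t)) * B)"
        by (simp add: N real_le_rsqrt)
    qed auto
    from LIM_zero_cancel[OF Lim_null_comparison[OF this lim]]
    show "((\<lambda>t. H0_inner (X t) H) \<longlongrightarrow> H0_inner (X t) H) (at t within {0..})" .
  qed
  have c1: "continuous_on {0..} x1"
    using cont[OF psi_H0(1)[of a b s n]] by (subst continuous_on_cong[OF refl]) (auto simp: x1_def H0_inner_psi XH)
  have c2: "continuous_on {0..} (x2 m)" for m
    using cont[OF psi_H0(2)[of m]] by (subst continuous_on_cong[OF refl]) (auto simp: x2_def H0_inner_psi XH)
  have FH: "F t \<in> H0" for t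
    unfolding F_def H0_def by (auto intro!: L2I_zero L2I_add L2I_scale_right L2I_hphi)
  have al: "alpha1 a b s n = ip (halpha b) (psi1_snd a b s n)" "beta1 a b s n = ip hbeta (psi1_snd a b s n)"
    "alpha2 b m = ip (halpha b) (ecos m)" "beta2 m = ip hbeta (ecos m)" for m
    unfolding alpha1_def beta1_def alpha2_def beta2_def
    by (subst H0_inner_psi; simp add: H0_def L2I_hphi L2I_zero mode1_def)+
  have F1: "H0_inner (F t) (psi1 a b s n) = alpha1 a b s n * u t + beta1 a b s n * v t" for t
    unfolding H0_inner_psi[OF FH] al mode1_def
    by (simp add: F_def ip_add_left L2I_hphi L2I_modes mult.commute[of _ "u t"] mult.commute[of _ "v t"] ip_scale_left
        L2I_scale)
  have F2: "H0_inner (F t) (psi2 m) = alpha2 b m * u t + beta2 m * v t" for t m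
    unfolding H0_inner_psi[OF FH] al
    by (simp add: F_def ip_add_left L2I_hphi L2I_modes mult.commute[of _ "u t"] mult.commute[of _ "v t"] ip_scale_left
        L2I_scale)
  have main: "((\<lambda>\<tau>. lam1 a n * x1 \<tau> - jordan_coupling a b s n * x2 (partner2 a b n) \<tau> + (alpha1 a b s n * u \<tau> + beta1 a b s n * v \<tau>))
      has_integral (x1 t - mode1 a b s (fst X0) (snd X0) n)) {0..t} \<and>
     ((\<lambda>\<tau>. lam2 b m * x2 m \<tau> + (alpha2 b m * u \<tau> + beta2 m * v \<tau>)) has_integral (x2 m t - ip (snd X0) (ecos m))) {0..t}"
    if t: "t \<ge> 0" for t m
  proof -
    obtain W V G where W: "has_H0_integral X W t" and AW: "opA a b s W V" and G: "has_H0_integral F G t"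
      and eq: "eq_state (X t) (add_state X0 (add_state V G))"
      using mild t unfolding mild_solution_def F_def by blast
    obtain f f' f'' g g' g'' where f: "has_L2_deriv2 f f' f''" and g: "has_L2_deriv2 g g' g''"
      and bc: "f 1 = 0" "g' 0 = 0" "g' 1 = 0" "f' 0 = s * g 0"
      and eW: "eq_state W (f, g)" and eV: "eq_state V ((\<lambda>x. f'' x + a * f x), (\<lambda>x. g'' x + b * g x))"
      using AW unfolding opA_def by blast
    have WH: "W \<in> H0" and GH: "G \<in> H0" using W G by (simp_all add: has_H0_integral_def)
    have fg: "f \<in> L2I" "g \<in> L2I" "f'' \<in> L2I" "g'' \<in> L2I"
      using f g unfolding has_L2_deriv2_def by (auto intro: has_L2_deriv_L2I has_L2_derivD_L2I)
    define p where "p x = f'' x + a * f x" for x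
    define q where "q x = g'' x + b * g x" for x
    have pq: "p \<in> L2I" "q \<in> L2I" unfolding p_def q_def by (intro L2I_add L2I_scale fg)+
    have L: "fst X0 \<in> L2I" "snd X0 \<in> L2I" "fst G \<in> L2I" "snd G \<in> L2I" "fst W \<in> L2I" "snd W \<in> L2I"
      using X0 GH WH by (auto simp: H0_def)
    have e1: "eqI (fst (X t)) (\<lambda>x. fst X0 x + (p x + fst G x))"
    proof -
      have "eqI (\<lambda>x. fst X0 x + (fst V x + fst G x)) (\<lambda>x. fst X0 x + (p x + fst G x))"
        using eV unfolding eq_state_def p_def by (intro eqI_add eqI_refl) simp
      then show ?thesis using eq unfolding eq_state_def add_state_def by (auto intro: eqI_trans)
    qed
    have e2: "eqI (snd (X t)) (\<lambda>x. snd X0 x + (q x + snd G x))"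
    proof -
      have "eqI (\<lambda>x. snd X0 x + (snd V x + snd G x)) (\<lambda>x. snd X0 x + (q x + snd G x))"
        using eV unfolding eq_state_def q_def by (intro eqI_add eqI_refl) simp
      then show ?thesis using eq unfolding eq_state_def add_state_def by (auto intro: eqI_trans)
    qed
    have ew: "eqI (fst W) f" "eqI (snd W) g" using eW by (simp_all add: eq_state_def)
    have "x1 t = mode1 a b s (\<lambda>x. fst X0 x + (p x + fst G x)) (\<lambda>x. snd X0 x + (q x + snd G x)) n"
      unfolding x1_def by (intro mode1_cong XL t L2I_add L pq e1 e2)
    also have "\<dots> = mode1 a b s (fst X0) (snd X0) n + (mode1 a b s p q n + mode1 a b s (fst G) (snd G) n)"
      by (simp add: mode1_add L pq L2I_add)
    also have "mode1 a b s p q n = lam1 a n * mode1 a b s f g n - jordan_coupling a b s n * ip g (ecos (partner2 a b n))"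
      using ip_psi1_opA[OF f g bc, of a n b] by (simp add: mode1_def p_def[abs_def] q_def[abs_def])
    also have "mode1 a b s f g n = H0_inner W (psi1 a b s n)"
      unfolding H0_inner_psi[OF WH] by (intro mode1_cong[symmetric] fg L ew)
    also have "ip g (ecos (partner2 a b n)) = H0_inner W (psi2 (partner2 a b n))"
      unfolding H0_inner_psi[OF WH] by (intro ip_cong_AE[symmetric] fg L ew L2I_modes eqI_refl)
    also have "mode1 a b s (fst G) (snd G) n = H0_inner G (psi1 a b s n)" by (simp add: H0_inner_psi[OF GH])
    finally have v1: "x1 t - mode1 a b s (fst X0) (snd X0) n =
       lam1 a n * H0_inner W (psi1 a b s n) - jordan_coupling a b s n * H0_inner W (psi2 (partner2 a b n)) + H0_inner G (psi1 a b s n)" by simp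
    have "x2 m t = ip (\<lambda>x. snd X0 x + (q x + snd G x)) (ecos m)"
      unfolding x2_def by (intro ip_cong_AE XL t L2I_add L pq e2 L2I_modes eqI_refl)
    also have "\<dots> = ip (snd X0) (ecos m) + (ip q (ecos m) + ip (snd G) (ecos m))"
      by (simp add: ip_add_left L pq L2I_add L2I_modes)
    also have "ip q (ecos m) = lam2 b m * ip g (ecos m)"
      using ip_ecos_opA[OF g bc(2,3), of b m] by (simp add: q_def[abs_def])
    also have "ip g (ecos m) = H0_inner W (psi2 m)"
      unfolding H0_inner_psi[OF WH] by (intro ip_cong_AE[symmetric] fg L ew L2I_modes eqI_refl)
    also have "ip (snd G) (ecos m) = H0_inner G (psi2 m)" by (simp add: H0_inner_psi[OF GH])
    finally have v2: "x2 m t - ip (snd X0) (ecos m) = lam2 b m * H0_inner W (psi2 m) + H0_inner G (psi2 m)" by simp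
    have i1: "(x1 has_integral H0_inner W (psi1 a b s n)) {0..t}"
    proof (rule has_integral_eq)
      show "((\<lambda>\<tau>. H0_inner (X \<tau>) (psi1 a b s n)) has_integral H0_inner W (psi1 a b s n)) {0..t}"
        using W psi_H0 by (simp add: has_H0_integral_def)
    qed (simp add: x1_def H0_inner_psi XH)
    have i2: "(x2 m has_integral H0_inner W (psi2 m)) {0..t}" for m
    proof (rule has_integral_eq)
      show "((\<lambda>\<tau>. H0_inner (X \<tau>) (psi2 m)) has_integral H0_inner W (psi2 m)) {0..t}"
        using W psi_H0 by (simp add: has_H0_integral_def)
    qed (simp add: x2_def H0_inner_psi XH)
    have i3: "((\<lambda>\<tau>. alpha1 a b s n * u \<tau> + beta1 a b s n * v \<tau>) has_integral H0_inner G (psi1 a b s n)) {0..t}"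
      "((\<lambda>\<tau>. alpha2 b m * u \<tau> + beta2 m * v \<tau>) has_integral H0_inner G (psi2 m)) {0..t}"
      unfolding F1[symmetric] F2[symmetric] using G psi_H0 by (simp_all add: has_H0_integral_def)
    show ?thesis
      unfolding v1 v2 by (intro conjI has_integral_add has_integral_diff has_integral_mult_right i1 i2 i3)
  qed
  have h1: "continuous_on {0..} (\<lambda>\<tau>. lam1 a n * x1 \<tau> - jordan_coupling a b s n * x2 (partner2 a b n) \<tau> + (alpha1 a b s n * u \<tau> + beta1 a b s n * v \<tau>))"
    by (intro continuous_intros c1 c2 u v)
  have h2: "continuous_on {0..} (\<lambda>\<tau>. lam2 b m * x2 m \<tau> + (alpha2 b m * u \<tau> + beta2 m * v \<tau>))" for m
    by (intro continuous_intros c2 u v)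
  show "mode1 a b s (fst (X 0)) (snd (X 0)) n = mode1 a b s (fst X0) (snd X0) n"
    using derivative_if_has_integral(1)[OF conjunct1[OF main] h1] by (simp add: x1_def)
  show "ip (snd (X 0)) (ecos m) = ip (snd X0) (ecos m)"
    using derivative_if_has_integral(1)[OF conjunct2[OF main] h2] by (simp add: x2_def)
  show "((\<lambda>\<tau>. mode1 a b s (fst (X \<tau>)) (snd (X \<tau>)) n) has_real_derivative
       lam1 a n * mode1 a b s (fst (X t)) (snd (X t)) n - jordan_coupling a b s n * ip (snd (X t)) (ecos (partner2 a b n))
       + alpha1 a b s n * u t + beta1 a b s n * v t) (at t within {0..})" if "t \<ge> 0"
    using derivative_if_has_integral(2)[OF conjunct1[OF main] h1 that] unfolding x1_def[abs_def] x2_def by (simp add: add.assoc)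
  show "((\<lambda>\<tau>. ip (snd (X \<tau>)) (ecos m)) has_real_derivative
       lam2 b m * ip (snd (X t)) (ecos m) + alpha2 b m * u t + beta2 m * v t) (at t within {0..})" if "t \<ge> 0"
    using derivative_if_has_integral(2)[OF conjunct2[OF main] h2 that] unfolding x2_def[abs_def] by (simp add: add.assoc)
qed

lemma modal_input_coefficients:
  "alpha1 a b s n = mode1 a b s (\<lambda>x. 0) (halpha b) n" "beta1 a b s n = mode1 a b s (\<lambda>x. 0) hbeta n"
  "alpha2 b m = ip (halpha b) (ecos m)" "beta2 m = ip hbeta (ecos m)"
  unfolding alpha1_def beta1_def alpha2_def beta2_def
  by (subst H0_inner_psi; simp add: H0_def L2I_hphi L2I_zero)+

text \<open>The coefficients of the input are themselves modal coordinates of elements of the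
  state space.\<close>

lemma summable_input_coefficients:
  "summable (\<lambda>n. (alpha1 a b s n)\<^sup>2)" "summable (\<lambda>n. (beta1 a b s n)\<^sup>2)"
  "summable (\<lambda>m. (alpha2 b m)\<^sup>2)" "summable (\<lambda>m. (beta2 m)\<^sup>2)"
  unfolding modal_input_coefficients
  by (intro sums_summable[OF mode1_sums] sums_summable[OF nsq_ecos_sums] L2I_zero L2I_hphi)+


section \<open>Fast modes\<close>

lemma suminf_shift_le:
  fixes f :: "nat \<Rightarrow> real"
  assumes "summable f" "\<And>n. f n \<ge> 0"
  shows "summable (\<lambda>k. f (k + N))" "(\<Sum>k. f (k + N)) \<le> suminf f" "0 \<le> (\<Sum>k. f (k + N))"
proof -
  show s: "summable (\<lambda>k. f (k + N))" using assms(1) by (simp add: summable_iff_shift)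
  show "(\<Sum>k. f (k + N)) \<le> suminf f"
    using suminf_split_initial_segment[OF assms(1), of N] sum_nonneg[of "{..<N}" f] assms(2) by simp
  show "0 \<le> (\<Sum>k. f (k + N))" using assms(2) by (intro suminf_nonneg s) auto
qed

lemma small_tail:
  fixes c :: "nat \<Rightarrow> real"
  assumes "summable (\<lambda>n. (c n)\<^sup>2)" "\<epsilon> > 0"
  obtains P where "\<And>N. N \<ge> P \<Longrightarrow> sqrt (\<Sum>k. (c (k + Suc N))\<^sup>2) \<le> \<epsilon>"
proof -
  obtain P where P: "\<And>n. n \<ge> P \<Longrightarrow> norm (\<Sum>k. (c (k + n))\<^sup>2) < \<epsilon>\<^sup>2"
    using suminf_exist_split[of "\<epsilon>\<^sup>2" "\<lambda>n. (c n)\<^sup>2"] assms by auto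
  show ?thesis
  proof (rule that[of P])
    fix N assume "N \<ge> P"
    then have "(\<Sum>k. (c (k + Suc N))\<^sup>2) \<le> \<epsilon>\<^sup>2" using P[of "Suc N"] by auto
    then show "sqrt (\<Sum>k. (c (k + Suc N))\<^sup>2) \<le> \<epsilon>" using assms(2) by (intro real_le_lsqrt suminf_nonneg) (auto intro!: suminf_shift_le(3)[OF assms(1)] suminf_shift_le(1)[OF assms(1)])
  qed
qed

text \<open>The amplification with which an input of size \<open>exp (- \<delta> * t)\<close>
  appears in the fast mode \<open>n\<close>. The value \<open>0\<close> for slow modes makes sums
  over all \<open>n\<close> meaningful.\<close>

definition gain :: "real \<Rightarrow> nat \<Rightarrow> (nat \<Rightarrow> real) \<Rightarrow> (nat \<Rightarrow> real) \<Rightarrow> (nat \<Rightarrow> real) \<Rightarrow> nat \<Rightarrow> real" where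
  "gain \<delta> N0 l p q n = (if n > N0 then (\<bar>p n\<bar> + \<bar>q n\<bar>) / (- \<delta> - l n) else 0)"

text \<open>The exponents beyond \<open>N0\<close> are bounded by the first of them, whose
  distance to \<open>- \<delta>\<close> is the spectral gap of the fast part.\<close>

definition fast_family :: "real \<Rightarrow> nat \<Rightarrow> (nat \<Rightarrow> real) \<Rightarrow> (nat \<Rightarrow> real) \<Rightarrow> (nat \<Rightarrow> real) \<Rightarrow> bool" where
  "fast_family \<delta> N0 l p q \<longleftrightarrow> (\<forall>n>N0. l n \<le> l (N0 + 1)) \<and> l (N0 + 1) < - \<delta> \<and>
     summable (\<lambda>n. (p n)\<^sup>2) \<and> summable (\<lambda>n. (q n)\<^sup>2)"

lemma gain_nonneg: "fast_family \<delta> N0 l p q \<Longrightarrow> 0 \<le> gain \<delta> N0 l p q n"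
  by (force simp: gain_def fast_family_def intro!: divide_nonneg_nonneg)

lemma summable_gain:
  assumes "fast_family \<delta> N0 l p q" shows "summable (\<lambda>n. (gain \<delta> N0 l p q n)\<^sup>2)"
proof -
  define g where "g = - \<delta> - l (N0 + 1)"
  have g: "g > 0" using assms by (simp add: g_def fast_family_def)
  show ?thesis
  proof (rule summable_comparison_test')
    show "summable (\<lambda>n. (2 * (p n)\<^sup>2 + 2 * (q n)\<^sup>2) / g\<^sup>2)"
      using assms by (intro summable_divide summable_add summable_mult) (simp_all add: fast_family_def)
    fix n :: nat
    have "gain \<delta> N0 l p q n \<le> (\<bar>p n\<bar> + \<bar>q n\<bar>) / g"
    proof (cases "n > N0")
      case True
      then have "l n \<le> l (N0 + 1)" using assms by (simp add: fast_family_def)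
      then have "g \<le> - \<delta> - l n" by (simp add: g_def)
      then have "(\<bar>p n\<bar> + \<bar>q n\<bar>) / (- \<delta> - l n) \<le> (\<bar>p n\<bar> + \<bar>q n\<bar>) / g"
        using g by (intro divide_left_mono) (auto intro!: mult_pos_pos)
      then show ?thesis using True by (simp add: gain_def)
    qed (use g in \<open>simp add: gain_def\<close>)
    then have "(gain \<delta> N0 l p q n)\<^sup>2 \<le> ((\<bar>p n\<bar> + \<bar>q n\<bar>) / g)\<^sup>2"
      using gain_nonneg[OF assms] by (intro power_mono)
    also have "\<dots> \<le> (2 * (p n)\<^sup>2 + 2 * (q n)\<^sup>2) / g\<^sup>2"
      using sum_squares_bound[of "\<bar>p n\<bar>" "\<bar>q n\<bar>"] by (simp add: power_divide power2_sum divide_right_mono)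
    finally show "norm ((gain \<delta> N0 l p q n)\<^sup>2) \<le> (2 * (p n)\<^sup>2 + 2 * (q n)\<^sup>2) / g\<^sup>2" by simp
  qed
qed

definition mode_ode :: "(nat \<Rightarrow> real) \<Rightarrow> (nat \<Rightarrow> real) \<Rightarrow> (nat \<Rightarrow> real) \<Rightarrow> (real \<Rightarrow> real) \<Rightarrow> (real \<Rightarrow> real) \<Rightarrow> nat \<Rightarrow> (real \<Rightarrow> real) \<Rightarrow> bool" where
  "mode_ode l p q u v n x \<longleftrightarrow> (\<forall>t\<ge>0. (x has_real_derivative l n * x t + p n * u t + q n * v t) (at t within {0..}))"

lemma fast_mode_bound:
  assumes fam: "fast_family \<delta> N0 l p q" and n: "n > N0" and ode: "mode_ode l p q u v n x"
    and U: "\<And>t. t \<in> {0..T} \<Longrightarrow> \<bar>u t\<bar> \<le> U * exp (- \<delta> * t)" "\<And>t. t \<in> {0..T} \<Longrightarrow> \<bar>v t\<bar> \<le> U * exp (- \<delta> * t)" "U \<ge> 0"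
    and t: "t \<in> {0..T}"
  shows "\<bar>x t\<bar> \<le> (\<bar>x 0\<bar> + gain \<delta> N0 l p q n * U) * exp (- \<delta> * t)"
proof -
  have "\<bar>x t\<bar> \<le> (\<bar>x 0\<bar> + ((\<bar>p n\<bar> + \<bar>q n\<bar>) * U) / (- \<delta> - l n)) * exp (- \<delta> * t)"
  proof (rule scalar_decay_real[of T x "l n" "\<lambda>t. p n * u t + q n * v t"])
    show "(x has_real_derivative l n * x \<tau> + (p n * u \<tau> + q n * v \<tau>)) (at \<tau> within {0..})" if "\<tau> \<in> {0..T}" for \<tau>
      using ode that by (simp add: mode_ode_def add.assoc)
    show "\<bar>p n * u \<tau> + q n * v \<tau>\<bar> \<le> (\<bar>p n\<bar> + \<bar>q n\<bar>) * U * exp (- \<delta> * \<tau>)" if "\<tau> \<in> {0..T}" for \<tau>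
    proof -
      have "\<bar>p n * u \<tau>\<bar> \<le> \<bar>p n\<bar> * (U * exp (- \<delta> * \<tau>))" "\<bar>q n * v \<tau>\<bar> \<le> \<bar>q n\<bar> * (U * exp (- \<delta> * \<tau>))"
        unfolding abs_mult using U that by (intro mult_left_mono; simp)+
      then show ?thesis by (simp add: distrib_right mult.assoc)
    qed
    show "l n < - \<delta>" using fam n unfolding fast_family_def by fastforce
  qed (use U t in auto)
  then show ?thesis using n by (simp add: gain_def)
qed

text \<open>The contribution of the modes beyond \<open>N\<close> to the output. The factor in
  front is the tail of the output coefficients, which becomes small for large \<open>N\<close>;
  the remaining factor does not depend on \<open>N\<close>.\<close>

lemma fast_tail_bound:
  assumes fam: "fast_family \<delta> N0 l p q" and N: "N \<ge> N0" and ode: "\<And>n. n > N0 \<Longrightarrow> mode_ode l p q u v n (x n)"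
    and c: "summable (\<lambda>n. (c n)\<^sup>2)"
    and U: "\<And>t. t \<in> {0..T} \<Longrightarrow> \<bar>u t\<bar> \<le> U * exp (- \<delta> * t)" "\<And>t. t \<in> {0..T} \<Longrightarrow> \<bar>v t\<bar> \<le> U * exp (- \<delta> * t)" "U \<ge> 0"
    and x0: "summable (\<lambda>n. (x n 0)\<^sup>2)" "(\<Sum>n. (x n 0)\<^sup>2) \<le> I\<^sup>2" "I \<ge> 0"
    and r: "(\<lambda>k. c (k + Suc N) * x (k + Suc N) t) sums r" and t: "t \<in> {0..T}"
  shows "\<bar>r\<bar> \<le> sqrt (\<Sum>k. (c (k + Suc N))\<^sup>2) * (I + sqrt (\<Sum>n. (gain \<delta> N0 l p q n)\<^sup>2) * U) * exp (- \<delta> * t)"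
proof -
  define c' where "c' k = c (k + Suc N)" for k
  define y where "y k = x (k + Suc N) 0" for k
  define \<gamma> where "\<gamma> k = gain \<delta> N0 l p q (k + Suc N)" for k
  define e where "e = exp (- \<delta> * t)"
  have e: "e > 0" by (simp add: e_def)
  have g0: "\<gamma> k \<ge> 0" for k unfolding \<gamma>_def by (rule gain_nonneg[OF fam])
  have s: "summable (\<lambda>k. (c' k)\<^sup>2)" "summable (\<lambda>k. (y k)\<^sup>2)" "summable (\<lambda>k. (\<gamma> k)\<^sup>2)"
    unfolding c'_def y_def \<gamma>_def using c x0(1) summable_gain[OF fam] by (intro suminf_shift_le(1); simp)+
  have y: "sqrt (\<Sum>k. (y k)\<^sup>2) \<le> I"
    using suminf_shift_le(2)[OF x0(1), of "Suc N"] x0(2,3) suminf_shift_le(3)[OF x0(1), of "Suc N"] unfolding y_def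
    by (intro real_le_lsqrt) auto
  have \<gamma>: "sqrt (\<Sum>k. (\<gamma> k)\<^sup>2) \<le> sqrt (\<Sum>n. (gain \<delta> N0 l p q n)\<^sup>2)"
    unfolding \<gamma>_def by (intro real_sqrt_le_mono suminf_shift_le(2) summable_gain[OF fam]) auto
  note m1 = summable_mult_l2[OF s(1,2)] and m2 = summable_mult_l2[OF s(1,3)]
  define b where "b k = \<bar>c' k * y k\<bar> * e + \<bar>c' k * \<gamma> k\<bar> * (U * e)" for k
  have bs: "summable b" unfolding b_def by (intro summable_add summable_mult2 m1 m2)
  have le: "\<bar>c' k * x (k + Suc N) t\<bar> \<le> b k" for k
  proof -
    have "\<bar>x (k + Suc N) t\<bar> \<le> (\<bar>y k\<bar> + \<gamma> k * U) * e"
      unfolding y_def \<gamma>_def e_def using N by (intro fast_mode_bound[OF fam _ ode U t]) auto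
    from mult_left_mono[OF this, of "\<bar>c' k\<bar>"] show ?thesis
      using g0 by (simp add: b_def abs_mult algebra_simps)
  qed
  have as: "summable (\<lambda>k. \<bar>c' k * x (k + Suc N) t\<bar>)"
    using le by (intro summable_comparison_test'[OF bs]) auto
  have "\<bar>r\<bar> = \<bar>\<Sum>k. c' k * x (k + Suc N) t\<bar>" using sums_unique[OF r] by (simp add: c'_def)
  also have "\<dots> \<le> (\<Sum>k. \<bar>c' k * x (k + Suc N) t\<bar>)" by (rule summable_rabs[OF as])
  also have "\<dots> \<le> suminf b" by (rule suminf_le[OF le as bs])
  also have "\<dots> = (\<Sum>k. \<bar>c' k * y k\<bar>) * e + (\<Sum>k. \<bar>c' k * \<gamma> k\<bar>) * (U * e)"
    unfolding b_def
    by (simp only: suminf_add[OF summable_mult2[OF m1(1)] summable_mult2[OF m2(1)], symmetric] suminf_mult2[OF m1(1)] suminf_mult2[OF m2(1)])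
  also have "\<dots> \<le> (sqrt (\<Sum>k. (c' k)\<^sup>2) * sqrt (\<Sum>k. (y k)\<^sup>2)) * e + (sqrt (\<Sum>k. (c' k)\<^sup>2) * sqrt (\<Sum>k. (\<gamma> k)\<^sup>2)) * (U * e)"
    using m1(2) m2(2) e U(3) by (intro add_mono mult_right_mono) auto
  also have "\<dots> \<le> (sqrt (\<Sum>k. (c' k)\<^sup>2) * I) * e + (sqrt (\<Sum>k. (c' k)\<^sup>2) * sqrt (\<Sum>n. (gain \<delta> N0 l p q n)\<^sup>2)) * (U * e)"
    using y \<gamma> e U(3) suminf_nonneg[OF s(1)] by (intro add_mono mult_right_mono mult_left_mono) auto
  finally show ?thesis unfolding c'_def e_def by (simp add: algebra_simps)
qed

text \<open>Plant and observer copies of a mode between \<open>N0\<close> and \<open>N\<close>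
  receive the same input, so their difference obeys the homogeneous equation. The bound is
  independent of \<open>N\<close> and of the input.\<close>

lemma intermediate_sum_bound:
  fixes x h :: "nat \<Rightarrow> real \<Rightarrow> real"
  assumes fam: "fast_family \<delta> N0 l p q" and ode: "\<And>n. n > N0 \<Longrightarrow> mode_ode l p q u v n (x n)"
    and oh: "\<And>n. n \<in> {N0 + 1..N} \<Longrightarrow> mode_ode l p q u v n (h n)"
    and c: "summable (\<lambda>n. (c n)\<^sup>2)"
    and x0: "summable (\<lambda>n. (x n 0)\<^sup>2)" "(\<Sum>n. (x n 0)\<^sup>2) \<le> I\<^sup>2" "I \<ge> 0"
    and h0: "(\<Sum>n=N0 + 1..N. (h n 0)\<^sup>2) \<le> I\<^sup>2" and t: "t \<ge> 0"
  shows "\<bar>\<Sum>n=N0 + 1..N. c n * (h n t - x n t)\<bar> \<le> sqrt (\<Sum>n. (c n)\<^sup>2) * (2 * I) * exp (- \<delta> * t)"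
proof -
  define e where "e n t = h n t - x n t" for n t
  have decay: "\<bar>e n t\<bar> \<le> \<bar>e n 0\<bar> * exp (- \<delta> * t)" if n: "n \<in> {N0 + 1..N}" for n
  proof -
    have "mode_ode l (\<lambda>n. 0) (\<lambda>n. 0) u v n (e n)"
      unfolding mode_ode_def
    proof (intro allI impI)
      fix t :: real assume "t \<ge> 0"
      then have "(e n has_real_derivative (l n * h n t + p n * u t + q n * v t) - (l n * x n t + p n * u t + q n * v t)) (at t within {0..})"
        using oh[OF n] ode[of n] n unfolding mode_ode_def e_def by (intro DERIV_diff) auto
      then show "(e n has_real_derivative l n * e n t + 0 * u t + 0 * v t) (at t within {0..})"
        by (simp add: e_def algebra_simps)
    qed
    moreover have "l n < - \<delta>" using fam n unfolding fast_family_def by (metis Suc_eq_plus1 Suc_le_eq atLeastAtMost_iff order_le_less_trans)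
    ultimately have "\<bar>e n t\<bar> \<le> (\<bar>e n 0\<bar> + 0 / (- \<delta> - l n)) * exp (- \<delta> * t)"
      by (intro scalar_decay_real[of t "e n" "l n" "\<lambda>t. 0"]) (use t in \<open>auto simp: mode_ode_def\<close>)
    then show ?thesis by simp
  qed
  have "(\<Sum>n=N0 + 1..N. (e n 0)\<^sup>2) \<le> (\<Sum>n=N0 + 1..N. 2 * (h n 0)\<^sup>2 + 2 * (x n 0)\<^sup>2)"
  proof (rule sum_mono)
    fix n
    have "0 \<le> (h n 0 + x n 0)\<^sup>2" by simp
    then show "(e n 0)\<^sup>2 \<le> 2 * (h n 0)\<^sup>2 + 2 * (x n 0)\<^sup>2"
      unfolding e_def power2_sum power2_diff by linarith
  qed
  also have "\<dots> = 2 * (\<Sum>n=N0 + 1..N. (h n 0)\<^sup>2) + 2 * (\<Sum>n=N0 + 1..N. (x n 0)\<^sup>2)"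
    by (simp add: sum.distrib sum_distrib_left)
  also have "\<dots> \<le> 2 * I\<^sup>2 + 2 * I\<^sup>2"
    using h0 sum_le_suminf[OF x0(1), of "{N0 + 1..N}"] x0(2) by (intro add_mono mult_left_mono) auto
  finally have e0: "(\<Sum>n=N0 + 1..N. (e n 0)\<^sup>2) \<le> (2 * I)\<^sup>2" by (simp add: power_mult_distrib)
  have "\<bar>\<Sum>n=N0 + 1..N. c n * e n t\<bar> \<le> (\<Sum>n=N0 + 1..N. \<bar>c n\<bar> * (\<bar>e n 0\<bar> * exp (- \<delta> * t)))"
    by (rule order_trans[OF sum_abs]) (intro sum_mono, simp only: abs_mult, intro mult_left_mono decay, auto)
  also have "\<dots> = (\<Sum>n=N0 + 1..N. \<bar>c n\<bar> * \<bar>e n 0\<bar>) * exp (- \<delta> * t)"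
    by (simp add: sum_distrib_right mult.assoc)
  also have "\<dots> \<le> (L2_set c {N0 + 1..N} * L2_set (\<lambda>n. e n 0) {N0 + 1..N}) * exp (- \<delta> * t)"
    by (intro mult_right_mono L2_set_mult_ineq) simp
  also have "\<dots> \<le> (sqrt (\<Sum>n. (c n)\<^sup>2) * (2 * I)) * exp (- \<delta> * t)"
  proof (intro mult_right_mono mult_mono)
    show "L2_set c {N0 + 1..N} \<le> sqrt (\<Sum>n. (c n)\<^sup>2)"
      unfolding L2_set_def by (intro real_sqrt_le_mono sum_le_suminf c) auto
    show "L2_set (\<lambda>n. e n 0) {N0 + 1..N} \<le> 2 * I"
      unfolding L2_set_def using e0 x0(3) by (intro real_le_lsqrt sum_nonneg) auto
  qed (auto intro: suminf_nonneg c)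
  finally show ?thesis by (simp add: e_def)
qed

section \<open>Closing the loop by small gain\<close>

text \<open>The conclusion of \<open>Hurwitz_decay\<close> as a property of the matrix; the
  small-gain argument uses nothing else.\<close>

definition decay_matrix :: "nat \<Rightarrow> (nat \<Rightarrow> nat \<Rightarrow> real) \<Rightarrow> real \<Rightarrow> real \<Rightarrow> bool" where
  "decay_matrix n A \<delta> D \<longleftrightarrow> D \<ge> 0 \<and> (\<forall>F T X t i. linear_ode n A \<delta> F T X \<longrightarrow> t \<in> {0..T} \<longrightarrow> i < n \<longrightarrow>
     \<bar>X t i\<bar> \<le> D * ((\<Sum>j<n. \<bar>X 0 j\<bar>) + F) * exp (- \<delta> * t))"

text \<open>The entries of \<open>A1a - B1a K\<close>, with the input as the last
  component.\<close>

definition closed_matrix :: "nat \<Rightarrow> (nat \<Rightarrow> nat \<Rightarrow> real) \<Rightarrow> (nat \<Rightarrow> real) \<Rightarrow> (nat \<Rightarrow> real) \<Rightarrow> (nat \<Rightarrow> real) \<Rightarrow> real \<Rightarrow> nat \<Rightarrow> nat \<Rightarrow> real" where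
  "closed_matrix n A Bu Bv K ku i j =
     (if i < n then (if j < n then A i j - Bv i * K j else Bu i - Bv i * ku) else (if j < n then - K j else - ku))"

text \<open>The loop in modal coordinates, with arbitrary coefficients: \<open>n0\<close> slow
  modes governed by the matrix \<open>A\<close>, two families of fast modes, and the gains of the
  controller.\<close>

locale modal_loop =
  fixes \<delta> ku :: real and n0 N0 M0 :: nat and A :: "nat \<Rightarrow> nat \<Rightarrow> real"
    and Bu Bv C L K l1 l2 p1 p2 q1 q2 c1 c2 :: "nat \<Rightarrow> real" and D1 D2 :: real
  assumes fam1: "fast_family \<delta> N0 l1 p1 q1" and fam2: "fast_family \<delta> M0 l2 p2 q2"
    and c1: "summable (\<lambda>n. (c1 n)\<^sup>2)" and c2: "summable (\<lambda>m. (c2 m)\<^sup>2)"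
    and observer: "decay_matrix n0 (\<lambda>i j. A i j - L i * C j) \<delta> D1"
    and controller: "decay_matrix (n0 + 1) (closed_matrix n0 A Bu Bv K ku) \<delta> D2"
begin

text \<open>A trajectory: \<open>X\<close> are the slow modes and \<open>Xh\<close> their
  estimates, \<open>x1\<close>, \<open>x2\<close> the modes of the plant and \<open>h1\<close>,
  \<open>h2\<close> the estimates of those between slow modes and truncation,
  \<open>\<zeta>\<close> is the output of the modes beyond the truncation, and \<open>I\<close>
  bounds the initial data. In the equation for \<open>Xh\<close> the output has already been
  expanded, so that only estimation errors and \<open>\<zeta>\<close> remain.\<close>

definition loop where
  "loop N M I x1 x2 X Xh h1 h2 u v \<zeta> \<longleftrightarrow> N \<ge> N0 \<and> M \<ge> M0 \<and> I \<ge> 0 \<and>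
    (\<forall>t\<ge>0. v t = - (\<Sum>j<n0. K j * Xh t j) - ku * u t) \<and>
    (\<forall>t\<ge>0. (u has_real_derivative v t) (at t within {0..})) \<and>
    (\<forall>t\<ge>0. \<forall>i<n0. ((\<lambda>\<tau>. X \<tau> i) has_real_derivative (\<Sum>j<n0. A i j * X t j) + Bu i * u t + Bv i * v t) (at t within {0..})) \<and>
    (\<forall>n>N0. mode_ode l1 p1 q1 u v n (x1 n)) \<and> (\<forall>m>M0. mode_ode l2 p2 q2 u v m (x2 m)) \<and>
    (\<forall>n\<in>{N0 + 1..N}. mode_ode l1 p1 q1 u v n (h1 n)) \<and> (\<forall>m\<in>{M0 + 1..M}. mode_ode l2 p2 q2 u v m (h2 m)) \<and>
    (\<forall>t\<ge>0. \<exists>r1 r2. (\<lambda>k. c1 (k + Suc N) * x1 (k + Suc N) t) sums r1 \<and> (\<lambda>k. c2 (k + Suc M) * x2 (k + Suc M) t) sums r2 \<and> \<zeta> t = r1 + r2) \<and>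
    (\<forall>t\<ge>0. \<forall>i<n0. ((\<lambda>\<tau>. Xh \<tau> i) has_real_derivative (\<Sum>j<n0. A i j * Xh t j) + Bu i * u t + Bv i * v t
        - ((\<Sum>j<n0. C j * (Xh t j - X t j)) + (\<Sum>n=N0 + 1..N. c1 n * (h1 n t - x1 n t))
            + (\<Sum>m=M0 + 1..M. c2 m * (h2 m t - x2 m t)) - \<zeta> t) * L i) (at t within {0..})) \<and>
    summable (\<lambda>n. (x1 n 0)\<^sup>2) \<and> (\<Sum>n. (x1 n 0)\<^sup>2) \<le> I\<^sup>2 \<and> summable (\<lambda>m. (x2 m 0)\<^sup>2) \<and> (\<Sum>m. (x2 m 0)\<^sup>2) \<le> I\<^sup>2 \<and>
    (\<Sum>n=N0 + 1..N. (h1 n 0)\<^sup>2) \<le> I\<^sup>2 \<and> (\<Sum>m=M0 + 1..M. (h2 m 0)\<^sup>2) \<le> I\<^sup>2 \<and>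
    \<bar>u 0\<bar> \<le> I \<and> (\<forall>i<n0. \<bar>X 0 i\<bar> \<le> I \<and> \<bar>Xh 0 i\<bar> \<le> I)"

text \<open>Suppose that \<open>u\<close> and \<open>v\<close> are bounded by
  \<open>U * exp (- \<delta> * t)\<close> up to some time. The observer error is then forced by
  \<open>w\<close>, the sum of decaying intermediate errors and of the output tail, which is of
  size \<open>const * I + \<epsilon> * const * U\<close>. The error in turn forces the controlled
  system, whence \<open>u\<close> and \<open>v\<close> are again bounded, now by
  \<open>const * I + U / 4\<close>. Taking for \<open>U\<close> the best constant on the given
  interval removes \<open>U\<close> from the right-hand side. The constants are independent of the
  interval and of the truncation.\<close>

lemma small_gain:
  obtains D :: real and P :: nat where "D \<ge> 0"
    "\<And>N M I x1 x2 X Xh h1 h2 u v \<zeta> t i. \<lbrakk>loop N M I x1 x2 X Xh h1 h2 u v \<zeta>; N \<ge> P; M \<ge> P; t \<ge> 0\<rbrakk> \<Longrightarrow>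
       \<bar>u t\<bar> \<le> D * I * exp (- \<delta> * t) \<and> \<bar>v t\<bar> \<le> D * I * exp (- \<delta> * t) \<and>
       (i < n0 \<longrightarrow> \<bar>X t i\<bar> \<le> D * I * exp (- \<delta> * t) \<and> \<bar>Xh t i\<bar> \<le> D * I * exp (- \<delta> * t))"
proof -
  define k1 where "k1 = sqrt (\<Sum>n. (c1 n)\<^sup>2)"
  define k2 where "k2 = sqrt (\<Sum>m. (c2 m)\<^sup>2)"
  define \<gamma>1 where "\<gamma>1 = sqrt (\<Sum>n. (gain \<delta> N0 l1 p1 q1 n)\<^sup>2)"
  define \<gamma>2 where "\<gamma>2 = sqrt (\<Sum>m. (gain \<delta> M0 l2 p2 q2 m)\<^sup>2)"
  define \<Lambda> where "\<Lambda> = (\<Sum>i<n0. \<bar>L i\<bar>)"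
  define \<Gamma> where "\<Gamma> = (\<Sum>i<n0. \<bar>C i\<bar>)"
  define \<Omega> where "\<Omega> = (\<Sum>i<n0. \<bar>K i\<bar>) + \<bar>ku\<bar> + 1"
  have nn: "k1 \<ge> 0" "k2 \<ge> 0" "\<gamma>1 \<ge> 0" "\<gamma>2 \<ge> 0" "\<Lambda> \<ge> 0" "\<Gamma> \<ge> 0" "\<Omega> \<ge> 1"
    unfolding k1_def k2_def \<gamma>1_def \<gamma>2_def \<Lambda>_def \<Gamma>_def \<Omega>_def
    by (auto intro!: real_sqrt_ge_zero suminf_nonneg c1 c2 summable_gain fam1 fam2 sum_nonneg add_nonneg_nonneg)
  have D12: "D1 \<ge> 0" "D2 \<ge> 0" using observer controller by (simp_all add: decay_matrix_def)
  \<comment> \<open>All bounds have the form \<open>p * I + q * W\<close>, where \<open>W\<close> is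
    the size of the disturbance \<open>w\<close>. The pairs \<open>(p, q)\<close> are
    \<open>(e1, e2)\<close> for the observer error, \<open>(i1, i2)\<close> for the innovation and
    \<open>(x1c, x2c)\<close> for the controlled system.\<close>
  define e1 where "e1 = D1 * (2 * real n0)"
  define e2 where "e2 = D1 * \<Lambda>"
  define i1 where "i1 = \<Gamma> * e1"
  define i2 where "i2 = \<Gamma> * e2 + 1"
  define x1c where "x1c = D2 * (real n0 + 1 + \<Lambda> * i1)"
  define x2c where "x2c = D2 * (\<Lambda> * i2)"
  have pos: "e1 \<ge> 0" "e2 \<ge> 0" "i1 \<ge> 0" "i2 \<ge> 0" "x1c \<ge> 0" "x2c \<ge> 0"
    unfolding e1_def e2_def i1_def i2_def x1c_def x2c_def using D12 nn by (auto intro!: mult_nonneg_nonneg add_nonneg_nonneg)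
  define \<kappa> where "\<kappa> = 2 * \<Omega> * x2c * (\<gamma>1 + \<gamma>2) + 1"
  have \<kappa>: "\<kappa> > 0" using nn pos by (auto simp: \<kappa>_def intro!: add_nonneg_pos mult_nonneg_nonneg)
  \<comment> \<open>The tails of the output coefficients have to be so small that one turn around
    the loop contracts.\<close>
  define \<epsilon> where "\<epsilon> = 1 / (2 * \<kappa>)"
  have \<epsilon>: "\<epsilon> > 0" using \<kappa> by (simp add: \<epsilon>_def)
  have \<epsilon>half: "2 * \<Omega> * x2c * (\<epsilon> * (\<gamma>1 + \<gamma>2)) \<le> 1 / 2"
  proof -
    have "2 * \<Omega> * x2c * (\<gamma>1 + \<gamma>2) \<le> \<kappa>" by (simp add: \<kappa>_def)
    from mult_right_mono[OF this, of \<epsilon>] \<epsilon> have "2 * \<Omega> * x2c * (\<gamma>1 + \<gamma>2) * \<epsilon> \<le> \<kappa> * \<epsilon>" by simp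
    also have "\<kappa> * \<epsilon> = 1 / 2" using \<kappa> by (simp add: \<epsilon>_def)
    finally show ?thesis by (simp add: mult_ac)
  qed
  obtain P1 where P1: "\<And>N. N \<ge> P1 \<Longrightarrow> sqrt (\<Sum>k. (c1 (k + Suc N))\<^sup>2) \<le> \<epsilon>" using small_tail[OF c1 \<epsilon>] by blast
  obtain P2 where P2: "\<And>N. N \<ge> P2 \<Longrightarrow> sqrt (\<Sum>k. (c2 (k + Suc N))\<^sup>2) \<le> \<epsilon>" using small_tail[OF c2 \<epsilon>] by blast
  \<comment> \<open>The disturbance is bounded by
    \<open>w1 * I + \<epsilon> * (\<gamma>1 + \<gamma>2) * U\<close>.\<close>
  define w1 where "w1 = 2 * k1 + 2 * k2 + 2 * \<epsilon>"
  have w1: "w1 \<ge> 0" using nn \<epsilon> by (simp add: w1_def)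
  define D where "D = 4 * \<Omega> * (x1c + x2c * w1)"
  define Dw where "Dw = w1 + \<epsilon> * (\<gamma>1 + \<gamma>2) * D"
  define DX where "DX = x1c + x2c * Dw"
  define DE where "DE = e1 + e2 * Dw"
  have Dp: "D \<ge> 0" unfolding D_def using nn pos w1 by (auto intro!: mult_nonneg_nonneg add_nonneg_nonneg)
  then have Dwp: "Dw \<ge> 0" unfolding Dw_def using nn \<epsilon> w1 by (auto intro!: mult_nonneg_nonneg add_nonneg_nonneg)
  then have DXp: "DX \<ge> 0" "DE \<ge> 0" unfolding DX_def DE_def using pos by (auto intro!: mult_nonneg_nonneg add_nonneg_nonneg)
  have "\<bar>u t\<bar> \<le> (D + DX + DE) * I * exp (- \<delta> * t) \<and> \<bar>v t\<bar> \<le> (D + DX + DE) * I * exp (- \<delta> * t) \<and>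
       (i < n0 \<longrightarrow> \<bar>X t i\<bar> \<le> (D + DX + DE) * I * exp (- \<delta> * t) \<and> \<bar>Xh t i\<bar> \<le> (D + DX + DE) * I * exp (- \<delta> * t))"
    if lp: "loop N M I x1 x2 X Xh h1 h2 u v \<zeta>" and NP: "N \<ge> max P1 P2" "M \<ge> max P1 P2" and t0: "t \<ge> 0"
    for N M I x1 x2 X Xh h1 h2 u v \<zeta> t i
  proof -
    note l = lp[unfolded loop_def]
    have NM: "N \<ge> N0" "M \<ge> M0" and I: "I \<ge> 0" using l by simp_all
    have v: "v t = - (\<Sum>j<n0. K j * Xh t j) - ku * u t" if "t \<ge> 0" for t using l that by blast
    have ud: "(u has_real_derivative v t) (at t within {0..})" if "t \<ge> 0" for t using l that by blast
    have Xd: "((\<lambda>\<tau>. X \<tau> i) has_real_derivative (\<Sum>j<n0. A i j * X t j) + Bu i * u t + Bv i * v t) (at t within {0..})"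
      if "t \<ge> 0" "i < n0" for t i using l that by blast
    have Xhd: "((\<lambda>\<tau>. Xh \<tau> i) has_real_derivative (\<Sum>j<n0. A i j * Xh t j) + Bu i * u t + Bv i * v t
        - ((\<Sum>j<n0. C j * (Xh t j - X t j)) + (\<Sum>n=N0 + 1..N. c1 n * (h1 n t - x1 n t))
            + (\<Sum>m=M0 + 1..M. c2 m * (h2 m t - x2 m t)) - \<zeta> t) * L i) (at t within {0..})"
      if "t \<ge> 0" "i < n0" for t i using l that by blast
    have o1: "\<And>n. n > N0 \<Longrightarrow> mode_ode l1 p1 q1 u v n (x1 n)" and o2: "\<And>m. m > M0 \<Longrightarrow> mode_ode l2 p2 q2 u v m (x2 m)"
      and oh1: "\<And>n. n \<in> {N0 + 1..N} \<Longrightarrow> mode_ode l1 p1 q1 u v n (h1 n)"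
      and oh2: "\<And>m. m \<in> {M0 + 1..M} \<Longrightarrow> mode_ode l2 p2 q2 u v m (h2 m)"
      using l by blast+
    have z: "\<exists>r1 r2. (\<lambda>k. c1 (k + Suc N) * x1 (k + Suc N) t) sums r1 \<and> (\<lambda>k. c2 (k + Suc M) * x2 (k + Suc M) t) sums r2 \<and> \<zeta> t = r1 + r2"
      if "t \<ge> 0" for t using l that by blast
    have i1': "summable (\<lambda>n. (x1 n 0)\<^sup>2)" "(\<Sum>n. (x1 n 0)\<^sup>2) \<le> I\<^sup>2" and i2': "summable (\<lambda>m. (x2 m 0)\<^sup>2)" "(\<Sum>m. (x2 m 0)\<^sup>2) \<le> I\<^sup>2"
      and ih: "(\<Sum>n=N0 + 1..N. (h1 n 0)\<^sup>2) \<le> I\<^sup>2" "(\<Sum>m=M0 + 1..M. (h2 m 0)\<^sup>2) \<le> I\<^sup>2"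
      and i0: "\<bar>u 0\<bar> \<le> I" "\<And>i. i < n0 \<Longrightarrow> \<bar>X 0 i\<bar> \<le> I" "\<And>i. i < n0 \<Longrightarrow> \<bar>Xh 0 i\<bar> \<le> I"
      using l by blast+
    define w where "w t = (\<Sum>n=N0 + 1..N. c1 n * (h1 n t - x1 n t)) + (\<Sum>m=M0 + 1..M. c2 m * (h2 m t - x2 m t)) - \<zeta> t" for t
    \<comment> \<open>One turn around the loop: bounds on the input up to \<open>T\<close> reproduce
      bounds up to \<open>T\<close>.\<close>
    have turn: "\<bar>w t\<bar> \<le> (w1 * I + \<epsilon> * (\<gamma>1 + \<gamma>2) * U) * exp (- \<delta> * t) \<and>
        (\<forall>i<n0. \<bar>Xh t i - X t i\<bar> \<le> (e1 * I + e2 * (w1 * I + \<epsilon> * (\<gamma>1 + \<gamma>2) * U)) * exp (- \<delta> * t)) \<and>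
        \<bar>u t\<bar> \<le> (x1c * I + x2c * (w1 * I + \<epsilon> * (\<gamma>1 + \<gamma>2) * U)) * exp (- \<delta> * t) \<and>
        (\<forall>i<n0. \<bar>Xh t i\<bar> \<le> (x1c * I + x2c * (w1 * I + \<epsilon> * (\<gamma>1 + \<gamma>2) * U)) * exp (- \<delta> * t))"
      if U: "\<And>t. t \<in> {0..T} \<Longrightarrow> \<bar>u t\<bar> \<le> U * exp (- \<delta> * t)" "\<And>t. t \<in> {0..T} \<Longrightarrow> \<bar>v t\<bar> \<le> U * exp (- \<delta> * t)" "U \<ge> 0"
        and tT: "t \<in> {0..T}" for U T t
    proof -
      define W where "W = w1 * I + \<epsilon> * (\<gamma>1 + \<gamma>2) * U"
      have Wp: "W \<ge> 0" unfolding W_def using w1 I nn \<epsilon> U(3) by (auto intro!: mult_nonneg_nonneg add_nonneg_nonneg)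
      have wb: "\<bar>w t\<bar> \<le> W * exp (- \<delta> * t)" if t: "t \<in> {0..T}" for t
      proof -
        have tn: "t \<ge> 0" using t by simp
        obtain r1 r2 where r: "(\<lambda>k. c1 (k + Suc N) * x1 (k + Suc N) t) sums r1" "(\<lambda>k. c2 (k + Suc M) * x2 (k + Suc M) t) sums r2" "\<zeta> t = r1 + r2"
          using z[OF tn] by blast
        have "\<bar>r1\<bar> \<le> sqrt (\<Sum>k. (c1 (k + Suc N))\<^sup>2) * (I + \<gamma>1 * U) * exp (- \<delta> * t)"
          unfolding \<gamma>1_def by (rule fast_tail_bound[OF fam1 NM(1) o1 c1 U i1' I r(1) t])
        also have "\<dots> \<le> \<epsilon> * (I + \<gamma>1 * U) * exp (- \<delta> * t)"
          using P1[of N] NP I nn U(3) by (intro mult_right_mono) (auto intro!: add_nonneg_nonneg)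
        finally have b1: "\<bar>r1\<bar> \<le> \<epsilon> * (I + \<gamma>1 * U) * exp (- \<delta> * t)" .
        have "\<bar>r2\<bar> \<le> sqrt (\<Sum>k. (c2 (k + Suc M))\<^sup>2) * (I + \<gamma>2 * U) * exp (- \<delta> * t)"
          unfolding \<gamma>2_def by (rule fast_tail_bound[OF fam2 NM(2) o2 c2 U i2' I r(2) t])
        also have "\<dots> \<le> \<epsilon> * (I + \<gamma>2 * U) * exp (- \<delta> * t)"
          using P2[of M] NP I nn U(3) by (intro mult_right_mono) (auto intro!: add_nonneg_nonneg)
        finally have b2: "\<bar>r2\<bar> \<le> \<epsilon> * (I + \<gamma>2 * U) * exp (- \<delta> * t)" .
        have b3: "\<bar>\<Sum>n=N0 + 1..N. c1 n * (h1 n t - x1 n t)\<bar> \<le> k1 * (2 * I) * exp (- \<delta> * t)"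
          unfolding k1_def by (rule intermediate_sum_bound[OF fam1 o1 oh1 c1 i1' I ih(1) tn])
        have b4: "\<bar>\<Sum>m=M0 + 1..M. c2 m * (h2 m t - x2 m t)\<bar> \<le> k2 * (2 * I) * exp (- \<delta> * t)"
          unfolding k2_def by (rule intermediate_sum_bound[OF fam2 o2 oh2 c2 i2' I ih(2) tn])
        have "\<bar>w t\<bar> \<le> k1 * (2 * I) * exp (- \<delta> * t) + k2 * (2 * I) * exp (- \<delta> * t) + (\<epsilon> * (I + \<gamma>1 * U) * exp (- \<delta> * t) + \<epsilon> * (I + \<gamma>2 * U) * exp (- \<delta> * t))"
          unfolding w_def r(3) using b1 b2 b3 b4 by linarith
        also have "\<dots> = W * exp (- \<delta> * t)" by (simp add: W_def w1_def algebra_simps)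
        finally show ?thesis .
      qed
      define E where "E t i = Xh t i - X t i" for t i
      have "linear_ode n0 (\<lambda>i j. A i j - L i * C j) \<delta> (\<Lambda> * W) T E"
        unfolding linear_ode_def
      proof (intro conjI exI[of _ "\<lambda>t i. - (w t * L i)"] ballI allI impI)
        show "0 \<le> \<Lambda> * W" using nn Wp by simp
        fix t i assume t: "t \<in> {0..T}" and i: "i < n0"
        have "((\<lambda>\<tau>. E \<tau> i) has_real_derivative ((\<Sum>j<n0. A i j * Xh t j) + Bu i * u t + Bv i * v t - ((\<Sum>j<n0. C j * (Xh t j - X t j)) + w t) * L i)
             - ((\<Sum>j<n0. A i j * X t j) + Bu i * u t + Bv i * v t)) (at t within {0..})"
          unfolding E_def using Xd[of t i] Xhd[of t i] t i by (intro DERIV_diff) (auto simp: w_def add.assoc add_diff_eq)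
        moreover have "(\<Sum>j<n0. (A i j - L i * C j) * E t j) = (\<Sum>j<n0. A i j * Xh t j) - (\<Sum>j<n0. A i j * X t j) - (\<Sum>j<n0. C j * (Xh t j - X t j)) * L i"
          by (simp add: E_def algebra_simps sum.distrib sum_subtractf sum_distrib_left sum_distrib_right)
        moreover have "(p + q + r - (g + w') * k) - (p' + q + r) = (p - p' - g * k) + - (w' * k)" for p q r g w' k p' :: real
          by (simp add: algebra_simps)
        ultimately show "((\<lambda>\<tau>. E \<tau> i) has_real_derivative (\<Sum>j<n0. (A i j - L i * C j) * E t j) + - (w t * L i)) (at t within {0..})"
          by (simp only:)
        have "\<bar>w t\<bar> * \<bar>L i\<bar> \<le> (W * exp (- \<delta> * t)) * \<Lambda>"
          using wb[OF t] Wp i unfolding \<Lambda>_def by (intro mult_mono member_le_sum[of i "{..<n0}" "\<lambda>i. \<bar>L i\<bar>"]) auto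
        then show "\<bar>- (w t * L i)\<bar> \<le> \<Lambda> * W * exp (- \<delta> * t)" by (simp add: abs_mult mult_ac)
      qed
      then have Eb: "\<bar>E t i\<bar> \<le> (e1 * I + e2 * W) * exp (- \<delta> * t)" if "t \<in> {0..T}" "i < n0" for t i
      proof -
        have "\<bar>E t i\<bar> \<le> D1 * ((\<Sum>j<n0. \<bar>E 0 j\<bar>) + \<Lambda> * W) * exp (- \<delta> * t)"
          using observer \<open>linear_ode n0 (\<lambda>i j. A i j - L i * C j) \<delta> (\<Lambda> * W) T E\<close> that unfolding decay_matrix_def by blast
        also have "\<dots> \<le> D1 * (2 * real n0 * I + \<Lambda> * W) * exp (- \<delta> * t)"
        proof -
          have "(\<Sum>j<n0. \<bar>E 0 j\<bar>) \<le> (\<Sum>j<n0. 2 * I)"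
            using i0 unfolding E_def by (intro sum_mono) (smt (verit) lessThan_iff)
          then show ?thesis using D12 by (intro mult_right_mono mult_left_mono) auto
        qed
        also have "\<dots> = (e1 * I + e2 * W) * exp (- \<delta> * t)" by (simp add: e1_def e2_def algebra_simps)
        finally show ?thesis .
      qed
      define \<iota> where "\<iota> t = (\<Sum>j<n0. C j * E t j) + w t" for t
      have \<iota>b: "\<bar>\<iota> t\<bar> \<le> (i1 * I + i2 * W) * exp (- \<delta> * t)" if t: "t \<in> {0..T}" for t
      proof -
        have "\<bar>\<Sum>j<n0. C j * E t j\<bar> \<le> (\<Sum>j<n0. \<bar>C j\<bar> * ((e1 * I + e2 * W) * exp (- \<delta> * t)))"
          by (rule order_trans[OF sum_abs]) (intro sum_mono, simp only: abs_mult, intro mult_left_mono Eb t, auto)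
        also have "\<dots> = \<Gamma> * ((e1 * I + e2 * W) * exp (- \<delta> * t))" by (simp add: \<Gamma>_def sum_distrib_right)
        finally have "\<bar>\<Sum>j<n0. C j * E t j\<bar> \<le> \<Gamma> * ((e1 * I + e2 * W) * exp (- \<delta> * t))" .
        then have "\<bar>\<iota> t\<bar> \<le> \<Gamma> * ((e1 * I + e2 * W) * exp (- \<delta> * t)) + W * exp (- \<delta> * t)"
          using wb[OF t] unfolding \<iota>_def by linarith
        also have "\<dots> = (i1 * I + i2 * W) * exp (- \<delta> * t)" by (simp add: i1_def i2_def algebra_simps)
        finally show ?thesis .
      qed
      \<comment> \<open>The controlled system: the estimates together with the input, forced by the
        innovation.\<close>
      define Z where "Z t i = (if i < n0 then Xh t i else u t)" for t i
      have IWp: "i1 * I + i2 * W \<ge> 0" using pos I Wp by (simp add: add_nonneg_nonneg)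
      have Zs: "(\<Sum>j<n0 + 1. f j * Z t j) = (\<Sum>j<n0. f j * Xh t j) + f n0 * u t" for f t
        by (simp add: Z_def)
      have odeZ: "linear_ode (n0 + 1) (closed_matrix n0 A Bu Bv K ku) \<delta> (\<Lambda> * (i1 * I + i2 * W)) T Z"
        unfolding linear_ode_def
      proof (intro conjI exI[of _ "\<lambda>t i. if i < n0 then - (\<iota> t * L i) else 0"] ballI allI impI)
        show "0 \<le> \<Lambda> * (i1 * I + i2 * W)" using nn IWp by simp
        fix t i assume t: "t \<in> {0..T}" and i: "i < n0 + 1"
        have tn: "t \<ge> 0" using t by simp
        show "((\<lambda>\<tau>. Z \<tau> i) has_real_derivative (\<Sum>j<n0 + 1. closed_matrix n0 A Bu Bv K ku i j * Z t j) + (if i < n0 then - (\<iota> t * L i) else 0)) (at t within {0..})"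
        proof (cases "i < n0")
          case True
          have "(\<Sum>j<n0 + 1. closed_matrix n0 A Bu Bv K ku i j * Z t j) = (\<Sum>j<n0. A i j * Xh t j) - Bv i * (\<Sum>j<n0. K j * Xh t j) + (Bu i - Bv i * ku) * u t"
            unfolding Zs using True by (simp add: closed_matrix_def algebra_simps sum_subtractf sum_distrib_left)
          then have "(\<Sum>j<n0 + 1. closed_matrix n0 A Bu Bv K ku i j * Z t j) + - (\<iota> t * L i) =
             (\<Sum>j<n0. A i j * Xh t j) + Bu i * u t + Bv i * v t
              - ((\<Sum>j<n0. C j * (Xh t j - X t j)) + (\<Sum>n=N0 + 1..N. c1 n * (h1 n t - x1 n t))
                + (\<Sum>m=M0 + 1..M. c2 m * (h2 m t - x2 m t)) - \<zeta> t) * L i"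
            unfolding v[OF tn] \<iota>_def w_def E_def by (simp add: algebra_simps)
          then show ?thesis using Xhd[OF tn True] True by (simp add: Z_def)
        next
          case False
          then have "(\<Sum>j<n0 + 1. closed_matrix n0 A Bu Bv K ku i j * Z t j) = v t"
            unfolding Zs v[OF tn] by (simp add: closed_matrix_def sum_negf)
          then show ?thesis using ud[OF tn] False by (simp add: Z_def)
        qed
        show "\<bar>if i < n0 then - (\<iota> t * L i) else 0\<bar> \<le> \<Lambda> * (i1 * I + i2 * W) * exp (- \<delta> * t)"
        proof (cases "i < n0")
          case True
          then have "\<bar>\<iota> t\<bar> * \<bar>L i\<bar> \<le> ((i1 * I + i2 * W) * exp (- \<delta> * t)) * \<Lambda>"
            using \<iota>b[OF t] IWp unfolding \<Lambda>_def by (intro mult_mono member_le_sum[of i "{..<n0}" "\<lambda>i. \<bar>L i\<bar>"]) auto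
          then show ?thesis using True by (simp add: abs_mult mult_ac)
        qed (use nn IWp in auto)
      qed
      have Zb: "\<bar>Z t i\<bar> \<le> (x1c * I + x2c * W) * exp (- \<delta> * t)" if "t \<in> {0..T}" "i < n0 + 1" for t i
      proof -
        have "\<bar>Z t i\<bar> \<le> D2 * ((\<Sum>j<n0 + 1. \<bar>Z 0 j\<bar>) + \<Lambda> * (i1 * I + i2 * W)) * exp (- \<delta> * t)"
          using controller odeZ that unfolding decay_matrix_def by blast
        also have "\<dots> \<le> D2 * ((real n0 + 1) * I + \<Lambda> * (i1 * I + i2 * W)) * exp (- \<delta> * t)"
        proof -
          have "(\<Sum>j<n0 + 1. \<bar>Z 0 j\<bar>) \<le> (\<Sum>j<n0 + 1. I)"
            using i0 unfolding Z_def by (intro sum_mono) auto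
          then show ?thesis using D12 by (intro mult_right_mono mult_left_mono) (auto simp: algebra_simps)
        qed
        also have "\<dots> = (x1c * I + x2c * W) * exp (- \<delta> * t)" by (simp add: x1c_def x2c_def algebra_simps)
        finally show ?thesis .
      qed
      have "\<bar>Xh t i\<bar> \<le> (x1c * I + x2c * W) * exp (- \<delta> * t)" if "i < n0" for i
        using Zb[OF tT, of i] that by (simp add: Z_def)
      moreover have "\<bar>u t\<bar> \<le> (x1c * I + x2c * W) * exp (- \<delta> * t)"
        using Zb[OF tT, of n0] by (simp add: Z_def)
      ultimately show ?thesis
        using wb[OF tT] Eb[OF tT] unfolding W_def[symmetric] E_def by blast
    qed
    have vb: "\<bar>v t\<bar> \<le> \<Omega> * (R * exp (- \<delta> * t))"
      if "t \<ge> 0" "\<bar>u t\<bar> \<le> R * exp (- \<delta> * t)" "\<forall>i<n0. \<bar>Xh t i\<bar> \<le> R * exp (- \<delta> * t)" "R \<ge> 0" for t R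
    proof -
      have "\<bar>\<Sum>j<n0. K j * Xh t j\<bar> \<le> (\<Sum>j<n0. \<bar>K j\<bar> * (R * exp (- \<delta> * t)))"
        by (rule order_trans[OF sum_abs]) (intro sum_mono, simp only: abs_mult, intro mult_left_mono, use that in auto)
      also have "\<dots> = (\<Sum>j<n0. \<bar>K j\<bar>) * (R * exp (- \<delta> * t))" by (simp add: sum_distrib_right)
      finally have 1: "\<bar>\<Sum>j<n0. K j * Xh t j\<bar> \<le> (\<Sum>j<n0. \<bar>K j\<bar>) * (R * exp (- \<delta> * t))" .
      have 2: "\<bar>ku * u t\<bar> \<le> \<bar>ku\<bar> * (R * exp (- \<delta> * t))" unfolding abs_mult using that by (intro mult_left_mono) auto
      have "\<bar>v t\<bar> \<le> ((\<Sum>j<n0. \<bar>K j\<bar>) + \<bar>ku\<bar>) * (R * exp (- \<delta> * t))"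
        unfolding v[OF that(1)] distrib_right using 1 2 by linarith
      also have "\<dots> \<le> \<Omega> * (R * exp (- \<delta> * t))" unfolding \<Omega>_def using that(4) by (intro mult_right_mono) auto
      finally show ?thesis .
    qed
    have cu: "continuous_on {0..} u"
      using ud by (intro DERIV_continuous_on[where D=v]) auto
    have cXh: "continuous_on {0..} (\<lambda>t. Xh t i)" if "i < n0" for i
      using Xhd that by (intro DERIV_continuous_on) auto
    have cv: "continuous_on {0..} v"
    proof -
      have "continuous_on {0..} (\<lambda>t. - (\<Sum>j<n0. K j * Xh t j) - ku * u t)"
        by (intro continuous_intros cu cXh) auto
      then show ?thesis by (rule continuous_on_eq) (simp add: v)
    qed
    \<comment> \<open>The maximum of the weighted input over \<open>[0, t]\<close> is attained at some
      time \<open>s\<close>; one turn around the loop at the time \<open>s\<close> bounds the maximum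
      by itself.\<close>
    have close: "\<bar>u t\<bar> \<le> D * I * exp (- \<delta> * t) \<and> \<bar>v t\<bar> \<le> D * I * exp (- \<delta> * t)" if t: "t \<ge> 0" for t
    proof -
      define m where "m \<tau> = max \<bar>u \<tau>\<bar> \<bar>v \<tau>\<bar> * exp (\<delta> * \<tau>)" for \<tau>
      have "continuous_on {0..t} m"
        unfolding m_def by (intro continuous_intros continuous_on_subset[OF cu] continuous_on_subset[OF cv]) auto
      then obtain s where s: "s \<in> {0..t}" "\<And>\<tau>. \<tau> \<in> {0..t} \<Longrightarrow> m \<tau> \<le> m s"
        using continuous_attains_sup[of "{0..t}" m] t by auto
      define U where "U = m s"
      have Up: "U \<ge> 0" by (simp add: U_def m_def)
      have mU: "max \<bar>u \<tau>\<bar> \<bar>v \<tau>\<bar> \<le> U * exp (- \<delta> * \<tau>)" if "\<tau> \<in> {0..t}" for \<tau>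
      proof -
        have "max \<bar>u \<tau>\<bar> \<bar>v \<tau>\<bar> = m \<tau> * exp (- \<delta> * \<tau>)" by (simp add: m_def mult.assoc exp_add[symmetric])
        also have "\<dots> \<le> U * exp (- \<delta> * \<tau>)" unfolding U_def using s(2)[OF that] by (intro mult_right_mono) auto
        finally show ?thesis .
      qed
      define R where "R = x1c * I + x2c * (w1 * I + \<epsilon> * (\<gamma>1 + \<gamma>2) * U)"
      have Rp: "R \<ge> 0" unfolding R_def using pos I w1 \<epsilon> nn Up by (auto intro!: mult_nonneg_nonneg add_nonneg_nonneg)
      have tb: "\<bar>u s\<bar> \<le> R * exp (- \<delta> * s)" "\<forall>i<n0. \<bar>Xh s i\<bar> \<le> R * exp (- \<delta> * s)"
        using turn[of t U s] mU Up s(1) unfolding R_def by simp_all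
      have "s \<ge> 0" using s(1) by simp
      have "\<bar>v s\<bar> \<le> \<Omega> * (R * exp (- \<delta> * s))" by (rule vb[OF \<open>s \<ge> 0\<close> tb Rp])
      moreover have "\<bar>u s\<bar> \<le> \<Omega> * (R * exp (- \<delta> * s))"
        using tb(1) mult_right_mono[OF nn(7), of "R * exp (- \<delta> * s)"] Rp by simp
      ultimately have "max \<bar>u s\<bar> \<bar>v s\<bar> * exp (\<delta> * s) \<le> (\<Omega> * (R * exp (- \<delta> * s))) * exp (\<delta> * s)"
        by (intro mult_right_mono) auto
      also have "\<dots> = \<Omega> * R" by (simp add: mult.assoc exp_add[symmetric])
      finally have "U \<le> \<Omega> * R" by (simp add: U_def m_def)
      then have "2 * U \<le> 2 * (\<Omega> * R)" by simp
      also have "2 * (\<Omega> * R) = 2 * \<Omega> * (x1c + x2c * w1) * I + (2 * \<Omega> * x2c * (\<epsilon> * (\<gamma>1 + \<gamma>2))) * U"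
        by (simp add: R_def algebra_simps)
      also have "\<dots> \<le> 2 * \<Omega> * (x1c + x2c * w1) * I + 1 / 2 * U"
        using \<epsilon>half Up by (intro add_left_mono mult_right_mono)
      finally have "U \<le> 2 * \<Omega> * (x1c + x2c * w1) * I" using Up by linarith
      also have "\<dots> \<le> D * I"
        unfolding D_def using I nn pos w1 by (intro mult_right_mono) (auto intro!: mult_nonneg_nonneg add_nonneg_nonneg)
      finally have "U * exp (- \<delta> * t) \<le> D * I * exp (- \<delta> * t)" by (intro mult_right_mono) auto
      moreover have "\<bar>u t\<bar> \<le> U * exp (- \<delta> * t)" "\<bar>v t\<bar> \<le> U * exp (- \<delta> * t)" using mU[of t] t by auto
      ultimately show ?thesis by linarith
    qed
    have DI: "D * I \<ge> 0" using Dp I by simp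
    have ge: "\<And>\<tau>. \<tau> \<in> {0..t} \<Longrightarrow> \<bar>u \<tau>\<bar> \<le> (D * I) * exp (- \<delta> * \<tau>)" "\<And>\<tau>. \<tau> \<in> {0..t} \<Longrightarrow> \<bar>v \<tau>\<bar> \<le> (D * I) * exp (- \<delta> * \<tau>)"
      using close by simp_all
    note T = turn[OF ge DI, of t]
    have c: "x1c * I + x2c * (w1 * I + \<epsilon> * (\<gamma>1 + \<gamma>2) * (D * I)) = DX * I"
      "e1 * I + e2 * (w1 * I + \<epsilon> * (\<gamma>1 + \<gamma>2) * (D * I)) = DE * I"
      by (simp_all add: DX_def DE_def Dw_def algebra_simps)
    have mono: "D * I * exp (- \<delta> * t) \<le> (D + DX + DE) * I * exp (- \<delta> * t)" "DX * I * exp (- \<delta> * t) \<le> (D + DX + DE) * I * exp (- \<delta> * t)"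
      "(DX + DE) * I * exp (- \<delta> * t) \<le> (D + DX + DE) * I * exp (- \<delta> * t)"
      using Dp DXp I by (intro mult_right_mono; simp)+
    have X: "\<bar>Xh t i\<bar> \<le> DX * I * exp (- \<delta> * t)" "\<bar>Xh t i - X t i\<bar> \<le> DE * I * exp (- \<delta> * t)" if "i < n0"
      using T t0 that unfolding c by simp_all
    have "\<bar>X t i\<bar> \<le> (DX + DE) * I * exp (- \<delta> * t)" if "i < n0"
      using X[OF that] by (simp add: distrib_right)
    then show ?thesis using close[OF t0] mono X by (meson order_trans)
  qed
  then show ?thesis
    using that[of "D + DX + DE" "max P1 P2"] Dp DXp by auto
qed

end


section \<open>Weighted decay of the fast modes\<close>

text \<open>The parabolic smoothing of the system: dividing by \<open>- \<delta> - l n\<close>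
  gains two powers of \<open>n + 1\<close>, although the input coefficients are merely square
  summable.\<close>

lemma summable_weighted_gain:
  assumes fam: "fast_family \<delta> N0 l p q" and ev: "\<forall>\<^sub>F n in sequentially. (real n + 1)\<^sup>2 \<le> - \<delta> - l n"
    and w: "\<And>n. 0 \<le> w n" "\<And>n. w n \<le> (real n + 1)\<^sup>2"
  shows "summable (\<lambda>n. (w n * gain \<delta> N0 l p q n)\<^sup>2)"
proof (rule summable_comparison_test_ev)
  show "summable (\<lambda>n. 2 * (p n)\<^sup>2 + 2 * (q n)\<^sup>2)"
    using fam by (intro summable_add summable_mult) (simp_all add: fast_family_def)
  show "\<forall>\<^sub>F n in sequentially. norm ((w n * gain \<delta> N0 l p q n)\<^sup>2) \<le> 2 * (p n)\<^sup>2 + 2 * (q n)\<^sup>2"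
    using ev
  proof eventually_elim
    fix n assume n: "(real n + 1)\<^sup>2 \<le> - \<delta> - l n"
    have "w n * gain \<delta> N0 l p q n \<le> \<bar>p n\<bar> + \<bar>q n\<bar>"
    proof (cases "n > N0")
      case True
      have pos: "0 < - \<delta> - l n" using n by (smt (verit) of_nat_0_le_iff zero_less_power)
      have "w n * (\<bar>p n\<bar> + \<bar>q n\<bar>) \<le> (- \<delta> - l n) * (\<bar>p n\<bar> + \<bar>q n\<bar>)"
        using w(2)[of n] n by (intro mult_right_mono) auto
      then show ?thesis using pos True by (simp add: gain_def field_simps)
    qed (simp add: gain_def)
    then have "(w n * gain \<delta> N0 l p q n)\<^sup>2 \<le> (\<bar>p n\<bar> + \<bar>q n\<bar>)\<^sup>2"
      using w(1) gain_nonneg[OF fam] by (intro power_mono mult_nonneg_nonneg)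
    also have "\<dots> \<le> 2 * (p n)\<^sup>2 + 2 * (q n)\<^sup>2"
      using sum_squares_bound[of "\<bar>p n\<bar>" "\<bar>q n\<bar>"] by (simp add: power2_sum)
    finally show "norm ((w n * gain \<delta> N0 l p q n)\<^sup>2) \<le> 2 * (p n)\<^sup>2 + 2 * (q n)\<^sup>2" by simp
  qed
qed

lemma square_sum_decay:
  fixes x y g :: "nat \<Rightarrow> real"
  assumes le: "\<And>n. \<bar>y n\<bar> \<le> (\<bar>x n\<bar> + g n * I) * e" and x: "summable (\<lambda>n. (x n)\<^sup>2)" and g: "summable (\<lambda>n. (g n)\<^sup>2)"
  shows "summable (\<lambda>n. (y n)\<^sup>2)" and "(\<Sum>n. (y n)\<^sup>2) \<le> e\<^sup>2 * (2 * (\<Sum>n. (x n)\<^sup>2) + 2 * (\<Sum>n. (g n)\<^sup>2) * I\<^sup>2)"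
proof -
  define b where "b n = e\<^sup>2 * (2 * (x n)\<^sup>2 + 2 * (g n)\<^sup>2 * I\<^sup>2)" for n
  have bs: "summable b" unfolding b_def by (intro summable_mult summable_add summable_mult2 x g)
  have yb: "(y n)\<^sup>2 \<le> b n" for n
  proof -
    have "\<bar>y n\<bar>\<^sup>2 \<le> ((\<bar>x n\<bar> + g n * I) * e)\<^sup>2" using le[of n] by (intro power_mono) auto
    also have "\<dots> = e\<^sup>2 * (\<bar>x n\<bar> + g n * I)\<^sup>2" by (simp add: power_mult_distrib mult.commute)
    also have "\<dots> \<le> b n"
    proof -
      have "(\<bar>x n\<bar> + g n * I)\<^sup>2 \<le> 2 * \<bar>x n\<bar>\<^sup>2 + 2 * (g n * I)\<^sup>2"
        unfolding power2_sum using sum_squares_bound[of "\<bar>x n\<bar>" "g n * I"] by linarith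
      also have "\<dots> = 2 * (x n)\<^sup>2 + 2 * (g n)\<^sup>2 * I\<^sup>2" by (simp add: power_mult_distrib)
      finally show ?thesis unfolding b_def by (intro mult_left_mono) auto
    qed
    finally show ?thesis by simp
  qed
  show s: "summable (\<lambda>n. (y n)\<^sup>2)" using yb by (intro summable_comparison_test'[OF bs]) auto
  have "(\<Sum>n. (y n)\<^sup>2) \<le> suminf b" by (rule suminf_le[OF yb s bs])
  also have "suminf b = e\<^sup>2 * (2 * (\<Sum>n. (x n)\<^sup>2) + 2 * (\<Sum>n. (g n)\<^sup>2) * I\<^sup>2)"
    unfolding b_def
    using suminf_mult[OF summable_add[OF summable_mult[OF x, of 2] summable_mult2[OF summable_mult[OF g, of 2], of "I\<^sup>2"]], of "e\<^sup>2"]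
      suminf_add[OF summable_mult[OF x, of 2] summable_mult2[OF summable_mult[OF g, of 2], of "I\<^sup>2"]]
      suminf_mult[OF x, of 2] suminf_mult2[OF summable_mult[OF g, of 2], of "I\<^sup>2"] suminf_mult[OF g, of 2]
    by simp
  finally show "(\<Sum>n. (y n)\<^sup>2) \<le> e\<^sup>2 * (2 * (\<Sum>n. (x n)\<^sup>2) + 2 * (\<Sum>n. (g n)\<^sup>2) * I\<^sup>2)" .
qed

section \<open>The closed loop in modal coordinates\<close>

lemma linear_ode_cong:
  assumes "\<And>i j. i < n \<Longrightarrow> j < n \<Longrightarrow> A i j = B i j"
  shows "linear_ode n A \<delta> F T X = linear_ode n B \<delta> F T X"
proof -
  have "(\<Sum>j<n. A i j * X t j) = (\<Sum>j<n. B i j * X t j)" if "i < n" for i t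
    using that assms by (intro sum.cong) auto
  then show ?thesis unfolding linear_ode_def by auto
qed

lemma decay_matrix_of_Hurwitz:
  assumes "A \<in> carrier_mat n n" "eigenvalues_left_of A (- \<delta>)"
    and "\<And>i j. i < n \<Longrightarrow> j < n \<Longrightarrow> A $$ (i, j) = B i j"
  obtains D where "decay_matrix n B \<delta> D"
proof -
  obtain D where D: "D \<ge> 0" "\<And>F T X t i. \<lbrakk>linear_ode n (\<lambda>i j. A $$ (i, j)) \<delta> F T X; t \<in> {0..T}; i < n\<rbrakk> \<Longrightarrow>
       \<bar>X t i\<bar> \<le> D * ((\<Sum>j<n. \<bar>X 0 j\<bar>) + F) * exp (- \<delta> * t)"
    using Hurwitz_decay[OF assms(1,2)] by blast
  have "decay_matrix n B \<delta> D"
    unfolding decay_matrix_def using D linear_ode_cong[of n "\<lambda>i j. A $$ (i, j)" B, OF assms(3)] by blast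
  then show ?thesis by (rule that)
qed

lemma hphi_props: "has_L2_deriv2 hphi (\<lambda>x. 1 - x) (\<lambda>x. - 1)" "nsq hphi \<le> 1" "nsq (\<lambda>x. 1 - x) \<le> 1" "(\<lambda>x. 1 - x) \<in> L2I"
proof -
  show "has_L2_deriv2 hphi (\<lambda>x. 1 - x) (\<lambda>x. - 1)"
    by (rule has_L2_deriv2I) (auto simp: hphi_def[abs_def] intro!: continuous_intros derivative_eq_intros)
  have "\<bar>hphi x\<bar> \<le> 1" if "x \<in> {0<..<1}" for x
  proof -
    have "0 \<le> x * (1 - x / 2)" "x * (1 - x / 2) \<le> 1" using that by (auto intro!: mult_le_one)
    then show ?thesis by (simp add: hphi_def power2_eq_square algebra_simps)
  qed
  then show "nsq hphi \<le> 1" using nsq_le_bound[OF L2I_hphi(1), of 1] by simp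
  show L: "(\<lambda>x. 1 - x) \<in> L2I" by (intro L2I_continuous continuous_intros)
  show "nsq (\<lambda>x. 1 - x) \<le> 1" using nsq_le_bound[OF L, of 1] by simp
qed

lemma sum_split_at:
  fixes f :: "nat \<Rightarrow> real"
  assumes "N \<ge> N0" shows "(\<Sum>n<Suc N. f n) = (\<Sum>n\<le>N0. f n) + (\<Sum>n=N0 + 1..N. f n)"
proof -
  have "{..<Suc N} = {..N0} \<union> {N0 + 1..N}" using assms by auto
  then show ?thesis by (simp only:) (rule sum.union_disjoint, auto)
qed

text \<open>The plant with controller and observer gains whose finite-dimensional matrices are
  Hurwitz. Truncation orders and trajectories are left free, because one set of constants serves
  all of them.\<close>

locale plant =
  fixes a b s \<delta> ku :: real and c :: "real \<Rightarrow> real" and N0 M0 :: nat and Kx L :: "real Matrix.vec"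
  assumes c: "c \<in> L2I" and gap1: "lam1 a (N0 + 1) < - \<delta>" and gap2: "lam2 b (M0 + 1) < - \<delta>"
    and D1: "\<forall>n\<in>Delta1 a b. n \<le> N0" and D2: "\<forall>m\<in>Delta2 a b. m \<le> M0"
    and Kx: "Kx \<in> carrier_vec (N0 + M0 + 2)" and L: "L \<in> carrier_vec (N0 + M0 + 2)"
    and evK: "eigenvalues_left_of (matA1a a b s N0 M0 - matB1a a b s N0 M0 * matK Kx ku) (- \<delta>)"
    and evL: "eigenvalues_left_of (matA1 a b s N0 M0 - col_mat L * row_mat (vecC1 a b s c N0 M0)) (- \<delta>)"
begin

abbreviation "n0 \<equiv> N0 + M0 + 2"

lemma lam_mono: "n > N0 \<Longrightarrow> lam1 a n \<le> lam1 a (N0 + 1)" "m > M0 \<Longrightarrow> lam2 b m \<le> lam2 b (M0 + 1)"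
  unfolding lam1_def lam2_def by (auto intro!: mult_right_mono power_mono)

lemma families:
  "fast_family \<delta> N0 (lam1 a) (alpha1 a b s) (beta1 a b s)" "fast_family \<delta> M0 (lam2 b) (alpha2 b) beta2"
  unfolding fast_family_def using gap1 gap2 lam_mono summable_input_coefficients by auto

abbreviation "A1 \<equiv> \<lambda>i j. matA1 a b s N0 M0 $$ (i, j)"

lemma modal_loop_exists:
  obtains E1 E2 where "modal_loop \<delta> ku n0 N0 M0 A1 (\<lambda>i. vecB1u a b s N0 M0 $ i) (\<lambda>i. vecB1v a b s N0 M0 $ i)
     (\<lambda>i. vecC1 a b s c N0 M0 $ i) (\<lambda>i. L $ i) (\<lambda>i. Kx $ i) (lam1 a) (lam2 b) (alpha1 a b s) (alpha2 b) (beta1 a b s) beta2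
     (c1 c) (c2 a b s c) E1 E2"
proof -
  obtain E1 where E1: "decay_matrix n0 (\<lambda>i j. matA1 a b s N0 M0 $$ (i, j) - L $ i * vecC1 a b s c N0 M0 $ j) \<delta> E1"
    using decay_matrix_of_Hurwitz[OF observer_matrix_index(2)[OF D1 D2 L, of 0 0] evL]
      observer_matrix_index(1)[OF D1 D2 L] by (metis (no_types, lifting) add_2_eq_Suc' zero_less_Suc)
  note cm = controller_matrix_index[where s=s and ku=ku, OF D1 D2 Kx]
  obtain E2 where E2: "decay_matrix (n0 + 1) (closed_matrix n0 A1 (\<lambda>i. vecB1u a b s N0 M0 $ i) (\<lambda>i. vecB1v a b s N0 M0 $ i) (\<lambda>i. Kx $ i) ku) \<delta> E2"
  proof (rule decay_matrix_of_Hurwitz[OF cm(1) evK])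
    fix i j assume "i < n0 + 1" "j < n0 + 1"
    then have "(i < n0 \<or> i = n0) \<and> (j < n0 \<or> j = n0)" by linarith
    then show "(matA1a a b s N0 M0 - matB1a a b s N0 M0 * matK Kx ku) $$ (i, j) =
       closed_matrix n0 A1 (\<lambda>i. vecB1u a b s N0 M0 $ i) (\<lambda>i. vecB1v a b s N0 M0 $ i) (\<lambda>i. Kx $ i) ku i j"
      using cm(2)[of i j] cm(3)[of i] cm(4)[of j] cm(5) unfolding closed_matrix_def by (elim conjE disjE) simp_all
  qed blast
  show ?thesis
    by (rule that, unfold_locales) (use families E1 E2 summable_c1[OF c] summable_c2[OF c] in auto)
qed

text \<open>The coordinates of the homogenized state.\<close>

definition x1 where "x1 y z u n t = mode1 a b s (y t) (\<lambda>x. z t x - hphi x * u t) n"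
definition x2 where "x2 z u m t = ip (\<lambda>x. z t x - hphi x * u t) (ecos m)"

text \<open>The size of the initial data measured in modal coordinates.\<close>

definition I0 where "I0 N M y z u Xh h1 h2 =
  sqrt ((\<Sum>n. (x1 y z u n 0)\<^sup>2) + (\<Sum>m. (x2 z u m 0)\<^sup>2) + controller_normsq N0 M0 N M u Xh h1 h2 0)"

lemma scalar_prod_n0: "v \<in> carrier_vec n0 \<Longrightarrow> w \<bullet> v = (\<Sum>i<n0. w $ i * v $ i)"
  by (simp add: scalar_prod_def atLeast0LessThan)

lemma closed_loop_facts:
  assumes cl: "closed_loop a b s c N0 M0 N M Kx ku L y0 z0 y z u Xh h1 h2" and y0: "y0 \<in> L2I" and z0: "z0 \<in> L2I"
  defines "v \<equiv> \<lambda>t. - (Kx \<bullet> Xh t) - ku * u t"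
  shows "t \<ge> 0 \<Longrightarrow> y t \<in> L2I" and "t \<ge> 0 \<Longrightarrow> (\<lambda>x. z t x - hphi x * u t) \<in> L2I"
    and "x1 y z u n 0 = mode1 a b s y0 (\<lambda>x. z0 x - hphi x * u 0) n"
    and "x2 z u m 0 = ip (\<lambda>x. z0 x - hphi x * u 0) (ecos m)"
    and "t \<ge> 0 \<Longrightarrow> (x1 y z u n has_real_derivative lam1 a n * x1 y z u n t - jordan_coupling a b s n * x2 z u (partner2 a b n) t
       + alpha1 a b s n * u t + beta1 a b s n * v t) (at t within {0..})"
    and "t \<ge> 0 \<Longrightarrow> (x2 z u m has_real_derivative lam2 b m * x2 z u m t + alpha2 b m * u t + beta2 m * v t) (at t within {0..})"
proof -
  have ud: "(u has_real_derivative v t) (at t within {0..})" if "t \<ge> 0" for t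
    using cl that unfolding closed_loop_def Let_def v_def by blast
  have XC: "Xh t \<in> carrier_vec n0" if "t \<ge> 0" for t using cl that unfolding closed_loop_def Let_def by blast
  have cX: "continuous_on {0..} (\<lambda>t. Xh t $ i)" if "i < n0" for i
  proof (rule DERIV_continuous_on)
    fix t :: real assume "t \<in> {0..}"
    then show "((\<lambda>\<tau>. Xh \<tau> $ i) has_real_derivative
             (matA1 a b s N0 M0 *\<^sub>v Xh t + u t \<cdot>\<^sub>v vecB1u a b s N0 M0
              + (- (Kx \<bullet> Xh t) - ku * u t) \<cdot>\<^sub>v vecB1v a b s N0 M0 - (vecC1 a b s c N0 M0 \<bullet> Xh t
                    + (\<Sum>n=N0+1..N. c1 c n * h1 n t)
                    + (\<Sum>m=M0+1..M. c2 a b s c m * h2 m t) - (LINT x|I01. c x * y t x)) \<cdot>\<^sub>v L) $ i) (at t within {0..})"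
      using cl that unfolding closed_loop_def Let_def by auto
  qed
  have cu: "continuous_on {0..} u" by (rule DERIV_continuous_on[of _ u v]) (use ud in auto)
  have cv: "continuous_on {0..} v"
  proof (rule continuous_on_eq)
    show "continuous_on {0..} (\<lambda>t. - (\<Sum>i<n0. Kx $ i * Xh t $ i) - ku * u t)"
      by (intro continuous_intros cu cX) auto
    show "- (\<Sum>i<n0. Kx $ i * Xh t $ i) - ku * u t = v t" if "t \<in> {0..}" for t
      using scalar_prod_n0[OF XC, of t Kx] that by (simp only: v_def atLeast_iff)
  qed
  have mild: "mild_solution (opA a b s) (\<lambda>t. ((\<lambda>x. 0), (\<lambda>x. halpha b x * u t + hbeta x * v t)))
         (y0, (\<lambda>x. z0 x - hphi x * u 0)) (\<lambda>t. (y t, (\<lambda>x. z t x - hphi x * u t)))"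
    using cl unfolding closed_loop_def Let_def v_def by blast
  have X0: "(y0, (\<lambda>x. z0 x - hphi x * u 0)) \<in> H0"
    using y0 z0 by (auto simp: H0_def intro!: L2I_diff L2I_scale_right L2I_hphi)
  note ms = mild_solution_modes[OF mild X0 cu cv, unfolded fst_conv snd_conv]
  show "t \<ge> 0 \<Longrightarrow> y t \<in> L2I" "t \<ge> 0 \<Longrightarrow> (\<lambda>x. z t x - hphi x * u t) \<in> L2I" using ms(1)[of t] by (auto simp: H0_def)
  show "x1 y z u n 0 = mode1 a b s y0 (\<lambda>x. z0 x - hphi x * u 0) n" using ms(2) by (simp add: x1_def)
  show "x2 z u m 0 = ip (\<lambda>x. z0 x - hphi x * u 0) (ecos m)" using ms(4) by (simp add: x2_def)
  show "t \<ge> 0 \<Longrightarrow> (x1 y z u n has_real_derivative lam1 a n * x1 y z u n t - jordan_coupling a b s n * x2 z u (partner2 a b n) t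
       + alpha1 a b s n * u t + beta1 a b s n * v t) (at t within {0..})"
    using ms(3) unfolding x1_def[abs_def] x2_def by simp
  show "t \<ge> 0 \<Longrightarrow> (x2 z u m has_real_derivative lam2 b m * x2 z u m t + alpha2 b m * u t + beta2 m * v t) (at t within {0..})"
    using ms(5) unfolding x2_def[abs_def] by simp
qed

lemma controller_normsq_parts:
  assumes "Xh t \<in> carrier_vec n0"
  shows "(u t)\<^sup>2 \<le> controller_normsq N0 M0 N M u Xh h1 h2 t" "i < n0 \<Longrightarrow> (Xh t $ i)\<^sup>2 \<le> controller_normsq N0 M0 N M u Xh h1 h2 t"
    "(\<Sum>n=N0+1..N. (h1 n t)\<^sup>2) \<le> controller_normsq N0 M0 N M u Xh h1 h2 t"
    "(\<Sum>m=M0+1..M. (h2 m t)\<^sup>2) \<le> controller_normsq N0 M0 N M u Xh h1 h2 t" "0 \<le> controller_normsq N0 M0 N M u Xh h1 h2 t"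
proof -
  have X: "Xh t \<bullet> Xh t = (\<Sum>i<n0. (Xh t $ i)\<^sup>2)" using assms by (simp add: scalar_prod_n0 power2_eq_square)
  have p: "0 \<le> (\<Sum>i<n0. (Xh t $ i)\<^sup>2)" "0 \<le> (\<Sum>n=N0+1..N. (h1 n t)\<^sup>2)" "0 \<le> (\<Sum>m=M0+1..M. (h2 m t)\<^sup>2)" "0 \<le> (u t)\<^sup>2"
    by (intro sum_nonneg; simp)+ simp
  show "(Xh t $ i)\<^sup>2 \<le> controller_normsq N0 M0 N M u Xh h1 h2 t" if "i < n0"
  proof -
    have "(Xh t $ i)\<^sup>2 \<le> (\<Sum>i<n0. (Xh t $ i)\<^sup>2)" by (rule member_le_sum) (use that in auto)
    then show ?thesis using p unfolding controller_normsq_def X by linarith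
  qed
  show "(u t)\<^sup>2 \<le> controller_normsq N0 M0 N M u Xh h1 h2 t" "(\<Sum>n=N0+1..N. (h1 n t)\<^sup>2) \<le> controller_normsq N0 M0 N M u Xh h1 h2 t"
    "(\<Sum>m=M0+1..M. (h2 m t)\<^sup>2) \<le> controller_normsq N0 M0 N M u Xh h1 h2 t" "0 \<le> controller_normsq N0 M0 N M u Xh h1 h2 t"
    using p unfolding controller_normsq_def X by linarith+
qed

lemma initial_bounds:
  assumes cl: "closed_loop a b s c N0 M0 N M Kx ku L y0 z0 y z u Xh h1 h2" and y0: "y0 \<in> L2I" and z0: "z0 \<in> L2I"
  shows "summable (\<lambda>n. (x1 y z u n 0)\<^sup>2)" "summable (\<lambda>m. (x2 z u m 0)\<^sup>2)" "I0 N M y z u Xh h1 h2 \<ge> 0"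
    "(I0 N M y z u Xh h1 h2)\<^sup>2 = (\<Sum>n. (x1 y z u n 0)\<^sup>2) + (\<Sum>m. (x2 z u m 0)\<^sup>2) + controller_normsq N0 M0 N M u Xh h1 h2 0"
    "(\<Sum>n. (x1 y z u n 0)\<^sup>2) \<le> (I0 N M y z u Xh h1 h2)\<^sup>2" "(\<Sum>m. (x2 z u m 0)\<^sup>2) \<le> (I0 N M y z u Xh h1 h2)\<^sup>2"
    "controller_normsq N0 M0 N M u Xh h1 h2 0 \<le> (I0 N M y z u Xh h1 h2)\<^sup>2"
proof -
  have XC: "Xh 0 \<in> carrier_vec n0" using cl unfolding closed_loop_def Let_def by blast
  note f = closed_loop_facts[OF cl y0 z0]
  show s1: "summable (\<lambda>n. (x1 y z u n 0)\<^sup>2)" "summable (\<lambda>m. (x2 z u m 0)\<^sup>2)"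
    unfolding x1_def x2_def by (intro sums_summable[OF mode1_sums] sums_summable[OF nsq_ecos_sums] f; simp)+
  have p: "0 \<le> (\<Sum>n. (x1 y z u n 0)\<^sup>2)" "0 \<le> (\<Sum>m. (x2 z u m 0)\<^sup>2)" "0 \<le> controller_normsq N0 M0 N M u Xh h1 h2 0"
    using s1 controller_normsq_parts(5)[of Xh 0 N M u h1 h2] XC by (auto intro: suminf_nonneg)
  then show "I0 N M y z u Xh h1 h2 \<ge> 0" by (simp add: I0_def)
  show e: "(I0 N M y z u Xh h1 h2)\<^sup>2 = (\<Sum>n. (x1 y z u n 0)\<^sup>2) + (\<Sum>m. (x2 z u m 0)\<^sup>2) + controller_normsq N0 M0 N M u Xh h1 h2 0"
    using p by (simp add: I0_def)
  show "(\<Sum>n. (x1 y z u n 0)\<^sup>2) \<le> (I0 N M y z u Xh h1 h2)\<^sup>2" "(\<Sum>m. (x2 z u m 0)\<^sup>2) \<le> (I0 N M y z u Xh h1 h2)\<^sup>2"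
    "controller_normsq N0 M0 N M u Xh h1 h2 0 \<le> (I0 N M y z u Xh h1 h2)\<^sup>2"
    unfolding e using p by linarith+
qed

end


context plant
begin

section \<open>Decay of the controlled modes\<close>

definition trajectory where
  "trajectory P N M y0 z0 y z u Xh h1 h2 \<longleftrightarrow> N0 \<le> N \<and> M0 \<le> M \<and> P \<le> N \<and> P \<le> M \<and> y0 \<in> L2I \<and> z0 \<in> L2I \<and>
     closed_loop a b s c N0 M0 N M Kx ku L y0 z0 y z u Xh h1 h2"

text \<open>The outcome of the small-gain argument for the plant: exponential decay of everything
  that is finite-dimensional and common to all truncations.\<close>

definition slow_decay where
  "slow_decay D P \<longleftrightarrow> D \<ge> 0 \<and> (\<forall>N M y0 z0 y z u Xh h1 h2 t. trajectory P N M y0 z0 y z u Xh h1 h2 \<longrightarrow> t \<ge> 0 \<longrightarrow>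
     \<bar>u t\<bar> \<le> D * I0 N M y z u Xh h1 h2 * exp (- \<delta> * t) \<and>
     \<bar>- (Kx \<bullet> Xh t) - ku * u t\<bar> \<le> D * I0 N M y z u Xh h1 h2 * exp (- \<delta> * t) \<and>
     (\<forall>i<n0. \<bar>Xh t $ i\<bar> \<le> D * I0 N M y z u Xh h1 h2 * exp (- \<delta> * t)) \<and>
     (\<forall>n\<le>N0. \<bar>x1 y z u n t\<bar> \<le> D * I0 N M y z u Xh h1 h2 * exp (- \<delta> * t)) \<and>
     (\<forall>m\<le>M0. \<bar>x2 z u m t\<bar> \<le> D * I0 N M y z u Xh h1 h2 * exp (- \<delta> * t)))"

text \<open>The trajectories of the plant are trajectories of the modal loop. The output tail
  \<open>\<zeta>\<close> is defined as what the truncation leaves of the output, and the output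
  expansion identifies it as the required sum over the modes beyond the truncation.\<close>

lemma slow_decay_exists: "\<exists>D P. slow_decay D P"
proof -
  obtain E1 E2 where ml: "modal_loop \<delta> ku n0 N0 M0 A1 (\<lambda>i. vecB1u a b s N0 M0 $ i) (\<lambda>i. vecB1v a b s N0 M0 $ i)
     (\<lambda>i. vecC1 a b s c N0 M0 $ i) (\<lambda>i. L $ i) (\<lambda>i. Kx $ i) (lam1 a) (lam2 b) (alpha1 a b s) (alpha2 b) (beta1 a b s) beta2
     (c1 c) (c2 a b s c) E1 E2"
    by (rule modal_loop_exists)
  interpret ml: modal_loop \<delta> ku n0 N0 M0 A1 "\<lambda>i. vecB1u a b s N0 M0 $ i" "\<lambda>i. vecB1v a b s N0 M0 $ i"
     "\<lambda>i. vecC1 a b s c N0 M0 $ i" "\<lambda>i. L $ i" "\<lambda>i. Kx $ i" "lam1 a" "lam2 b" "alpha1 a b s" "alpha2 b" "beta1 a b s" beta2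
     "c1 c" "c2 a b s c" E1 E2
    by (rule ml)
  obtain D P where D: "D \<ge> 0" and sg: "\<And>N M I x1 x2 X Xh h1 h2 u v \<zeta> t i. \<lbrakk>ml.loop N M I x1 x2 X Xh h1 h2 u v \<zeta>; N \<ge> P; M \<ge> P; t \<ge> 0\<rbrakk> \<Longrightarrow>
       \<bar>u t\<bar> \<le> D * I * exp (- \<delta> * t) \<and> \<bar>v t\<bar> \<le> D * I * exp (- \<delta> * t) \<and>
       (i < n0 \<longrightarrow> \<bar>X t i\<bar> \<le> D * I * exp (- \<delta> * t) \<and> \<bar>Xh t i\<bar> \<le> D * I * exp (- \<delta> * t))"
    using ml.small_gain by blast
  have main: "\<bar>u t\<bar> \<le> (real n0 * D + D) * I0 N M y z u Xh h1 h2 * exp (- \<delta> * t) \<and>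
       \<bar>- (Kx \<bullet> Xh t) - ku * u t\<bar> \<le> (real n0 * D + D) * I0 N M y z u Xh h1 h2 * exp (- \<delta> * t) \<and>
       (\<forall>i<n0. \<bar>Xh t $ i\<bar> \<le> (real n0 * D + D) * I0 N M y z u Xh h1 h2 * exp (- \<delta> * t)) \<and>
       (\<forall>n\<le>N0. \<bar>x1 y z u n t\<bar> \<le> (real n0 * D + D) * I0 N M y z u Xh h1 h2 * exp (- \<delta> * t)) \<and>
       (\<forall>m\<le>M0. \<bar>x2 z u m t\<bar> \<le> (real n0 * D + D) * I0 N M y z u Xh h1 h2 * exp (- \<delta> * t))"
    if traj: "trajectory P N M y0 z0 y z u Xh h1 h2" and t: "t \<ge> 0" for N M y0 z0 y z u Xh h1 h2 t
  proof -
    have cl: "closed_loop a b s c N0 M0 N M Kx ku L y0 z0 y z u Xh h1 h2" and y0: "y0 \<in> L2I" and z0: "z0 \<in> L2I"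
      and NM: "N \<ge> N0" "M \<ge> M0" "N \<ge> P" "M \<ge> P"
      using traj unfolding trajectory_def by blast+
    define v where "v t = - (Kx \<bullet> Xh t) - ku * u t" for t
    define I where "I = I0 N M y z u Xh h1 h2"
    define ym where "ym t = (LINT x|I01. c x * y t x)" for t
    define innov where "innov t = vecC1 a b s c N0 M0 \<bullet> Xh t + (\<Sum>n=N0+1..N. c1 c n * h1 n t)
                    + (\<Sum>m=M0+1..M. c2 a b s c m * h2 m t) - ym t" for t
    define \<xi>1 where "\<xi>1 = x1 y z u"
    define \<xi>2 where "\<xi>2 = x2 z u"
    define X where "X t i = modal_vec a b N0 M0 (\<lambda>n. \<xi>1 n t) (\<lambda>m. \<xi>2 m t) $ i" for t i
    note f = closed_loop_facts[OF cl y0 z0, folded v_def \<xi>1_def \<xi>2_def]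
    note ib = initial_bounds[OF cl y0 z0, folded I_def \<xi>1_def \<xi>2_def]
    have ud: "(u has_real_derivative v t) (at t within {0..})" if "t \<ge> 0" for t
      using cl that unfolding closed_loop_def Let_def v_def by blast
    have XC: "Xh t \<in> carrier_vec n0" if "t \<ge> 0" for t using cl that unfolding closed_loop_def Let_def by blast
    have Xhd: "((\<lambda>\<tau>. Xh \<tau> $ i) has_real_derivative
             (matA1 a b s N0 M0 *\<^sub>v Xh t + u t \<cdot>\<^sub>v vecB1u a b s N0 M0 + v t \<cdot>\<^sub>v vecB1v a b s N0 M0 - innov t \<cdot>\<^sub>v L) $ i) (at t within {0..})"
      if "t \<ge> 0" "i < n0" for t i
      using cl that unfolding closed_loop_def Let_def v_def innov_def ym_def by blast
    have h1d: "mode_ode (lam1 a) (alpha1 a b s) (beta1 a b s) u v n (h1 n)" if "n \<in> {N0 + 1..N}" for n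
      using cl that unfolding closed_loop_def Let_def v_def mode_ode_def by blast
    have h2d: "mode_ode (lam2 b) (alpha2 b) beta2 u v m (h2 m)" if "m \<in> {M0 + 1..M}" for m
      using cl that unfolding closed_loop_def Let_def v_def mode_ode_def by blast
    have x1d: "mode_ode (lam1 a) (alpha1 a b s) (beta1 a b s) u v n (\<xi>1 n)" if "n > N0" for n
    proof -
      have "jordan_coupling a b s n = 0" using D1 that by (auto simp: jordan_coupling_def)
      then show ?thesis using f(5)[of _ n] by (simp add: mode_ode_def)
    qed
    have x2d: "mode_ode (lam2 b) (alpha2 b) beta2 u v m (\<xi>2 m)" for m
      using f(6)[of _ m] by (simp add: mode_ode_def)
    note A1c = dims(2)[OF D1 D2, of s]
    have mulv: "(matA1 a b s N0 M0 *\<^sub>v w) $ i = (\<Sum>j<n0. matA1 a b s N0 M0 $$ (i, j) * w $ j)" if "w \<in> carrier_vec n0" "i < n0" for w i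
      using that A1c by (simp add: scalar_prod_def atLeast0LessThan)
    have Bc: "vecB1u a b s N0 M0 \<in> carrier_vec n0" "vecB1v a b s N0 M0 \<in> carrier_vec n0"
      unfolding vecB1u_def vecB1v_def by (rule modal_vec_carrier[OF D1 D2])+
    have Xd: "((\<lambda>\<tau>. X \<tau> i) has_real_derivative (\<Sum>j<n0. matA1 a b s N0 M0 $$ (i, j) * X t j) + vecB1u a b s N0 M0 $ i * u t
        + vecB1v a b s N0 M0 $ i * v t) (at t within {0..})" if t: "t \<ge> 0" and i: "i < n0" for t i
    proof -
      have "(\<Sum>j<n0. matA1 a b s N0 M0 $$ (i, j) * X t j) = (matA1 a b s N0 M0 *\<^sub>v modal_vec a b N0 M0 (\<lambda>n. \<xi>1 n t) (\<lambda>m. \<xi>2 m t)) $ i"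
        unfolding X_def by (rule mulv[symmetric, OF modal_vec_carrier[OF D1 D2] i])
      also have "\<dots> = case_sum (\<lambda>n. lam1 a n * \<xi>1 n t - jordan_coupling a b s n * \<xi>2 (partner2 a b n) t) (\<lambda>m. lam2 b m * \<xi>2 m t) (mode_list a b N0 M0 ! i)"
        by (simp only: matA1_mult_modal_vec[OF D1 D2] modal_vec_index[OF D1 D2 i])
      finally have S: "(\<Sum>j<n0. matA1 a b s N0 M0 $$ (i, j) * X t j) =
         case_sum (\<lambda>n. lam1 a n * \<xi>1 n t - jordan_coupling a b s n * \<xi>2 (partner2 a b n) t) (\<lambda>m. lam2 b m * \<xi>2 m t) (mode_list a b N0 M0 ! i)" .
      have Xi: "(\<lambda>\<tau>. X \<tau> i) = (\<lambda>\<tau>. case_sum (\<lambda>n. \<xi>1 n \<tau>) (\<lambda>m. \<xi>2 m \<tau>) (mode_list a b N0 M0 ! i))"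
        unfolding X_def by (simp only: modal_vec_index[OF D1 D2 i])
      show ?thesis
        unfolding S Xi vecB1u_def vecB1v_def modal_vec_index[OF D1 D2 i]
        using f(5)[OF t] f(6)[OF t] by (rule_tac mode_list_nth_cases[OF D1 D2 i]) simp_all
    qed
    define \<zeta> where "\<zeta> t = ym t - vecC1 a b s c N0 M0 \<bullet> modal_vec a b N0 M0 (\<lambda>n. \<xi>1 n t) (\<lambda>m. \<xi>2 m t)
       - (\<Sum>n=N0+1..N. c1 c n * \<xi>1 n t) - (\<Sum>m=M0+1..M. c2 a b s c m * \<xi>2 m t)" for t
    have \<zeta>: "\<exists>r1 r2. (\<lambda>k. c1 c (k + Suc N) * \<xi>1 (k + Suc N) t) sums r1 \<and> (\<lambda>k. c2 a b s c (k + Suc M) * \<xi>2 (k + Suc M) t) sums r2 \<and> \<zeta> t = r1 + r2"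
      if t: "t \<ge> 0" for t
    proof -
      obtain p q where pq: "(\<lambda>n. c1 c n * mode1 a b s (y t) (\<lambda>x. z t x - hphi x * u t) n) sums p"
        "(\<lambda>m. c2 a b s c m * ip (\<lambda>x. z t x - hphi x * u t) (ecos m)) sums q" "ip c (y t) = p + q"
        using output_expansion[OF c f(1,2), OF t t] by blast
      have "(\<lambda>k. c1 c (k + Suc N) * \<xi>1 (k + Suc N) t) sums (p - (\<Sum>n<Suc N. c1 c n * \<xi>1 n t))"
        using sums_split_initial_segment[OF pq(1), of "Suc N"] by (simp add: \<xi>1_def x1_def)
      moreover have "(\<lambda>k. c2 a b s c (k + Suc M) * \<xi>2 (k + Suc M) t) sums (q - (\<Sum>m<Suc M. c2 a b s c m * \<xi>2 m t))"
        using sums_split_initial_segment[OF pq(2), of "Suc M"] by (simp add: \<xi>2_def x2_def)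
      moreover have "ym t = p + q" using pq(3) by (simp add: ym_def ip_def)
      then have "\<zeta> t = (p - (\<Sum>n<Suc N. c1 c n * \<xi>1 n t)) + (q - (\<Sum>m<Suc M. c2 a b s c m * \<xi>2 m t))"
        unfolding \<zeta>_def vecC1_mult_modal_vec[OF D1 D2] sum_split_at[OF NM(1)] sum_split_at[OF NM(2)] by simp
      ultimately show ?thesis by blast
    qed
    have innov: "innov t = (\<Sum>j<n0. vecC1 a b s c N0 M0 $ j * (Xh t $ j - X t j)) + (\<Sum>n=N0 + 1..N. c1 c n * (h1 n t - \<xi>1 n t))
            + (\<Sum>m=M0 + 1..M. c2 a b s c m * (h2 m t - \<xi>2 m t)) - \<zeta> t" if "t \<ge> 0" for t
    proof -
      have "vecC1 a b s c N0 M0 \<bullet> Xh t = (\<Sum>j<n0. vecC1 a b s c N0 M0 $ j * Xh t $ j)"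
        by (rule scalar_prod_n0[OF XC[OF that]])
      moreover have "vecC1 a b s c N0 M0 \<bullet> modal_vec a b N0 M0 (\<lambda>n. \<xi>1 n t) (\<lambda>m. \<xi>2 m t) = (\<Sum>j<n0. vecC1 a b s c N0 M0 $ j * X t j)"
        unfolding X_def by (rule scalar_prod_n0[OF modal_vec_carrier[OF D1 D2]])
      ultimately show ?thesis
        by (simp only: innov_def \<zeta>_def right_diff_distrib sum_subtractf)
    qed
    have Xhd': "((\<lambda>\<tau>. Xh \<tau> $ i) has_real_derivative (\<Sum>j<n0. matA1 a b s N0 M0 $$ (i, j) * Xh t $ j) + vecB1u a b s N0 M0 $ i * u t
        + vecB1v a b s N0 M0 $ i * v t - innov t * L $ i) (at t within {0..})" if t: "t \<ge> 0" and i: "i < n0" for t i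
    proof -
      have "(matA1 a b s N0 M0 *\<^sub>v Xh t + u t \<cdot>\<^sub>v vecB1u a b s N0 M0 + v t \<cdot>\<^sub>v vecB1v a b s N0 M0 - innov t \<cdot>\<^sub>v L) $ i =
        (matA1 a b s N0 M0 *\<^sub>v Xh t) $ i + u t * vecB1u a b s N0 M0 $ i + v t * vecB1v a b s N0 M0 $ i - innov t * L $ i"
        using i Bc L A1c by simp
      then show ?thesis using Xhd[OF t i] mulv[OF XC[OF t] i] by (simp only: mult.commute)
    qed
    have X0: "\<bar>X 0 i\<bar> \<le> I" if "i < n0" for i
    proof -
      have "(X 0 i)\<^sup>2 \<le> I\<^sup>2"
        unfolding X_def modal_vec_index[OF D1 D2 that]
      proof (rule mode_list_nth_cases[OF D1 D2 that])
        fix n assume "mode_list a b N0 M0 ! i = Inl n"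
        then show "(case_sum (\<lambda>n. \<xi>1 n 0) (\<lambda>m. \<xi>2 m 0) (mode_list a b N0 M0 ! i))\<^sup>2 \<le> I\<^sup>2"
          using sum_le_suminf[OF ib(1), of "{n}"] ib(5) by simp
      next
        fix n assume "mode_list a b N0 M0 ! i = Inr n"
        then show "(case_sum (\<lambda>n. \<xi>1 n 0) (\<lambda>m. \<xi>2 m 0) (mode_list a b N0 M0 ! i))\<^sup>2 \<le> I\<^sup>2"
          using sum_le_suminf[OF ib(2), of "{n}"] ib(6) by simp
      qed
      then show ?thesis using ib(3) by (simp add: abs_le_square_iff[symmetric])
    qed
    note cp = controller_normsq_parts[where Xh=Xh and t=0 and u=u and N=N and M=M and ?h1.0=h1 and ?h2.0=h2, OF XC[OF order_refl]]
    have abs: "\<bar>r\<bar> \<le> I" if "r\<^sup>2 \<le> controller_normsq N0 M0 N M u Xh h1 h2 0" for r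
      using that ib(3,7) by (metis abs_le_square_iff abs_of_nonneg order_trans)
    have "ml.loop N M I \<xi>1 \<xi>2 X (\<lambda>t i. Xh t $ i) h1 h2 u v \<zeta>"
      unfolding ml.loop_def
    proof (intro conjI allI impI ballI)
      show "v t = - (\<Sum>j<n0. Kx $ j * Xh t $ j) - ku * u t" if "t \<ge> 0" for t
        unfolding v_def using scalar_prod_n0[OF XC[OF that], of Kx] by (simp only:)
      show "((\<lambda>\<tau>. Xh \<tau> $ i) has_real_derivative (\<Sum>j<n0. matA1 a b s N0 M0 $$ (i, j) * Xh t $ j) + vecB1u a b s N0 M0 $ i * u t
        + vecB1v a b s N0 M0 $ i * v t - ((\<Sum>j<n0. vecC1 a b s c N0 M0 $ j * (Xh t $ j - X t j)) + (\<Sum>n=N0 + 1..N. c1 c n * (h1 n t - \<xi>1 n t))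
            + (\<Sum>m=M0 + 1..M. c2 a b s c m * (h2 m t - \<xi>2 m t)) - \<zeta> t) * L $ i) (at t within {0..})" if "t \<ge> 0" "i < n0" for t i
        using Xhd'[OF that] unfolding innov[OF that(1)] .
      show "\<bar>u 0\<bar> \<le> I" by (rule abs[OF cp(1)])
      show "\<bar>Xh 0 $ i\<bar> \<le> I" if "i < n0" for i by (rule abs[OF cp(2)[OF that]])
      show "(\<Sum>n=N0 + 1..N. (h1 n 0)\<^sup>2) \<le> I\<^sup>2" by (rule order_trans[OF cp(3) ib(7)])
      show "(\<Sum>m=M0 + 1..M. (h2 m 0)\<^sup>2) \<le> I\<^sup>2" by (rule order_trans[OF cp(4) ib(7)])
      show "N0 \<le> N" "M0 \<le> M" "0 \<le> I" by (rule NM ib)+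
      show "(u has_real_derivative v t) (at t within {0..})" if "t \<ge> 0" for t by (rule ud[OF that])
      show "((\<lambda>\<tau>. X \<tau> i) has_real_derivative (\<Sum>j<n0. matA1 a b s N0 M0 $$ (i, j) * X t j) + vecB1u a b s N0 M0 $ i * u t
        + vecB1v a b s N0 M0 $ i * v t) (at t within {0..})" if "t \<ge> 0" "i < n0" for t i by (rule Xd[OF that])
      show "mode_ode (lam1 a) (alpha1 a b s) (beta1 a b s) u v n (\<xi>1 n)" if "N0 < n" for n by (rule x1d[OF that])
      show "mode_ode (lam2 b) (alpha2 b) beta2 u v m (\<xi>2 m)" for m by (rule x2d)
      show "mode_ode (lam1 a) (alpha1 a b s) (beta1 a b s) u v n (h1 n)" if "n \<in> {N0 + 1..N}" for n by (rule h1d[OF that])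
      show "mode_ode (lam2 b) (alpha2 b) beta2 u v m (h2 m)" if "m \<in> {M0 + 1..M}" for m by (rule h2d[OF that])
      show "\<exists>r1 r2. (\<lambda>k. c1 c (k + Suc N) * \<xi>1 (k + Suc N) t) sums r1 \<and> (\<lambda>k. c2 a b s c (k + Suc M) * \<xi>2 (k + Suc M) t) sums r2 \<and> \<zeta> t = r1 + r2"
        if "t \<ge> 0" for t by (rule \<zeta>[OF that])
      show "\<bar>X 0 i\<bar> \<le> I" if "i < n0" for i by (rule X0[OF that])
      show "summable (\<lambda>n. (\<xi>1 n 0)\<^sup>2)" "(\<Sum>n. (\<xi>1 n 0)\<^sup>2) \<le> I\<^sup>2" "summable (\<lambda>m. (\<xi>2 m 0)\<^sup>2)" "(\<Sum>m. (\<xi>2 m 0)\<^sup>2) \<le> I\<^sup>2"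
        by (rule ib)+
    qed
    note r = sg[OF this NM(3,4) t, unfolded mult.assoc]
    define e where "e = I * exp (- \<delta> * t)"
    have e0: "e \<ge> 0" using ib(3) by (simp add: e_def)
    have mono: "D * e \<le> (real n0 * D + D) * e" "real n0 * (D * e) \<le> (real n0 * D + D) * e"
      using D e0 by (simp_all add: distrib_right)
    have sumX: "(\<Sum>n\<le>N0. \<bar>\<xi>1 n t\<bar>) + (\<Sum>m\<le>M0. \<bar>\<xi>2 m t\<bar>) \<le> real n0 * (D * e)"
    proof -
      have "(\<Sum>n\<le>N0. \<bar>\<xi>1 n t\<bar>) + (\<Sum>m\<le>M0. \<bar>\<xi>2 m t\<bar>) = (\<Sum>i<n0. \<bar>X t i\<bar>)"
        unfolding X_def by (rule sum_abs_modal_vec[OF D1 D2, symmetric])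
      also have "\<dots> \<le> (\<Sum>i<n0. D * e)"
        using r by (intro sum_mono) (simp only: e_def lessThan_iff)
      finally show ?thesis by (simp only: sum_constant card_lessThan)
    qed
    have s0: "0 \<le> (\<Sum>n\<le>N0. \<bar>\<xi>1 n t\<bar>)" "0 \<le> (\<Sum>m\<le>M0. \<bar>\<xi>2 m t\<bar>)" by (intro sum_nonneg; simp)+
    have "\<bar>\<xi>1 n t\<bar> \<le> (real n0 * D + D) * e" if "n \<le> N0" for n
    proof -
      have "\<bar>\<xi>1 n t\<bar> \<le> (\<Sum>n\<le>N0. \<bar>\<xi>1 n t\<bar>)" by (rule member_le_sum) (use that in auto)
      then show ?thesis using s0(2) sumX mono(2) by linarith
    qed
    moreover have "\<bar>\<xi>2 m t\<bar> \<le> (real n0 * D + D) * e" if "m \<le> M0" for m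
    proof -
      have "\<bar>\<xi>2 m t\<bar> \<le> (\<Sum>m\<le>M0. \<bar>\<xi>2 m t\<bar>)" by (rule member_le_sum) (use that in auto)
      then show ?thesis using s0(1) sumX mono(2) by linarith
    qed
    moreover have "\<bar>u t\<bar> \<le> D * e" "\<bar>v t\<bar> \<le> D * e" "\<forall>i<n0. \<bar>Xh t $ i\<bar> \<le> D * e"
      using r unfolding e_def by blast+
    ultimately show ?thesis
      unfolding I_def[symmetric] v_def[symmetric] \<xi>1_def[symmetric] \<xi>2_def[symmetric] mult.assoc[of _ I] e_def[symmetric]
      using mono(1) by (meson order_trans)
  qed
  have "slow_decay (real n0 * D + D) P"
    unfolding slow_decay_def by (intro conjI allI impI main) (use D in simp)
  then show ?thesis by blast
qed

end


section \<open>Decay of all modes\<close>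

text \<open>Shifting \<open>a\<close> and \<open>b\<close> by \<open>\<delta>\<close> shifts the
  eigenvalues by \<open>\<delta>\<close>, which reduces the claim to growth of the shifted
  eigenvalues and their sign.\<close>

lemma eventually_gap:
  "\<forall>\<^sub>F n in sequentially. (real n + 1)\<^sup>2 \<le> - \<delta> - lam1 a n" "\<forall>\<^sub>F m in sequentially. (real m + 1)\<^sup>2 \<le> - \<delta> - lam2 b m"
proof -
  have neg: "\<forall>\<^sub>F n in sequentially. l n < 0" if "\<forall>\<^sub>F n in sequentially. (real n + 1)\<^sup>2 \<le> \<bar>l n\<bar>" "\<And>n. l n \<le> r" for l :: "nat \<Rightarrow> real" and r
    using that(1) eventually_gt_at_top[of "nat \<lceil>\<bar>r\<bar>\<rceil>"]
  proof eventually_elim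
    fix n assume n: "(real n + 1)\<^sup>2 \<le> \<bar>l n\<bar>" "nat \<lceil>\<bar>r\<bar>\<rceil> < n"
    have "\<bar>r\<bar> < real n" using n(2) by linarith
    moreover have "real n + 1 \<le> (real n + 1)\<^sup>2" by (intro self_le_power) auto
    moreover have "r \<le> \<bar>r\<bar>" by simp
    ultimately have "r < \<bar>l n\<bar>" using n(1) by linarith
    then show "l n < 0" using that(2)[of n] by linarith
  qed
  have l1: "lam1 (a + \<delta>) n = \<delta> + lam1 a n" and l2: "lam2 (b + \<delta>) n = \<delta> + lam2 b n" for n
    by (simp_all add: lam1_def lam2_def)
  show "\<forall>\<^sub>F n in sequentially. (real n + 1)\<^sup>2 \<le> - \<delta> - lam1 a n"
  proof -
    have "lam1 (a + \<delta>) n \<le> a + \<delta>" for n by (simp add: lam1_def)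
    from eventually_lam_large(1)[of "a + \<delta>"] neg[OF eventually_lam_large(1) this]
    show ?thesis by eventually_elim (simp add: l1)
  qed
  show "\<forall>\<^sub>F n in sequentially. (real n + 1)\<^sup>2 \<le> - \<delta> - lam2 b n"
  proof -
    have "lam2 (b + \<delta>) n \<le> b + \<delta>" for n by (simp add: lam2_def)
    from eventually_lam_large(2)[of "b + \<delta>"] neg[OF eventually_lam_large(2) this]
    show ?thesis by eventually_elim (simp add: l2)
  qed
qed

text \<open>The share of the initial size \<open>I0\<close> in the weighted bound for mode
  \<open>n\<close>: slow modes are bounded by \<open>D * I0\<close> directly, fast modes through
  their gain for an input of this size.\<close>

definition gain_weight :: "nat \<Rightarrow> real \<Rightarrow> (nat \<Rightarrow> real) \<Rightarrow> (nat \<Rightarrow> real) \<Rightarrow> nat \<Rightarrow> real" where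
  "gain_weight N0 D w g n = (if n \<le> N0 then w n * D else w n * g n * D)"

lemma summable_gain_weight:
  assumes "summable (\<lambda>n. (w n * g n)\<^sup>2)"
  shows "summable (\<lambda>n. (gain_weight N0 D w g n)\<^sup>2)"
proof (rule summable_comparison_test_ev)
  show "summable (\<lambda>n. (w n * g n)\<^sup>2 * D\<^sup>2)" by (rule summable_mult2[OF assms])
  show "\<forall>\<^sub>F n in sequentially. norm ((gain_weight N0 D w g n)\<^sup>2) \<le> (w n * g n)\<^sup>2 * D\<^sup>2"
    using eventually_gt_at_top[of N0] by eventually_elim (simp add: gain_weight_def power_mult_distrib)
qed

context plant
begin

abbreviation "g1 \<equiv> gain \<delta> N0 (lam1 a) (alpha1 a b s) (beta1 a b s)"
abbreviation "g2 \<equiv> gain \<delta> M0 (lam2 b) (alpha2 b) beta2"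

lemma gains_summable:
  assumes "\<And>n. 0 \<le> w n" "\<And>n. w n \<le> (real n + 1)\<^sup>2"
  shows "summable (\<lambda>n. (w n * g1 n)\<^sup>2)" "summable (\<lambda>n. (w n * g2 n)\<^sup>2)"
  by (intro summable_weighted_gain families eventually_gap assms)+


text \<open>The estimates of the modes between slow modes and truncation obey the fast modal
  equations, so they inherit the decay of the input. Sums up to \<open>N\<close> are bounded by
  full series, which makes the constant independent of the truncation.\<close>

lemma controller_decay:
  assumes dec: "slow_decay D P"
  obtains D' :: real where "D' \<ge> 0"
    "\<And>N M y0 z0 y z u Xh h1 h2 t. \<lbrakk>trajectory P N M y0 z0 y z u Xh h1 h2; t \<ge> 0\<rbrakk> \<Longrightarrow>
       controller_normsq N0 M0 N M u Xh h1 h2 t \<le> D' * (I0 N M y z u Xh h1 h2)\<^sup>2 * exp (- 2 * \<delta> * t)"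
proof -
  have D: "D \<ge> 0" using dec by (simp add: slow_decay_def)
  define S1 where "S1 = (\<Sum>n. (g1 n)\<^sup>2)"
  define S2 where "S2 = (\<Sum>n. (g2 n)\<^sup>2)"
  have gs: "summable (\<lambda>n. (g1 n)\<^sup>2)" "summable (\<lambda>n. (g2 n)\<^sup>2)" by (intro summable_gain families)+
  have S: "S1 \<ge> 0" "S2 \<ge> 0" unfolding S1_def S2_def using gs by (auto intro: suminf_nonneg)
  define D' where "D' = D\<^sup>2 * (1 + real n0 + 2 * S1 + 2 * S2) + 4"
  have E2: "(exp (- \<delta> * t))\<^sup>2 = exp (- 2 * \<delta> * t)" for t by (simp add: power2_eq_square exp_add[symmetric])
  have fin_sum: "(\<Sum>n\<in>F. (h n)\<^sup>2) \<le> e\<^sup>2 * (2 * (\<Sum>n\<in>F. (h' n)\<^sup>2) + 2 * Sg * I\<^sup>2)"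
    if "finite F" "\<And>n. n \<in> F \<Longrightarrow> \<bar>h n\<bar> \<le> (\<bar>h' n\<bar> + g n * I) * e" "(\<Sum>n\<in>F. (g n)\<^sup>2) \<le> Sg" for F :: "nat set" and h h' g :: "nat \<Rightarrow> real" and e I Sg :: real
  proof -
    have "(\<Sum>n\<in>F. (h n)\<^sup>2) \<le> (\<Sum>n\<in>F. e\<^sup>2 * (2 * (h' n)\<^sup>2 + 2 * (g n)\<^sup>2 * I\<^sup>2))"
    proof (rule sum_mono)
      fix n assume "n \<in> F"
      then have "\<bar>h n\<bar>\<^sup>2 \<le> ((\<bar>h' n\<bar> + g n * I) * e)\<^sup>2" using that(2) by (intro power_mono) auto
      also have "\<dots> = e\<^sup>2 * (\<bar>h' n\<bar> + g n * I)\<^sup>2" by (simp add: power_mult_distrib mult.commute)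
      also have "\<dots> \<le> e\<^sup>2 * (2 * (h' n)\<^sup>2 + 2 * (g n)\<^sup>2 * I\<^sup>2)"
      proof (rule mult_left_mono)
        have "(\<bar>h' n\<bar> + g n * I)\<^sup>2 \<le> 2 * \<bar>h' n\<bar>\<^sup>2 + 2 * (g n * I)\<^sup>2"
          unfolding power2_sum using sum_squares_bound[of "\<bar>h' n\<bar>" "g n * I"] by linarith
        then show "(\<bar>h' n\<bar> + g n * I)\<^sup>2 \<le> 2 * (h' n)\<^sup>2 + 2 * (g n)\<^sup>2 * I\<^sup>2" by (simp add: power_mult_distrib)
      qed simp
      finally show "(h n)\<^sup>2 \<le> e\<^sup>2 * (2 * (h' n)\<^sup>2 + 2 * (g n)\<^sup>2 * I\<^sup>2)" by simp
    qed
    also have "\<dots> = e\<^sup>2 * (2 * (\<Sum>n\<in>F. (h' n)\<^sup>2) + 2 * (\<Sum>n\<in>F. (g n)\<^sup>2) * I\<^sup>2)"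
      by (simp add: sum_distrib_left sum_distrib_right sum.distrib distrib_left mult.assoc)
    also have "\<dots> \<le> e\<^sup>2 * (2 * (\<Sum>n\<in>F. (h' n)\<^sup>2) + 2 * Sg * I\<^sup>2)"
      using that(3) by (intro mult_left_mono add_left_mono mult_right_mono) auto
    finally show ?thesis .
  qed
  show ?thesis
  proof (rule that[of D'])
    show "D' \<ge> 0" using S by (simp add: D'_def)
    fix N M y0 z0 y z u Xh h1 h2 and t :: real
    assume traj: "trajectory P N M y0 z0 y z u Xh h1 h2" and t: "t \<ge> 0"
    have cl: "closed_loop a b s c N0 M0 N M Kx ku L y0 z0 y z u Xh h1 h2" and y0: "y0 \<in> L2I" and z0: "z0 \<in> L2I"
      and NM: "N \<ge> N0" "M \<ge> M0" "N \<ge> P" "M \<ge> P"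
      using traj unfolding trajectory_def by blast+
    define I where "I = I0 N M y z u Xh h1 h2"
    define e where "e = exp (- \<delta> * t)"
    define v where "v t = - (Kx \<bullet> Xh t) - ku * u t" for t
    note ib = initial_bounds[OF cl y0 z0, folded I_def]
    note r = dec[unfolded slow_decay_def, THEN conjunct2, rule_format, OF traj, folded I_def v_def]
    have DI: "D * I \<ge> 0" using D ib(3) by simp
    have XC: "Xh t \<in> carrier_vec n0" if "t \<ge> 0" for t using cl that unfolding closed_loop_def Let_def by blast
    have U: "\<And>\<tau>. \<tau> \<in> {0..t} \<Longrightarrow> \<bar>u \<tau>\<bar> \<le> (D * I) * exp (- \<delta> * \<tau>)" "\<And>\<tau>. \<tau> \<in> {0..t} \<Longrightarrow> \<bar>v \<tau>\<bar> \<le> (D * I) * exp (- \<delta> * \<tau>)"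
      using r by simp_all
    have tt: "t \<in> {0..t}" using t by simp
    have b1: "\<bar>h1 n t\<bar> \<le> (\<bar>h1 n 0\<bar> + (g1 n * D) * I) * e" if "n \<in> {N0 + 1..N}" for n
    proof -
      have "mode_ode (lam1 a) (alpha1 a b s) (beta1 a b s) u v n (h1 n)"
        using cl that unfolding closed_loop_def Let_def v_def mode_ode_def by blast
      then show ?thesis
        using fast_mode_bound[OF families(1) _ _ U DI tt] that by (simp add: e_def mult.assoc)
    qed
    have b2: "\<bar>h2 m t\<bar> \<le> (\<bar>h2 m 0\<bar> + (g2 m * D) * I) * e" if "m \<in> {M0 + 1..M}" for m
    proof -
      have "mode_ode (lam2 b) (alpha2 b) beta2 u v m (h2 m)"
        using cl that unfolding closed_loop_def Let_def v_def mode_ode_def by blast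
      then show ?thesis
        using fast_mode_bound[OF families(2) _ _ U DI tt] that by (simp add: e_def mult.assoc)
    qed
    have G1: "(\<Sum>n\<in>F. (g1 n * D)\<^sup>2) \<le> S1 * D\<^sup>2" and G2: "(\<Sum>n\<in>F. (g2 n * D)\<^sup>2) \<le> S2 * D\<^sup>2" if "finite F" for F
      unfolding power_mult_distrib sum_distrib_right[symmetric] S1_def S2_def
      by (intro mult_right_mono sum_le_suminf gs that; simp)+
    note cp = controller_normsq_parts[where Xh=Xh and t=0 and u=u and N=N and M=M and ?h1.0=h1 and ?h2.0=h2, OF XC[OF order_refl]]
    have H1: "(\<Sum>n=N0+1..N. (h1 n t)\<^sup>2) \<le> e\<^sup>2 * (2 * I\<^sup>2 + 2 * (S1 * D\<^sup>2) * I\<^sup>2)"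
      by (rule order_trans[OF fin_sum[OF _ b1 G1]]) (use order_trans[OF cp(3) ib(7)] in \<open>auto intro!: mult_left_mono\<close>)
    have H2: "(\<Sum>m=M0+1..M. (h2 m t)\<^sup>2) \<le> e\<^sup>2 * (2 * I\<^sup>2 + 2 * (S2 * D\<^sup>2) * I\<^sup>2)"
      by (rule order_trans[OF fin_sum[OF _ b2 G2]]) (use order_trans[OF cp(4) ib(7)] in \<open>auto intro!: mult_left_mono\<close>)
    have sq: "x\<^sup>2 \<le> D\<^sup>2 * I\<^sup>2 * e\<^sup>2" if "\<bar>x\<bar> \<le> D * I * e" for x
      using power_mono[OF that, of 2] by (simp add: power_mult_distrib)
    have ut: "\<bar>u t\<bar> \<le> D * I * e" using r[OF t] by (simp add: e_def)
    have Xt: "Xh t \<bullet> Xh t \<le> real n0 * (D\<^sup>2 * I\<^sup>2 * e\<^sup>2)"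
    proof -
      have "Xh t \<bullet> Xh t = (\<Sum>i<n0. (Xh t $ i)\<^sup>2)" unfolding power2_eq_square by (rule scalar_prod_n0[OF XC[OF t]])
      also have "\<dots> \<le> (\<Sum>i<n0. D\<^sup>2 * I\<^sup>2 * e\<^sup>2)" using r[OF t] by (intro sum_mono sq) (simp only: e_def lessThan_iff)
      finally show ?thesis by (simp only: sum_constant card_lessThan)
    qed
    have "controller_normsq N0 M0 N M u Xh h1 h2 t \<le> D\<^sup>2 * I\<^sup>2 * e\<^sup>2 + real n0 * (D\<^sup>2 * I\<^sup>2 * e\<^sup>2)
       + e\<^sup>2 * (2 * I\<^sup>2 + 2 * (S1 * D\<^sup>2) * I\<^sup>2) + e\<^sup>2 * (2 * I\<^sup>2 + 2 * (S2 * D\<^sup>2) * I\<^sup>2)"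
      unfolding controller_normsq_def using sq[OF ut] Xt H1 H2 by linarith
    also have "\<dots> = D' * I\<^sup>2 * e\<^sup>2" by (simp add: D'_def algebra_simps)
    finally show "controller_normsq N0 M0 N M u Xh h1 h2 t \<le> D' * (I0 N M y z u Xh h1 h2)\<^sup>2 * exp (- 2 * \<delta> * t)"
      unfolding E2[symmetric] e_def[symmetric] I_def[symmetric] .
  qed
qed

text \<open>The weight is arbitrary up to \<open>(n + 1)\<^sup>2\<close>, since one statement
  serves three purposes: weight \<open>1\<close> for the norm of \<^const>\<open>H0\<close>,
  \<open>n + 1\<close> for that of \<^const>\<open>H1\<close> and \<open>(n + 1)\<^sup>2\<close>
  for regularity.\<close>

lemma weighted_modes_decay:
  fixes w :: "nat \<Rightarrow> real" and t :: real
  assumes dec: "slow_decay D P" and traj: "trajectory P N M y0 z0 y z u Xh h1 h2" and t: "t \<ge> 0"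
      and w: "\<And>n. 0 \<le> w n" "\<And>n. w n \<le> (real n + 1)\<^sup>2"
      and sw: "summable (\<lambda>n. (w n * x1 y z u n 0)\<^sup>2)" "summable (\<lambda>m. (w m * x2 z u m 0)\<^sup>2)"
  shows "summable (\<lambda>n. (w n * x1 y z u n t)\<^sup>2) \<and> summable (\<lambda>m. (w m * x2 z u m t)\<^sup>2) \<and>
       (\<Sum>n. (w n * x1 y z u n t)\<^sup>2) + (\<Sum>m. (w m * x2 z u m t)\<^sup>2) \<le>
         (2 * (\<Sum>n. (w n * x1 y z u n 0)\<^sup>2) + 2 * (\<Sum>m. (w m * x2 z u m 0)\<^sup>2)
           + 2 * ((\<Sum>n. (gain_weight N0 D w g1 n)\<^sup>2) + (\<Sum>m. (gain_weight M0 D w g2 m)\<^sup>2)) * (I0 N M y z u Xh h1 h2)\<^sup>2) * exp (- 2 * \<delta> * t)"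
proof -
  have D: "D \<ge> 0" using dec by (simp add: slow_decay_def)
  have E2: "(exp (- \<delta> * t))\<^sup>2 = exp (- 2 * \<delta> * t)" for t by (simp add: power2_eq_square exp_add[symmetric])
  have cl: "closed_loop a b s c N0 M0 N M Kx ku L y0 z0 y z u Xh h1 h2" and y0: "y0 \<in> L2I" and z0: "z0 \<in> L2I"
    and NM: "N \<ge> N0" "M \<ge> M0" "N \<ge> P" "M \<ge> P"
    using traj unfolding trajectory_def by blast+
  define I where "I = I0 N M y z u Xh h1 h2"
  define e where "e = exp (- \<delta> * t)"
  define v where "v t = - (Kx \<bullet> Xh t) - ku * u t" for t
  note ib = initial_bounds[OF cl y0 z0, folded I_def]
  note f = closed_loop_facts[OF cl y0 z0, folded v_def]
  note r = dec[unfolded slow_decay_def, THEN conjunct2, rule_format, OF traj, folded I_def v_def]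
  have DI: "D * I \<ge> 0" using D ib(3) by simp
  have e: "e > 0" by (simp add: e_def)
  have U: "\<And>\<tau>. \<tau> \<in> {0..t} \<Longrightarrow> \<bar>u \<tau>\<bar> \<le> (D * I) * exp (- \<delta> * \<tau>)" "\<And>\<tau>. \<tau> \<in> {0..t} \<Longrightarrow> \<bar>v \<tau>\<bar> \<le> (D * I) * exp (- \<delta> * \<tau>)"
    using r by simp_all
  have tt: "t \<in> {0..t}" using t by simp
  have weigh: "\<bar>w n * x\<bar> \<le> (\<bar>w n * x'\<bar> + gain_weight N D w g n * I) * e"
    if "n \<le> N \<Longrightarrow> \<bar>x\<bar> \<le> D * I * e" "n > N \<Longrightarrow> \<bar>x\<bar> \<le> (\<bar>x'\<bar> + g n * (D * I)) * e" for n N x x' g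
  proof (cases "n \<le> N")
    case True
    have "\<bar>w n * x\<bar> \<le> w n * (D * I * e)" unfolding abs_mult using that(1)[OF True] w(1)[of n] by (simp add: mult_left_mono)
    also have "\<dots> = gain_weight N D w g n * I * e" using True by (simp add: gain_weight_def)
    also have "\<dots> \<le> (\<bar>w n * x'\<bar> + gain_weight N D w g n * I) * e" using e by (intro mult_right_mono) auto
    finally show ?thesis .
  next
    case False
    have "\<bar>w n * x\<bar> \<le> w n * ((\<bar>x'\<bar> + g n * (D * I)) * e)" unfolding abs_mult using that(2) False w(1)[of n] by (simp add: mult_left_mono)
    also have "\<dots> = (\<bar>w n * x'\<bar> + gain_weight N D w g n * I) * e"
      using False w(1)[of n] by (simp add: gain_weight_def abs_mult algebra_simps)
    finally show ?thesis .
  qed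
  have b1: "\<bar>w n * x1 y z u n t\<bar> \<le> (\<bar>w n * x1 y z u n 0\<bar> + gain_weight N0 D w g1 n * I) * e" for n
  proof (rule weigh)
    show "\<bar>x1 y z u n t\<bar> \<le> D * I * e" if "n \<le> N0" using r[OF t] that by (simp add: e_def)
    show "\<bar>x1 y z u n t\<bar> \<le> (\<bar>x1 y z u n 0\<bar> + g1 n * (D * I)) * e" if "n > N0"
    proof -
      have "jordan_coupling a b s n = 0" using D1 that by (auto simp: jordan_coupling_def)
      then have "mode_ode (lam1 a) (alpha1 a b s) (beta1 a b s) u v n (x1 y z u n)"
        using f(5)[of _ n] by (simp add: mode_ode_def)
      then show ?thesis using fast_mode_bound[OF families(1) that _ U DI tt] by (simp add: e_def)
    qed
  qed
  have b2: "\<bar>w m * x2 z u m t\<bar> \<le> (\<bar>w m * x2 z u m 0\<bar> + gain_weight M0 D w g2 m * I) * e" for m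
  proof (rule weigh)
    show "\<bar>x2 z u m t\<bar> \<le> D * I * e" if "m \<le> M0" using r[OF t] that by (simp add: e_def)
    show "\<bar>x2 z u m t\<bar> \<le> (\<bar>x2 z u m 0\<bar> + g2 m * (D * I)) * e" if "m > M0"
    proof -
      have "mode_ode (lam2 b) (alpha2 b) beta2 u v m (x2 z u m)"
        using f(6)[of _ m] by (simp add: mode_ode_def)
      then show ?thesis using fast_mode_bound[OF families(2) that _ U DI tt] by (simp add: e_def)
    qed
  qed
  note q1 = square_sum_decay[OF b1 sw(1) summable_gain_weight[OF gains_summable(1)[OF w]]]
  note q2 = square_sum_decay[OF b2 sw(2) summable_gain_weight[OF gains_summable(2)[OF w]]]
  have "(\<Sum>n. (w n * x1 y z u n t)\<^sup>2) + (\<Sum>m. (w m * x2 z u m t)\<^sup>2) \<le>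
    e\<^sup>2 * (2 * (\<Sum>n. (w n * x1 y z u n 0)\<^sup>2) + 2 * (\<Sum>n. (gain_weight N0 D w g1 n)\<^sup>2) * I\<^sup>2) +
    e\<^sup>2 * (2 * (\<Sum>m. (w m * x2 z u m 0)\<^sup>2) + 2 * (\<Sum>m. (gain_weight M0 D w g2 m)\<^sup>2) * I\<^sup>2)"
    using q1(2) q2(2) by linarith
  also have "\<dots> = (2 * (\<Sum>n. (w n * x1 y z u n 0)\<^sup>2) + 2 * (\<Sum>m. (w m * x2 z u m 0)\<^sup>2)
         + 2 * ((\<Sum>n. (gain_weight N0 D w g1 n)\<^sup>2) + (\<Sum>m. (gain_weight M0 D w g2 m)\<^sup>2)) * I\<^sup>2) * e\<^sup>2"
    by (simp add: algebra_simps)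
  finally show "summable (\<lambda>n. (w n * x1 y z u n t)\<^sup>2) \<and> summable (\<lambda>m. (w m * x2 z u m t)\<^sup>2) \<and>
     (\<Sum>n. (w n * x1 y z u n t)\<^sup>2) + (\<Sum>m. (w m * x2 z u m t)\<^sup>2) \<le>
       (2 * (\<Sum>n. (w n * x1 y z u n 0)\<^sup>2) + 2 * (\<Sum>m. (w m * x2 z u m 0)\<^sup>2)
         + 2 * ((\<Sum>n. (gain_weight N0 D w g1 n)\<^sup>2) + (\<Sum>m. (gain_weight M0 D w g2 m)\<^sup>2)) * (I0 N M y z u Xh h1 h2)\<^sup>2) * exp (- 2 * \<delta> * t)"
    using q1(1) q2(1) unfolding E2[symmetric] e_def[symmetric] I_def[symmetric] by blast
qed

end


section \<open>Decay of the state\<close>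

lemma weight_bounds: "(1::real) \<le> (real n + 1)\<^sup>2" "real n + 1 \<le> (real n + 1)\<^sup>2"
  by (auto intro: self_le_power)

lemma nsq_hphi_scale: "nsq (\<lambda>x. hphi x * r) \<le> r\<^sup>2" and nsq_slope_scale: "nsq (\<lambda>x. (1 - x) * r) \<le> r\<^sup>2"
proof -
  have "nsq (\<lambda>x. hphi x * r) = r\<^sup>2 * nsq hphi" using nsq_scale[of r hphi] by (simp add: mult.commute)
  also have "\<dots> \<le> r\<^sup>2 * 1" by (intro mult_left_mono hphi_props) auto
  finally show "nsq (\<lambda>x. hphi x * r) \<le> r\<^sup>2" by simp
  have "nsq (\<lambda>x. (1 - x) * r) = r\<^sup>2 * nsq (\<lambda>x. 1 - x)" using nsq_scale[of r "\<lambda>x. 1 - x"] by (simp add: mult.commute)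
  also have "\<dots> \<le> r\<^sup>2 * 1" by (intro mult_left_mono hphi_props) auto
  finally show "nsq (\<lambda>x. (1 - x) * r) \<le> r\<^sup>2" by simp
qed

lemma hphi_scale:
  "(\<lambda>x. hphi x * r) \<in> L2I" "(\<lambda>x. (1 - x) * r) \<in> L2I"
  "has_L2_deriv (\<lambda>x. hphi x * r) (\<lambda>x. (1 - x) * r)" "has_L2_deriv (\<lambda>x. (1 - x) * r) (\<lambda>x. - 1 * r)"
proof -
  show "(\<lambda>x. hphi x * r) \<in> L2I" "(\<lambda>x. (1 - x) * r) \<in> L2I" by (intro L2I_scale_right L2I_hphi hphi_props)+
  show "has_L2_deriv (\<lambda>x. hphi x * r) (\<lambda>x. (1 - x) * r)" "has_L2_deriv (\<lambda>x. (1 - x) * r) (\<lambda>x. - 1 * r)"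
    using hphi_props(1) has_L2_deriv_scale[of hphi "\<lambda>x. 1 - x" r] has_L2_deriv_scale[of "\<lambda>x. 1 - x" "\<lambda>x. - 1" r]
    unfolding has_L2_deriv2_def by (simp_all add: mult.commute)
qed

lemma input_square_decay:
  fixes r :: real
  assumes "\<bar>r\<bar> \<le> D * I * exp (- \<delta> * t)" shows "r\<^sup>2 \<le> D\<^sup>2 * I\<^sup>2 * exp (- 2 * \<delta> * t)"
proof -
  have "(exp (- \<delta> * t))\<^sup>2 = exp (- 2 * \<delta> * t)" by (simp add: power2_eq_square exp_add[symmetric])
  then show ?thesis using power_mono[OF assms, of 2] by (simp only: power_mult_distrib power2_abs abs_ge_zero)
qed

context plant
begin

lemma gain_weight_sums_nonneg:
  assumes "\<And>n. 0 \<le> w n" "\<And>n. w n \<le> (real n + 1)\<^sup>2"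
  shows "0 \<le> (\<Sum>n. (gain_weight N0 D w g1 n)\<^sup>2) + (\<Sum>m. (gain_weight M0 D w g2 m)\<^sup>2)"
  using summable_gain_weight[OF gains_summable(1)[OF assms]] summable_gain_weight[OF gains_summable(2)[OF assms]]
  by (intro add_nonneg_nonneg suminf_nonneg) auto

text \<open>Norm equivalence translates the initial state into modal coordinates and the decayed
  coordinates back into the state. The passage between \<open>z\<close> and the homogenized state
  costs multiples of the input, which belongs to the controller part of the norm.\<close>

lemma H0_estimate:
  assumes dec: "slow_decay D P"
  obtains C :: real where "C > 0"
    "\<And>N M y0 z0 y z u Xh h1 h2 t. \<lbrakk>trajectory P N M y0 z0 y z u Xh h1 h2; t \<ge> 0\<rbrakk> \<Longrightarrow>
       H0_normsq (y t, z t) + controller_normsq N0 M0 N M u Xh h1 h2 t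
            \<le> C * exp (- 2 * \<delta> * t) * (H0_normsq (y0, z0) + controller_normsq N0 M0 N M u Xh h1 h2 0)"
proof -
  have D: "D \<ge> 0" using dec by (simp add: slow_decay_def)
  obtain B where B: "B \<ge> 0" "\<And>N M y0 z0 y z u Xh h1 h2 t. \<lbrakk>trajectory P N M y0 z0 y z u Xh h1 h2; t \<ge> 0\<rbrakk> \<Longrightarrow>
       controller_normsq N0 M0 N M u Xh h1 h2 t \<le> B * (I0 N M y z u Xh h1 h2)\<^sup>2 * exp (- 2 * \<delta> * t)"
    using controller_decay[OF dec] by blast
  obtain K0 where K0: "K0 > 0"
    "\<And>f g. f \<in> L2I \<Longrightarrow> g \<in> L2I \<Longrightarrow> nsq f + nsq g \<le> K0 * ((\<Sum>n. (mode1 a b s f g n)\<^sup>2) + (\<Sum>m. (ip g (ecos m))\<^sup>2))"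
    "\<And>f g. f \<in> L2I \<Longrightarrow> g \<in> L2I \<Longrightarrow> (\<Sum>n. (mode1 a b s f g n)\<^sup>2) + (\<Sum>m. (ip g (ecos m))\<^sup>2) \<le> K0 * (nsq f + nsq g)"
    using norm_equivalence_H0[of a b s] by metis
  define w0 where "w0 n = (1::real)" for n :: nat
  have wb: "0 \<le> w0 n" "w0 n \<le> (real n + 1)\<^sup>2" for n by (simp_all add: w0_def weight_bounds(1))
  define \<Gamma> where "\<Gamma> = (\<Sum>n. (gain_weight N0 D w0 g1 n)\<^sup>2) + (\<Sum>m. (gain_weight M0 D w0 g2 m)\<^sup>2)"
  have \<Gamma>: "\<Gamma> \<ge> 0" unfolding \<Gamma>_def by (rule gain_weight_sums_nonneg[OF wb])
  define B0 where "B0 = 2 * K0 * (2 + 2 * \<Gamma>) + 2 * D\<^sup>2 + B"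
  define J0 where "J0 = 2 * K0 + 2 * K0 + 1"
  have pos: "B0 \<ge> 0" "J0 \<ge> 0"
    unfolding B0_def J0_def using B(1) K0(1) \<Gamma> by (auto intro!: add_nonneg_nonneg mult_nonneg_nonneg)
  define C where "C = B0 * J0 + 1"
  have C: "C > 0" "B0 * J0 \<le> C" unfolding C_def using mult_nonneg_nonneg[OF pos] by linarith+
  show ?thesis
  proof (rule that[of C])
    show "C > 0" by (rule C)
    fix N M y0 z0 y z u Xh h1 h2 and t :: real
    assume traj: "trajectory P N M y0 z0 y z u Xh h1 h2" and t: "t \<ge> 0"
    have cl: "closed_loop a b s c N0 M0 N M Kx ku L y0 z0 y z u Xh h1 h2" and y0: "y0 \<in> L2I" and z0: "z0 \<in> L2I"
      and NM: "N \<ge> N0" "M \<ge> M0" "N \<ge> P" "M \<ge> P"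
      using traj unfolding trajectory_def by blast+
    define I where "I = I0 N M y z u Xh h1 h2"
    define e where "e = exp (- 2 * \<delta> * t)"
    define \<zeta> where "\<zeta> t x = z t x - hphi x * u t" for t x
    define \<zeta>0 where "\<zeta>0 x = z0 x - hphi x * u 0" for x
    define k0 where "k0 = controller_normsq N0 M0 N M u Xh h1 h2 0"
    have e: "e > 0" by (simp add: e_def)
    note ib = initial_bounds[OF cl y0 z0, folded I_def]
    note f = closed_loop_facts[OF cl y0 z0]
    have d: "controller_normsq N0 M0 N M u Xh h1 h2 t \<le> B * I\<^sup>2 * e" using B(2)[OF traj t] by (simp add: I_def e_def)
    have ut: "\<bar>u t\<bar> \<le> D * I * exp (- \<delta> * t)" using dec traj t unfolding slow_decay_def I_def by blast
    have XC: "Xh 0 \<in> carrier_vec n0" using cl unfolding closed_loop_def Let_def by blast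
    have u0: "(u 0)\<^sup>2 \<le> k0" "0 \<le> k0" unfolding k0_def using controller_normsq_parts(1)[where Xh=Xh and t=0, OF XC] controller_normsq_parts(5)[where Xh=Xh and t=0, OF XC] by simp_all
    have L0: "\<zeta>0 \<in> L2I" unfolding \<zeta>0_def by (intro L2I_diff z0 hphi_scale)
    have Lt: "y t \<in> L2I" "\<zeta> t \<in> L2I" using f(1,2)[OF t] by (simp_all add: \<zeta>_def[abs_def])
    have z_eq: "z t = (\<lambda>x. \<zeta> t x + hphi x * u t)" by (simp add: \<zeta>_def fun_eq_iff)
    have Lz: "z t \<in> L2I" unfolding z_eq by (intro L2I_add Lt hphi_scale)
    have s0: "summable (\<lambda>n. (w0 n * x1 y z u n 0)\<^sup>2)" "summable (\<lambda>n. (w0 n * x2 z u n 0)\<^sup>2)" using ib(1,2) by (simp_all add: w0_def)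
    have "(\<Sum>n. (x1 y z u n t)\<^sup>2) + (\<Sum>m. (x2 z u m t)\<^sup>2) \<le> (2 * (\<Sum>n. (x1 y z u n 0)\<^sup>2) + 2 * (\<Sum>m. (x2 z u m 0)\<^sup>2) + 2 * \<Gamma> * I\<^sup>2) * e"
      using weighted_modes_decay[OF dec traj t wb(1,2) s0] unfolding \<Gamma>_def[symmetric] I_def[symmetric] e_def[symmetric] by (simp add: w0_def)
    also have "\<dots> \<le> (2 * I\<^sup>2 + 2 * \<Gamma> * I\<^sup>2) * e"
      using ib(4) u0(2) e unfolding k0_def[symmetric] by (intro mult_right_mono) auto
    finally have sums: "(\<Sum>n. (x1 y z u n t)\<^sup>2) + (\<Sum>m. (x2 z u m t)\<^sup>2) \<le> (2 + 2 * \<Gamma>) * (I\<^sup>2 * e)" by (simp add: algebra_simps)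
    have "nsq (y t) + nsq (\<zeta> t) \<le> K0 * ((\<Sum>n. (x1 y z u n t)\<^sup>2) + (\<Sum>m. (x2 z u m t)\<^sup>2))"
      using K0(2)[OF Lt] by (simp add: x1_def x2_def \<zeta>_def[abs_def])
    also have "\<dots> \<le> K0 * ((2 + 2 * \<Gamma>) * (I\<^sup>2 * e))" using sums K0(1) by (intro mult_left_mono) auto
    finally have n1: "nsq (y t) + nsq (\<zeta> t) \<le> K0 * ((2 + 2 * \<Gamma>) * (I\<^sup>2 * e))" .
    have n2: "nsq (z t) \<le> 2 * nsq (\<zeta> t) + 2 * (u t)\<^sup>2"
      using nsq_add_le[OF Lt(2) hphi_scale(1)[of "u t"]] nsq_hphi_scale[of "u t"] unfolding z_eq by linarith
    have n3: "(u t)\<^sup>2 \<le> D\<^sup>2 * (I\<^sup>2 * e)" using input_square_decay[OF ut] by (simp add: e_def mult.assoc)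
    have h0: "H0_normsq (y t, z t) = nsq (y t) + nsq (z t)" unfolding H0_normsq_def using Lt Lz by (simp add: H0_inner_eq)
    have "H0_normsq (y t, z t) + controller_normsq N0 M0 N M u Xh h1 h2 t
        \<le> 2 * (K0 * ((2 + 2 * \<Gamma>) * (I\<^sup>2 * e))) + 2 * (D\<^sup>2 * (I\<^sup>2 * e)) + B * I\<^sup>2 * e"
      unfolding h0 using n1 n2 n3 d nsq_nonneg[of "y t"] by linarith
    also have "\<dots> = B0 * I\<^sup>2 * e" by (simp add: B0_def algebra_simps)
    also have "\<dots> \<le> B0 * (J0 * (H0_normsq (y0, z0) + k0)) * e"
    proof (intro mult_right_mono mult_left_mono)
      have "(\<Sum>n. (x1 y z u n 0)\<^sup>2) + (\<Sum>m. (x2 z u m 0)\<^sup>2) \<le> K0 * (nsq y0 + nsq \<zeta>0)"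
        using K0(3)[OF y0 L0] by (simp add: f(3,4) \<zeta>0_def[abs_def])
      also have "nsq y0 + nsq \<zeta>0 \<le> 2 * nsq y0 + 2 * nsq z0 + 2 * k0"
        using nsq_diff_le[OF z0 hphi_scale(1)[of "u 0"]] nsq_hphi_scale[of "u 0"] u0 nsq_nonneg[of y0] unfolding \<zeta>0_def by linarith
      finally have "I\<^sup>2 \<le> K0 * (2 * nsq y0 + 2 * nsq z0 + 2 * k0) + k0"
        using K0(1) unfolding ib(4) k0_def[symmetric] by (simp add: mult_left_mono)
      also have "\<dots> \<le> J0 * (nsq y0 + nsq z0 + k0)"
        unfolding J0_def using K0(1) nsq_nonneg[of y0] nsq_nonneg[of z0] u0(2)
        by (simp add: algebra_simps)
      finally show "I\<^sup>2 \<le> J0 * (H0_normsq (y0, z0) + k0)"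
        unfolding H0_normsq_def using y0 z0 by (simp add: H0_inner_eq)
    qed (use pos e in auto)
    also have "\<dots> = (B0 * J0) * (e * (H0_normsq (y0, z0) + k0))" by (simp add: mult_ac)
    also have "\<dots> \<le> C * (e * (H0_normsq (y0, z0) + k0))"
    proof (rule mult_right_mono[OF C(2)])
      have "H0_normsq (y0, z0) \<ge> 0" unfolding H0_normsq_def using y0 z0 by (simp add: H0_inner_eq nsq_nonneg)
      then show "0 \<le> e * (H0_normsq (y0, z0) + k0)" using e u0 by simp
    qed
    finally show "H0_normsq (y t, z t) + controller_normsq N0 M0 N M u Xh h1 h2 t
            \<le> C * exp (- 2 * \<delta> * t) * (H0_normsq (y0, z0) + controller_normsq N0 M0 N M u Xh h1 h2 0)"
      by (simp only: e_def k0_def mult.assoc)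
  qed
qed

text \<open>Analysis and synthesis in \<open>H\<^sup>1\<close> take the place of the norm
  equivalence. Compatible data correspond to a homogenized initial state in the domain of the
  operator, as \<open>hphi\<close> removes the slope \<open>u 0\<close> of \<open>z0\<close> at
  \<open>0\<close> without changing the other boundary conditions.\<close>

lemma H1_estimate:
  assumes dec: "slow_decay D P"
  obtains C :: real where "C > 0"
    "\<And>N M y0 z0 y z u Xh h1 h2 t. \<lbrakk>trajectory P N M y0 z0 y z u Xh h1 h2; t \<ge> 0; compatible_data s y0 z0 (u 0)\<rbrakk> \<Longrightarrow>
       (y t, z t) \<in> H1 \<and> H1_normsq (y t, z t) + controller_normsq N0 M0 N M u Xh h1 h2 t
            \<le> C * exp (- 2 * \<delta> * t) * (H1_normsq (y0, z0) + controller_normsq N0 M0 N M u Xh h1 h2 0)"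
proof -
  have D: "D \<ge> 0" using dec by (simp add: slow_decay_def)
  obtain B where B: "B \<ge> 0" "\<And>N M y0 z0 y z u Xh h1 h2 t. \<lbrakk>trajectory P N M y0 z0 y z u Xh h1 h2; t \<ge> 0\<rbrakk> \<Longrightarrow>
       controller_normsq N0 M0 N M u Xh h1 h2 t \<le> B * (I0 N M y z u Xh h1 h2)\<^sup>2 * exp (- 2 * \<delta> * t)"
    using controller_decay[OF dec] by blast
  obtain K1 where K1: "K1 > 0" and syn:
    "\<And>f g. \<lbrakk>f \<in> L2I; g \<in> L2I; summable (\<lambda>n. ((real n + 1) * ((real n + 1) * mode1 a b s f g n))\<^sup>2);
       summable (\<lambda>m. ((real m + 1) * ((real m + 1) * ip g (ecos m)))\<^sup>2)\<rbrakk> \<Longrightarrow>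
     \<exists>p p' q q'. eqI f p \<and> has_L2_deriv p p' \<and> p 1 = 0 \<and> eqI g q \<and> has_L2_deriv q q' \<and>
        nsq p' + nsq q + nsq q' \<le> K1 * H1_energy a b s f g"
    using H1_synthesis[of a b s] by blast
  obtain K2 where K2: "K2 > 0" and ana:
    "\<And>f f' g g'. \<lbrakk>has_L2_deriv f f'; f 1 = 0; has_L2_deriv g g'\<rbrakk> \<Longrightarrow>
       summable (\<lambda>n. ((real n + 1) * mode1 a b s f g n)\<^sup>2) \<and> summable (\<lambda>m. ((real m + 1) * ip g (ecos m))\<^sup>2) \<and>
       H1_energy a b s f g \<le> K2 * (nsq f' + nsq g + nsq g')"
    by (rule H1_analysis[of a b s]) blast
  define w1 where "w1 n = real n + 1" for n :: nat
  define w2 where "w2 n = (real n + 1)\<^sup>2" for n :: nat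
  have wb: "0 \<le> w1 n" "w1 n \<le> (real n + 1)\<^sup>2" "0 \<le> w2 n" "w2 n \<le> (real n + 1)\<^sup>2" for n
    by (simp_all add: w1_def w2_def weight_bounds(2))
  define \<Gamma> where "\<Gamma> = (\<Sum>n. (gain_weight N0 D w1 g1 n)\<^sup>2) + (\<Sum>m. (gain_weight M0 D w1 g2 m)\<^sup>2)"
  have \<Gamma>: "\<Gamma> \<ge> 0" unfolding \<Gamma>_def by (rule gain_weight_sums_nonneg[OF wb(1,2)])
  define B1 where "B1 = 2 * K1 * (2 + 2 * \<Gamma>) + 4 * D\<^sup>2 + B"
  define J1 where "J1 = 2 * (2 * K2 + 4 * K2) + 1"
  have pos: "B1 \<ge> 0" "J1 \<ge> 0"
    unfolding B1_def J1_def using B(1) K1 K2 \<Gamma> by (auto intro!: add_nonneg_nonneg mult_nonneg_nonneg)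
  define C where "C = B1 * J1 + 1"
  have C: "C > 0" "B1 * J1 \<le> C" unfolding C_def using mult_nonneg_nonneg[OF pos] by linarith+
  show ?thesis
  proof (rule that[of C])
    show "C > 0" by (rule C)
    fix N M y0 z0 y z u Xh h1 h2 and t :: real
    assume traj: "trajectory P N M y0 z0 y z u Xh h1 h2" and t: "t \<ge> 0" and comp: "compatible_data s y0 z0 (u 0)"
    have cl: "closed_loop a b s c N0 M0 N M Kx ku L y0 z0 y z u Xh h1 h2" and y0: "y0 \<in> L2I" and z0: "z0 \<in> L2I"
      and NM: "N \<ge> N0" "M \<ge> M0" "N \<ge> P" "M \<ge> P"
      using traj unfolding trajectory_def by blast+
    define I where "I = I0 N M y z u Xh h1 h2"
    define e where "e = exp (- 2 * \<delta> * t)"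
    define \<zeta> where "\<zeta> t x = z t x - hphi x * u t" for t x
    define \<zeta>0 where "\<zeta>0 x = z0 x - hphi x * u 0" for x
    define k0 where "k0 = controller_normsq N0 M0 N M u Xh h1 h2 0"
    have e: "e > 0" by (simp add: e_def)
    note ib = initial_bounds[OF cl y0 z0, folded I_def]
    note f = closed_loop_facts[OF cl y0 z0]
    have d: "controller_normsq N0 M0 N M u Xh h1 h2 t \<le> B * I\<^sup>2 * e" using B(2)[OF traj t] by (simp add: I_def e_def)
    have ut: "\<bar>u t\<bar> \<le> D * I * exp (- \<delta> * t)" using dec traj t unfolding slow_decay_def I_def by blast
    have XC: "Xh 0 \<in> carrier_vec n0" using cl unfolding closed_loop_def Let_def by blast
    have u0: "(u 0)\<^sup>2 \<le> k0" "0 \<le> k0" unfolding k0_def using controller_normsq_parts(1)[where Xh=Xh and t=0, OF XC] controller_normsq_parts(5)[where Xh=Xh and t=0, OF XC] by simp_all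
    have Lt: "y t \<in> L2I" "\<zeta> t \<in> L2I" using f(1,2)[OF t] by (simp_all add: \<zeta>_def[abs_def])
    have z_eq: "z t = (\<lambda>x. \<zeta> t x + hphi x * u t)" by (simp add: \<zeta>_def fun_eq_iff)
    have Lz: "z t \<in> L2I" unfolding z_eq by (intro L2I_add Lt hphi_scale)
    obtain y0' y0'' z0' z0'' where cy: "has_L2_deriv2 y0 y0' y0''" and cz: "has_L2_deriv2 z0 z0' z0''"
      and bc: "y0 1 = 0" "z0' 1 = 0" "y0' 0 = s * z0 0" "z0' 0 = u 0"
      using comp unfolding compatible_data_def by blast
    define \<zeta>0' where "\<zeta>0' x = z0' x - (1 - x) * u 0" for x
    have c\<zeta>: "has_L2_deriv2 \<zeta>0 \<zeta>0' (\<lambda>x. z0'' x - - 1 * u 0)"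
      using cz unfolding has_L2_deriv2_def \<zeta>0_def \<zeta>0'_def by (intro conjI has_L2_deriv_diff hphi_scale) simp_all
    have bc': "\<zeta>0' 0 = 0" "\<zeta>0' 1 = 0" "y0' 0 = s * \<zeta>0 0"
      using bc by (simp_all add: \<zeta>0_def \<zeta>0'_def hphi_def)
    have d1: "has_L2_deriv y0 y0'" "has_L2_deriv z0 z0'" "has_L2_deriv \<zeta>0 \<zeta>0'" using cy cz c\<zeta> by (simp_all add: has_L2_deriv2_def)
    have x0: "x1 y z u n 0 = mode1 a b s y0 \<zeta>0 n" "x2 z u n 0 = ip \<zeta>0 (ecos n)" for n
      using f(3,4) by (simp_all add: \<zeta>0_def[abs_def])
    have sq2: "summable (\<lambda>n. (w2 n * x1 y z u n 0)\<^sup>2)" "summable (\<lambda>m. (w2 m * x2 z u m 0)\<^sup>2)"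
      using domain_modes_summable[OF cy c\<zeta> bc(1) bc'] unfolding x0 w2_def by (simp_all add: power2_eq_square[of "real _ + 1"] mult.assoc)
    have s1: "summable (\<lambda>n. (w1 n * x1 y z u n 0)\<^sup>2)" "summable (\<lambda>m. (w1 m * x2 z u m 0)\<^sup>2)"
      and en0: "H1_energy a b s y0 \<zeta>0 \<le> K2 * (nsq y0' + nsq \<zeta>0 + nsq \<zeta>0')"
      using ana[OF d1(1) bc(1) d1(3)] by (simp_all add: x0 w1_def)
    define E0 where "E0 = (\<Sum>n. (w1 n * x1 y z u n 0)\<^sup>2) + (\<Sum>m. (w1 m * x2 z u m 0)\<^sup>2)"
    have E0_eq: "E0 = H1_energy a b s y0 \<zeta>0" by (simp add: E0_def x0 w1_def)
    have IE: "I\<^sup>2 \<le> E0 + k0"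
      using summable_weight_mono(2)[OF s1(1)[unfolded w1_def]] summable_weight_mono(2)[OF s1(2)[unfolded w1_def]]
      unfolding ib(4) k0_def E0_def w1_def by linarith
    have E0p: "E0 \<ge> 0" unfolding E0_def using s1 by (intro add_nonneg_nonneg suminf_nonneg) auto
    have st: "summable (\<lambda>n. ((real n + 1) * ((real n + 1) * mode1 a b s (y t) (\<zeta> t) n))\<^sup>2)"
       "summable (\<lambda>m. ((real m + 1) * ((real m + 1) * ip (\<zeta> t) (ecos m)))\<^sup>2)"
      using weighted_modes_decay[OF dec traj t wb(3,4) sq2]
      by (simp_all add: w2_def x1_def x2_def \<zeta>_def[abs_def] power2_eq_square[of "real _ + 1"] mult.assoc)
    have "H1_energy a b s (y t) (\<zeta> t) = (\<Sum>n. (w1 n * x1 y z u n t)\<^sup>2) + (\<Sum>m. (w1 m * x2 z u m t)\<^sup>2)"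
      by (simp add: w1_def x1_def x2_def \<zeta>_def[abs_def])
    also have "\<dots> \<le> (2 * E0 + 2 * \<Gamma> * I\<^sup>2) * e"
      using weighted_modes_decay[OF dec traj t wb(1,2) s1] unfolding \<Gamma>_def[symmetric] I_def[symmetric] e_def[symmetric] E0_def by simp
    also have "\<dots> \<le> (2 * (E0 + k0) + 2 * \<Gamma> * (E0 + k0)) * e"
      using IE u0 e \<Gamma> by (intro mult_right_mono add_mono mult_left_mono) auto
    finally have en: "H1_energy a b s (y t) (\<zeta> t) \<le> (2 + 2 * \<Gamma>) * ((E0 + k0) * e)" by (simp add: algebra_simps)
    obtain p p' q q' where pq: "eqI (y t) p" "has_L2_deriv p p'" "p 1 = 0" "eqI (\<zeta> t) q" "has_L2_deriv q q'"
      "nsq p' + nsq q + nsq q' \<le> K1 * H1_energy a b s (y t) (\<zeta> t)"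
      using syn[OF Lt st] by blast
    have eqz: "eqI (z t) (\<lambda>x. q x + hphi x * u t)"
      unfolding z_eq by (intro eqI_add pq eqI_refl)
    have dz: "has_L2_deriv (\<lambda>x. q x + hphi x * u t) (\<lambda>x. q' x + (1 - x) * u t)"
      by (intro has_L2_deriv_add pq hphi_scale)
    have mem: "(y t, z t) \<in> H1"
      unfolding H1_def H1I_1_def H1I_def using pq eqz dz by blast
    have h1: "H1_normsq (y t, z t) = nsq p' + nsq (\<lambda>x. q x + hphi x * u t) + nsq (\<lambda>x. q' x + (1 - x) * u t)"
      by (rule H1_normsq_eq[OF pq(1,2) eqz dz Lz])
    have n2: "nsq (\<lambda>x. q x + hphi x * u t) \<le> 2 * nsq q + 2 * (u t)\<^sup>2"
      using nsq_add_le[OF has_L2_deriv_L2I[OF pq(5)] hphi_scale(1)[of "u t"]] nsq_hphi_scale[of "u t"] by linarith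
    have n2': "nsq (\<lambda>x. q' x + (1 - x) * u t) \<le> 2 * nsq q' + 2 * (u t)\<^sup>2"
      using nsq_add_le[OF has_L2_derivD_L2I[OF pq(5)] hphi_scale(2)[of "u t"]] nsq_slope_scale[of "u t"] by linarith
    have n1: "nsq p' + nsq q + nsq q' \<le> K1 * ((2 + 2 * \<Gamma>) * ((E0 + k0) * e))"
      by (rule order_trans[OF pq(6) mult_left_mono[OF en]]) (use K1 in simp)
    have I2: "I\<^sup>2 * e \<le> (E0 + k0) * e" using IE e by (intro mult_right_mono) auto
    have "(u t)\<^sup>2 \<le> D\<^sup>2 * (I\<^sup>2 * e)" using input_square_decay[OF ut] by (simp add: e_def mult.assoc)
    also have "\<dots> \<le> D\<^sup>2 * ((E0 + k0) * e)" by (intro mult_left_mono I2) auto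
    finally have n3: "(u t)\<^sup>2 \<le> D\<^sup>2 * ((E0 + k0) * e)" .
    have "controller_normsq N0 M0 N M u Xh h1 h2 t \<le> B * (I\<^sup>2 * e)" using d by (simp add: mult.assoc)
    also have "\<dots> \<le> B * ((E0 + k0) * e)" using B(1) by (intro mult_left_mono I2)
    finally have n4: "controller_normsq N0 M0 N M u Xh h1 h2 t \<le> B * ((E0 + k0) * e)" .
    have "H1_normsq (y t, z t) + controller_normsq N0 M0 N M u Xh h1 h2 t
        \<le> 2 * (K1 * ((2 + 2 * \<Gamma>) * ((E0 + k0) * e))) + 4 * (D\<^sup>2 * ((E0 + k0) * e)) + B * ((E0 + k0) * e)"
      unfolding h1 using n1 n2 n2' n3 n4 nsq_nonneg[of p'] by linarith
    also have "\<dots> = B1 * (E0 + k0) * e" by (simp add: B1_def algebra_simps)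
    also have "\<dots> \<le> B1 * (J1 * (H1_normsq (y0, z0) + k0)) * e"
    proof (intro mult_right_mono mult_left_mono)
      note L = has_L2_deriv_L2I[OF d1(2)] has_L2_derivD_L2I[OF d1(2)]
      have a1: "nsq \<zeta>0 \<le> 2 * nsq z0 + 2 * k0"
        using nsq_diff_le[OF L(1) hphi_scale(1)[of "u 0"]] nsq_hphi_scale[of "u 0"] u0 unfolding \<zeta>0_def by linarith
      have a2: "nsq \<zeta>0' \<le> 2 * nsq z0' + 2 * k0"
        using nsq_diff_le[OF L(2) hphi_scale(2)[of "u 0"]] nsq_slope_scale[of "u 0"] u0 unfolding \<zeta>0'_def by linarith
      define S where "S = nsq y0' + nsq z0 + nsq z0'"
      have S: "S \<ge> 0" by (simp add: S_def nsq_nonneg)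
      have "nsq y0' + nsq \<zeta>0 + nsq \<zeta>0' \<le> 2 * S + 4 * k0"
        using a1 a2 nsq_nonneg[of y0'] unfolding S_def distrib_left by linarith
      then have "K2 * (nsq y0' + nsq \<zeta>0 + nsq \<zeta>0') \<le> K2 * (2 * S + 4 * k0)"
        using K2 by (intro mult_left_mono) auto
      then have "E0 + k0 \<le> K2 * (2 * S + 4 * k0) + k0"
        using en0 unfolding E0_eq by linarith
      also have "\<dots> \<le> J1 * (S + k0)"
        unfolding J1_def using K2 S u0(2) by (simp add: algebra_simps)
      finally show "E0 + k0 \<le> J1 * (H1_normsq (y0, z0) + k0)"
        unfolding S_def H1_normsq_eq[OF eqI_refl d1(1) eqI_refl d1(2) z0] .
    qed (use pos e in auto)
    also have "\<dots> = (B1 * J1) * (e * (H1_normsq (y0, z0) + k0))" by (simp add: mult_ac)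
    also have "\<dots> \<le> C * (e * (H1_normsq (y0, z0) + k0))"
    proof (rule mult_right_mono[OF C(2)])
      have "H1_normsq (y0, z0) \<ge> 0" unfolding H1_normsq_eq[OF eqI_refl d1(1) eqI_refl d1(2) z0] by (simp add: nsq_nonneg)
      then show "0 \<le> e * (H1_normsq (y0, z0) + k0)" using e u0 by simp
    qed
    finally show "(y t, z t) \<in> H1 \<and> H1_normsq (y t, z t) + controller_normsq N0 M0 N M u Xh h1 h2 t
            \<le> C * exp (- 2 * \<delta> * t) * (H1_normsq (y0, z0) + controller_normsq N0 M0 N M u Xh h1 h2 0)"
      using mem by (simp only: e_def k0_def mult.assoc simp_thms)
  qed
qed

end

theorem theorem3:
  fixes a b s \<delta> ku :: real and c :: "real \<Rightarrow> real" and N0 M0 :: nat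
    and Kx L :: "real Matrix.vec"
  assumes "s \<noteq> 0" and "c \<in> L2I" and "\<delta> > 0"
    and "lam1 a (N0 + 1) < - \<delta>" and "lam2 b (M0 + 1) < - \<delta>"
    and "\<forall>n\<in>Delta1 a b. n \<le> N0" and "\<forall>m\<in>Delta2 a b. m \<le> M0"
    and "Theta a b \<inter> {0..N0} = {}"
    and "\<forall>n\<in>{0..N0}. c1 c n \<noteq> 0"
    and "\<forall>m\<in>{0..M0} - Delta2 a b. c2 a b s c m \<noteq> 0"
    and "Kx \<in> carrier_vec (N0 + M0 + 2)" and "L \<in> carrier_vec (N0 + M0 + 2)"
    and "eigenvalues_left_of (matA1a a b s N0 M0 - matB1a a b s N0 M0 * matK Kx ku) (- \<delta>)"
    and "eigenvalues_left_of (matA1 a b s N0 M0 - col_mat L * row_mat (vecC1 a b s c N0 M0)) (- \<delta>)"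
  shows "\<exists>P::nat. \<forall>N M. N \<ge> N0 \<and> M \<ge> M0 \<and> N \<ge> P \<and> M \<ge> P \<longrightarrow>
    (\<exists>C>0. \<forall>y0 z0 y z u Xh x1 x2.
       y0 \<in> L2I \<and> z0 \<in> L2I \<and> closed_loop a b s c N0 M0 N M Kx ku L y0 z0 y z u Xh x1 x2 \<longrightarrow>
         (\<forall>t\<ge>0. H0_normsq (y t, z t) + controller_normsq N0 M0 N M u Xh x1 x2 t
            \<le> C * exp (- 2 * \<delta> * t) *
                (H0_normsq (y0, z0) + controller_normsq N0 M0 N M u Xh x1 x2 0)) \<and>
         (compatible_data s y0 z0 (u 0) \<longrightarrow>
           (\<forall>t\<ge>0. (y t, z t) \<in> H1 \<and>
              H1_normsq (y t, z t) + controller_normsq N0 M0 N M u Xh x1 x2 t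
              \<le> C * exp (- 2 * \<delta> * t) *
                  (H1_normsq (y0, z0) + controller_normsq N0 M0 N M u Xh x1 x2 0))))"
proof -
  interpret plant a b s \<delta> ku c N0 M0 Kx L
    by unfold_locales (use assms in auto)
  obtain D P where dec: "slow_decay D P" using slow_decay_exists by blast
  obtain C0 where C0: "C0 > 0"
    "\<And>N M y0 z0 y z u Xh h1 h2 t. \<lbrakk>trajectory P N M y0 z0 y z u Xh h1 h2; t \<ge> 0\<rbrakk> \<Longrightarrow>
       H0_normsq (y t, z t) + controller_normsq N0 M0 N M u Xh h1 h2 t
            \<le> C0 * exp (- 2 * \<delta> * t) * (H0_normsq (y0, z0) + controller_normsq N0 M0 N M u Xh h1 h2 0)"
    using H0_estimate[OF dec] by blast
  obtain C1 where C1: "C1 > 0"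
    "\<And>N M y0 z0 y z u Xh h1 h2 t. \<lbrakk>trajectory P N M y0 z0 y z u Xh h1 h2; t \<ge> 0; compatible_data s y0 z0 (u 0)\<rbrakk> \<Longrightarrow>
       (y t, z t) \<in> H1 \<and> H1_normsq (y t, z t) + controller_normsq N0 M0 N M u Xh h1 h2 t
            \<le> C1 * exp (- 2 * \<delta> * t) * (H1_normsq (y0, z0) + controller_normsq N0 M0 N M u Xh h1 h2 0)"
    using H1_estimate[OF dec] by blast
  show ?thesis
  proof (intro exI[of _ P] allI impI exI[of _ "max C0 C1"] conjI)
    show "max C0 C1 > 0" using C0(1) by simp
    fix N M y0 z0 y z u Xh and h1 h2 :: "nat \<Rightarrow> real \<Rightarrow> real" and t :: real
    assume NM: "N0 \<le> N \<and> M0 \<le> M \<and> P \<le> N \<and> P \<le> M"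
      and sol: "y0 \<in> L2I \<and> z0 \<in> L2I \<and> closed_loop a b s c N0 M0 N M Kx ku L y0 z0 y z u Xh h1 h2" and t: "0 \<le> t"
    have traj: "trajectory P N M y0 z0 y z u Xh h1 h2" using NM sol by (simp add: trajectory_def)
    have "Xh 0 \<in> carrier_vec (N0 + M0 + 2)" using sol unfolding closed_loop_def Let_def by blast
    then have k0: "0 \<le> controller_normsq N0 M0 N M u Xh h1 h2 0" by (rule controller_normsq_parts(5))
    have mono: "C' * exp (- 2 * \<delta> * t) * r \<le> max C0 C1 * exp (- 2 * \<delta> * t) * r" if "C' \<le> max C0 C1" "r \<ge> 0" for C' r
      using that by (intro mult_right_mono) auto
    have "0 \<le> H0_normsq (y0, z0) + controller_normsq N0 M0 N M u Xh h1 h2 0"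
      using k0 sol unfolding H0_normsq_def by (simp add: H0_inner_eq nsq_nonneg)
    from order_trans[OF C0(2)[OF traj t] mono[OF _ this]]
    show "H0_normsq (y t, z t) + controller_normsq N0 M0 N M u Xh h1 h2 t
        \<le> max C0 C1 * exp (- 2 * \<delta> * t) * (H0_normsq (y0, z0) + controller_normsq N0 M0 N M u Xh h1 h2 0)" by simp
    assume comp: "compatible_data s y0 z0 (u 0)"
    show "(y t, z t) \<in> H1" using C1(2)[OF traj t comp] by blast
    have "0 \<le> H1_normsq (y0, z0)"
      using comp sol H1_normsq_eq[OF eqI_refl _ eqI_refl] unfolding compatible_data_def has_L2_deriv2_def
      by (metis add_nonneg_nonneg nsq_nonneg)
    then have "0 \<le> H1_normsq (y0, z0) + controller_normsq N0 M0 N M u Xh h1 h2 0" using k0 by simp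
    from order_trans[OF conjunct2[OF C1(2)[OF traj t comp]] mono[OF _ this]]
    show "H1_normsq (y t, z t) + controller_normsq N0 M0 N M u Xh h1 h2 t
        \<le> max C0 C1 * exp (- 2 * \<delta> * t) * (H1_normsq (y0, z0) + controller_normsq N0 M0 N M u Xh h1 h2 0)" by simp
  qed
qed

end
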